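(* In the fixed-design, homoscedastic setting of the context, with $\widehat\Sigma_{jj}=1$ for all $1\le j\le p$, assume: (a) $[\kappa(s_*,4)]^{-1}=O(1)$ and $n^{-1}\|\mathbf XF^*\|_{op}^2=O(m+s_* )$; (b) $\Lambda_1\asymp\Lambda_K\asymp m$; (c) $\kappa(s_*,4)>0$ and $K=O(n)$. Then, for any $(\Psi^*,L^* )$ with $\Psi^*+L^*=F^*$, $\|\Psi^*\|_{\ell_0/\ell_2}\le s_*$ and $\|L^*\|_F^2\le R_*$ (where $R_*\ge0$), there exists a suitable choice of $\lambda_2$ such that the three-step estimator $\widetilde\Theta$ defined in the context satisfies, with probability tending to one, $$\frac1{\sqrt m}\|\widetilde\Theta-\Theta^*\|_{\ell_1/\ell_2}\ \lessapprox\ \max\left\{\frac{s_*}{\sqrt n},\ \sqrt{\frac{s_*(m+s_* )}m}\cdot\mathrm{Err}(P_{B^*})\right\},$$ where $$\mathrm{Err}(P_{B^*})=\min\left\{\frac{\sigma_1R_*}m+\frac{Ks_*}n,\ \frac{qK}n,\ \sqrt{\frac{(p+\sigma_1s_* )KR_*}{nm}}+\frac{Ks_*}n\right\}+\frac K{\sqrt n}.$$ Here $a_n\lessapprox b_n$ means $a_n=O(b_n)$ up to multiplicative logarithmic factors of $m$ or $p$.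
   Context: Setting. For each $n$: $p,m,K$ are positive integers with $K<m$ (all of $p,m,K,s_*,R_*$ and the matrices below may depend on $n$); $\mathbf X\in\mathbb{R}^{n\times p}$ is deterministic; $\mathbf Y=\mathbf XF^*+\boldsymbol\varepsilon$ with $F^*=\Psi^*+L^*$, $L^*=A^*B^*$, $\boldsymbol\varepsilon=\mathbf WB^*+\mathbf E$, where $\Psi^*\in\mathbb{R}^{p\times m}$, $A^*\in\mathbb{R}^{p\times K}$, $B^*\in\mathbb{R}^{K\times m}$ are deterministic, $\mathrm{rank}(B^* )=K$, and $s_*\le p$. $\mathbf W\in\mathbb{R}^{n\times K}$ and $\mathbf E\in\mathbb{R}^{n\times m}$ are independent mean-zero random matrices, each with i.i.d. rows; $\Sigma_W=\mathrm{Cov}(\mathbf W_{i\cdot})$ has rank $K$, and $\mathrm{Cov}(\mathbf E_{i\cdot})=\tau^2I_m$. Noise assumption: for positive constants $\gamma_w,\gamma_e$: the vectors $\Sigma_W^{-1/2}\mathbf W_{i\cdot}$, $1\le i\le n$, are i.i.d. $\gamma_w$ sub-Gaussian; for each fixed $j$ the $\mathbf E_{ij}$, $1\le i\le n$, are i.i.d. $\gamma_e$ sub-Gaussian, and for each fixed $i$ the $\mathbf E_{ij}$, $1\le j\le m$, are independent. (A centered random variable $\xi$ is $\gamma$ sub-Gaussian if $\mathbb{E}e^{t\xi}\le e^{\gamma^2t^2/2}$ for all $t\in\mathbb{R}$; a random vector is $\gamma$ sub-Gaussian if its inner product with every unit vector is $\gamma$ sub-Gaussian.) Notation. $P_{B^*}=B^{*T}(B^*B^{*T})^{-1}B^*$,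 $\Theta^*=\Psi^*(I_m-P_{B^*})$. $\Lambda_1,\Lambda_K$ are the largest and $K$th largest eigenvalues of $B^{*T}\Sigma_WB^*$. $\|M\|_{\ell_1/\ell_2}=\sum_j\|M_{j\cdot}\|_2$ (sum over rows); $\|M\|_{\ell_0/\ell_2}$ is the number of nonzero rows; $\|\cdot\|_{op}$, $\|\cdot\|_F$ are the operator and Frobenius norms. $\widehat\Sigma=n^{-1}\mathbf X^T\mathbf X$, $q=\mathrm{rank}(\mathbf X)$, $\sigma_1$ is the largest eigenvalue of $\widehat\Sigma$. $\kappa(s,\alpha)=\min_{|S|\le s}\min_{\Delta\in\mathcal C(S,\alpha)}\|\mathbf X\Delta\|_F/(\sqrt n\|\Delta_{S\cdot}\|_F)$ with $\mathcal C(S,\alpha)=\{\Delta\in\mathbb{R}^{p\times m}\setminus\{0\}:\alpha\|\Delta_{S\cdot}\|_{\ell_1/\ell_2}\ge\|\Delta_{S^c\cdot}\|_{\ell_1/\ell_2}\}$, $S\subseteq\{1,\dots,p\}$. $a_n\asymp b_n$ means $a_n=O(b_n)$ and $b_n=O(a_n)$. Estimator. (i) $(\widehat\Psi,\widehat L)$ solves $\min_{\Psi,L}\frac1n\|\mathbf Y-\mathbf X(\Psi+L)\|_F^2+\lambda_1\|\Psi\|_{\ell_1/\ell_2}+\lambda_2\|L\|_F^2$, $\widehat F=\widehat\Psi+\widehat L$, with $\lambda_1=4\sqrt{\max_jM_{jj}}\,\big(1+\sqrt{2\log(p/\epsilon')/r_e(\Gamma_\varepsilon)}\big)\sqrt{V_\varepsilon/n}$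 for a suitable $\epsilon'>0$, where $M=n^{-1}\mathbf X^TQ_{\lambda_2}^2\mathbf X$, $Q_{\lambda_2}=I_n-\mathbf X(\mathbf X^T\mathbf X+n\lambda_2I_p)^{-1}\mathbf X^T$, $\Gamma_\varepsilon=\gamma_w^2B^{*T}\Sigma_WB^*+\gamma_e^2I_m$, $V_\varepsilon=\mathrm{tr}(\Gamma_\varepsilon)$, $r_e(\Gamma_\varepsilon)=V_\varepsilon/\|\Gamma_\varepsilon\|_{op}$. (ii) $\widehat P_{B^*}=\widehat U\widehat U^T$, where $\widehat U$ consists of orthonormal eigenvectors for the $K$ largest eigenvalues of $\widehat\Sigma_\varepsilon=\frac1n(\mathbf Y-\mathbf X\widehat F)^T(\mathbf Y-\mathbf X\widehat F)$. (iii) $\widetilde\Theta$ solves $\min_\Theta\frac1n\|\mathbf Y(I_m-\widehat P_{B^*})-\mathbf X\Theta\|_F^2+\lambda_3\|\Theta\|_{\ell_1/\ell_2}$, with $\lambda_3$ suitably chosen subject to $\lambda_3\ge4\gamma_e\sqrt{\max_j\widehat\Sigma_{jj}}\,(\sqrt m+\sqrt{2\log(p/\epsilon)})/\sqrt n$ for a suitable $\epsilon>0$.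
   Formalization: The bound with one constant and probability tending to one is proved when max(m,p) tends to infinity (it fails, e.g., for fixed m, p with Gaussian noise); in general it is proved with probability at least 1−δ for large n, with constant and tuning depending on δ. *)

theory Defs
  imports
    "HOL-Probability.Probability"
    "HOL-Library.Landau_Symbols"
    "Jordan_Normal_Form.Char_Poly"
    "Jordan_Normal_Form.DL_Rank"
    "Jordan_Normal_Form.Gauss_Jordan_Elimination"
begin

section \<open>Matrix notions\<close>

definition vnorm :: "real Matrix.vec \<Rightarrow> real" where
  "vnorm v = sqrt (scalar_prod v v)"

definition frob_norm :: "real Matrix.mat \<Rightarrow> real" where
  "frob_norm A = sqrt (\<Sum>i<dim_row A. \<Sum>j<dim_col A. (A $$ (i,j))\<^sup>2)"

definition op_norm :: "real Matrix.mat \<Rightarrow> real" where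
  "op_norm A = Sup {vnorm (A *\<^sub>v v) |v. v \<in> carrier_vec (dim_col A) \<and> vnorm v \<le> 1}"

definition l1l2_norm :: "real Matrix.mat \<Rightarrow> real" where
  "l1l2_norm A = (\<Sum>j<dim_row A. vnorm (Matrix.row A j))"

definition l0l2_norm :: "real Matrix.mat \<Rightarrow> nat" where
  "l0l2_norm A = card {j. j < dim_row A \<and> Matrix.row A j \<noteq> 0\<^sub>v (dim_col A)}"

definition mat_trace :: "real Matrix.mat \<Rightarrow> real" where
  "mat_trace A = (\<Sum>i<dim_row A. A $$ (i,i))"

definition mat_rank :: "real Matrix.mat \<Rightarrow> nat" where
  "mat_rank A = vec_space.rank (dim_row A) A"

definition mat_inv :: "real Matrix.mat \<Rightarrow> real Matrix.mat" where
  "mat_inv A = the (mat_inverse A)"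

text \<open>The rows outside \<open>S\<close> are set to zero instead of being removed; the norms above do not
  see the difference.\<close>

definition restrict_rows :: "nat set \<Rightarrow> real Matrix.mat \<Rightarrow> real Matrix.mat" where
  "restrict_rows S A =
     Matrix.mat (dim_row A) (dim_col A) (\<lambda>(i,j). if i \<in> S then A $$ (i,j) else 0)"

text \<open>The \<open>k\<close>-th largest eigenvalue (\<open>k \<ge> 1\<close>), counted with multiplicity, of a symmetric
  matrix, all of whose characteristic roots are real.\<close>

definition kth_eigenvalue :: "real Matrix.mat \<Rightarrow> nat \<Rightarrow> real" where
  "kth_eigenvalue A k = rev (sorted_list_of_multiset (proots (char_poly A))) ! (k - 1)"

text \<open>\<open>S\<^sup>-\<^sup>1\<^sup>/\<^sup>2\<close> for a symmetric positive definite matrix \<open>S\<close>.\<close>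

definition inv_sqrt_mat :: "real Matrix.mat \<Rightarrow> real Matrix.mat" where
  "inv_sqrt_mat S = (THE R. R \<in> carrier_mat (dim_row S) (dim_row S) \<and> R\<^sup>T = R \<and>
     (\<forall>v\<in>carrier_vec (dim_row S). 0 \<le> scalar_prod v (R *\<^sub>v v)) \<and>
     R * S * R = 1\<^sub>m (dim_row S))"

section \<open>Random vectors and matrices\<close>

text \<open>Borel sigma-algebras on \<open>\<real>\<^sup>d\<close> and \<open>\<real>\<^bsup>r\<times>c\<^esup>\<close>: generated by the coordinates.\<close>

definition vec_borel :: "nat \<Rightarrow> real Matrix.vec measure" where
  "vec_borel d = vimage_algebra (carrier_vec d)
     (\<lambda>v. \<lambda>i\<in>{..<d}. vec_index v i) (\<Pi>\<^sub>M i\<in>{..<d}. borel)"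

definition mat_borel :: "nat \<Rightarrow> nat \<Rightarrow> real Matrix.mat measure" where
  "mat_borel r c = vimage_algebra (carrier_mat r c)
     (\<lambda>A. \<lambda>ij\<in>{..<r} \<times> {..<c}. A $$ ij) (\<Pi>\<^sub>M ij\<in>{..<r} \<times> {..<c}. borel)"

definition subgaussian :: "'a measure \<Rightarrow> real \<Rightarrow> ('a \<Rightarrow> real) \<Rightarrow> bool" where
  "subgaussian M g \<xi> \<longleftrightarrow> integrable M \<xi> \<and> (\<integral>\<omega>. \<xi> \<omega> \<partial>M) = 0 \<and>
     (\<forall>t. integrable M (\<lambda>\<omega>. exp (t * \<xi> \<omega>)) \<and>
          (\<integral>\<omega>. exp (t * \<xi> \<omega>) \<partial>M) \<le> exp (g\<^sup>2 * t\<^sup>2 / 2))"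

definition subgaussian_vec ::
  "'a measure \<Rightarrow> nat \<Rightarrow> real \<Rightarrow> ('a \<Rightarrow> real Matrix.vec) \<Rightarrow> bool" where
  "subgaussian_vec M d g Z \<longleftrightarrow>
     (\<forall>u\<in>carrier_vec d. vnorm u = 1 \<longrightarrow> subgaussian M g (\<lambda>\<omega>. scalar_prod u (Z \<omega>)))"

definition mean_zero_sq_integrable :: "'a measure \<Rightarrow> nat \<Rightarrow> nat \<Rightarrow> ('a \<Rightarrow> real Matrix.mat) \<Rightarrow> bool"
  where "mean_zero_sq_integrable M r c Z \<longleftrightarrow> (\<forall>i<r. \<forall>j<c.
     integrable M (\<lambda>\<omega>. Z \<omega> $$ (i,j)) \<and> (\<integral>\<omega>. Z \<omega> $$ (i,j) \<partial>M) = 0 \<and>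
     integrable M (\<lambda>\<omega>. (Z \<omega> $$ (i,j))\<^sup>2))"

definition cov_mat :: "'a measure \<Rightarrow> nat \<Rightarrow> ('a \<Rightarrow> real Matrix.vec) \<Rightarrow> real Matrix.mat" where
  "cov_mat M d Z = Matrix.mat d d (\<lambda>(k,l).
     \<integral>\<omega>. (vec_index (Z \<omega>) k - (\<integral>\<omega>'. vec_index (Z \<omega>') k \<partial>M)) *
         (vec_index (Z \<omega>) l - (\<integral>\<omega>'. vec_index (Z \<omega>') l \<partial>M)) \<partial>M)"

definition iid_rows :: "'a measure \<Rightarrow> nat \<Rightarrow> nat \<Rightarrow> ('a \<Rightarrow> real Matrix.mat) \<Rightarrow> bool" where
  "iid_rows M r c Z \<longleftrightarrow>
     prob_space.indep_vars M (\<lambda>_. vec_borel c) (\<lambda>i \<omega>. Matrix.row (Z \<omega>) i) {..<r} \<and>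
     (\<forall>i<r. \<forall>i'<r. distr M (vec_borel c) (\<lambda>\<omega>. Matrix.row (Z \<omega>) i) =
                     distr M (vec_borel c) (\<lambda>\<omega>. Matrix.row (Z \<omega>) i'))"

text \<open>The i.i.d. property of the whitened rows of \<open>W\<close> and of the entries in a column of \<open>E\<close>
  is inherited from \<^const>\<open>iid_rows\<close>.\<close>

definition noise_model :: "'a measure \<Rightarrow> nat \<Rightarrow> nat \<Rightarrow> nat \<Rightarrow> real \<Rightarrow> real \<Rightarrow>
    real Matrix.mat \<Rightarrow> real \<Rightarrow> ('a \<Rightarrow> real Matrix.mat) \<Rightarrow> ('a \<Rightarrow> real Matrix.mat) \<Rightarrow> bool" where
  "noise_model M n K m \<gamma>w \<gamma>e \<Sigma>W \<tau> W E \<longleftrightarrow>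
     prob_space M \<and>
     W \<in> measurable M (mat_borel n K) \<and> E \<in> measurable M (mat_borel n m) \<and>
     prob_space.indep_var M (mat_borel n K) W (mat_borel n m) E \<and>
     mean_zero_sq_integrable M n K W \<and> mean_zero_sq_integrable M n m E \<and>
     iid_rows M n K W \<and> iid_rows M n m E \<and>
     \<Sigma>W \<in> carrier_mat K K \<and> mat_rank \<Sigma>W = K \<and>
     (\<forall>i<n. cov_mat M K (\<lambda>\<omega>. Matrix.row (W \<omega>) i) = \<Sigma>W) \<and>
     (\<forall>i<n. cov_mat M m (\<lambda>\<omega>. Matrix.row (E \<omega>) i) = \<tau>\<^sup>2 \<cdot>\<^sub>m 1\<^sub>m m) \<and>
     (\<forall>i<n. subgaussian_vec M K \<gamma>w (\<lambda>\<omega>. inv_sqrt_mat \<Sigma>W *\<^sub>v Matrix.row (W \<omega>) i)) \<and>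
     (\<forall>i<n. \<forall>j<m. subgaussian M \<gamma>e (\<lambda>\<omega>. E \<omega> $$ (i,j))) \<and>
     (\<forall>i<n. prob_space.indep_vars M (\<lambda>_. borel) (\<lambda>j \<omega>. E \<omega> $$ (i,j)) {..<m})"

text \<open>Inner probability: the probability of \<open>S\<close> if \<open>S\<close> is an event. It is needed because the
  events below quantify over all solutions of the (possibly non-unique) minimization problems.\<close>

definition inner_prob :: "'a measure \<Rightarrow> 'a set \<Rightarrow> real" where
  "inner_prob M S = Sup (measure M ` {A \<in> sets M. A \<subseteq> S})"

section \<open>Model quantities\<close>

definition response :: "real Matrix.mat \<Rightarrow> real Matrix.mat \<Rightarrow> real Matrix.mat \<Rightarrow> real Matrix.mat \<Rightarrow>
    real Matrix.mat \<Rightarrow> real Matrix.mat \<Rightarrow> real Matrix.mat" where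
  "response X \<Psi> A B W E = X * (\<Psi> + A * B) + (W * B + E)"

definition proj_rows :: "real Matrix.mat \<Rightarrow> real Matrix.mat" where
  "proj_rows B = B\<^sup>T * mat_inv (B * B\<^sup>T) * B"

definition Theta_star :: "real Matrix.mat \<Rightarrow> real Matrix.mat \<Rightarrow> real Matrix.mat" where
  "Theta_star \<Psi> B = \<Psi> * (1\<^sub>m (dim_col B) - proj_rows B)"

definition sample_cov :: "real Matrix.mat \<Rightarrow> real Matrix.mat" where
  "sample_cov X = (1 / real (dim_row X)) \<cdot>\<^sub>m (X\<^sup>T * X)"

definition re_cone :: "nat \<Rightarrow> nat \<Rightarrow> nat set \<Rightarrow> real \<Rightarrow> real Matrix.mat set" where
  "re_cone p m S \<alpha> = {\<Delta> \<in> carrier_mat p m. \<Delta> \<noteq> 0\<^sub>m p m \<and>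
     l1l2_norm (restrict_rows ({..<p} - S) \<Delta>) \<le> \<alpha> * l1l2_norm (restrict_rows S \<Delta>)}"

text \<open>Extended-real valued, so that the constant is \<open>\<infinity>\<close> when there is no admissible \<open>\<Delta>\<close>;
  this happens exactly for \<open>s = 0\<close>.\<close>

definition re_const :: "real Matrix.mat \<Rightarrow> nat \<Rightarrow> nat \<Rightarrow> real \<Rightarrow> ereal" where
  "re_const X m s \<alpha> =
     (INF (S, \<Delta>) \<in> {(S, \<Delta>). S \<subseteq> {..<dim_col X} \<and> card S \<le> s \<and> \<Delta> \<in> re_cone (dim_col X) m S \<alpha>}.
        ereal (frob_norm (X * \<Delta>) / (sqrt (real (dim_row X)) * frob_norm (restrict_rows S \<Delta>))))"

section \<open>Tuning parameters\<close>

definition ridge_Q :: "real Matrix.mat \<Rightarrow> real \<Rightarrow> real Matrix.mat" where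
  "ridge_Q X l2 = 1\<^sub>m (dim_row X) -
     X * mat_inv (X\<^sup>T * X + (real (dim_row X) * l2) \<cdot>\<^sub>m 1\<^sub>m (dim_col X)) * X\<^sup>T"

definition ridge_M :: "real Matrix.mat \<Rightarrow> real \<Rightarrow> real Matrix.mat" where
  "ridge_M X l2 = (1 / real (dim_row X)) \<cdot>\<^sub>m (X\<^sup>T * (ridge_Q X l2 * ridge_Q X l2) * X)"

definition max_diag :: "real Matrix.mat \<Rightarrow> real" where
  "max_diag A = Max ((\<lambda>j. A $$ (j,j)) ` {..<dim_row A})"

definition Gamma_eps :: "real \<Rightarrow> real \<Rightarrow> real Matrix.mat \<Rightarrow> real Matrix.mat \<Rightarrow> real Matrix.mat" where
  "Gamma_eps \<gamma>w \<gamma>e \<Sigma>W B = \<gamma>w\<^sup>2 \<cdot>\<^sub>m (B\<^sup>T * \<Sigma>W * B) + \<gamma>e\<^sup>2 \<cdot>\<^sub>m 1\<^sub>m (dim_col B)"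

definition effective_rank :: "real Matrix.mat \<Rightarrow> real" where
  "effective_rank G = mat_trace G / op_norm G"

definition lambda1 :: "real Matrix.mat \<Rightarrow> real Matrix.mat \<Rightarrow> real \<Rightarrow> real \<Rightarrow> real" where
  "lambda1 X G l2 \<epsilon>' = 4 * sqrt (max_diag (ridge_M X l2)) *
     (1 + sqrt (2 * ln (real (dim_col X) / \<epsilon>') / effective_rank G)) *
     sqrt (mat_trace G / real (dim_row X))"

definition lambda3_lower :: "real Matrix.mat \<Rightarrow> nat \<Rightarrow> real \<Rightarrow> real \<Rightarrow> real" where
  "lambda3_lower X m \<gamma>e \<epsilon> = 4 * \<gamma>e * sqrt (max_diag (sample_cov X)) *
     (sqrt (real m) + sqrt (2 * ln (real (dim_col X) / \<epsilon>))) / sqrt (real (dim_row X))"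

section \<open>The three-step estimator\<close>

definition step1_objective :: "real Matrix.mat \<Rightarrow> real Matrix.mat \<Rightarrow> real \<Rightarrow> real \<Rightarrow>
    real Matrix.mat \<Rightarrow> real Matrix.mat \<Rightarrow> real" where
  "step1_objective X Y l1 l2 \<Psi> L = 1 / real (dim_row X) * (frob_norm (Y - X * (\<Psi> + L)))\<^sup>2 +
     l1 * l1l2_norm \<Psi> + l2 * (frob_norm L)\<^sup>2"

definition step1_solution :: "real Matrix.mat \<Rightarrow> real Matrix.mat \<Rightarrow> real \<Rightarrow> real \<Rightarrow>
    real Matrix.mat \<Rightarrow> real Matrix.mat \<Rightarrow> bool" where
  "step1_solution X Y l1 l2 \<Psi>h Lh \<longleftrightarrow>
     \<Psi>h \<in> carrier_mat (dim_col X) (dim_col Y) \<and> Lh \<in> carrier_mat (dim_col X) (dim_col Y) \<and>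
     (\<forall>\<Psi>\<in>carrier_mat (dim_col X) (dim_col Y). \<forall>L\<in>carrier_mat (dim_col X) (dim_col Y).
        step1_objective X Y l1 l2 \<Psi>h Lh \<le> step1_objective X Y l1 l2 \<Psi> L)"

definition residual_cov :: "real Matrix.mat \<Rightarrow> real Matrix.mat \<Rightarrow> real Matrix.mat \<Rightarrow> real Matrix.mat" where
  "residual_cov X Y F = (1 / real (dim_row X)) \<cdot>\<^sub>m ((Y - X * F)\<^sup>T * (Y - X * F))"

definition top_eigenvectors :: "real Matrix.mat \<Rightarrow> nat \<Rightarrow> real Matrix.mat \<Rightarrow> bool" where
  "top_eigenvectors S K U \<longleftrightarrow> U \<in> carrier_mat (dim_row S) K \<and> U\<^sup>T * U = 1\<^sub>m K \<and>
     (\<forall>k<K. eigenvector S (Matrix.col U k) (kth_eigenvalue S (Suc k)))"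

definition step3_objective :: "real Matrix.mat \<Rightarrow> real Matrix.mat \<Rightarrow> real Matrix.mat \<Rightarrow> real \<Rightarrow>
    real Matrix.mat \<Rightarrow> real" where
  "step3_objective X Y P l3 \<Theta> =
     1 / real (dim_row X) * (frob_norm (Y * (1\<^sub>m (dim_col Y) - P) - X * \<Theta>))\<^sup>2 + l3 * l1l2_norm \<Theta>"

definition step3_solution :: "real Matrix.mat \<Rightarrow> real Matrix.mat \<Rightarrow> real Matrix.mat \<Rightarrow> real \<Rightarrow>
    real Matrix.mat \<Rightarrow> bool" where
  "step3_solution X Y P l3 \<Theta>h \<longleftrightarrow> \<Theta>h \<in> carrier_mat (dim_col X) (dim_col Y) \<and>
     (\<forall>\<Theta>\<in>carrier_mat (dim_col X) (dim_col Y).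
        step3_objective X Y P l3 \<Theta>h \<le> step3_objective X Y P l3 \<Theta>)"

definition three_step_estimate :: "real Matrix.mat \<Rightarrow> real Matrix.mat \<Rightarrow> nat \<Rightarrow>
    real \<Rightarrow> real \<Rightarrow> real \<Rightarrow> real Matrix.mat \<Rightarrow> bool" where
  "three_step_estimate X Y K l1 l2 l3 \<Theta> \<longleftrightarrow> (\<exists>\<Psi>h Lh U.
     step1_solution X Y l1 l2 \<Psi>h Lh \<and>
     top_eigenvectors (residual_cov X Y (\<Psi>h + Lh)) K U \<and>
     step3_solution X Y (U * U\<^sup>T) l3 \<Theta>)"

section \<open>Rate\<close>

text \<open>\<open>\<sigma>\<close> is the largest eigenvalue of the sample covariance and \<open>q\<close> the rank of the design.\<close>

definition Err_P :: "nat \<Rightarrow> nat \<Rightarrow> nat \<Rightarrow> nat \<Rightarrow> nat \<Rightarrow> nat \<Rightarrow> real \<Rightarrow> real \<Rightarrow> real" where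
  "Err_P n p m K s q \<sigma> R =
     Min {\<sigma> * R / real m + real K * real s / real n,
          real q * real K / real n,
          sqrt ((real p + \<sigma> * real s) * real K * R / (real n * real m)) +
            real K * real s / real n} +
     real K / sqrt (real n)"

definition rate :: "real Matrix.mat \<Rightarrow> nat \<Rightarrow> nat \<Rightarrow> nat \<Rightarrow> real \<Rightarrow> real" where
  "rate X m K s R =
     max (real s / sqrt (real (dim_row X)))
         (sqrt (real s * (real m + real s) / real m) *
            Err_P (dim_row X) (dim_col X) m K s (mat_rank X) (kth_eigenvalue (sample_cov X) 1) R)"

text \<open>``Logarithmic factors of \<open>m\<close> or \<open>p\<close>'' are powers of the following quantity; the summand
  1 keeps it bounded away from zero for \<open>m = p = 1\<close>.\<close>

definition log_factor :: "nat \<Rightarrow> nat \<Rightarrow> real" where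
  "log_factor m p = 1 + ln (real m) + ln (real p)"

text \<open>Every solution of the three-step procedure has scaled \<open>\<ell>\<^sub>1/\<ell>\<^sub>2\<close> error at most \<open>b\<close>.\<close>

definition error_event :: "'a measure \<Rightarrow> real Matrix.mat \<Rightarrow> ('a \<Rightarrow> real Matrix.mat) \<Rightarrow> nat \<Rightarrow>
    real \<Rightarrow> real \<Rightarrow> real \<Rightarrow> real Matrix.mat \<Rightarrow> real \<Rightarrow> 'a set" where
  "error_event M X Y K l1 l2 l3 \<Theta>s b = {\<omega> \<in> space M.
     \<forall>\<Theta>. three_step_estimate X (Y \<omega>) K l1 l2 l3 \<Theta> \<longrightarrow>
         1 / sqrt (real (dim_col \<Theta>s)) * l1l2_norm (\<Theta> - \<Theta>s) \<le> b}"

end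

theory Submission
  imports
    Defs
    "HOL-Combinatorics.List_Permutation"
    "HOL-Computational_Algebra.Fundamental_Theorem_Algebra"
begin

text \<open>Write \<open>\<epsilon> = W B + E\<close>, \<open>G = B\<^sup>T \<Sigma>\<^sub>W B\<close>, \<open>V = tr \<Gamma>\<^sub>\<epsilon>\<close> and \<open>\<nu> = \<lambda>\<^sub>2\<close>.

  Minimizing over \<open>L\<close> first turns step 1 into a group lasso with the quadratic form of the ridge
  residual operator \<open>Q = (I + X X\<^sup>T / (n \<nu>))\<^sup>-\<^sup>1\<close>, and the residual into \<open>Q (\<epsilon> + X L - X D)\<close>, where
  \<open>D\<close> is the error of the sparse part. Hence the residual covariance differs from \<open>G + \<tau>\<^sup>2 I\<close> in
  Frobenius norm by the fluctuation of \<open>\<epsilon>\<^sup>T \<epsilon> / n\<close>, of order \<open>V / \<surd>n\<close>, by the shrinkage term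
  \<open>V tr(I - Q) / n\<close>, and by the ridge bias and the lasso error. A very large, a very small and a
  balancing \<open>\<nu>\<close> give the three members of the minimum in \<open>Err_P\<close>. As \<open>\<Lambda>\<^sub>K \<asymp> m\<close>, a Davis--Kahan
  argument, in which Ky Fan's maximum principle compares \<open>P\<close> with the projection onto the top
  eigenvectors, bounds the Frobenius norm of the difference of the two projections by \<open>Err_P\<close> up
  to logarithms.

  Since \<open>W B (I - P) = 0\<close>, the data of step 3 are
  \<open>X \<Theta>\<^sup>* + (X F\<^sup>* + W B) (P - P') + E (I - P')\<close> with the estimated projection \<open>P'\<close>. The middle term
  is a perturbation bounded with the operator norms of \<open>X F\<^sup>*\<close> and \<open>W B\<close>; the last
  one is dominated by \<open>\<lambda>\<^sub>3\<close>, and the group lasso oracle inequality gives the rate.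

  Only second moments are used for the quadratic terms in the noise: the loss \<open>1 / \<delta>\<close> in Markov's
  inequality is affordable with \<open>\<delta>\<close> of the order of the inverse of the logarithmic factor. When
  that factor stays bounded, \<open>\<delta>\<close> is a constant.\<close>

no_notation Finite_Cartesian_Product.vec_nth (infixl "$" 90)
no_notation Inner_Product.real_inner_class.inner (infix "\<bullet>" 70)
hide_const (open) Finite_Cartesian_Product.vec Finite_Cartesian_Product.mat
  Finite_Cartesian_Product.row Finite_Cartesian_Product.rows Finite_Cartesian_Product.column
  Finite_Cartesian_Product.columns Finite_Cartesian_Product.transpose
  Finite_Cartesian_Product.map_matrix Cross3.cross3

section \<open>Frobenius and mixed norms\<close>

text \<open>Quadratic quantities are written with the trace inner product \<open>fip A B\<close> =
  tr(A^T B), so that the Loewner inequalities for the ridge operator become scalar inequalities. One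
  parameter T of the order of \<open>log_factor\<close> drives all bounds: the union over at most a
  multiple of (p m)^2 linear forms costs exp(-T), and the loss in Markov's inequality satisfies
  1/\<delta> \<le> T. The exponent 3 of the logarithmic factor is T^2 from the estimated projection
  (one factor from the tuning, one from Markov) times T from the operator norm of X F + W B. The
  scale is set by V = O(K m): a covariance fluctuation V / sqrt n divided by an eigenvalue gap of
  order m is K / sqrt n, the last summand of \<open>Err_P\<close>. The obstacle in step 1 is that
  the restricted eigenvalue condition concerns X, while the lasso lives in the quadratic form of Q.
  The passage costs a factor 1 + \<sigma>/\<nu>, which competes with the bias \<nu> R and with the
  degrees of freedom tr(I - Q); this competition dictates the three choices of \<nu>.\<close>

definition fip :: "real mat \<Rightarrow> real mat \<Rightarrow> real" where
  "fip A B = (\<Sum>i<dim_row A. \<Sum>j<dim_col A. A $$ (i,j) * B $$ (i,j))"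

declare minus_carrier_mat [simp]

lemma scalar_prod_eq_sum: "dim_vec v = n \<Longrightarrow> u \<bullet> v = (\<Sum>i<n. u $ i * v $ i)"
  by (simp add: scalar_prod_def atLeast0LessThan)

lemma fip_eq: "A \<in> carrier_mat n m \<Longrightarrow> fip A B = (\<Sum>i<n. \<Sum>j<m. A $$ (i,j) * B $$ (i,j))"
  by (simp add: fip_def carrier_matD)

lemma fip_commute: "A \<in> carrier_mat n m \<Longrightarrow> B \<in> carrier_mat n m \<Longrightarrow> fip A B = fip B A"
  by (simp add: fip_eq mult.commute)

lemma fip_add_left: "A \<in> carrier_mat n m \<Longrightarrow> B \<in> carrier_mat n m \<Longrightarrow>
    fip (A + B) C = fip A C + fip B C"
  by (simp add: fip_eq[of _ n m] algebra_simps sum.distrib)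

lemma fip_add_right: "A \<in> carrier_mat n m \<Longrightarrow> B \<in> carrier_mat n m \<Longrightarrow> C \<in> carrier_mat n m \<Longrightarrow>
    fip C (A + B) = fip C A + fip C B"
  by (simp add: fip_eq[of _ n m] algebra_simps sum.distrib)

lemma fip_minus_left: "A \<in> carrier_mat n m \<Longrightarrow> B \<in> carrier_mat n m \<Longrightarrow>
    fip (A - B) C = fip A C - fip B C"
  by (simp add: fip_eq[of _ n m] algebra_simps sum_subtractf minus_carrier_mat)

lemma fip_minus_right: "A \<in> carrier_mat n m \<Longrightarrow> B \<in> carrier_mat n m \<Longrightarrow> C \<in> carrier_mat n m \<Longrightarrow>
    fip C (A - B) = fip C A - fip C B"
  by (simp add: fip_eq[of _ n m] algebra_simps sum_subtractf)

lemma fip_smult_left: "fip (c \<cdot>\<^sub>m A) B = c * fip A B"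
  by (simp add: fip_def sum_distrib_left algebra_simps)

lemma fip_smult_right: "A \<in> carrier_mat n m \<Longrightarrow> B \<in> carrier_mat n m \<Longrightarrow> fip A (c \<cdot>\<^sub>m B) = c * fip A B"
  by (simp add: fip_eq[of _ n m] sum_distrib_left algebra_simps)

lemma fip_transpose: "A \<in> carrier_mat n m \<Longrightarrow> B \<in> carrier_mat n m \<Longrightarrow> fip A\<^sup>T B\<^sup>T = fip A B"
  unfolding fip_eq[of A n m] fip_eq[of "A\<^sup>T" m n]
  by (simp add: fip_eq[of _ m n]  transpose_carrier_mat) (rule sum.swap)

lemma fip_self_ge0: "0 \<le> fip A A"
  by (simp add: fip_def sum_nonneg)

lemma mult_mat_index: "A \<in> carrier_mat n k \<Longrightarrow> B \<in> carrier_mat k m \<Longrightarrow> i < n \<Longrightarrow> j < m \<Longrightarrow>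
    (A * B) $$ (i,j) = (\<Sum>l<k. A $$ (i,l) * B $$ (l,j))"
  by (simp add: scalar_prod_eq_sum[of _ k])

lemma mult_mat_vec_index: "A \<in> carrier_mat n k \<Longrightarrow> v \<in> carrier_vec k \<Longrightarrow> i < n \<Longrightarrow>
    (A *\<^sub>v v) $ i = (\<Sum>l<k. A $$ (i,l) * v $ l)"
  by (simp add: scalar_prod_eq_sum[of v k])

text \<open>Left multiplication by \<open>A\<close> and by its transpose are adjoint for
  \<open>fip\<close>; together with the right-hand version below this replaces the cyclic property
  of the trace.\<close>

lemma fip_mult_left:
  assumes "A \<in> carrier_mat n k" "B \<in> carrier_mat k m" "C \<in> carrier_mat n m"
  shows "fip (A * B) C = fip B (A\<^sup>T * C)"
proof -
  have "fip (A * B) C = (\<Sum>i<n. \<Sum>j<m. \<Sum>l<k. A $$ (i,l) * B $$ (l,j) * C $$ (i,j))"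
    using assms by (simp add: fip_eq[of _ n m] mult_mat_index[of A n k B m] sum_distrib_right
        del: index_mult_mat)
  also have "\<dots> = (\<Sum>i<n. \<Sum>l<k. \<Sum>j<m. A $$ (i,l) * B $$ (l,j) * C $$ (i,j))"
    by (intro sum.cong refl sum.swap)
  also have "\<dots> = (\<Sum>l<k. \<Sum>i<n. \<Sum>j<m. A $$ (i,l) * B $$ (l,j) * C $$ (i,j))"
    by (rule sum.swap)
  also have "\<dots> = (\<Sum>l<k. \<Sum>j<m. \<Sum>i<n. A $$ (i,l) * B $$ (l,j) * C $$ (i,j))"
    by (intro sum.cong refl sum.swap)
  also have "\<dots> = fip B (A\<^sup>T * C)"
    using assms by (auto simp add: fip_eq[of _ k m] mult_mat_index[of "A\<^sup>T" k n C m] sum_distrib_left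
        algebra_simps simp del: index_mult_mat intro!: sum.cong)
  finally show ?thesis .
qed

lemma fip_mult_left2:
  assumes "A \<in> carrier_mat n k" "B \<in> carrier_mat k m" "C \<in> carrier_mat n m"
  shows "fip (A * B) C = fip A (C * B\<^sup>T)"
proof -
  have "fip (A * B) C = fip (B\<^sup>T * A\<^sup>T) C\<^sup>T"
    using assms fip_transpose[of "A * B" n m C] transpose_mult[of A n k B m] by auto
  also have "\<dots> = fip A\<^sup>T (B * C\<^sup>T)"
    using fip_mult_left[of "B\<^sup>T" m k "A\<^sup>T" n "C\<^sup>T"] assms by auto
  also have "B * C\<^sup>T = (C * B\<^sup>T)\<^sup>T"
    using assms transpose_mult[of C n m "B\<^sup>T" k] by auto
  also have "fip A\<^sup>T ((C * B\<^sup>T)\<^sup>T) = fip A (C * B\<^sup>T)"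
    using assms fip_transpose[of A n k "C * B\<^sup>T"] by auto
  finally show ?thesis .
qed

lemma frob_sq: "(frob_norm A)\<^sup>2 = fip A A"
  by (simp add: frob_norm_def fip_def sum_nonneg power2_eq_square)

lemma frob_eq_sqrt: "frob_norm A = sqrt (fip A A)"
  by (simp add: frob_norm_def fip_def power2_eq_square)

lemma frob_ge0 [simp]: "0 \<le> frob_norm A"
  by (simp add: frob_norm_def sum_nonneg)

lemma frob_L2: "A \<in> carrier_mat n m \<Longrightarrow> frob_norm A = L2_set (\<lambda>x. A $$ x) ({..<n} \<times> {..<m})"
  by (simp add: frob_norm_def L2_set_def sum.cartesian_product)

lemma vnorm_L2: "v \<in> carrier_vec n \<Longrightarrow> vnorm v = L2_set (\<lambda>i. v $ i) {..<n}"
  by (simp add: vnorm_def L2_set_def scalar_prod_eq_sum[of v n] power2_eq_square)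

lemma vnorm_ge0 [simp]: "0 \<le> vnorm v"
  by (simp add: vnorm_def scalar_prod_def sum_nonneg)

lemma vnorm_sq: "(vnorm v)\<^sup>2 = v \<bullet> v"
  by (simp add: vnorm_def scalar_prod_def sum_nonneg)

lemma fip_le_frob:
  assumes "A \<in> carrier_mat n m" "B \<in> carrier_mat n m"
  shows "\<bar>fip A B\<bar> \<le> frob_norm A * frob_norm B"
proof -
  have "fip A B = (\<Sum>x\<in>{..<n} \<times> {..<m}. A $$ x * B $$ x)"
    using assms by (simp add: fip_eq[of A n m] sum.cartesian_product)
  also have "\<bar>\<dots>\<bar> \<le> (\<Sum>x\<in>{..<n} \<times> {..<m}. \<bar>A $$ x\<bar> * \<bar>B $$ x\<bar>)"
    by (rule order.trans[OF sum_abs]) (simp add: abs_mult)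
  also have "\<dots> \<le> frob_norm A * frob_norm B"
    using L2_set_mult_ineq[of "\<lambda>x. A $$ x" "\<lambda>x. B $$ x" "{..<n} \<times> {..<m}"] assms
    by (simp add: frob_L2[of _ n m])
  finally show ?thesis .
qed

lemma frob_add:
  assumes "A \<in> carrier_mat n m" "B \<in> carrier_mat n m"
  shows "frob_norm (A + B) \<le> frob_norm A + frob_norm B"
proof -
  have "frob_norm (A + B) = L2_set (\<lambda>x. A $$ x + B $$ x) ({..<n} \<times> {..<m})"
    using assms by (subst frob_L2[of _ n m]) (auto intro!: L2_set_cong)
  then show ?thesis
    using L2_set_triangle_ineq[of "\<lambda>x. A $$ x" "\<lambda>x. B $$ x" "{..<n} \<times> {..<m}"] assms
    by (simp add: frob_L2[of _ n m])
qed

lemma frob_smult: "frob_norm (c \<cdot>\<^sub>m A) = \<bar>c\<bar> * frob_norm A"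
  by (simp add: frob_norm_def power_mult_distrib real_sqrt_mult flip: sum_distrib_left)

lemma frob_minus:
  assumes "A \<in> carrier_mat n m" "B \<in> carrier_mat n m"
  shows "frob_norm (A - B) \<le> frob_norm A + frob_norm B"
proof -
  have "A - B = A + (-1) \<cdot>\<^sub>m B" using assms by (intro eq_matI) auto
  then show ?thesis using frob_add[of A n m "(-1) \<cdot>\<^sub>m B"] assms by (simp add: frob_smult)
qed

lemma frob_transpose: "frob_norm A\<^sup>T = frob_norm A"
  unfolding frob_eq_sqrt by (subst fip_transpose[of A "dim_row A" "dim_col A"]) auto

lemma frob_0 [simp]: "frob_norm (0\<^sub>m n m) = 0"
  by (simp add: frob_norm_def)

lemma frob_eq_0: "A \<in> carrier_mat n m \<Longrightarrow> frob_norm A = 0 \<Longrightarrow> A = 0\<^sub>m n m"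
  by (intro eq_matI) (auto simp: frob_L2[of A n m] L2_set_eq_0_iff)

lemma scalar_prod_le_vnorm:
  assumes "u \<in> carrier_vec n" "v \<in> carrier_vec n"
  shows "\<bar>u \<bullet> v\<bar> \<le> vnorm u * vnorm v"
proof -
  have "\<bar>u \<bullet> v\<bar> \<le> (\<Sum>i<n. \<bar>u $ i\<bar> * \<bar>v $ i\<bar>)"
    using assms by (simp add: scalar_prod_eq_sum[of v n]) (rule order.trans[OF sum_abs], simp add: abs_mult)
  also have "\<dots> \<le> vnorm u * vnorm v"
    using L2_set_mult_ineq[of "\<lambda>i. u $ i" "\<lambda>i. v $ i" "{..<n}"] assms by (simp add: vnorm_L2)
  finally show ?thesis .
qed

lemma vnorm_add: "u \<in> carrier_vec n \<Longrightarrow> v \<in> carrier_vec n \<Longrightarrow> vnorm (u + v) \<le> vnorm u + vnorm v"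
  using L2_set_triangle_ineq[of "\<lambda>i. u $ i" "\<lambda>i. v $ i" "{..<n}"]
  by (simp add: vnorm_L2[of _ n] L2_set_def)

lemma vnorm_smult: "vnorm (c \<cdot>\<^sub>v v) = \<bar>c\<bar> * vnorm v"
proof -
  have "(c \<cdot>\<^sub>v v) \<bullet> (c \<cdot>\<^sub>v v) = c\<^sup>2 * (v \<bullet> v)" by (simp add: power2_eq_square)
  then show ?thesis by (simp add: vnorm_def real_sqrt_mult)
qed

lemma vnorm_uminus_aux: "(-1) \<cdot>\<^sub>v v = - (v :: real vec)"
  by (intro eq_vecI) auto

lemma vnorm_minus: "u \<in> carrier_vec n \<Longrightarrow> v \<in> carrier_vec n \<Longrightarrow> vnorm (u - v) \<le> vnorm u + vnorm v"
  using vnorm_add[of u n "(-1) \<cdot>\<^sub>v v"] vnorm_smult[of "-1" v]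
  by (simp add: minus_add_uminus_vec[of u n v] vnorm_uminus_aux)

lemma vnorm_0 [simp]: "vnorm (0\<^sub>v n) = 0"
  by (simp add: vnorm_def)

lemma vnorm_eq_0: "v \<in> carrier_vec n \<Longrightarrow> vnorm v = 0 \<Longrightarrow> v = 0\<^sub>v n"
  by (intro eq_vecI) (auto simp: vnorm_L2[of v n] L2_set_eq_0_iff)

lemma fip_rows: "A \<in> carrier_mat n m \<Longrightarrow> B \<in> carrier_mat n m \<Longrightarrow> fip A B = (\<Sum>i<n. row A i \<bullet> row B i)"
  by (simp add: fip_eq scalar_prod_eq_sum[of _ m])

lemma fip_cols: "A \<in> carrier_mat n m \<Longrightarrow> B \<in> carrier_mat n m \<Longrightarrow> fip A B = (\<Sum>j<m. col A j \<bullet> col B j)"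
  by (subst fip_eq, assumption, subst sum.swap) (simp add: scalar_prod_eq_sum[of _ n])

section \<open>Frobenius norms by rows and columns, norms of products\<close>

lemma frob_sq_rows: "A \<in> carrier_mat n m \<Longrightarrow> (frob_norm A)\<^sup>2 = (\<Sum>i<n. (vnorm (row A i))\<^sup>2)"
  by (simp add: frob_sq fip_rows vnorm_sq)

lemma frob_sq_cols: "A \<in> carrier_mat n m \<Longrightarrow> (frob_norm A)\<^sup>2 = (\<Sum>i<m. (vnorm (col A i))\<^sup>2)"
  by (simp add: frob_sq fip_cols vnorm_sq)

text \<open>The columns of \<open>A\<close> are treated one by one. The operator bound is a
  hypothesis on vectors and not an \<open>op_norm\<close>, so that the design or the random signal
  matrix can be plugged in directly.\<close>

lemma frob_mult_le_op:
  assumes M: "M \<in> carrier_mat k n" and A: "A \<in> carrier_mat n m" and c: "0 \<le> c"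
    and op: "\<And>v. v \<in> carrier_vec n \<Longrightarrow> vnorm (M *\<^sub>v v) \<le> c * vnorm v"
  shows "frob_norm (M * A) \<le> c * frob_norm A"
proof -
  have "(frob_norm (M * A))\<^sup>2 = (\<Sum>j<m. (vnorm (M *\<^sub>v col A j))\<^sup>2)"
    using M A by (subst frob_sq_cols[of "M * A" k m]) (auto simp: mult_mat_vec_def intro!: sum.cong)
  also have "\<dots> \<le> (\<Sum>j<m. (c * vnorm (col A j))\<^sup>2)"
    using A by (intro sum_mono power_mono op) auto
  also have "\<dots> = (c * frob_norm A)\<^sup>2"
    by (simp add: power_mult_distrib frob_sq_cols[OF A] sum_distrib_left)
  finally show ?thesis using c by (simp add: power2_le_iff_abs_le)
qed

lemma vnorm_mult_le_frob:
  assumes M: "M \<in> carrier_mat k n" and v: "v \<in> carrier_vec n"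
  shows "vnorm (M *\<^sub>v v) \<le> frob_norm M * vnorm v"
proof -
  have "(vnorm (M *\<^sub>v v))\<^sup>2 = (\<Sum>i<k. (row M i \<bullet> v)\<^sup>2)"
    unfolding vnorm_sq using M v by (subst scalar_prod_eq_sum[of _ k]) (auto simp: power2_eq_square)
  also have "\<dots> \<le> (\<Sum>i<k. (vnorm (row M i) * vnorm v)\<^sup>2)"
    using M v scalar_prod_le_vnorm[of "row M _" n v] by (intro sum_mono) (auto simp: abs_le_square_iff[symmetric])
  also have "\<dots> = (frob_norm M * vnorm v)\<^sup>2"
    by (simp add: power_mult_distrib frob_sq_rows[OF M] sum_distrib_right)
  finally show ?thesis by (simp add: power2_le_iff_abs_le)
qed

lemma frob_mult:
  assumes "M \<in> carrier_mat k n" "A \<in> carrier_mat n m"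
  shows "frob_norm (M * A) \<le> frob_norm M * frob_norm A"
  using assms by (intro frob_mult_le_op[of _ k n _ m] vnorm_mult_le_frob) auto

lemma frob_gram: "M \<in> carrier_mat k n \<Longrightarrow> frob_norm (M\<^sup>T * M) \<le> (frob_norm M)\<^sup>2"
  using frob_mult[of "M\<^sup>T" n k M n] by (simp add: frob_transpose power2_eq_square)

text \<open>Duality of the mixed norm with the largest row norm: this is how a penalty level above
  the row norms of a noise matrix absorbs the noise term of a lasso inequality.\<close>

lemma fip_le_l1l2:
  assumes C: "C \<in> carrier_mat p m" and D: "D \<in> carrier_mat p m"
    and c: "\<And>j. j < p \<Longrightarrow> vnorm (row C j) \<le> c"
  shows "\<bar>fip C D\<bar> \<le> c * l1l2_norm D"
proof -
  have "\<bar>fip C D\<bar> \<le> (\<Sum>j<p. \<bar>row C j \<bullet> row D j\<bar>)"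
    using C D by (simp add: fip_rows[of _ p m])
  also have "\<dots> \<le> (\<Sum>j<p. c * vnorm (row D j))"
    using C D by (intro sum_mono order.trans[OF scalar_prod_le_vnorm[of _ m]] mult_right_mono c) auto
  finally show ?thesis using D by (simp add: l1l2_norm_def sum_distrib_left)
qed

text \<open>Duality: \<open>\<parallel>C\<^sup>T D\<parallel>\<^sub>F\<^sup>2 = \<langle>C (C\<^sup>T D), D\<rangle>\<close>, and the rows of \<open>C (C\<^sup>T D)\<close> are
  controlled by those of \<open>C\<close>.\<close>

lemma frob_mult_le_l1l2:
  assumes C: "C \<in> carrier_mat p k" and D: "D \<in> carrier_mat p m" and c0: "0 \<le> c"
    and c: "\<And>j. j < p \<Longrightarrow> vnorm (row C j) \<le> c"
  shows "frob_norm (C\<^sup>T * D) \<le> c * l1l2_norm D"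
proof (cases "frob_norm (C\<^sup>T * D) = 0")
  case True
  then show ?thesis using c0 by (simp add: l1l2_norm_def sum_nonneg)
next
  case False
  define G where "G = C\<^sup>T * D"
  have G: "G \<in> carrier_mat k m" using C D by (simp add: G_def)
  have "(frob_norm G)\<^sup>2 = fip D (C * G)"
    unfolding frob_sq by (subst (1) G_def, subst fip_mult_left[of "C\<^sup>T" k p D m]) (use C D G in auto)
  also have "\<dots> = fip (C * G) D" using C D G by (intro fip_commute[of _ p m]) auto
  also have "\<dots> \<le> (c * frob_norm G) * l1l2_norm D"
  proof (rule order.trans[OF abs_ge_self], rule fip_le_l1l2)
    show "C * G \<in> carrier_mat p m" "D \<in> carrier_mat p m" using C D G by auto
    fix j assume j: "j < p"
    have "row (C * G) j = G\<^sup>T *\<^sub>v row C j"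
    proof (rule eq_vecI)
      fix i assume "i < dim_vec (G\<^sup>T *\<^sub>v row C j)"
      then have i: "i < m" using G by simp
      have "row (C * G) j $ i = row C j \<bullet> col G i" using C G i j by simp
      also have "\<dots> = col G i \<bullet> row C j" using C G i j by (intro comm_scalar_prod[of _ k]) auto
      finally show "row (C * G) j $ i = (G\<^sup>T *\<^sub>v row C j) $ i" using G i by simp
    qed (use C G in simp)
    then have "vnorm (row (C * G) j) \<le> frob_norm G * vnorm (row C j)"
      using vnorm_mult_le_frob[of "G\<^sup>T" m k "row C j"] C G j by (simp add: frob_transpose)
    also have "\<dots> \<le> frob_norm G * c" by (intro mult_left_mono c j) auto
    finally show "vnorm (row (C * G) j) \<le> c * frob_norm G" by (simp add: mult.commute)
  qed
  finally have "frob_norm G * frob_norm G \<le> frob_norm G * (c * l1l2_norm D)"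
    by (simp add: power2_eq_square algebra_simps)
  moreover have "0 < frob_norm G" using False frob_ge0[of G] unfolding G_def by linarith
  ultimately show ?thesis by (simp only: mult_le_cancel_left_pos G_def)
qed

section \<open>The mixed norm and its restriction to a set of rows\<close>

lemma l1l2_ge0 [simp]: "0 \<le> l1l2_norm D"
  by (simp add: l1l2_norm_def sum_nonneg)

lemma l1l2_triangle:
  assumes "A \<in> carrier_mat p m" "B \<in> carrier_mat p m"
  shows "l1l2_norm (A + B) \<le> l1l2_norm A + l1l2_norm B"
proof -
  have "(\<Sum>j<p. vnorm (row (A + B) j)) \<le> (\<Sum>j<p. vnorm (row A j) + vnorm (row B j))"
  proof (rule sum_mono)
    fix j assume j: "j \<in> {..<p}"
    then have "row (A + B) j = row A j + row B j" using assms by (intro eq_vecI) auto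
    then show "vnorm (row (A + B) j) \<le> vnorm (row A j) + vnorm (row B j)"
      using j assms vnorm_add[of "row A j" m "row B j"] by auto
  qed
  then show ?thesis using assms by (simp add: l1l2_norm_def sum.distrib)
qed

lemma row_restrict_rows: "j < dim_row D \<Longrightarrow> row (restrict_rows S D) j = (if j \<in> S then row D j else 0\<^sub>v (dim_col D))"
  by (intro eq_vecI) (auto simp: restrict_rows_def)

lemma restrict_rows_carrier [simp]: "D \<in> carrier_mat p m \<Longrightarrow> restrict_rows S D \<in> carrier_mat p m"
  by (auto simp: restrict_rows_def)

lemma l1l2_restrict: "D \<in> carrier_mat p m \<Longrightarrow> S \<subseteq> {..<p} \<Longrightarrow> l1l2_norm (restrict_rows S D) = (\<Sum>j\<in>S. vnorm (row D j))"
proof -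
  assume a: "D \<in> carrier_mat p m" "S \<subseteq> {..<p}"
  have "l1l2_norm (restrict_rows S D) = (\<Sum>j<p. if j \<in> S then vnorm (row D j) else 0)"
    using a by (auto simp: l1l2_norm_def row_restrict_rows restrict_rows_carrier carrier_matD[OF restrict_rows_carrier[OF a(1)]]
       intro!: sum.cong)
  also have "\<dots> = (\<Sum>j\<in>S. vnorm (row D j))"
    using a by (simp add: sum.If_cases Int_absorb1)
  finally show ?thesis .
qed

lemma l1l2_split:
  assumes "D \<in> carrier_mat p m" "S \<subseteq> {..<p}"
  shows "l1l2_norm D = l1l2_norm (restrict_rows S D) + l1l2_norm (restrict_rows ({..<p} - S) D)"
  using assms sum.subset_diff[of S "{..<p}" "\<lambda>j. vnorm (row D j)"]
  by (simp add: l1l2_restrict[of D p m]) (simp add: l1l2_norm_def add.commute)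

text \<open>Cauchy--Schwarz against the constant 1 on \<open>S\<close>; the sparsity enters the fast
  lasso bound through this inequality.\<close>

lemma l1l2_restrict_le_frob:
  assumes D: "D \<in> carrier_mat p m" and S: "S \<subseteq> {..<p}"
  shows "l1l2_norm (restrict_rows S D) \<le> sqrt (real (card S)) * frob_norm (restrict_rows S D)"
proof -
  have "(frob_norm (restrict_rows S D))\<^sup>2 = (\<Sum>j<p. if j \<in> S then (vnorm (row D j))\<^sup>2 else 0)"
    using D by (subst frob_sq_rows[of _ p m]) (auto simp: row_restrict_rows intro!: sum.cong)
  also have "\<dots> = (\<Sum>j\<in>S. (vnorm (row D j))\<^sup>2)"
    using S by (simp add: sum.If_cases Int_absorb1)
  finally have F: "frob_norm (restrict_rows S D) = L2_set (\<lambda>j. vnorm (row D j)) S"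
    by (metis L2_set_def frob_ge0 real_sqrt_unique)
  have "(\<Sum>j\<in>S. \<bar>1::real\<bar> * \<bar>vnorm (row D j)\<bar>) \<le> L2_set (\<lambda>_. 1) S * L2_set (\<lambda>j. vnorm (row D j)) S"
    by (rule L2_set_mult_ineq)
  then show ?thesis
    using F l1l2_restrict[OF D S] by (simp add: L2_set_def)
qed

lemma l1l2_eq_0: "D \<in> carrier_mat p m \<Longrightarrow> l1l2_norm D = 0 \<Longrightarrow> D = 0\<^sub>m p m"
proof (intro eq_matI)
  fix i j assume D: "D \<in> carrier_mat p m" "l1l2_norm D = 0" and ij: "i < dim_row (0\<^sub>m p m :: real mat)" "j < dim_col (0\<^sub>m p m :: real mat)"
  then have "vnorm (row D i) = 0"
    by (auto simp: l1l2_norm_def sum_nonneg_eq_0_iff)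
  then have "row D i = 0\<^sub>v m" using D ij by (intro vnorm_eq_0) auto
  then have "row D i $ j = 0" using ij by simp
  then show "D $$ (i, j) = 0\<^sub>m p m $$ (i, j)" using D ij by auto
qed auto

section \<open>The spectral theorem\<close>

lemma symmetric_scalar_prod:
  fixes S :: "real mat"
  assumes "S \<in> carrier_mat d d" "S\<^sup>T = S" "x \<in> carrier_vec d" "y \<in> carrier_vec d"
  shows "(S *\<^sub>v x) \<bullet> y = x \<bullet> (S *\<^sub>v y)"
  using transpose_vec_mult_scalar[of S d d y x] assms by simp

lemma scalar_prod_self_pos: "v \<in> carrier_vec d \<Longrightarrow> v \<noteq> 0\<^sub>v d \<Longrightarrow> 0 < v \<bullet> (v :: real vec)"
  using vnorm_eq_0[of v d] vnorm_sq[of v] by (metis vnorm_ge0 zero_less_power2)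

text \<open>The fundamental theorem of algebra yields a complex eigenpair. Splitting the eigenvector
  into x + i y and testing the symmetry of \<open>S\<close> on x and y forces the eigenvalue to be
  real, and then whichever of x and y is nonzero is a real eigenvector.\<close>

lemma symmetric_real_eigenvector:
  assumes S: "S \<in> carrier_mat d d" and sym: "S\<^sup>T = S" and d: "d > 0"
  obtains e v where "v \<in> carrier_vec d" "v \<noteq> 0\<^sub>v d" "S *\<^sub>v v = e \<cdot>\<^sub>v (v :: real vec)"
proof -
  let ?c = complex_of_real
  let ?C = "map_mat ?c S"
  have C: "?C \<in> carrier_mat d d" using S by simp
  have "degree (char_poly ?C) = d" using degree_monic_char_poly[OF C] by simp
  then have "\<not> constant (poly (char_poly ?C))" using d by (simp add: constant_degree)
  then obtain \<mu> where "poly (char_poly ?C) \<mu> = 0" using fundamental_theorem_of_algebra by blast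
  then have "eigenvalue ?C \<mu>" using eigenvalue_root_char_poly[OF C] by simp
  then obtain z where z: "z \<in> carrier_vec d" "z \<noteq> 0\<^sub>v d" "?C *\<^sub>v z = \<mu> \<cdot>\<^sub>v z"
    using C by (auto simp: eigenvalue_def eigenvector_def)
  define x where "x = map_vec Re z"
  define y where "y = map_vec Im z"
  have xy: "x \<in> carrier_vec d" "y \<in> carrier_vec d" using z by (auto simp: x_def y_def)
  have eq: "(\<Sum>j<d. ?c (S $$ (i,j)) * z $ j) = \<mu> * z $ i" if "i < d" for i
  proof -
    have "(?C *\<^sub>v z) $ i = (\<Sum>j<d. ?c (S $$ (i,j)) * z $ j)"
      using that z(1) S by (simp add: scalar_prod_def atLeast0LessThan)
    then show ?thesis using z that by simp
  qed
  have Sx: "S *\<^sub>v x = Re \<mu> \<cdot>\<^sub>v x - Im \<mu> \<cdot>\<^sub>v y"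
  proof (rule eq_vecI)
    fix i assume "i < dim_vec (Re \<mu> \<cdot>\<^sub>v x - Im \<mu> \<cdot>\<^sub>v y)"
    then have i: "i < d" using xy by simp
    show "(S *\<^sub>v x) $ i = (Re \<mu> \<cdot>\<^sub>v x - Im \<mu> \<cdot>\<^sub>v y) $ i"
      using arg_cong[OF eq[OF i], of Re] i S xy z(1)
      by (subst mult_mat_vec_index[OF S xy(1) i]) (simp add: x_def y_def)
  qed (use S xy in auto)
  have Sy: "S *\<^sub>v y = Im \<mu> \<cdot>\<^sub>v x + Re \<mu> \<cdot>\<^sub>v y"
  proof (rule eq_vecI)
    fix i assume "i < dim_vec (Im \<mu> \<cdot>\<^sub>v x + Re \<mu> \<cdot>\<^sub>v y)"
    then have i: "i < d" using xy by simp
    show "(S *\<^sub>v y) $ i = (Im \<mu> \<cdot>\<^sub>v x + Re \<mu> \<cdot>\<^sub>v y) $ i"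
      using arg_cong[OF eq[OF i], of Im] i S xy z(1)
      by (subst mult_mat_vec_index[OF S xy(2) i]) (simp add: x_def y_def algebra_simps)
  qed (use S xy in auto)
  have nz: "x \<noteq> 0\<^sub>v d \<or> y \<noteq> 0\<^sub>v d"
  proof (rule ccontr)
    assume "\<not> ?thesis"
    then have 0: "x = 0\<^sub>v d" "y = 0\<^sub>v d" by auto
    have "z = 0\<^sub>v d"
    proof (rule eq_vecI)
      fix i assume "i < dim_vec (0\<^sub>v d :: complex vec)"
      then have i: "i < d" by simp
      show "z $ i = 0\<^sub>v d $ i"
        using arg_cong[OF 0(1), of "\<lambda>v. v $ i"] arg_cong[OF 0(2), of "\<lambda>v. v $ i"] i z(1)
        by (simp add: x_def y_def complex_eq_iff)
    qed (use z in simp)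
    then show False using z by simp
  qed
  \<comment> \<open>The left side is Re \<mu> (x . y) - Im \<mu> (y . y), the right side Im \<mu> (x
    . x) + Re \<mu> (x . y); only the terms with Im \<mu> survive.\<close>
  have "(S *\<^sub>v x) \<bullet> y = x \<bullet> (S *\<^sub>v y)" by (rule symmetric_scalar_prod[OF S sym xy])
  then have "Im \<mu> * (x \<bullet> x + y \<bullet> y) = 0"
    unfolding Sx Sy using xy
    by (simp add: minus_scalar_prod_distrib[of _ d] scalar_prod_add_distrib[of _ d] algebra_simps)
  moreover have "x \<bullet> x + y \<bullet> y > 0"
    using nz scalar_prod_self_pos[OF xy(1)] scalar_prod_self_pos[OF xy(2)] vnorm_sq[of x] vnorm_sq[of y]
    by (metis add_nonneg_pos add_pos_nonneg zero_le_power2)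
  ultimately have "Im \<mu> = 0" by simp
  then have "S *\<^sub>v x = Re \<mu> \<cdot>\<^sub>v x" "S *\<^sub>v y = Re \<mu> \<cdot>\<^sub>v y"
    unfolding Sx Sy using xy by (auto intro!: eq_vecI)
  then show ?thesis using that nz xy by blast
qed

text \<open>The Householder reflection that exchanges \<open>v\<close> and the first basis vector.\<close>

lemma reflection_exists:
  assumes v: "v \<in> carrier_vec d" and v1: "v \<bullet> v = (1::real)" and d: "d > 0"
  obtains W where "W \<in> carrier_mat d d" "W\<^sup>T = W" "W * W = 1\<^sub>m d" "col W 0 = v"
proof -
  define w where "w = v - unit_vec d 0"
  have w: "w \<in> carrier_vec d" using v by (simp add: w_def)
  \<comment> \<open>If \<open>v\<close> already is the first basis vector, then \<open>w\<close> is
    zero, the quotient is 0 by convention and \<open>W\<close> becomes the identity, as it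
    should.\<close>
  define c where "c = 2 / (w \<bullet> w)"
  define W where "W = mat d d (\<lambda>(i,j). (if i = j then 1 else 0) - c * w $ i * w $ j)"
  have W: "W \<in> carrier_mat d d" by (simp add: W_def)
  have wi: "w $ i = v $ i - (if i = 0 then 1 else 0)" if "i < d" for i
    using that v by (simp add: w_def)
  have ww: "w \<bullet> w = 2 - 2 * v $ 0"
  proof -
    have "w \<bullet> w = v \<bullet> v - 2 * v $ 0 + 1"
      unfolding w_def using v d
      by (simp add: minus_scalar_prod_distrib[of _ d] scalar_prod_minus_distrib[of _ d]
         scalar_prod_left_unit[of _ d] scalar_prod_right_unit[of _ d])
    then show ?thesis using v1 by simp
  qed
  have c: "c * c * (w \<bullet> w) = 2 * c" by (simp add: c_def)
  have sum_w: "(\<Sum>k<d. w $ k * w $ k) = w \<bullet> w" using w by (simp add: scalar_prod_eq_sum[of w d])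
  show ?thesis
  proof (rule that[OF W])
    show "W\<^sup>T = W" by (rule eq_matI) (auto simp: W_def)
    show "W * W = 1\<^sub>m d"
    proof (rule eq_matI)
      fix i j assume "i < dim_row (1\<^sub>m d :: real mat)" "j < dim_col (1\<^sub>m d :: real mat)"
      then have ij: "i < d" "j < d" by auto
      have "(W * W) $$ (i,j) = (\<Sum>k<d. ((if i = k then 1 else 0) - c * w $ i * w $ k) * ((if k = j then 1 else 0) - c * w $ k * w $ j))"
        using mult_mat_index[OF W W ij] ij by (simp add: W_def)
      also have "\<dots> = (\<Sum>k<d. (if i = k then if k = j then 1 else 0 else 0) - (if i = k then c * w $ k * w $ j else 0)
           - (if k = j then c * w $ i * w $ k else 0) + c * c * w $ i * w $ j * (w $ k * w $ k))"
        by (intro sum.cong) (auto simp: algebra_simps)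
      also have "\<dots> = (if i = j then 1 else 0) - 2 * c * w $ i * w $ j + c * c * w $ i * w $ j * (w \<bullet> w)"
        using ij sum_w by (simp add: sum.distrib sum_subtractf flip: sum_distrib_left)
      also have "\<dots> = (if i = j then 1 else 0) + (c * c * (w \<bullet> w) - 2 * c) * (w $ i * w $ j)"
        by (simp add: algebra_simps)
      finally show "(W * W) $$ (i,j) = 1\<^sub>m d $$ (i,j)" using ij c by simp
    qed (auto simp: W_def)
    show "col W 0 = v"
    proof (rule eq_vecI)
      fix i assume "i < dim_vec v"
      then have i: "i < d" using v by simp
      show "col W 0 $ i = v $ i"
      proof (cases "w \<bullet> w = 0")
        case True
        then have "w = 0\<^sub>v d" using vnorm_eq_0[OF w] by (simp add: vnorm_def)
        then show ?thesis using wi[OF i] i d by (auto simp: W_def c_def True)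
      next
        case False
        then have "c * w $ 0 = -1" using ww wi[OF d] by (simp add: c_def field_simps)
        then have "c * w $ i * w $ 0 = - w $ i" by (metis mult.commute mult.left_commute mult_minus1)
        then show ?thesis using wi[OF i] i d by (auto simp: W_def)
      qed
    qed (use v W in auto)
  qed
qed

text \<open>Deflation: conjugating with the reflection that sends the first basis vector to a unit
  eigenvector clears the first column below the diagonal, symmetry clears the first row, and the
  induction hypothesis handles the remaining block.\<close>

lemma symmetric_diagonalizable:
  assumes "S \<in> carrier_mat d d" "S\<^sup>T = (S :: real mat)"
  shows "\<exists>U l. U \<in> carrier_mat d d \<and> U\<^sup>T * U = 1\<^sub>m d \<and> U\<^sup>T * S * U = mat d d (\<lambda>(i,j). if i = j then l i else (0::real))"
  using assms
proof (induction d arbitrary: S)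
  case 0
  then show ?case by (intro exI[of _ "1\<^sub>m 0"] exI[of _ "\<lambda>_. 0"]) (auto intro!: eq_matI)
next
  case (Suc d)
  note S = Suc.prems(1) and sym = Suc.prems(2)
  obtain e v0 where v0: "v0 \<in> carrier_vec (Suc d)" "v0 \<noteq> 0\<^sub>v (Suc d)" "S *\<^sub>v v0 = e \<cdot>\<^sub>v v0"
    by (rule symmetric_real_eigenvector[OF S sym]) auto
  define v where "v = (1 / vnorm v0) \<cdot>\<^sub>v v0"
  have n0: "vnorm v0 > 0" using v0 vnorm_eq_0[of v0] vnorm_ge0[of v0] by (metis order_le_less)
  have v: "v \<in> carrier_vec (Suc d)" and v1: "v \<bullet> v = 1"
    using v0 n0 vnorm_sq[of v0] by (auto simp: v_def field_simps power2_eq_square)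
  have Sv: "S *\<^sub>v v = e \<cdot>\<^sub>v v"
    using v0 S by (simp add: v_def mult_mat_vec[of S "Suc d" "Suc d"] smult_smult_assoc mult.commute)
  obtain W where W: "W \<in> carrier_mat (Suc d) (Suc d)" "W\<^sup>T = W" "W * W = 1\<^sub>m (Suc d)" "col W 0 = v"
    using reflection_exists[OF v v1] by auto
  define S' where "S' = W * S * W"
  have S': "S' \<in> carrier_mat (Suc d) (Suc d)" using W S by (simp add: S'_def)
  have sym': "S'\<^sup>T = S'"
  proof -
    have "S'\<^sup>T = W\<^sup>T * (W * S)\<^sup>T" unfolding S'_def
      using W S by (intro transpose_mult[of _ "Suc d" "Suc d" _ "Suc d"]) auto
    also have "(W * S)\<^sup>T = S * W"
      using W S sym transpose_mult[of W "Suc d" "Suc d" S "Suc d"] by simp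
    finally show ?thesis using W S by (simp add: S'_def assoc_mult_mat[of _ "Suc d" "Suc d" _ "Suc d"])
  qed
  have col0: "col S' 0 = e \<cdot>\<^sub>v unit_vec (Suc d) 0"
  proof -
    have "col S' 0 = (W * S) *\<^sub>v col W 0" unfolding S'_def using W S by (intro col_mult2) auto
    also have "\<dots> = W *\<^sub>v (S *\<^sub>v v)" using W S v by simp
    also have "\<dots> = e \<cdot>\<^sub>v (W *\<^sub>v v)" using W v Sv by (simp add: mult_mat_vec[of W "Suc d" "Suc d"])
    also have "W *\<^sub>v v = col (W * W) 0" using W by (subst col_mult2[of _ "Suc d" "Suc d" _ "Suc d"]) auto
    also have "\<dots> = unit_vec (Suc d) 0" using W by simp
    finally show ?thesis .
  qed
  have S'0: "S' $$ (i, 0) = (if i = 0 then e else 0)" if "i < Suc d" for i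
    using arg_cong[OF col0, of "\<lambda>u. u $ i"] that S' by (auto simp: unit_vec_def)
  have S'0': "S' $$ (0, i) = (if i = 0 then e else 0)" if "i < Suc d" for i
    using S'0[OF that] arg_cong[OF sym', of "\<lambda>M. M $$ (i, 0)"] that S' by auto
  define S3 where "S3 = mat d d (\<lambda>(i,j). S' $$ (Suc i, Suc j))"
  have S3: "S3 \<in> carrier_mat d d" by (simp add: S3_def)
  have "S3\<^sup>T = S3"
  proof (rule eq_matI)
    fix i j assume "i < dim_row S3" "j < dim_col S3"
    then show "S3\<^sup>T $$ (i,j) = S3 $$ (i,j)"
      using arg_cong[OF sym', of "\<lambda>M. M $$ (Suc i, Suc j)"] S' by (auto simp: S3_def)
  qed (auto simp: S3_def)
  then obtain U3 l where U3: "U3 \<in> carrier_mat d d" "U3\<^sup>T * U3 = 1\<^sub>m d"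
      "U3\<^sup>T * S3 * U3 = mat d d (\<lambda>(i,j). if i = j then l i else 0)"
    using Suc.IH[OF S3] by blast
  define F where "F = four_block_mat (1\<^sub>m 1) (0\<^sub>m 1 d) (0\<^sub>m d 1) U3"
  have F: "F \<in> carrier_mat (Suc d) (Suc d)" using U3 four_block_carrier_mat[of "1\<^sub>m 1" 1 1 U3 d d] by (simp add: F_def)
  have FT: "F\<^sup>T = four_block_mat (1\<^sub>m 1) (0\<^sub>m 1 d) (0\<^sub>m d 1) U3\<^sup>T"
    unfolding F_def using U3 by (subst transpose_four_block_mat[of _ 1 1 _ d _ d]) auto
  have S'b: "S' = four_block_mat (mat 1 1 (\<lambda>_. e)) (0\<^sub>m 1 d) (0\<^sub>m d 1) S3"
  proof (rule eq_matI)
    fix i j assume "i < dim_row (four_block_mat (mat 1 1 (\<lambda>_. e)) (0\<^sub>m 1 d) (0\<^sub>m d 1) S3)"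
      "j < dim_col (four_block_mat (mat 1 1 (\<lambda>_. e)) (0\<^sub>m 1 d) (0\<^sub>m d 1) S3)"
    then have "i < Suc d" "j < Suc d" using S3 by auto
    then show "S' $$ (i, j) = four_block_mat (mat 1 1 (\<lambda>_. e)) (0\<^sub>m 1 d) (0\<^sub>m d 1) S3 $$ (i, j)"
      using S'0[of i] S'0'[of j] S3 by (cases i; cases j) (auto simp: S3_def)
  qed (use S' S3 in auto)
  have FF: "F\<^sup>T * F = 1\<^sub>m (Suc d)"
    unfolding FT unfolding F_def using U3
    by (subst mult_four_block_mat[of _ 1 1 _ d _ d _ _ 1 _ d]) (auto intro!: eq_matI)
  have FSF: "F\<^sup>T * S' * F = mat (Suc d) (Suc d) (\<lambda>(i,j). if i = j then case_nat e l i else 0)"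
  proof -
    have "F\<^sup>T * S' = four_block_mat (mat 1 1 (\<lambda>_. e)) (0\<^sub>m 1 d) (0\<^sub>m d 1) (U3\<^sup>T * S3)"
      unfolding FT S'b using U3 S3
      by (subst mult_four_block_mat[of _ 1 1 _ d _ d _ _ 1 _ d]) auto
    then have "F\<^sup>T * S' * F = four_block_mat (mat 1 1 (\<lambda>_. e)) (0\<^sub>m 1 d) (0\<^sub>m d 1) (U3\<^sup>T * S3 * U3)"
      unfolding F_def using U3 S3
      by (simp only:) (subst mult_four_block_mat[of _ 1 1 _ d _ d _ _ 1 _ d], auto)
    then show ?thesis unfolding U3(3) by (auto intro!: eq_matI split: nat.splits if_splits simp: less_Suc_eq_0_disj)
  qed
  define U where "U = W * F"
  have U: "U \<in> carrier_mat (Suc d) (Suc d)" using W F by (simp add: U_def)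
  have UT: "U\<^sup>T = F\<^sup>T * W"
    using transpose_mult[OF W(1) F] W by (simp add: U_def)
  have asc: "(X * Y) * Z = X * (Y * Z)" if "X \<in> carrier_mat (Suc d) (Suc d)" "Y \<in> carrier_mat (Suc d) (Suc d)"
     "Z \<in> carrier_mat (Suc d) (Suc d)" for X Y Z :: "real mat"
    using that by (rule assoc_mult_mat)
  have "U\<^sup>T * U = F\<^sup>T * (W * (W * F))" unfolding UT unfolding U_def
    using W F by (intro asc) auto
  also have "W * (W * F) = (W * W) * F" by (rule asc[OF W(1) W(1) F, symmetric])
  also have "F\<^sup>T * (W * W * F) = 1\<^sub>m (Suc d)" using W F FF by simp
  finally have 1: "U\<^sup>T * U = 1\<^sub>m (Suc d)" .
  have FTc: "F\<^sup>T \<in> carrier_mat (Suc d) (Suc d)" using F by simp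
  have WS: "W * S \<in> carrier_mat (Suc d) (Suc d)" using W S by simp
  have WF: "W * F \<in> carrier_mat (Suc d) (Suc d)" using W F by simp
  have "U\<^sup>T * S * U = F\<^sup>T * (W * S) * (W * F)" unfolding UT unfolding U_def
    by (simp only: asc[OF FTc W(1) S])
  also have "\<dots> = F\<^sup>T * (W * S * (W * F))" by (rule asc[OF FTc WS WF])
  also have "W * S * (W * F) = S' * F" unfolding S'_def by (rule asc[OF WS W(1) F, symmetric])
  also have "F\<^sup>T * (S' * F) = F\<^sup>T * S' * F" by (rule asc[OF FTc S' F, symmetric])
  finally have "U\<^sup>T * S * U = F\<^sup>T * S' * F" .
  with 1 U FSF show ?case by (intro exI[of _ U] exI[of _ "case_nat e l"] conjI) (simp_all only:)
qed

definition orthonormal_basis :: "nat \<Rightarrow> (nat \<Rightarrow> real vec) \<Rightarrow> bool" where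
  "orthonormal_basis d u \<longleftrightarrow> (\<forall>i<d. u i \<in> carrier_vec d) \<and> (\<forall>i<d. \<forall>j<d. u i \<bullet> u j = (if i = j then 1 else 0))"

text \<open>Orthonormality says U^T U = I; for a square matrix this gives U U^T = I, which is the
  completeness of the family.\<close>

lemma parseval:
  assumes u: "orthonormal_basis d u" and x: "x \<in> carrier_vec d" and y: "y \<in> carrier_vec d"
  shows "x \<bullet> y = (\<Sum>i<d. (u i \<bullet> x) * (u i \<bullet> y))"
proof -
  define U where "U = mat d d (\<lambda>(i,j). u j $ i)"
  have U: "U \<in> carrier_mat d d" by (simp add: U_def)
  have ui: "u i \<in> carrier_vec d" if "i < d" for i using u that by (auto simp: orthonormal_basis_def)
  have colU: "col U i = u i" if "i < d" for i
    using that ui[OF that] by (intro eq_vecI) (auto simp: U_def)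
  have "U\<^sup>T * U = 1\<^sub>m d"
    using U u by (intro eq_matI) (auto simp: colU orthonormal_basis_def)
  then have 1: "U * U\<^sup>T = 1\<^sub>m d" using U by (intro mat_mult_left_right_inverse[of "U\<^sup>T"]) auto
  have Ux: "(U\<^sup>T *\<^sub>v z) $ i = u i \<bullet> z" if "i < d" for i z using that U colU by simp
  have "x \<bullet> y = x \<bullet> (U *\<^sub>v (U\<^sup>T *\<^sub>v y))"
    using 1 U y assoc_mult_mat_vec[of U d d "U\<^sup>T" d y] by simp
  also have "\<dots> = (U\<^sup>T *\<^sub>v x) \<bullet> (U\<^sup>T *\<^sub>v y)"
    using transpose_vec_mult_scalar[of U d d "U\<^sup>T *\<^sub>v y" x] U x y by simp
  also have "\<dots> = (\<Sum>i<d. (u i \<bullet> x) * (u i \<bullet> y))"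
    using U by (subst scalar_prod_eq_sum[of _ d]) (auto simp: Ux simp del: index_mult_mat_vec)
  finally show ?thesis .
qed

text \<open>Diagonalization gives eigenvalues in an arbitrary order, whereas
  \<open>kth_eigenvalue\<close> reads them off the sorted roots of the characteristic polynomial.
  Both lists have the same multiset of entries, so a permutation of the columns reconciles
  them.\<close>

theorem spectral_theorem:
  assumes S: "S \<in> carrier_mat d d" and sym: "S\<^sup>T = (S :: real mat)"
  obtains u where "orthonormal_basis d u"
    "\<And>i. i < d \<Longrightarrow> S *\<^sub>v u i = kth_eigenvalue S (Suc i) \<cdot>\<^sub>v u i"
    "\<And>i j. i \<le> j \<Longrightarrow> j < d \<Longrightarrow> kth_eigenvalue S (Suc j) \<le> kth_eigenvalue S (Suc i)"
proof -
  obtain U l where U: "U \<in> carrier_mat d d" "U\<^sup>T * U = 1\<^sub>m d"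
    and D: "U\<^sup>T * S * U = mat d d (\<lambda>(i,j). if i = j then l i else 0)" (is "_ = ?D")
    using symmetric_diagonalizable[OF S sym] by blast
  have U2: "U * U\<^sup>T = 1\<^sub>m d" using U by (intro mat_mult_left_right_inverse[of "U\<^sup>T"]) auto
  have asc: "(X * Y) * Z = X * (Y * Z)" if "X \<in> carrier_mat d d" "Y \<in> carrier_mat d d"
     "Z \<in> carrier_mat d d" for X Y Z :: "real mat"
    using that by (rule assoc_mult_mat)
  have "U * ?D = (U * U\<^sup>T) * (S * U)" unfolding D[symmetric] using U S by (simp add: asc)
  then have SU: "S * U = U * ?D" using U S U2 by simp
  have "U * ?D * U\<^sup>T = S * (U * U\<^sup>T)" unfolding SU[symmetric] using U S by (simp add: asc)
  then have SD: "S = U * ?D * U\<^sup>T" using U2 S by simp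
  have "similar_mat S ?D"
    unfolding similar_mat_def similar_mat_wit_def using U U2 SD S
    by (intro exI[of _ U] exI[of _ "U\<^sup>T"]) (auto simp: Let_def)
  then have "char_poly S = char_poly ?D" by (rule char_poly_similar)
  also have "\<dots> = (\<Prod>a\<leftarrow>diag_mat ?D. [:- a, 1:])"
    by (rule char_poly_upper_triangular[of _ d]) auto
  also have "diag_mat ?D = map l [0..<d]" by (auto simp: diag_mat_def)
  finally have cp: "char_poly S = (\<Prod>a\<leftarrow>map l [0..<d]. [:- a, 1:])" .
  have "proots (\<Prod>a\<leftarrow>xs. [:- a, 1:]) = mset xs" for xs :: "real list"
  proof (induction xs)
    case (Cons a xs)
    have "(\<Prod>a\<leftarrow>xs. [:- a, 1:]) \<noteq> (0 :: real poly)" by (auto simp: prod_list_zero_iff)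
    then show ?case using Cons by (simp add: proots_mult del: mult_pCons_left)
  qed simp
  then have pr: "proots (char_poly S) = mset (map l [0..<d])" by (simp only: cp)
  define es where "es = rev (sorted_list_of_multiset (mset (map l [0..<d])))"
  have k: "kth_eigenvalue S (Suc i) = es ! i" for i
    by (simp add: kth_eigenvalue_def pr es_def)
  have len: "length es = d" unfolding es_def
    by (metis length_map length_rev length_upt diff_zero mset_sorted_list_of_multiset size_mset)
  have "mset es = mset (map l [0..<d])" by (simp add: es_def)
  \<comment> \<open>\<open>f\<close> is the permutation that lists the columns of \<open>U\<close>
    by decreasing eigenvalue.\<close>
  then obtain f where f: "bij_betw f {..<length es} {..<length (map l [0..<d])}"
     "\<forall>i<length es. es ! i = map l [0..<d] ! f i"
    using permutation_Ex_bij by blast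
  have fd: "f i < d" if "i < d" for i using f(1) that len by (auto simp: bij_betw_def)
  have finj: "f i = f j \<longleftrightarrow> i = j" if "i < d" "j < d" for i j
    using f(1) that len by (auto simp: bij_betw_def inj_on_def)
  have esl: "es ! i = l (f i)" if "i < d" for i using f(2) that fd[OF that] len by simp
  have srt: "sorted (rev es)" by (simp add: es_def)
  show ?thesis
  proof (rule that[of "\<lambda>i. col U (f i)"])
    have "col U i \<bullet> col U j = (if i = j then 1 else 0)" if "i < d" "j < d" for i j
      using arg_cong[OF U(2), of "\<lambda>M. M $$ (i,j)"] that U(1) by auto
    then show "orthonormal_basis d (\<lambda>i. col U (f i))"
      using U fd finj by (auto simp: orthonormal_basis_def)
    fix i assume i: "i < d"
    have "S *\<^sub>v col U (f i) = col (S * U) (f i)" using S U i fd by (intro col_mult2[symmetric]) auto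
    also have "\<dots> = U *\<^sub>v col ?D (f i)" unfolding SU using U fd i by (intro col_mult2[of _ d d _ d]) auto
    also have "col ?D (f i) = l (f i) \<cdot>\<^sub>v unit_vec d (f i)"
      using fd[OF i] by (intro eq_vecI) auto
    also have "U *\<^sub>v (l (f i) \<cdot>\<^sub>v unit_vec d (f i)) = l (f i) \<cdot>\<^sub>v (U *\<^sub>v unit_vec d (f i))"
      using U by (intro mult_mat_vec) auto
    also have "U *\<^sub>v unit_vec d (f i) = col U (f i)"
      using U fd[OF i] by (intro eq_vecI) (auto simp: scalar_prod_right_unit[of _ d])
    finally show "S *\<^sub>v col U (f i) = kth_eigenvalue S (Suc i) \<cdot>\<^sub>v col U (f i)"
      by (simp add: k esl i)
  next
    fix i j assume ij: "i \<le> j" "j < d"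
    show "kth_eigenvalue S (Suc j) \<le> kth_eigenvalue S (Suc i)"
      unfolding k using srt ij len sorted_rev_nth_mono[of es i j] by simp
  qed
qed

section \<open>The ridge residual operator\<close>

text \<open>\<open>mat_inv\<close> extracts the value of an option, so its equations need a proof
  that the Gauss--Jordan inverse exists; a trivial kernel supplies it through the
  determinant.\<close>

lemma mat_inv_mult:
  assumes A: "A \<in> carrier_mat d d" and inj: "\<And>v. v \<in> carrier_vec d \<Longrightarrow> A *\<^sub>v v = 0\<^sub>v d \<Longrightarrow> v = 0\<^sub>v d"
  shows "mat_inv A \<in> carrier_mat d d" "A * mat_inv A = 1\<^sub>m d" "mat_inv A * A = 1\<^sub>m d"
proof -
  have "det A \<noteq> 0" using det_0_iff_vec_prod_zero_field[OF A] inj by blast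
  then have "A \<in> Units (ring_mat TYPE(real) d b)" for b :: unit
    using det_non_zero_imp_unit[OF A] by simp
  then obtain B where B: "mat_inverse A = Some B"
    using mat_inverse(1)[OF A, of "()"] by (cases "mat_inverse A") auto
  then show "mat_inv A \<in> carrier_mat d d" "A * mat_inv A = 1\<^sub>m d" "mat_inv A * A = 1\<^sub>m d"
    using mat_inverse(2)[OF A B] by (auto simp: mat_inv_def)
qed

lemma transpose_smult_mat: "(c \<cdot>\<^sub>m A)\<^sup>T = c \<cdot>\<^sub>m A\<^sup>T"
  by (intro eq_matI) auto

lemma mat_eq_minusI:
  "A \<in> carrier_mat a b \<Longrightarrow> B \<in> carrier_mat a b \<Longrightarrow> A + B = C \<Longrightarrow> A = C - (B :: real mat)"
  by (auto intro!: eq_matI)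

lemma smult_add_minus_aux:
  "A \<in> carrier_mat a b \<Longrightarrow> G \<in> carrier_mat a b \<Longrightarrow> H \<in> carrier_mat a b \<Longrightarrow>
    (A + c \<cdot>\<^sub>m G) + (c \<cdot>\<^sub>m G + H) - A = (2 * c) \<cdot>\<^sub>m G + (H :: real mat)"
  by (auto intro!: eq_matI)

lemma add_cancel_aux:
  "Z = w + v \<Longrightarrow> Y = v + u \<Longrightarrow> w \<in> carrier_mat a b \<Longrightarrow> v \<in> carrier_mat a b \<Longrightarrow> u \<in> carrier_mat a b \<Longrightarrow>
    Z - Y = w - (u :: real mat)"
  by (auto intro!: eq_matI)

lemma symmetric_from_inverse:
  assumes "A \<in> carrier_mat d d" "A\<^sup>T = A" "G \<in> carrier_mat d d" "A * G = 1\<^sub>m d"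
  shows "G\<^sup>T = (G :: real mat)"
proof -
  have "(A * G)\<^sup>T = 1\<^sub>m d" using assms(4) by simp
  then have "G\<^sup>T * A = 1\<^sub>m d" using transpose_mult[OF assms(1,3)] assms(2) by simp
  then have "G\<^sup>T * (A * G) = 1\<^sub>m d * G"
    using assms assoc_mult_mat[of "G\<^sup>T" d d A d G d] by simp
  then show ?thesis using assms by simp
qed

text \<open>With \<open>S = X X\<^sup>T / (n \<nu>)\<close> one has \<open>Q = (I + S)\<^sup>-\<^sup>1\<close>, and
  all the spectral inequalities for \<open>Q\<close> follow from \<open>Z = w + S w\<close> for \<open>w = Q Z\<close>.\<close>

locale ridge =
  fixes X :: "real mat" and n p :: nat and \<nu> :: real
  assumes X: "X \<in> carrier_mat n p" and n_pos: "0 < n" and nu_pos: "0 < \<nu>"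
begin

definition Q :: "real mat" where "Q = ridge_Q X \<nu>"

definition S :: "real mat" where "S = (1 / (real n * \<nu>)) \<cdot>\<^sub>m (X * X\<^sup>T)"

lemma n_nu: "0 < real n * \<nu>" using n_pos nu_pos by simp

lemma S: "S \<in> carrier_mat n n" using X by (simp add: S_def)

lemma S_sym: "S\<^sup>T = S"
proof -
  have "(X * X\<^sup>T)\<^sup>T = X * X\<^sup>T" using X by (simp add: transpose_mult[of X n p "X\<^sup>T" n])
  then show ?thesis unfolding S_def by (simp only: transpose_smult_mat)
qed

text \<open>Push-through identity. With G the inverse of X^T X + n \<nu> I one has X^T X G = I - n
  \<nu> G, whence S Q collapses to X G X^T, which is I - Q. The matrix to be inverted has a trivial
  kernel because its quadratic form is |X v|^2 + n \<nu> |v|^2.\<close>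

lemma Q: "Q \<in> carrier_mat n n" and Q_eq: "Q + S * Q = 1\<^sub>m n"
proof -
  define A where "A = X\<^sup>T * X + (real n * \<nu>) \<cdot>\<^sub>m 1\<^sub>m p"
  have A: "A \<in> carrier_mat p p" using X by (simp add: A_def)
  have XX: "X\<^sup>T * X \<in> carrier_mat p p" using X by simp
  define G where "G = mat_inv A"
  have inj: "v = 0\<^sub>v p" if v: "v \<in> carrier_vec p" "A *\<^sub>v v = 0\<^sub>v p" for v
  proof -
    have "A *\<^sub>v v = X\<^sup>T *\<^sub>v (X *\<^sub>v v) + (real n * \<nu>) \<cdot>\<^sub>v v"
    proof -
      have "A *\<^sub>v v = (X\<^sup>T * X) *\<^sub>v v + ((real n * \<nu>) \<cdot>\<^sub>m 1\<^sub>m p) *\<^sub>v v"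
        unfolding A_def using X v by (intro add_mult_distrib_mat_vec[of _ p p]) auto
      also have "(X\<^sup>T * X) *\<^sub>v v = X\<^sup>T *\<^sub>v (X *\<^sub>v v)" using X v by (intro assoc_mult_mat_vec) auto
      also have "((real n * \<nu>) \<cdot>\<^sub>m 1\<^sub>m p) *\<^sub>v v = (real n * \<nu>) \<cdot>\<^sub>v v"
        using v by (intro eq_vecI) (auto simp: scalar_prod_left_unit)
      finally show ?thesis .
    qed
    moreover have "v \<bullet> (A *\<^sub>v v) = 0" using v by simp
    ultimately have "0 = v \<bullet> (X\<^sup>T *\<^sub>v (X *\<^sub>v v) + (real n * \<nu>) \<cdot>\<^sub>v v)" by simp
    also have "\<dots> = v \<bullet> (X\<^sup>T *\<^sub>v (X *\<^sub>v v)) + real n * \<nu> * (v \<bullet> v)"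
      using v X by (subst scalar_prod_add_distrib[of _ p]) auto
    also have "v \<bullet> (X\<^sup>T *\<^sub>v (X *\<^sub>v v)) = (X *\<^sub>v v) \<bullet> (X *\<^sub>v v)"
      using transpose_vec_mult_scalar[of X n p v "X *\<^sub>v v"] X v
        comm_scalar_prod[of v p "X\<^sup>T *\<^sub>v (X *\<^sub>v v)"] by simp
    finally have "(vnorm (X *\<^sub>v v))\<^sup>2 + real n * \<nu> * (vnorm v)\<^sup>2 = 0" by (simp add: vnorm_sq)
    then have "real n * \<nu> * (vnorm v)\<^sup>2 \<le> 0" by (metis add.commute add_0 add_le_cancel_right le_add_same_cancel1 zero_le_power2)
    then have "vnorm v = 0" using n_pos nu_pos by (auto simp: mult_le_0_iff)
    then show ?thesis using vnorm_eq_0[OF v(1)] by simp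
  qed
  note G = mat_inv_mult[OF A inj, folded G_def]
  have dims: "dim_row X = n" "dim_col X = p" using X by auto
  have Qd: "Q = 1\<^sub>m n - X * G * X\<^sup>T" unfolding Q_def ridge_Q_def dims by (simp add: G_def A_def)
  have XGX: "X * G * X\<^sup>T \<in> carrier_mat n n" using X G by simp
  show Qc: "Q \<in> carrier_mat n n" unfolding Qd by (rule minus_carrier_mat[OF XGX])
  have XXG: "X\<^sup>T * X * G = 1\<^sub>m p - (real n * \<nu>) \<cdot>\<^sub>m G"
  proof -
    have "A * G = X\<^sup>T * X * G + ((real n * \<nu>) \<cdot>\<^sub>m 1\<^sub>m p) * G"
      unfolding A_def using X G(1) by (intro add_mult_distrib_mat[of _ p p]) auto
    also have "((real n * \<nu>) \<cdot>\<^sub>m 1\<^sub>m p) * G = (real n * \<nu>) \<cdot>\<^sub>m G"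
      using G(1) by (simp add: mult_smult_assoc_mat[of _ p p])
    finally have e: "X\<^sup>T * X * G + (real n * \<nu>) \<cdot>\<^sub>m G = 1\<^sub>m p" using G(2) by simp
    have c: "X\<^sup>T * X * G \<in> carrier_mat p p" using X G(1) by simp
    show ?thesis by (rule mat_eq_minusI[OF c _ e]) (use G(1) in simp)
  qed
  have "X * X\<^sup>T * (X * G * X\<^sup>T) = X * ((X\<^sup>T * X * G) * X\<^sup>T)"
  proof -
    have "X * X\<^sup>T * (X * G * X\<^sup>T) = X * (X\<^sup>T * (X * G * X\<^sup>T))"
      using X XGX by (intro assoc_mult_mat) auto
    also have "X\<^sup>T * (X * G * X\<^sup>T) = X\<^sup>T * (X * G) * X\<^sup>T" using X G(1) by (intro assoc_mult_mat[symmetric]) auto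
    also have "X\<^sup>T * (X * G) = X\<^sup>T * X * G" using X G(1) by (intro assoc_mult_mat[symmetric]) auto
    finally show ?thesis .
  qed
  also have "(X\<^sup>T * X * G) * X\<^sup>T = X\<^sup>T - (real n * \<nu>) \<cdot>\<^sub>m (G * X\<^sup>T)"
    unfolding XXG using X G(1)
    by (subst minus_mult_distrib_mat[of _ p p _ _ n]) (auto simp: mult_smult_assoc_mat[of G p p "X\<^sup>T" n])
  also have "X * (X\<^sup>T - (real n * \<nu>) \<cdot>\<^sub>m (G * X\<^sup>T)) = X * X\<^sup>T - (real n * \<nu>) \<cdot>\<^sub>m (X * G * X\<^sup>T)"
    using X G(1) by (subst mult_minus_distrib_mat[of _ n p _ n])
      (auto simp: mult_smult_distrib[of X n p _ n] assoc_mult_mat[of X n p G p "X\<^sup>T" n])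
  finally have e1: "X * X\<^sup>T * (X * G * X\<^sup>T) = X * X\<^sup>T - (real n * \<nu>) \<cdot>\<^sub>m (X * G * X\<^sup>T)" .
  have "S * Q = (1 / (real n * \<nu>)) \<cdot>\<^sub>m (X * X\<^sup>T * Q)"
    unfolding S_def using X Qc by (intro mult_smult_assoc_mat[of _ n n _ n]) auto
  also have "X * X\<^sup>T * Q = X * X\<^sup>T - X * X\<^sup>T * (X * G * X\<^sup>T)"
    unfolding Qd using X XGX by (subst mult_minus_distrib_mat[of _ n n _ n]) auto
  finally have SQ: "S * Q = (1 / (real n * \<nu>)) \<cdot>\<^sub>m (X * X\<^sup>T - (X * X\<^sup>T - (real n * \<nu>) \<cdot>\<^sub>m (X * G * X\<^sup>T)))"
    unfolding e1 .
  define U where "U = X * X\<^sup>T"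
  define V where "V = X * G * X\<^sup>T"
  have UV: "U \<in> carrier_mat n n" "V \<in> carrier_mat n n" using X XGX by (auto simp: U_def V_def)
  show "Q + S * Q = 1\<^sub>m n"
    unfolding SQ unfolding Qd U_def[symmetric] V_def[symmetric] using UV n_pos nu_pos by (auto intro!: eq_matI)
qed

lemma Q_sym: "Q\<^sup>T = Q"
proof (rule symmetric_from_inverse[of "1\<^sub>m n + S" n])
  show "(1\<^sub>m n + S)\<^sup>T = 1\<^sub>m n + S" using S transpose_add[of "1\<^sub>m n" n n S] by (simp add: S_sym)
  show "(1\<^sub>m n + S) * Q = 1\<^sub>m n" using S Q Q_eq by (simp add: add_mult_distrib_mat[of _ n n])
qed (use S Q in auto)

lemma split: "Z \<in> carrier_mat n m \<Longrightarrow> Z = Q * Z + S * (Q * Z)"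
proof -
  assume Z: "Z \<in> carrier_mat n m"
  have "Z = (Q + S * Q) * Z" using Q_eq Z by simp
  also have "\<dots> = Q * Z + S * Q * Z" using Q S Z by (intro add_mult_distrib_mat) auto
  also have "S * Q * Z = S * (Q * Z)" using Q S Z by (intro assoc_mult_mat) auto
  finally show ?thesis .
qed

lemma fip_S:
  assumes w: "w \<in> carrier_mat n m" and v: "v \<in> carrier_mat n m"
  shows "fip (S * w) v = fip (X\<^sup>T * w) (X\<^sup>T * v) / (real n * \<nu>)"
proof -
  have "S * w = (1 / (real n * \<nu>)) \<cdot>\<^sub>m (X * (X\<^sup>T * w))"
    unfolding S_def using X w by (subst mult_smult_assoc_mat[of _ n n _ m]) (auto simp: assoc_mult_mat[of X n p _ n w m])
  then show ?thesis using X w v by (simp add: fip_smult_left fip_mult_left[of X n p _ m])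
qed

lemma fip_S_self: "w \<in> carrier_mat n m \<Longrightarrow> 0 \<le> fip (S * w) w"
  using n_nu by (simp add: fip_S fip_self_ge0)

lemma fip_S_commute: "w \<in> carrier_mat n m \<Longrightarrow> v \<in> carrier_mat n m \<Longrightarrow> fip (S * w) v = fip w (S * v)"
  using S S_sym by (simp add: fip_mult_left[of S n n w m v])

lemma fip_Q_commute: "w \<in> carrier_mat n m \<Longrightarrow> v \<in> carrier_mat n m \<Longrightarrow> fip (Q * w) v = fip w (Q * v)"
  using Q Q_sym by (simp add: fip_mult_left[of Q n n w m v])

lemma quad_Q:
  assumes Z: "Z \<in> carrier_mat n m"
  defines "w \<equiv> Q * Z"
  shows "fip Z w = fip w w + fip (S * w) w"
    "fip Z Z = fip w w + 2 * fip (S * w) w + fip (S * w) (S * w)"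
proof -
  have w: "w \<in> carrier_mat n m" using Q Z by (simp add: w_def)
  have Sw: "S * w \<in> carrier_mat n m" using S w by simp
  have e: "Z = w + S * w" using split[OF Z] by (simp add: w_def)
  show 1: "fip Z w = fip w w + fip (S * w) w"
    by (subst e) (rule fip_add_left[OF w Sw])
  have "fip Z Z = fip Z w + fip Z (S * w)" by (subst (2) e) (rule fip_add_right[OF w Sw Z])
  also have "fip Z (S * w) = fip w (S * w) + fip (S * w) (S * w)" by (subst e) (rule fip_add_left[OF w Sw])
  finally show "fip Z Z = fip w w + 2 * fip (S * w) w + fip (S * w) (S * w)"
    using 1 fip_S_commute[OF w w] by simp
qed

text \<open>The Loewner order Q^2 \<le> Q \<le> I, tested on all columns of \<open>Z\<close> at
  once.\<close>

lemma Q_contraction: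
  assumes Z: "Z \<in> carrier_mat n m"
  shows "fip (Q * Z) (Q * Z) \<le> fip Z (Q * Z)" "fip Z (Q * Z) \<le> fip Z Z"
  using quad_Q[OF Z] fip_S_self[of "Q * Z" m] Q Z fip_self_ge0[of "S * (Q * Z)"] by auto

lemma Q_contraction': "Z \<in> carrier_mat n m \<Longrightarrow> fip (Q * Z) (Q * Z) \<le> fip Z Z"
  using Q_contraction[of Z m] by simp

text \<open>With w = Q Z the difference of the two Gram matrices is 2 w^T S w + (S w)^T (S w), a sum
  of positive semidefinite Gram matrices, whose Frobenius norms are at most their traces. The trace
  of Z^T (I - Q^2) Z is at most twice that of Z^T (I - Q) Z. For the noise this turns the shrinkage
  of the residuals into a quadratic form with a computable mean.\<close>

lemma gram_Q:
  assumes Z: "Z \<in> carrier_mat n m"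
  shows "frob_norm (Z\<^sup>T * Z - (Q * Z)\<^sup>T * (Q * Z)) \<le> 2 * (fip Z Z - fip Z (Q * Z))"
proof -
  define w where "w = Q * Z"
  have w: "w \<in> carrier_mat n m" using Q Z by (simp add: w_def)
  have Sw: "S * w \<in> carrier_mat n m" using S w by simp
  have e: "Z = w + S * w" using split[OF Z] by (simp add: w_def)
  define K where "K = X\<^sup>T * w"
  have K: "K \<in> carrier_mat p m" using X w by (simp add: K_def)
  have KK: "w\<^sup>T * (S * w) = (1 / (real n * \<nu>)) \<cdot>\<^sub>m (K\<^sup>T * K)"
  proof -
    have "S * w = (1 / (real n * \<nu>)) \<cdot>\<^sub>m (X * K)"
      unfolding S_def K_def using X w by (subst mult_smult_assoc_mat[of _ n n _ m]) (auto simp: assoc_mult_mat[of X n p _ n w m])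
    moreover have "w\<^sup>T * (X * K) = K\<^sup>T * K"
    proof -
      have "K\<^sup>T = w\<^sup>T * X" unfolding K_def using X w transpose_mult[of "X\<^sup>T" p n w m] by simp
      then show ?thesis using X w K assoc_mult_mat[of "w\<^sup>T" m n X p K m] by simp
    qed
    ultimately show ?thesis using w X K by (simp add: mult_smult_distrib[of _ m n _ m])
  qed
  have KK': "(S * w)\<^sup>T * w = (1 / (real n * \<nu>)) \<cdot>\<^sub>m (K\<^sup>T * K)"
  proof -
    have "(S * w)\<^sup>T * w = (w\<^sup>T * (S * w))\<^sup>T"
      using w Sw transpose_mult[of "w\<^sup>T" m n "S * w" m] by simp
    also have "\<dots> = (1 / (real n * \<nu>)) \<cdot>\<^sub>m (K\<^sup>T * K)\<^sup>T" unfolding KK by (rule transpose_smult_mat)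
    also have "(K\<^sup>T * K)\<^sup>T = K\<^sup>T * K" using K transpose_mult[of "K\<^sup>T" m p K m] by simp
    finally show ?thesis .
  qed
  have wT: "w\<^sup>T \<in> carrier_mat m n" "(S * w)\<^sup>T \<in> carrier_mat m n" using w Sw by auto
  define G where "G = K\<^sup>T * K"
  define H where "H = (S * w)\<^sup>T * (S * w)"
  have G: "G \<in> carrier_mat m m" using K by (simp add: G_def)
  have H: "H \<in> carrier_mat m m" using Sw by (simp add: H_def)
  have ww: "w\<^sup>T * w \<in> carrier_mat m m" using w by simp
  have "Z\<^sup>T * Z = (w\<^sup>T + (S * w)\<^sup>T) * (w + S * w)"
    using e transpose_add[OF w Sw] by simp
  also have "\<dots> = (w\<^sup>T * w + (S * w)\<^sup>T * w) + (w\<^sup>T * (S * w) + (S * w)\<^sup>T * (S * w))"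
    using w Sw wT by (simp add: add_mult_distrib_mat[of _ m n _ _ m] mult_add_distrib_mat[of _ m n _ m])
  finally have "Z\<^sup>T * Z - w\<^sup>T * w = (2 / (real n * \<nu>)) \<cdot>\<^sub>m G + H"
    unfolding KK KK' unfolding G_def[symmetric] H_def[symmetric]
    using smult_add_minus_aux[OF ww G H] by simp
  then have "frob_norm (Z\<^sup>T * Z - w\<^sup>T * w) \<le> (2 / (real n * \<nu>)) * frob_norm G + frob_norm H"
    using frob_add[of "(2 / (real n * \<nu>)) \<cdot>\<^sub>m G" m m H] G H n_nu by (simp add: frob_smult abs_of_pos)
  also have "\<dots> \<le> (2 / (real n * \<nu>)) * (frob_norm K)\<^sup>2 + (frob_norm (S * w))\<^sup>2"
    unfolding G_def H_def using K Sw n_nu by (intro add_mono mult_left_mono frob_gram) auto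
  also have "\<dots> = 2 * fip (S * w) w + fip (S * w) (S * w)"
    using fip_S[OF w w] by (simp add: frob_sq K_def)
  also have "\<dots> \<le> 2 * (fip Z Z - fip Z (Q * Z))"
    using quad_Q[OF Z] fip_self_ge0[of "S * w"] by (simp add: w_def)
  finally show ?thesis by (simp add: w_def)
qed

text \<open>The ridge bias is bounded without reference to the spectrum of X. For a = |X^T w| with w
  = Q X L, the quadratic form is at least a^2 / (n \<nu>) and at most |L| a, so that a bounds
  itself.\<close>

lemma quad_Q_image:
  assumes L: "L \<in> carrier_mat p m"
  shows "fip (X * L) (Q * (X * L)) \<le> real n * \<nu> * fip L L"
proof -
  define w where "w = Q * (X * L)"
  have w: "w \<in> carrier_mat n m" using Q X L by (simp add: w_def)
  have XL: "X * L \<in> carrier_mat n m" using X L by simp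
  define a where "a = frob_norm (X\<^sup>T * w)"
  have a0: "0 \<le> a" by (simp add: a_def)
  have "a\<^sup>2 / (real n * \<nu>) = fip (S * w) w" using fip_S[OF w w] by (simp add: a_def frob_sq)
  also have "\<dots> \<le> fip (X * L) w" using quad_Q(1)[OF XL] fip_self_ge0[of w] by (simp add: w_def)
  finally have 1: "a\<^sup>2 / (real n * \<nu>) \<le> fip (X * L) w" .
  have "fip (X * L) w = fip L (X\<^sup>T * w)" using X L w by (rule fip_mult_left)
  also have "\<dots> \<le> frob_norm L * a" unfolding a_def
    using fip_le_frob[of L p m "X\<^sup>T * w"] X L w by auto
  finally have 2: "fip (X * L) w \<le> frob_norm L * a" .
  have "a * a \<le> (real n * \<nu> * frob_norm L) * a"
    using order.trans[OF 1 2] n_nu by (simp add: field_simps power2_eq_square)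
  then have "a \<le> real n * \<nu> * frob_norm L"
    using a0 n_nu by (cases "a = 0") (auto simp: mult_le_cancel_right)
  then have "frob_norm L * a \<le> frob_norm L * (real n * \<nu> * frob_norm L)" by (intro mult_left_mono) auto
  then show ?thesis using 2 by (simp add: w_def frob_sq[symmetric] power2_eq_square algebra_simps)
qed

text \<open>The eigenvalues of S are at most \<sigma>/\<nu>, so those of Q are at least 1 / (1 +
  \<sigma>/\<nu>). This transfers the restricted eigenvalue condition on X to the quadratic form
  that step 1 actually controls.\<close>

lemma quad_Q_lower:
  assumes \<sigma>: "0 \<le> \<sigma>" and op: "\<And>L. L \<in> carrier_mat p m \<Longrightarrow> fip (X * L) (X * L) \<le> real n * \<sigma> * fip L L"
    and Z: "Z \<in> carrier_mat n m"
  shows "fip Z Z \<le> (1 + \<sigma> / \<nu>) * fip Z (Q * Z)"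
proof -
  define w where "w = Q * Z"
  have w: "w \<in> carrier_mat n m" using Q Z by (simp add: w_def)
  define K where "K = X\<^sup>T * w"
  have K: "K \<in> carrier_mat p m" using X w by (simp add: K_def)
  have XK: "X * K \<in> carrier_mat n m" using X K by simp
  have opK: "fip (X * K) (X * K) \<le> real n * \<sigma> * fip K K" by (rule op[OF K])
  \<comment> \<open>Cauchy--Schwarz turns the operator bound for X into the same bound for
    X^T.\<close>
  have "(fip K K)\<^sup>2 \<le> fip w w * fip (X * K) (X * K)"
  proof -
    have "fip K K = fip w (X * K)"
      using fip_mult_left[of "X\<^sup>T" p n w m K] X w K by (simp add: K_def)
    also have "\<dots> \<le> frob_norm w * frob_norm (X * K)" using fip_le_frob[OF w XK] by simp
    finally have "(fip K K)\<^sup>2 \<le> (frob_norm w * frob_norm (X * K))\<^sup>2"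
      using fip_self_ge0[of K] by (intro power_mono) auto
    then show ?thesis by (simp add: power_mult_distrib frob_sq)
  qed
  also have "\<dots> \<le> fip w w * (real n * \<sigma> * fip K K)" by (intro mult_left_mono opK fip_self_ge0)
  finally have "fip K K * fip K K \<le> (real n * \<sigma> * fip w w) * fip K K" by (simp add: power2_eq_square algebra_simps)
  then have KK: "fip K K \<le> real n * \<sigma> * fip w w"
    using fip_self_ge0[of K] fip_self_ge0[of w] \<sigma> n_pos
    by (cases "fip K K = 0") (auto simp: mult_le_cancel_right)
  have Sw: "fip (S * w) w = fip K K / (real n * \<nu>)" using fip_S[OF w w] by (simp add: K_def)
  have SK: "S * w = (1 / (real n * \<nu>)) \<cdot>\<^sub>m (X * K)"
      unfolding S_def K_def using X w by (subst mult_smult_assoc_mat[of _ n n _ m]) (auto simp: assoc_mult_mat[of X n p _ n w m])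
  have "fip (S * w) (S * w) = fip (X * K) (X * K) / (real n * \<nu>)\<^sup>2"
    unfolding SK using XK by (simp add: fip_smult_left fip_smult_right[of _ n m] power2_eq_square)
  also have "\<dots> \<le> real n * \<sigma> * fip K K / (real n * \<nu>)\<^sup>2" by (intro divide_right_mono opK) auto
  also have "\<dots> = \<sigma> / \<nu> * fip (S * w) w" unfolding Sw using n_pos nu_pos by (simp add: power2_eq_square)
  finally have 1: "fip (S * w) (S * w) \<le> \<sigma> / \<nu> * fip (S * w) w" .
  have 2: "fip (S * w) w \<le> \<sigma> / \<nu> * fip w w"
    unfolding Sw using KK n_pos nu_pos by (simp add: field_simps)
  show ?thesis
    using quad_Q[OF Z] 1 2 by (simp add: w_def[symmetric] algebra_simps)
qed

text \<open>The trace of \<open>I - Q\<close>, the effective degrees of freedom of the ridge step.\<close>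

definition dof :: real where "dof = fip (1\<^sub>m n) (1\<^sub>m n) - fip (1\<^sub>m n) Q"

text \<open>Since I - Q = S Q with Q \<le> I, the trace of I - Q is at most that of S. For columns
  of squared norm n the right-hand side becomes p / \<nu>.\<close>

lemma dof_le_frob: "dof \<le> fip X X / (real n * \<nu>)"
proof -
  let ?Z = "1\<^sub>m n"
  have Z: "?Z \<in> carrier_mat n n" by simp
  have w: "Q \<in> carrier_mat n n" and QZ: "Q * ?Z = Q" using Q by auto
  have Sw: "S * Q \<in> carrier_mat n n" "S * (S * Q) \<in> carrier_mat n n" using S Q by auto
  have e: "?Z = Q + S * Q" using Q_eq by simp
  have "dof = fip (S * Q) Q + fip (S * Q) (S * Q)"
    using quad_Q[OF Z] unfolding QZ dof_def by simp
  also have "\<dots> \<le> fip (S * ?Z) ?Z"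
  proof -
    have "S * ?Z = S * Q + S * (S * Q)" by (subst e) (use S Q Sw in \<open>simp add: mult_add_distrib_mat[of _ n n _ n]\<close>)
    then have "fip (S * ?Z) ?Z = fip (S * Q) ?Z + fip (S * (S * Q)) ?Z"
      using fip_add_left[OF Sw] by simp
    also have "fip (S * Q) ?Z = fip (S * Q) Q + fip (S * Q) (S * Q)"
      by (subst e) (rule fip_add_right[OF w Sw(1) Sw(1)])
    also have "fip (S * (S * Q)) ?Z = fip (S * (S * Q)) Q + fip (S * (S * Q)) (S * Q)"
      by (subst e) (rule fip_add_right[OF w Sw(1) Sw(2)])
    also have "fip (S * (S * Q)) Q = fip (S * Q) (S * Q)" by (rule fip_S_commute[OF Sw(1) w])
    finally show ?thesis using fip_S_self[OF Sw(1)] fip_self_ge0[of "S * Q"] by simp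
  qed
  also have "\<dots> = fip X X / (real n * \<nu>)"
    using fip_S[OF Z Z] X fip_transpose[OF X X] by simp
  finally show ?thesis .
qed

text \<open>H = I - Q acts inside the column space of X, so P absorbs it on both sides and tr H =
  tr(P H P), which is at most the squared Frobenius norm of P. This is the bound that stays finite
  as \<nu> tends to 0.\<close>

lemma dof_le_proj:
  assumes P: "P \<in> carrier_mat n n" "P\<^sup>T = P" "P * X = X"
  shows "dof \<le> fip P P"
proof -
  have PS: "P * S = S"
    unfolding S_def using P X by (simp add: mult_smult_distrib[of _ n n _ n] assoc_mult_mat[of P n n X p "X\<^sup>T" n, symmetric])
  define H where "H = S * Q"
  have H: "H \<in> carrier_mat n n" using S Q by (simp add: H_def)
  have H': "H = 1\<^sub>m n - Q"
    using Q_eq Q H by (intro mat_eq_minusI[of H n n Q]) (simp_all add: H_def[symmetric] comm_add_mat[of H n n Q])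
  have PH: "P * H = H" unfolding H_def using P S Q PS by (simp add: assoc_mult_mat[of P n n S n Q n, symmetric])
  have HT: "H\<^sup>T = H" unfolding H' using Q Q_sym transpose_minus[of "1\<^sub>m n" n n Q] by simp
  have HP: "H * P = H" using arg_cong[OF PH, of transpose_mat] transpose_mult[OF P(1) H] P HT by simp
  have "dof = fip (1\<^sub>m n) H" unfolding dof_def H' using Q by (simp add: fip_minus_right[of _ n n])
  also have "\<dots> = fip H (1\<^sub>m n)" using H by (intro fip_commute) auto
  also have "H = P * (H * P)" using PH HP by simp
  also have "fip (P * (H * P)) (1\<^sub>m n) = fip (H * P) P"
    using fip_mult_left[of P n n "H * P" n "1\<^sub>m n"] P H by simp
  also have "H * P = P - Q * P" unfolding H' using P Q by (simp add: minus_mult_distrib_mat[of _ n n _ _ n])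
  also have "fip (P - Q * P) P = fip P P - fip P (Q * P)"
    using P Q fip_minus_left[of P n n "Q * P" P] fip_Q_commute[of P n P] by simp
  also have "\<dots> \<le> fip P P" using Q_contraction(1)[OF P(1)] fip_self_ge0[of "Q * P"] by simp
  finally show ?thesis .
qed

text \<open>Completion of the square in L: for a fixed sparse part the ridge minimizer is X^T Q Z /
  (n \<nu>), its residual is Q Z, and \<open>V\<close> is the deviation from it.\<close>

lemma profile:
  assumes Z: "Z \<in> carrier_mat n m" and L: "L \<in> carrier_mat p m"
  defines "V \<equiv> L - (1 / (real n * \<nu>)) \<cdot>\<^sub>m (X\<^sup>T * (Q * Z))"
  shows "fip (Z - X * L) (Z - X * L) + real n * \<nu> * fip L L
      = fip Z (Q * Z) + fip (X * V) (X * V) + real n * \<nu> * fip V V"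
    "V \<in> carrier_mat p m" "Z - X * L = Q * Z - X * V"
proof -
  define w where "w = Q * Z"
  define L0 where "L0 = (1 / (real n * \<nu>)) \<cdot>\<^sub>m (X\<^sup>T * w)"
  have w: "w \<in> carrier_mat n m" using Q Z by (simp add: w_def)
  have L0: "L0 \<in> carrier_mat p m" using X w by (simp add: L0_def)
  have Vd: "V = L - L0" by (simp add: V_def L0_def w_def)
  show V: "V \<in> carrier_mat p m" using L L0 by (simp add: Vd)
  have XL0: "X * L0 = S * w"
    unfolding S_def L0_def using X w
    by (simp add: mult_smult_assoc_mat[of _ n n _ m] mult_smult_distrib[of _ n p _ m] assoc_mult_mat[of X n p _ n w m])
  have XV: "X * V \<in> carrier_mat n m" and Sw: "S * w \<in> carrier_mat n m" using X V S w by auto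
  have LV: "L = L0 + V" using L L0 by (auto simp: Vd intro!: eq_matI)
  have "X * L = S * w + X * V" unfolding LV using X L0 V by (simp add: mult_add_distrib_mat[of _ n p _ m] XL0)
  then have r: "Z - X * L = w - X * V"
    using split[OF Z] unfolding w_def[symmetric] by (intro add_cancel_aux[OF _ _ w Sw XV])
  then show "Z - X * L = Q * Z - X * V" by (simp add: w_def)
  have wXV: "w - X * V \<in> carrier_mat n m" using w XV by simp
  have 1: "fip (w - X * V) (w - X * V) = fip w w - 2 * fip w (X * V) + fip (X * V) (X * V)"
    using fip_minus_left[OF w XV] fip_minus_right[OF w XV] w XV fip_commute[OF w XV] by simp
  have 2: "fip L L = fip L0 L0 + 2 * fip L0 V + fip V V"
    unfolding LV using L0 V fip_add_left[OF L0 V] fip_add_right[OF L0 V] fip_commute[OF L0 V] by simp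
  have 3: "real n * \<nu> * fip L0 V = fip w (X * V)"
    using X w V n_pos nu_pos fip_mult_left[of "X\<^sup>T" p n w m V] by (simp add: L0_def fip_smult_left)
  have 4: "real n * \<nu> * fip L0 L0 = fip (S * w) w"
  proof -
    have "real n * \<nu> * fip L0 L0 = fip w (X * L0)"
      using X w L0 n_pos nu_pos fip_mult_left[of "X\<^sup>T" p n w m L0]
      by (simp add: fip_smult_left[of _ "X\<^sup>T * w"] L0_def[THEN arg_cong[of _ _ "\<lambda>M. fip M L0"]] del: index_smult_mat)
    then show ?thesis using fip_S_commute[OF w w] by (simp add: XL0)
  qed
  have "real n * \<nu> * fip L L = real n * \<nu> * fip L0 L0 + 2 * (real n * \<nu> * fip L0 V) + real n * \<nu> * fip V V"
    unfolding 2 by (simp add: algebra_simps)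
  then show "fip (Z - X * L) (Z - X * L) + real n * \<nu> * fip L L
      = fip Z (Q * Z) + fip (X * V) (X * V) + real n * \<nu> * fip V V"
    unfolding r 1 3 4 using quad_Q(1)[OF Z] by (simp add: w_def)
qed

text \<open>Identifies the matrix M in the definition of the first penalty with the scale of the
  rows of (Q X)^T times the noise.\<close>

lemma ridge_M_diag:
  assumes j: "j < p"
  shows "ridge_M X \<nu> $$ (j,j) = (vnorm (col (Q * X) j))\<^sup>2 / real n"
proof -
  have "X\<^sup>T * (Q * Q) * X = (Q * X)\<^sup>T * (Q * X)"
  proof -
    have "(Q * X)\<^sup>T = X\<^sup>T * Q" using transpose_mult[OF Q X] Q_sym by simp
    moreover have "X\<^sup>T * (Q * Q) = X\<^sup>T * Q * Q" using X Q by (intro assoc_mult_mat[symmetric]) auto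
    moreover have "X\<^sup>T * Q * Q * X = X\<^sup>T * Q * (Q * X)" using X Q by (intro assoc_mult_mat) auto
    ultimately show ?thesis by simp
  qed
  then show ?thesis
    using X Q j by (simp add: ridge_M_def Q_def[symmetric] vnorm_sq)
qed

lemma vnorm_col_QX_le:
  assumes j: "j < p"
  shows "(vnorm (col (Q * X) j))\<^sup>2 \<le> real n * \<nu>" "(vnorm (col (Q * X) j))\<^sup>2 \<le> (vnorm (col X j))\<^sup>2"
    "(vnorm (col (Q * (Q * X)) j))\<^sup>2 \<le> (vnorm (col (Q * X) j))\<^sup>2"
proof -
  \<comment> \<open>A column of X is viewed as the one-column product X e, so that the inequalities
    for quadratic forms of matrices apply to it.\<close>
  define e where "e = mat p 1 (\<lambda>(i,_). if i = j then 1 else (0::real))"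
  have e: "e \<in> carrier_mat p 1" by (simp add: e_def)
  have ce: "col e 0 = unit_vec p j" by (intro eq_vecI) (auto simp: e_def unit_vec_def)
  have ee: "fip e e = 1" using j by (simp add: fip_cols[OF e e] ce)
  have col: "col (A * e) 0 = col A j" if A: "A \<in> carrier_mat n p" for A
  proof -
    have "A *\<^sub>v unit_vec p j = col A j"
      using A j by (intro eq_vecI) (auto simp: scalar_prod_right_unit[of _ p])
    then show ?thesis using col_mult2[OF A e, of 0] by (simp add: ce)
  qed
  have f: "fip (A * e) (A * e) = (vnorm (col A j))\<^sup>2" if A: "A \<in> carrier_mat n p" for A
  proof -
    have "A * e \<in> carrier_mat n 1" by (rule mult_carrier_mat[OF A e])
    from fip_cols[OF this this] show ?thesis by (simp add: col[OF A] vnorm_sq del: col_mult2)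
  qed
  have Xe: "X * e \<in> carrier_mat n 1" by (rule mult_carrier_mat[OF X e])
  have QX: "Q * X \<in> carrier_mat n p" and QQX: "Q * (Q * X) \<in> carrier_mat n p" using Q X by auto
  have QXe: "Q * (X * e) = Q * X * e" by (rule assoc_mult_mat[OF Q X e, symmetric])
  have QQXe: "Q * (Q * X * e) = Q * (Q * X) * e" by (rule assoc_mult_mat[OF Q QX e, symmetric])
  show "(vnorm (col (Q * X) j))\<^sup>2 \<le> real n * \<nu>"
    using Q_contraction(1)[OF Xe] quad_Q_image[OF e] ee f[OF QX] by (simp add: QXe)
  show "(vnorm (col (Q * X) j))\<^sup>2 \<le> (vnorm (col X j))\<^sup>2"
    using Q_contraction'[OF Xe] f[OF QX] f[OF X] by (simp add: QXe)
  show "(vnorm (col (Q * (Q * X)) j))\<^sup>2 \<le> (vnorm (col (Q * X) j))\<^sup>2"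
    using Q_contraction'[OF mult_carrier_mat[OF QX e]] f[OF QX] f[OF QQX] by (simp add: QQXe)
qed

end

section \<open>Group lasso inequalities\<close>

lemma re_const_bound:
  assumes X: "X \<in> carrier_mat n p" and n: "0 < n" and c: "0 \<le> c"
    and pos: "re_const X m s 4 > 0" and inv: "real_of_ereal (inverse (re_const X m s 4)) \<le> c"
    and S: "S \<subseteq> {..<p}" "card S \<le> s" and D: "D \<in> re_cone p m S 4"
  shows "(frob_norm (restrict_rows S D))\<^sup>2 \<le> c\<^sup>2 * (fip (X * D) (X * D) / real n)"
proof -
  let ?F = "frob_norm (restrict_rows S D)" and ?G = "frob_norm (X * D)"
  have dims: "dim_row X = n" "dim_col X = p" using X by auto
  have le: "re_const X m s 4 \<le> ereal (?G / (sqrt (real n) * ?F))"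
    unfolding re_const_def dims using S D by (intro INF_lower2[of "(S, D)"]) auto
  \<comment> \<open>The element \<open>D\<close> of the cone makes the infimum smaller than
    infinity, and positivity excludes the other infinite value.\<close>
  then obtain r where r: "re_const X m s 4 = ereal r" "0 < r"
    using pos by (cases "re_const X m s 4") auto
  have rc: "1 / r \<le> c" using inv r by (simp add: inverse_eq_divide)
  have "?F \<le> c * ?G / sqrt (real n)"
  proof (cases "?F = 0")
    case True
    then show ?thesis using c by simp
  next
    case False
    then have F: "?F > 0" using frob_ge0[of "restrict_rows S D"] by linarith
    have "r \<le> ?G / (sqrt (real n) * ?F)" using le r by simp
    then have "?F \<le> (1 / r) * (?G / sqrt (real n))" using F n r(2) by (simp add: field_simps)
    also have "\<dots> \<le> c * (?G / sqrt (real n))" by (intro mult_right_mono rc) auto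
    finally show ?thesis by simp
  qed
  then have "?F\<^sup>2 \<le> (c * ?G / sqrt (real n))\<^sup>2" by (intro power_mono) auto
  then show ?thesis using n by (simp add: power_mult_distrib power_divide frob_sq)
qed

text \<open>Decomposability of the mixed norm: outside \<open>S\<close> the rows of \<open>T\<close>
  vanish, so those of \<open>D\<close> enter with their full norm, and on \<open>S\<close> the
  triangle inequality is applied row by row.\<close>

lemma l1l2_support_diff:
  assumes D: "D \<in> carrier_mat p m" and T: "T \<in> carrier_mat p m" and S: "S \<subseteq> {..<p}"
    and T0: "\<And>j. j < p \<Longrightarrow> j \<notin> S \<Longrightarrow> row T j = 0\<^sub>v m"
  shows "l1l2_norm T - l1l2_norm (T + D) \<le> l1l2_norm (restrict_rows S D) - l1l2_norm (restrict_rows ({..<p} - S) D)"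
proof -
  have TD: "T + D \<in> carrier_mat p m" using T D by simp
  have r: "row (T + D) j = row T j + row D j" if "j < p" for j
    using that T D by (auto intro!: eq_vecI)
  have a: "vnorm (row T j) - vnorm (row (T + D) j) \<le> vnorm (row D j)" if "j < p" for j
  proof -
    have c: "row T j \<in> carrier_vec m" "row D j \<in> carrier_vec m" using T D that by auto
    have "a = (a + b) - b" if "a \<in> carrier_vec m" "b \<in> carrier_vec m" for a b :: "real vec"
      using that by (auto intro!: eq_vecI)
    then have "row T j = row (T + D) j - row D j" using c r[OF that] by simp
    then show ?thesis using vnorm_minus[of "row (T + D) j" m "row D j"] c r[OF that] by simp
  qed
  have "l1l2_norm T = (\<Sum>j\<in>S. vnorm (row T j)) + (\<Sum>j\<in>{..<p} - S. vnorm (row T j))"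
    using l1l2_split[OF T S] by (simp add: l1l2_restrict[OF T] S)
  also have "(\<Sum>j\<in>{..<p} - S. vnorm (row T j)) = 0" using T0 by (intro sum.neutral) auto
  finally have 1: "l1l2_norm T = (\<Sum>j\<in>S. vnorm (row T j))" by simp
  have 2: "l1l2_norm (T + D) = (\<Sum>j\<in>S. vnorm (row (T + D) j)) + (\<Sum>j\<in>{..<p} - S. vnorm (row (T + D) j))"
    using l1l2_split[OF TD S] by (simp add: l1l2_restrict[OF TD] S)
  have 3: "(\<Sum>j\<in>{..<p} - S. vnorm (row (T + D) j)) = (\<Sum>j\<in>{..<p} - S. vnorm (row D j))"
  proof (rule sum.cong[OF refl])
    fix j assume "j \<in> {..<p} - S"
    then have j: "j < p" "j \<notin> S" by auto
    have "row D j \<in> carrier_vec m" using D j by auto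
    then show "vnorm (row (T + D) j) = vnorm (row D j)" by (simp add: r[OF j(1)] T0[OF j])
  qed
  have "(\<Sum>j\<in>S. vnorm (row T j)) - (\<Sum>j\<in>S. vnorm (row (T + D) j)) \<le> (\<Sum>j\<in>S. vnorm (row D j))"
    unfolding sum_subtractf[symmetric] using S a by (intro sum_mono) auto
  then show ?thesis unfolding 1 2 3 by (simp add: l1l2_restrict[OF D] S)
qed

text \<open>An oracle inequality with bias \<open>b\<close>, where \<open>g\<close> stands for any
  quadratic form in the error. Write d and e for the mixed norms of \<open>D\<close> on and off
  \<open>S\<close>. Either l d is at most a multiple of the bias, and then everything is, or the
  bias is dominated by l d, which puts \<open>D\<close> into the cone and makes the restricted
  eigenvalue available.\<close>

lemma lasso_bound:
  assumes D: "D \<in> carrier_mat p m" and T: "T \<in> carrier_mat p m" and S: "S \<subseteq> {..<p}" "card S \<le> s"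
    and T0: "\<And>j. j < p \<Longrightarrow> j \<notin> S \<Longrightarrow> row T j = 0\<^sub>v m"
    and l: "0 < l" and g: "0 \<le> g" and b: "0 \<le> b" and c: "0 \<le> c"
    and basic: "g / 2 \<le> 2 * b + l / 2 * l1l2_norm D + l * (l1l2_norm T - l1l2_norm (T + D))"
    and re: "D \<in> re_cone p m S 4 \<Longrightarrow> (frob_norm (restrict_rows S D))\<^sup>2 \<le> c * g"
  shows "g \<le> 16 * max b (l\<^sup>2 * real s * c)" "l * l1l2_norm D \<le> 20 * max b (l\<^sup>2 * real s * c)"
proof -
  define d where "d = l1l2_norm (restrict_rows S D)"
  define e where "e = l1l2_norm (restrict_rows ({..<p} - S) D)"
  have d0: "0 \<le> d" and e0: "0 \<le> e" by (auto simp: d_def e_def)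
  have De: "l1l2_norm D = d + e" using l1l2_split[OF D S(1)] by (simp add: d_def e_def)
  have "l * (l1l2_norm T - l1l2_norm (T + D)) \<le> l * (d - e)"
    using l1l2_support_diff[OF D T S(1) T0] l by (simp add: d_def e_def)
  then have main: "g / 2 \<le> 2 * b + 3 / 2 * (l * d) - 1 / 2 * (l * e)"
    using basic unfolding De right_diff_distrib[of l d e] distrib_left[of "l / 2" d e] by linarith
  have "g \<le> 16 * max b (l\<^sup>2 * real s * c) \<and> l * l1l2_norm D \<le> 20 * max b (l\<^sup>2 * real s * c)"
  \<comment> \<open>The threshold is chosen so that in the second case 2 b < l d / 2 and hence l e
    \<le> 4 l d, which is the cone constant 4 of the hypotheses. Both cases end with l d at most 4
    and l e at most 16 times the maximum, hence the factor 20.\<close>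
  proof (cases "l * d \<le> 4 * b")
    case True
    have "l * e \<le> 16 * b" "g \<le> 16 * b"
      using main True g l e0 mult_nonneg_nonneg[of l e] by linarith+
    moreover have "l * (d + e) = l * d + l * e" by (simp add: algebra_simps)
    ultimately show ?thesis unfolding De using True by linarith
  next
    case False
    have le: "l * e \<le> 4 * (l * d)" using main False g by linarith
    then have "e \<le> 4 * d" using l by (simp add: mult.commute mult.left_commute)
    moreover have "D \<noteq> 0\<^sub>m p m"
    proof
      assume "D = 0\<^sub>m p m"
      then have "l1l2_norm D = 0" by (simp add: l1l2_norm_def)
      then have "d = 0" using De d0 e0 by linarith
      then show False using False b by simp
    qed
    ultimately have "D \<in> re_cone p m S 4" using D by (simp add: re_cone_def d_def e_def)
    from re[OF this] have F: "(frob_norm (restrict_rows S D))\<^sup>2 \<le> c * g" .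
    have "d \<le> sqrt (real (card S)) * frob_norm (restrict_rows S D)"
      unfolding d_def by (rule l1l2_restrict_le_frob[OF D S(1)])
    then have "d\<^sup>2 \<le> (sqrt (real (card S)) * frob_norm (restrict_rows S D))\<^sup>2"
      using d0 by (intro power_mono)
    also have "\<dots> = real (card S) * (frob_norm (restrict_rows S D))\<^sup>2" by (simp add: power_mult_distrib)
    also have "\<dots> \<le> real s * (c * g)" using F S(2) c g by (intro mult_mono) auto
    finally have d2: "d\<^sup>2 \<le> real s * c * g" by simp
    have ld2: "(l * d)\<^sup>2 \<le> (l\<^sup>2 * real s * c) * g"
      using mult_left_mono[OF d2, of "l\<^sup>2"] by (simp add: power_mult_distrib algebra_simps)
    have g4: "g \<le> 4 * (l * d)" using main False mult_nonneg_nonneg[of l e] l e0 by linarith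
    define r where "r = l\<^sup>2 * real s * c"
    have r0: "0 \<le> r" using c by (simp add: r_def)
    have "(l * d)\<^sup>2 \<le> r * g" using ld2 by (simp only: r_def)
    also have "\<dots> \<le> r * (4 * (l * d))" by (rule mult_left_mono[OF g4 r0])
    finally have "(l * d) * (l * d) \<le> (4 * r) * (l * d)" by (simp add: power2_eq_square)
    moreover have "0 < l * d" using False b by linarith
    ultimately have ld: "l * d \<le> 4 * r" by (simp add: mult_le_cancel_right_pos)
    have "l * (d + e) = l * d + l * e" by (simp add: algebra_simps)
    then show ?thesis using ld le g4 unfolding De r_def[symmetric] by linarith
  qed
  then show "g \<le> 16 * max b (l\<^sup>2 * real s * c)" "l * l1l2_norm D \<le> 20 * max b (l\<^sup>2 * real s * c)" by auto
qed

text \<open>Here the cone is replaced by the triangle inequality for T = (T + D) - D; the price is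
  the norm of the target itself in place of its sparsity.\<close>

lemma lasso_slow_bound:
  assumes D: "D \<in> carrier_mat p m" and T: "T \<in> carrier_mat p m" and l: "0 < l" and g: "0 \<le> g" and b: "0 \<le> b"
    and basic: "g / 2 \<le> 2 * b + l / 2 * l1l2_norm D + l * (l1l2_norm T - l1l2_norm (T + D))"
  shows "g \<le> 4 * (b + l * l1l2_norm T)" "l * l1l2_norm D \<le> 4 * (b + l * l1l2_norm T)"
proof -
  have "l1l2_norm D \<le> l1l2_norm (T + D) + l1l2_norm ((-1) \<cdot>\<^sub>m T)"
  proof -
    have "D = (T + D) + (-1) \<cdot>\<^sub>m T" using D T by (auto intro!: eq_matI)
    then show ?thesis using l1l2_triangle[of "T + D" p m "(-1) \<cdot>\<^sub>m T"] D T by simp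
  qed
  also have "l1l2_norm ((-1) \<cdot>\<^sub>m T) = l1l2_norm T"
    using T by (simp add: l1l2_norm_def vnorm_smult)
  finally have "l1l2_norm T - l1l2_norm (T + D) \<le> 2 * l1l2_norm T - l1l2_norm D" by simp
  then have "l * (l1l2_norm T - l1l2_norm (T + D)) \<le> l * (2 * l1l2_norm T - l1l2_norm D)"
    using l by simp
  then have "g / 2 \<le> 2 * b + 2 * (l * l1l2_norm T) - l * l1l2_norm D / 2"
    using basic by (simp add: algebra_simps)
  moreover have "0 \<le> l * l1l2_norm D" using l by simp
  ultimately show "g \<le> 4 * (b + l * l1l2_norm T)" "l * l1l2_norm D \<le> 4 * (b + l * l1l2_norm T)"
    using g by (auto simp: algebra_simps)
qed

section \<open>Step 1: optimality, basic inequality and residual covariance\<close>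

context ridge
begin

text \<open>By \<open>profile\<close> the objective is a function of the sparse part plus two
  squares in the deviation of L from its ridge minimizer. Comparing the solution with the ridge
  minimizer at the same sparse part makes the deviation vanish; what is left is a group lasso in the
  Q-form whose residual is Q (Y - X \<Psi>).\<close>

lemma step1:
  assumes sol: "step1_solution X Y l1 \<nu> \<Psi>h Lh" and Y: "Y \<in> carrier_mat n m"
  shows "\<Psi>h \<in> carrier_mat p m" "Lh \<in> carrier_mat p m"
    "Y - X * (\<Psi>h + Lh) = Q * (Y - X * \<Psi>h)"
    "\<And>\<Psi>. \<Psi> \<in> carrier_mat p m \<Longrightarrow>
      fip (Y - X * \<Psi>h) (Q * (Y - X * \<Psi>h)) / real n + l1 * l1l2_norm \<Psi>h
      \<le> fip (Y - X * \<Psi>) (Q * (Y - X * \<Psi>)) / real n + l1 * l1l2_norm \<Psi>"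
proof -
  have dims: "dim_row X = n" "dim_col X = p" "dim_col Y = m" using X Y by auto
  show Ph: "\<Psi>h \<in> carrier_mat p m" and Lh: "Lh \<in> carrier_mat p m"
    using sol by (auto simp: step1_solution_def dims)
  define L0 where "L0 \<Psi> = (1 / (real n * \<nu>)) \<cdot>\<^sub>m (X\<^sup>T * (Q * (Y - X * \<Psi>)))" for \<Psi>
  have Z: "Y - X * \<Psi> \<in> carrier_mat n m" if "\<Psi> \<in> carrier_mat p m" for \<Psi> using X Y that by simp
  have L0: "L0 \<Psi> \<in> carrier_mat p m" if "\<Psi> \<in> carrier_mat p m" for \<Psi>
    unfolding L0_def using X Q Z[OF that] by simp
  have res: "Y - X * (\<Psi> + L) = (Y - X * \<Psi>) - X * L" if "\<Psi> \<in> carrier_mat p m" "L \<in> carrier_mat p m" for \<Psi> L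
  proof -
    have c: "X * \<Psi> \<in> carrier_mat n m" "X * L \<in> carrier_mat n m" using X that by auto
    have "X * (\<Psi> + L) = X * \<Psi> + X * L" by (rule mult_add_distrib_mat[OF X that])
    moreover have "Y - (A + B) = (Y - A) - B" if "A \<in> carrier_mat n m" "B \<in> carrier_mat n m" for A B
      using that Y by (auto intro!: eq_matI)
    ultimately show ?thesis using c by simp
  qed
  define q where "q \<Psi> = fip (Y - X * \<Psi>) (Q * (Y - X * \<Psi>)) / real n + l1 * l1l2_norm \<Psi>" for \<Psi>
  have obj: "step1_objective X Y l1 \<nu> \<Psi> L
      = q \<Psi> + fip (X * (L - L0 \<Psi>)) (X * (L - L0 \<Psi>)) / real n + \<nu> * fip (L - L0 \<Psi>) (L - L0 \<Psi>)"
    if "\<Psi> \<in> carrier_mat p m" "L \<in> carrier_mat p m" for \<Psi> L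
  proof -
    define a where "a = fip ((Y - X * \<Psi>) - X * L) ((Y - X * \<Psi>) - X * L)"
    define b where "b = fip (Y - X * \<Psi>) (Q * (Y - X * \<Psi>))"
    have "a + real n * \<nu> * fip L L
      = b + fip (X * (L - L0 \<Psi>)) (X * (L - L0 \<Psi>)) + real n * \<nu> * fip (L - L0 \<Psi>) (L - L0 \<Psi>)"
      using profile(1)[OF Z[OF that(1)] that(2)] by (simp add: L0_def a_def b_def)
    then have "(a + real n * \<nu> * fip L L) / real n
      = (b + fip (X * (L - L0 \<Psi>)) (X * (L - L0 \<Psi>)) + real n * \<nu> * fip (L - L0 \<Psi>) (L - L0 \<Psi>)) / real n"
      by simp
    then have "a / real n + \<nu> * fip L L
      = b / real n + fip (X * (L - L0 \<Psi>)) (X * (L - L0 \<Psi>)) / real n + \<nu> * fip (L - L0 \<Psi>) (L - L0 \<Psi>)"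
      using n_pos by (simp add: add_divide_distrib)
    then show ?thesis
      unfolding step1_objective_def frob_sq res[OF that] dims q_def a_def[symmetric] b_def[symmetric] by simp
  qed
  have zero: "L0 \<Psi> - L0 \<Psi> = 0\<^sub>m p m" if "\<Psi> \<in> carrier_mat p m" for \<Psi> using L0[OF that] by (auto intro!: eq_matI)
  have obj0: "step1_objective X Y l1 \<nu> \<Psi> (L0 \<Psi>) = q \<Psi>" if "\<Psi> \<in> carrier_mat p m" for \<Psi>
    using obj[OF that L0[OF that]] X by (simp add: zero[OF that] fip_def)
  have opt: "step1_objective X Y l1 \<nu> \<Psi>h Lh \<le> q \<Psi>" if "\<Psi> \<in> carrier_mat p m" for \<Psi>
    using sol that L0[OF that] unfolding obj0[OF that, symmetric] step1_solution_def dims by blast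
  define V where "V = Lh - L0 \<Psi>h"
  have V: "V \<in> carrier_mat p m" using L0[OF Ph] by (simp add: V_def)
  have oh: "step1_objective X Y l1 \<nu> \<Psi>h Lh = q \<Psi>h + fip (X * V) (X * V) / real n + \<nu> * fip V V"
    using obj[OF Ph Lh] by (simp add: V_def)
  have XV0: "0 \<le> fip (X * V) (X * V) / real n" "0 \<le> \<nu> * fip V V"
    using fip_self_ge0[of "X * V"] fip_self_ge0[of V] nu_pos by auto
  then have "\<nu> * fip V V \<le> 0" using opt[OF Ph] oh by linarith
  then have "frob_norm V = 0" using nu_pos fip_self_ge0[of V] by (simp add: mult_le_0_iff frob_eq_sqrt)
  then have V0: "V = 0\<^sub>m p m" by (rule frob_eq_0[OF V])
  show "Y - X * (\<Psi>h + Lh) = Q * (Y - X * \<Psi>h)"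
  proof -
    have c: "Q * (Y - X * \<Psi>h) \<in> carrier_mat n m" using Q Z[OF Ph] by simp
    have XV: "X * V = 0\<^sub>m n m" using X by (simp add: V0)
    have "Y - X * (\<Psi>h + Lh) = Q * (Y - X * \<Psi>h) - X * V"
      unfolding res[OF Ph Lh] V_def L0_def by (rule profile(3)[OF Z[OF Ph] Lh])
    also have "\<dots> = Q * (Y - X * \<Psi>h)"
      using c by (simp add: XV mat_eq_minusI[of _ n m "0\<^sub>m n m", symmetric])
    finally show ?thesis .
  qed
  show "fip (Y - X * \<Psi>h) (Q * (Y - X * \<Psi>h)) / real n + l1 * l1l2_norm \<Psi>h
      \<le> fip (Y - X * \<Psi>) (Q * (Y - X * \<Psi>)) / real n + l1 * l1l2_norm \<Psi>"
    if "\<Psi> \<in> carrier_mat p m" for \<Psi>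
    using opt[OF that] oh XV0 by (simp add: q_def)
qed

text \<open>Young's inequality for the Q-form, from its nonnegativity at 2 A - B. The weights leave
  half of the form of \<open>B\<close>, which the left-hand side of the lasso inequality can
  absorb.\<close>

lemma fip_Q_cross_le:
  assumes A: "A \<in> carrier_mat n m" and B: "B \<in> carrier_mat n m"
  shows "2 * fip (Q * A) B \<le> 2 * fip A (Q * A) + fip B (Q * B) / 2"
proof -
  have QA: "Q * A \<in> carrier_mat n m" and QB: "Q * B \<in> carrier_mat n m" using Q A B by auto
  have A2: "2 \<cdot>\<^sub>m A \<in> carrier_mat n m" using A by simp
  let ?C = "2 \<cdot>\<^sub>m A - B"
  have C: "?C \<in> carrier_mat n m" using A B by simp
  have "0 \<le> fip ?C (Q * ?C)" using Q_contraction(1)[OF C] fip_self_ge0[of "Q * ?C"] by linarith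
  also have "Q * ?C = 2 \<cdot>\<^sub>m (Q * A) - Q * B"
    using Q A B by (simp add: mult_minus_distrib_mat[of _ n n _ m] mult_smult_distrib[of _ n n _ m])
  also have "fip ?C (2 \<cdot>\<^sub>m (Q * A) - Q * B) = 4 * fip A (Q * A) - 2 * fip A (Q * B) - 2 * fip B (Q * A) + fip B (Q * B)"
    using A B A2 QA QB C
    by (simp add: fip_minus_left[of _ n m] fip_minus_right[of _ n m] fip_smult_left fip_smult_right[of _ n m])
  also have "fip A (Q * B) = fip (Q * A) B" by (rule fip_Q_commute[OF A B, symmetric])
  also have "fip B (Q * A) = fip (Q * A) B" by (rule fip_commute[OF B QA])
  finally show ?thesis by simp
qed

text \<open>The product of the noise with X D is controlled by the duality of the mixed norm, the
  product of X L with X D by Young's inequality. Thus the low-rank part acts as a bias, measured in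
  the Q-form.\<close>

lemma step1_basic:
  assumes sol: "step1_solution X Y l1 \<nu> \<Psi>h Lh"
    and \<Psi>: "\<Psi> \<in> carrier_mat p m" and L: "L \<in> carrier_mat p m" and E: "E \<in> carrier_mat n m"
    and Y: "Y = X * (\<Psi> + L) + E"
    and l1: "\<And>j. j < p \<Longrightarrow> vnorm (row ((Q * X)\<^sup>T * E) j) \<le> real n * l1 / 4"
  defines "D \<equiv> \<Psi>h - \<Psi>"
  shows "D \<in> carrier_mat p m" "Y - X * (\<Psi>h + Lh) = Q * (E + (X * L - X * D))"
    "fip (X * D) (Q * (X * D)) / real n / 2 \<le> 2 * (fip (X * L) (Q * (X * L)) / real n)
       + l1 / 2 * l1l2_norm D + l1 * (l1l2_norm \<Psi> - l1l2_norm (\<Psi> + D))"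
proof -
  have XP: "X * \<Psi> \<in> carrier_mat n m" and XL: "X * L \<in> carrier_mat n m" using X \<Psi> L by auto
  have XPL: "X * (\<Psi> + L) = X * \<Psi> + X * L" by (rule mult_add_distrib_mat[OF X \<Psi> L])
  have Yc: "Y \<in> carrier_mat n m" using E XPL XP XL unfolding Y by simp
  note s1 = step1[OF sol Yc]
  show D: "D \<in> carrier_mat p m" using \<Psi> by (simp add: D_def)
  have XD: "X * D \<in> carrier_mat n m" using X D by simp
  have PD: "\<Psi>h = \<Psi> + D" using s1(1) \<Psi> by (auto simp: D_def intro!: eq_matI)
  define Z where "Z = E + X * L"
  have Z: "Z \<in> carrier_mat n m" using E XL by (simp add: Z_def)
  have YP: "Y - X * \<Psi> = Z"
  proof -
    have "(A + B) + E - A = E + B" if "A \<in> carrier_mat n m" "B \<in> carrier_mat n m" for A B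
      using that E by (auto intro!: eq_matI)
    then show ?thesis unfolding Y XPL Z_def using XP XL by blast
  qed
  have YPh: "Y - X * \<Psi>h = Z - X * D"
  proof -
    have "X * \<Psi>h = X * \<Psi> + X * D" unfolding PD by (rule mult_add_distrib_mat[OF X \<Psi> D])
    moreover have "Y - (A + B) = Y - A - B" if "A \<in> carrier_mat n m" "B \<in> carrier_mat n m" for A B
      using that Yc by (auto intro!: eq_matI)
    ultimately show ?thesis using XP XD YP by simp
  qed
  have "Z - X * D = E + (X * L - X * D)"
  proof -
    have "(E + B) - A = E + (B - A)" if "A \<in> carrier_mat n m" "B \<in> carrier_mat n m" for A B
      using that E by (auto intro!: eq_matI)
    then show ?thesis unfolding Z_def using XD XL by blast
  qed
  then show "Y - X * (\<Psi>h + Lh) = Q * (E + (X * L - X * D))" using s1(3) YPh by simp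
  have QZ: "Q * Z \<in> carrier_mat n m" and QXD: "Q * (X * D) \<in> carrier_mat n m"
    and QE: "Q * E \<in> carrier_mat n m" and QXL: "Q * (X * L) \<in> carrier_mat n m" using Q Z XD E XL by auto
  have "fip (Z - X * D) (Q * (Z - X * D)) = fip Z (Q * Z) - 2 * fip (Q * Z) (X * D) + fip (X * D) (Q * (X * D))"
  proof -
    have "Q * (Z - X * D) = Q * Z - Q * (X * D)" by (rule mult_minus_distrib_mat[OF Q Z XD])
    then have "fip (Z - X * D) (Q * (Z - X * D)) = fip Z (Q * Z) - fip Z (Q * (X * D)) - fip (X * D) (Q * Z) + fip (X * D) (Q * (X * D))"
      using Z XD QZ QXD by (simp add: fip_minus_left[of _ n m] fip_minus_right[of _ n m])
    also have "fip Z (Q * (X * D)) = fip (Q * Z) (X * D)" by (rule fip_Q_commute[OF Z XD, symmetric])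
    also have "fip (X * D) (Q * Z) = fip (Q * Z) (X * D)" by (rule fip_commute[OF XD QZ])
    finally show ?thesis by simp
  qed
  moreover have "fip (Q * Z) (X * D) = fip (Q * E) (X * D) + fip (Q * (X * L)) (X * D)"
    unfolding Z_def using Q E XL QE QXL by (simp add: mult_add_distrib_mat[of _ n n _ m] fip_add_left[of _ n m])
  moreover have "fip (Z - X * D) (Q * (Z - X * D)) / real n + l1 * l1l2_norm \<Psi>h \<le> fip Z (Q * Z) / real n + l1 * l1l2_norm \<Psi>"
    using s1(4)[OF \<Psi>] unfolding YPh YP .
  moreover have "F = a - 2 * x + d \<Longrightarrow> x = y + y' \<Longrightarrow> F / real n + u \<le> a / real n + v
      \<Longrightarrow> d / real n \<le> 2 * (y + y') / real n + (v - u)" for F a x y y' d u v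
    by (simp add: add_divide_distrib diff_divide_distrib)
  ultimately have 1: "fip (X * D) (Q * (X * D)) / real n \<le> 2 * (fip (Q * E) (X * D) + fip (Q * (X * L)) (X * D)) / real n
      + l1 * (l1l2_norm \<Psi> - l1l2_norm (\<Psi> + D))"
    unfolding right_diff_distrib PD by blast
  have QX: "Q * X \<in> carrier_mat n p" using Q X by simp
  have 2: "fip (Q * E) (X * D) \<le> real n * l1 / 4 * l1l2_norm D"
  proof -
    have "fip (Q * E) (X * D) = fip E (Q * (X * D))" by (rule fip_Q_commute[OF E XD])
    also have "Q * (X * D) = Q * X * D" by (rule assoc_mult_mat[OF Q X D, symmetric])
    also have "fip E (Q * X * D) = fip (Q * X * D) E" using E QX D by (intro fip_commute) auto
    also have "\<dots> = fip D ((Q * X)\<^sup>T * E)" by (rule fip_mult_left[OF QX D E])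
    also have "\<dots> = fip ((Q * X)\<^sup>T * E) D" using E QX D by (intro fip_commute) auto
    also have "\<dots> \<le> real n * l1 / 4 * l1l2_norm D"
      using fip_le_l1l2[of "(Q * X)\<^sup>T * E" p m D "real n * l1 / 4"] QX E D l1 by auto
    finally show ?thesis .
  qed
  have 3: "2 * fip (Q * (X * L)) (X * D) \<le> 2 * fip (X * L) (Q * (X * L)) + fip (X * D) (Q * (X * D)) / 2"
    by (rule fip_Q_cross_le[OF XL XD])
  define a where "a = fip (X * D) (Q * (X * D))"
  define b where "b = fip (X * L) (Q * (X * L))"
  have "2 * (fip (Q * E) (X * D) + fip (Q * (X * L)) (X * D)) \<le> real n * (l1 / 2 * l1l2_norm D) + 2 * b + a / 2"
    using 2 3 by (simp add: a_def b_def)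
  then have "2 * (fip (Q * E) (X * D) + fip (Q * (X * L)) (X * D)) / real n \<le> (real n * (l1 / 2 * l1l2_norm D) + 2 * b + a / 2) / real n"
    by (rule divide_right_mono) simp
  also have "\<dots> = l1 / 2 * l1l2_norm D + 2 * (b / real n) + a / real n / 2"
    using n_pos by (simp add: add_divide_distrib)
  finally show "fip (X * D) (Q * (X * D)) / real n / 2 \<le> 2 * (fip (X * L) (Q * (X * L)) / real n)
       + l1 / 2 * l1l2_norm D + l1 * (l1l2_norm \<Psi> - l1l2_norm (\<Psi> + D))"
    using 1 by (simp add: a_def[symmetric] b_def[symmetric])
qed

text \<open>The residual is Q applied to noise plus H, where H = X L - X D. Its Gram matrix is
  compared with that of the noise: \<open>e3\<close> is the fluctuation of the noise,
  \<open>e2\<close> the shrinkage by Q, \<open>e1\<close> and the mixed norm of \<open>D\<close>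
  come from the cross terms, \<open>b\<close> and \<open>g\<close> from H itself.\<close>

lemma residual_cov_bound:
  assumes L: "L \<in> carrier_mat p m" and D: "D \<in> carrier_mat p m" and E: "E \<in> carrier_mat n m"
    and G: "G \<in> carrier_mat m m"
    and R: "Y - X * F = Q * (E + (X * L - X * D))"
    and l1: "\<And>j. j < p \<Longrightarrow> vnorm (row ((Q * (Q * X))\<^sup>T * E) j) \<le> real n * l1 / 4" "0 \<le> l1"
    and e1: "frob_norm ((Q * (Q * (X * L)))\<^sup>T * E) \<le> real n * e1"
    and e2: "fip E E - fip E (Q * E) \<le> real n * e2"
    and e3: "frob_norm ((1 / real n) \<cdot>\<^sub>m (E\<^sup>T * E) - G) \<le> e3"
    and b: "fip (X * L) (Q * (X * L)) \<le> real n * b"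
    and g: "fip (X * D) (Q * (X * D)) \<le> real n * g"
  shows "frob_norm (residual_cov X Y F - G) \<le> e3 + 2 * e2 + 2 * e1 + l1 * l1l2_norm D + 2 * b + 2 * g"
proof -
  have XL: "X * L \<in> carrier_mat n m" and XD: "X * D \<in> carrier_mat n m" using X L D by auto
  define H where "H = X * L - X * D"
  have H: "H \<in> carrier_mat n m" using XL XD by (simp add: H_def)
  define u where "u = Q * E"
  define v where "v = Q * H"
  have u: "u \<in> carrier_mat n m" and v: "v \<in> carrier_mat n m" using Q E H by (auto simp: u_def v_def)
  have R': "Y - X * F = u + v" unfolding R H_def[symmetric] u_def v_def by (rule mult_add_distrib_mat[OF Q E H])
  have sq: "(A + B)\<^sup>T * (A + B) = A\<^sup>T * A + A\<^sup>T * B + (A\<^sup>T * B)\<^sup>T + B\<^sup>T * B"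
    if "A \<in> carrier_mat n m" "B \<in> carrier_mat n m" for A B :: "real mat"
  proof -
    have t: "(A\<^sup>T * B)\<^sup>T = B\<^sup>T * A" using that transpose_mult[of "A\<^sup>T" m n B m] by simp
    have "(A + B)\<^sup>T * (A + B) = (A\<^sup>T + B\<^sup>T) * (A + B)" using transpose_add[OF that] by simp
    also have "\<dots> = (A\<^sup>T + B\<^sup>T) * A + (A\<^sup>T + B\<^sup>T) * B" using that by (intro mult_add_distrib_mat[of _ m n]) auto
    also have "(A\<^sup>T + B\<^sup>T) * A = A\<^sup>T * A + B\<^sup>T * A" using that by (intro add_mult_distrib_mat[of _ m n]) auto
    also have "(A\<^sup>T + B\<^sup>T) * B = A\<^sup>T * B + B\<^sup>T * B" using that by (intro add_mult_distrib_mat[of _ m n]) auto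
    finally have 1: "(A + B)\<^sup>T * (A + B) = (A\<^sup>T * A + B\<^sup>T * A) + (A\<^sup>T * B + B\<^sup>T * B)" .
    have 2: "(a + b) + (c + d) = a + c + b + d" if "a \<in> carrier_mat m m" "b \<in> carrier_mat m m"
       "c \<in> carrier_mat m m" "d \<in> carrier_mat m m" for a b c d :: "real mat"
      using that by (auto intro!: eq_matI)
    show ?thesis unfolding 1 t using that by (intro 2) auto
  qed
  define c where "c = u\<^sup>T * v"
  define a where "a = E\<^sup>T * E"
  define a' where "a' = u\<^sup>T * u"
  define d where "d = v\<^sup>T * v"
  have car: "a \<in> carrier_mat m m" "a' \<in> carrier_mat m m" "c \<in> carrier_mat m m" "d \<in> carrier_mat m m"
    using u v E by (auto simp: a_def a'_def c_def d_def)
  have dimX: "dim_row X = n" using X by simp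
  have rc: "residual_cov X Y F = (1 / real n) \<cdot>\<^sub>m (a' + c + c\<^sup>T + d)"
    unfolding residual_cov_def dimX R' sq[OF u v] by (simp add: a'_def c_def d_def)
  have eq: "residual_cov X Y F - G = ((1 / real n) \<cdot>\<^sub>m a - G) + (1 / real n) \<cdot>\<^sub>m ((-1) \<cdot>\<^sub>m (a - a') + (c + c\<^sup>T) + d)"
    unfolding rc using car G by (auto intro!: eq_matI simp: algebra_simps)
  have n1: "frob_norm ((-1) \<cdot>\<^sub>m (a - a') + (c + c\<^sup>T) + d) \<le> frob_norm (a - a') + 2 * frob_norm c + frob_norm d"
  proof -
    have "frob_norm ((-1) \<cdot>\<^sub>m (a - a') + (c + c\<^sup>T) + d) \<le> frob_norm ((-1) \<cdot>\<^sub>m (a - a') + (c + c\<^sup>T)) + frob_norm d"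
      using car by (intro frob_add) auto
    also have "frob_norm ((-1) \<cdot>\<^sub>m (a - a') + (c + c\<^sup>T)) \<le> frob_norm ((-1) \<cdot>\<^sub>m (a - a')) + frob_norm (c + c\<^sup>T)"
      using car by (intro frob_add) auto
    also have "frob_norm (c + c\<^sup>T) \<le> frob_norm c + frob_norm c\<^sup>T" using car by (intro frob_add) auto
    finally show ?thesis by (simp add: frob_smult frob_transpose)
  qed
  have A: "frob_norm (a - a') \<le> 2 * (real n * e2)"
    using gram_Q[OF E] e2 by (simp add: a_def a'_def u_def)
  \<comment> \<open>Parallelogram identity for the Q-form; the form at X L + X D is dropped because
    it is nonnegative.\<close>
  have HH: "fip H (Q * H) \<le> 2 * (real n * b) + 2 * (real n * g)"
  proof -
    have "Q * H = Q * (X * L) - Q * (X * D)" unfolding H_def by (rule mult_minus_distrib_mat[OF Q XL XD])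
    then have "fip H (Q * H) = fip (X * L) (Q * (X * L)) - fip (X * L) (Q * (X * D)) - fip (X * D) (Q * (X * L)) + fip (X * D) (Q * (X * D))"
      unfolding H_def using XL XD Q by (simp add: fip_minus_left[of _ n m] fip_minus_right[of _ n m])
    moreover have "0 \<le> fip (X * L + X * D) (Q * (X * L + X * D))"
      using Q_contraction(1)[of "X * L + X * D" m] fip_self_ge0[of "Q * (X * L + X * D)"] XL XD by auto
    moreover have "fip (X * L + X * D) (Q * (X * L + X * D)) = fip (X * L) (Q * (X * L)) + fip (X * L) (Q * (X * D)) + fip (X * D) (Q * (X * L)) + fip (X * D) (Q * (X * D))"
      using XL XD Q by (simp add: fip_add_left[of _ n m] fip_add_right[of _ n m] mult_add_distrib_mat[of _ n n _ m])
    ultimately show ?thesis using b g by linarith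
  qed
  have Dn: "frob_norm d \<le> 2 * (real n * b) + 2 * (real n * g)"
  proof -
    have "frob_norm d \<le> fip v v" using frob_gram[OF v] by (simp add: d_def frob_sq)
    also have "\<dots> \<le> fip H (Q * H)" using Q_contraction(1)[OF H] by (simp add: v_def)
    finally show ?thesis using HH by linarith
  qed
  \<comment> \<open>Both factors of the cross term carry one Q, so the noise meets Q^2 X L and Q^2 X
    D; this is why row bounds for the twice shrunken design are required.\<close>
  have Cn: "frob_norm c \<le> real n * e1 + real n * l1 / 4 * l1l2_norm D"
  proof -
    have QQX: "Q * (Q * X) \<in> carrier_mat n p" using Q X by simp
    have sw: "(Q * A)\<^sup>T * (Q * B) = A\<^sup>T * (Q * (Q * B))" if "A \<in> carrier_mat n m" "B \<in> carrier_mat n k" for A B k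
    proof -
      have "(Q * A)\<^sup>T = A\<^sup>T * Q" using transpose_mult[OF Q that(1)] Q_sym by simp
      then show ?thesis using that Q by (simp add: assoc_mult_mat[of "A\<^sup>T" m n Q n "Q * B" k])
    qed
    have "c = E\<^sup>T * (Q * (Q * H))" unfolding c_def u_def v_def by (rule sw[OF E H])
    also have "Q * (Q * H) = Q * (Q * (X * L)) - Q * (Q * (X * D))"
      unfolding H_def using Q XL XD by (simp add: mult_minus_distrib_mat[of _ n n _ m])
    also have "E\<^sup>T * \<dots> = E\<^sup>T * (Q * (Q * (X * L))) - E\<^sup>T * (Q * (Q * (X * D)))"
      using E Q XL XD by (intro mult_minus_distrib_mat[of _ m n]) auto
    finally have "frob_norm c \<le> frob_norm (E\<^sup>T * (Q * (Q * (X * L)))) + frob_norm (E\<^sup>T * (Q * (Q * (X * D))))"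
      using frob_minus[of "E\<^sup>T * (Q * (Q * (X * L)))" m m "E\<^sup>T * (Q * (Q * (X * D)))"] E Q XL XD by simp
    also have "E\<^sup>T * (Q * (Q * (X * L))) = ((Q * (Q * (X * L)))\<^sup>T * E)\<^sup>T"
      using E Q XL transpose_mult[of "(Q * (Q * (X * L)))\<^sup>T" m n E m] by simp
    also have "frob_norm \<dots> \<le> real n * e1" unfolding frob_transpose by (rule e1)
    also have "E\<^sup>T * (Q * (Q * (X * D))) = ((Q * (Q * X))\<^sup>T * E)\<^sup>T * D"
    proof -
      have "((Q * (Q * X))\<^sup>T * E)\<^sup>T = E\<^sup>T * (Q * (Q * X))"
        using E QQX transpose_mult[of "(Q * (Q * X))\<^sup>T" p n E m] by simp
      moreover have "Q * (Q * (X * D)) = Q * (Q * X) * D"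
        unfolding assoc_mult_mat[OF Q X D, symmetric] using Q X D by (intro assoc_mult_mat[symmetric]) auto
      ultimately show ?thesis using E QQX D by (simp add: assoc_mult_mat[of "E\<^sup>T" m n "Q * (Q * X)" p D m])
    qed
    also have "frob_norm \<dots> \<le> real n * l1 / 4 * l1l2_norm D"
      using E QQX D l1 by (intro frob_mult_le_l1l2[of _ p m _ m]) auto
    finally show ?thesis by simp
  qed
  have "frob_norm (residual_cov X Y F - G) \<le> e3 + (1 / real n) * (2 * (real n * e2) + 2 * (real n * e1 + real n * l1 / 4 * l1l2_norm D) + (2 * (real n * b) + 2 * (real n * g)))"
  proof -
    have "frob_norm (residual_cov X Y F - G) \<le> frob_norm ((1 / real n) \<cdot>\<^sub>m a - G) + frob_norm ((1 / real n) \<cdot>\<^sub>m ((-1) \<cdot>\<^sub>m (a - a') + (c + c\<^sup>T) + d))"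
      unfolding eq using car G by (intro frob_add[of _ m m]) auto
    also have "frob_norm ((1 / real n) \<cdot>\<^sub>m ((-1) \<cdot>\<^sub>m (a - a') + (c + c\<^sup>T) + d)) = (1 / real n) * frob_norm ((-1) \<cdot>\<^sub>m (a - a') + (c + c\<^sup>T) + d)"
      by (simp add: frob_smult)
    also have "\<dots> \<le> (1 / real n) * (2 * (real n * e2) + 2 * (real n * e1 + real n * l1 / 4 * l1l2_norm D) + (2 * (real n * b) + 2 * (real n * g)))"
    proof (rule mult_left_mono)
      show "frob_norm ((-1) \<cdot>\<^sub>m (a - a') + (c + c\<^sup>T) + d) \<le> 2 * (real n * e2) + 2 * (real n * e1 + real n * l1 / 4 * l1l2_norm D) + (2 * (real n * b) + 2 * (real n * g))"
      proof -
        have "x \<le> a + 2 * c + d \<Longrightarrow> a \<le> 2 * A \<Longrightarrow> c \<le> B + C \<Longrightarrow> d \<le> 2 * b + 2 * b'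
          \<Longrightarrow> x \<le> 2 * A + 2 * (B + C) + (2 * b + 2 * b')" for x a c d A B C b b' :: real by simp
        from this[OF n1 A Cn Dn] show ?thesis .
      qed
    qed simp
    finally show ?thesis using e3 by (simp add: a_def)
  qed
  also have "\<dots> = e3 + 2 * e2 + 2 * e1 + l1 / 2 * l1l2_norm D + 2 * b + 2 * g"
    using n_pos by (simp add: field_simps)
  also have "\<dots> \<le> e3 + 2 * e2 + 2 * e1 + l1 * l1l2_norm D + 2 * b + 2 * g"
    using mult_nonneg_nonneg[OF l1(2) l1l2_ge0[of D]] by simp
  finally show ?thesis .
qed

end

section \<open>Orthogonal projections and the Davis--Kahan bound\<close>

text \<open>For an orthogonal projection the squared Frobenius norm equals the trace and the rank,
  so the last conjunct fixes the rank without speaking about ranges.\<close>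

definition is_proj :: "nat \<Rightarrow> nat \<Rightarrow> real mat \<Rightarrow> bool" where
  "is_proj d k P \<longleftrightarrow> P \<in> carrier_mat d d \<and> P\<^sup>T = P \<and> P * P = P \<and> fip P P = real k"

lemma fip_one: "fip (1\<^sub>m k) (1\<^sub>m k) = real k"
proof -
  have "(\<Sum>j<k. (if i = j then 1 else 0) * (if i = j then 1 else (0::real))) = 1" if "i < k" for i
    using that by (simp add: if_distrib cong: if_cong)
  then show ?thesis by (simp add: fip_def)
qed

lemma is_projD:
  assumes "is_proj d k P"
  shows "P \<in> carrier_mat d d" "P\<^sup>T = P" "P * P = P" "fip P P = real k" "fip (1\<^sub>m d) P = real k"
proof -
  show P: "P \<in> carrier_mat d d" "P\<^sup>T = P" "P * P = P" "fip P P = real k" using assms by (auto simp: is_proj_def)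
  show "fip (1\<^sub>m d) P = real k"
  proof -
    have "fip (1\<^sub>m d) P = fip P (1\<^sub>m d)" using P by (intro fip_commute) auto
    also have "\<dots> = fip P P" using fip_mult_left2[OF P(1) P(1), of "1\<^sub>m d"] P by simp
    finally show ?thesis using P by simp
  qed
qed

lemma is_proj_complement:
  assumes "is_proj d k P"
  shows "1\<^sub>m d - P \<in> carrier_mat d d" "(1\<^sub>m d - P)\<^sup>T = 1\<^sub>m d - P" "(1\<^sub>m d - P) * (1\<^sub>m d - P) = 1\<^sub>m d - P"
proof -
  note P = is_projD[OF assms]
  show c: "1\<^sub>m d - P \<in> carrier_mat d d" using P by simp
  show "(1\<^sub>m d - P)\<^sup>T = 1\<^sub>m d - P" using P transpose_minus[of "1\<^sub>m d" d d P] by simp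
  have "(1\<^sub>m d - P) * (1\<^sub>m d - P) = (1\<^sub>m d - P) * 1\<^sub>m d - (1\<^sub>m d - P) * P"
    by (rule mult_minus_distrib_mat[OF c]) (use P in auto)
  also have "(1\<^sub>m d - P) * P = 1\<^sub>m d * P - P * P"
    by (rule minus_mult_distrib_mat) (use P in auto)
  also have "1\<^sub>m d * P - P * P = 0\<^sub>m d d" using P by (auto intro!: eq_matI)
  also have "(1\<^sub>m d - P) * 1\<^sub>m d = 1\<^sub>m d - P" by (rule right_mult_one_mat[OF c])
  also have "1\<^sub>m d - P - 0\<^sub>m d d = 1\<^sub>m d - P" using P(1) by (auto intro!: eq_matI)
  finally show "(1\<^sub>m d - P) * (1\<^sub>m d - P) = 1\<^sub>m d - P" .
qed

lemma idempotent_contraction: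
  assumes P: "P \<in> carrier_mat d d" "P\<^sup>T = P" "P * P = P" and v: "v \<in> carrier_vec d"
  shows "vnorm (P *\<^sub>v v) \<le> vnorm v"
proof -
  have Pv: "P *\<^sub>v v \<in> carrier_vec d" using P v by simp
  have "(vnorm (P *\<^sub>v v))\<^sup>2 = v \<bullet> (P *\<^sub>v (P *\<^sub>v v))"
    unfolding vnorm_sq using symmetric_scalar_prod[OF P(1,2) v Pv] .
  also have "P *\<^sub>v (P *\<^sub>v v) = P *\<^sub>v v" using assoc_mult_mat_vec[OF P(1,1) v] P by simp
  also have "v \<bullet> (P *\<^sub>v v) \<le> vnorm v * vnorm (P *\<^sub>v v)" using scalar_prod_le_vnorm[OF v Pv] by simp
  finally have "vnorm (P *\<^sub>v v) * vnorm (P *\<^sub>v v) \<le> vnorm v * vnorm (P *\<^sub>v v)" by (simp add: power2_eq_square)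
  then show ?thesis using vnorm_ge0[of "P *\<^sub>v v"] vnorm_ge0[of v]
    by (cases "vnorm (P *\<^sub>v v) = 0") (auto simp: mult_le_cancel_right)
qed

lemma proj_contraction:
  assumes "is_proj d k P" "v \<in> carrier_vec d"
  shows "vnorm (P *\<^sub>v v) \<le> vnorm v" "vnorm ((1\<^sub>m d - P) *\<^sub>v v) \<le> vnorm v"
  using idempotent_contraction[OF is_projD(1-3)[OF assms(1)] assms(2)]
    idempotent_contraction[OF is_proj_complement[OF assms(1)] assms(2)] by auto

lemma is_proj_orthonormal:
  assumes U: "U \<in> carrier_mat d k" and UU: "U\<^sup>T * U = 1\<^sub>m k"
  shows "is_proj d k (U * U\<^sup>T)"
proof -
  have UT: "U\<^sup>T \<in> carrier_mat k d" and P: "U * U\<^sup>T \<in> carrier_mat d d" using U by auto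
  have PU: "U * U\<^sup>T * U = U" using assoc_mult_mat[OF U UT U] UU U by simp
  have PT: "(U * U\<^sup>T)\<^sup>T = U * U\<^sup>T" using transpose_mult[OF U UT] by simp
  have PP: "U * U\<^sup>T * (U * U\<^sup>T) = U * U\<^sup>T" using assoc_mult_mat[OF P U UT] PU by simp
  have "fip (U * U\<^sup>T) (U * U\<^sup>T) = fip U (U * U\<^sup>T * U)"
    using fip_mult_left2[OF U UT P] by simp
  also have "\<dots> = fip U U" by (simp add: PU)
  also have "\<dots> = fip (1\<^sub>m k) (U\<^sup>T * U)"
    using fip_mult_left[OF U, of "1\<^sub>m k" k U] U by simp
  also have "\<dots> = real k" by (simp add: UU fip_one)
  finally show ?thesis using P PT PP by (simp add: is_proj_def)
qed

section \<open>Variational characterization of leading eigenspaces\<close>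

lemma fip_quadratic_cols:
  assumes "S \<in> carrier_mat d d" "C \<in> carrier_mat d k"
  shows "fip (S * C) C = (\<Sum>a<k. col C a \<bullet> (S *\<^sub>v col C a))"
proof -
  have SC: "S * C \<in> carrier_mat d k" using assms by simp
  have "fip (S * C) C = fip C (S * C)" using SC assms by (intro fip_commute)
  also have "\<dots> = (\<Sum>a<k. col C a \<bullet> col (S * C) a)" using SC assms by (intro fip_cols)
  also have "\<dots> = (\<Sum>a<k. col C a \<bullet> (S *\<^sub>v col C a))"
    using assms by (intro sum.cong refl arg_cong[of _ _ "\<lambda>v. col C _ \<bullet> v"] col_mult2) auto
  finally show ?thesis .
qed

lemma fip_proj:
  assumes "is_proj d k P" "S \<in> carrier_mat d d"
  shows "fip S P = (\<Sum>a<d. col P a \<bullet> (S *\<^sub>v col P a))"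
proof -
  note P = is_projD[OF assms(1)]
  have "fip (S * P) P = fip S (P * P)" using fip_mult_left2[OF assms(2) P(1) P(1)] P(2) by simp
  then show ?thesis using fip_quadratic_cols[OF assms(2) P(1)] P(3) by simp
qed

lemma quadratic_eigen:
  assumes u: "orthonormal_basis d u" and S: "S \<in> carrier_mat d d" "S\<^sup>T = S"
    and eig: "\<And>i. i < d \<Longrightarrow> S *\<^sub>v u i = l i \<cdot>\<^sub>v u i" and v: "v \<in> carrier_vec d"
  shows "v \<bullet> (S *\<^sub>v v) = (\<Sum>i<d. l i * (u i \<bullet> v)\<^sup>2)"
proof -
  have Sv: "S *\<^sub>v v \<in> carrier_vec d" using S v by simp
  have "u i \<bullet> (S *\<^sub>v v) = l i * (u i \<bullet> v)" if i: "i < d" for i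
  proof -
    have ui: "u i \<in> carrier_vec d" using u i by (auto simp: orthonormal_basis_def)
    show ?thesis using symmetric_scalar_prod[OF S ui v] ui v by (simp add: eig[OF i])
  qed
  then show ?thesis
    using parseval[OF u v Sv] by (auto simp: power2_eq_square algebra_simps intro!: sum.cong)
qed

text \<open>In an eigenbasis u_i of S the value at P is the sum of the eigenvalues with weights |P
  u_i|^2. These lie between 0 and 1 and add up to k, so the sum is largest when the weight sits on
  the first k eigenvalues. The matrix \<open>U\<close> is an arbitrary choice of top eigenvectors
  and need not consist of the u_i.\<close>

lemma ky_fan:
  assumes S: "S \<in> carrier_mat d d" "S\<^sup>T = S" and P: "is_proj d k P" and U: "top_eigenvectors S k U" and k: "k \<le> d"
  shows "fip S P \<le> fip S (U * U\<^sup>T)"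
proof -
  obtain u where u: "orthonormal_basis d u"
    and eig: "\<And>i. i < d \<Longrightarrow> S *\<^sub>v u i = kth_eigenvalue S (Suc i) \<cdot>\<^sub>v u i"
    and mono: "\<And>i j. i \<le> j \<Longrightarrow> j < d \<Longrightarrow> kth_eigenvalue S (Suc j) \<le> kth_eigenvalue S (Suc i)"
    using spectral_theorem[OF S] by blast
  define l where "l i = kth_eigenvalue S (Suc i)" for i
  have Uc: "U \<in> carrier_mat d k" and UU: "U\<^sup>T * U = 1\<^sub>m k"
    and ev: "\<And>a. a < k \<Longrightarrow> S *\<^sub>v col U a = l a \<cdot>\<^sub>v col U a"
    using U S by (auto simp: top_eigenvectors_def eigenvector_def l_def)
  have UT: "U\<^sup>T \<in> carrier_mat k d" and SU: "S * U \<in> carrier_mat d k" and P': "U * U\<^sup>T \<in> carrier_mat d d"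
    using Uc S by auto
  note Pd = is_projD[OF P]
  have ui: "u i \<in> carrier_vec d" if "i < d" for i using u that by (auto simp: orthonormal_basis_def)
  have "fip S (U * U\<^sup>T) = fip (U * U\<^sup>T) S" using S P' by (intro fip_commute)
  also have "\<dots> = fip U (S * U)" using fip_mult_left2[OF Uc UT S(1)] by simp
  also have "\<dots> = fip (S * U) U" using SU Uc by (intro fip_commute)
  also have "\<dots> = (\<Sum>a<k. l a)"
  proof -
    have "col U a \<bullet> (S *\<^sub>v col U a) = l a" if a: "a < k" for a
    proof -
      have "col U a \<bullet> col U a = 1" using arg_cong[OF UU, of "\<lambda>M. M $$ (a,a)"] a Uc by simp
      moreover have "col U a \<in> carrier_vec d" using Uc a by auto
      ultimately show ?thesis by (simp add: ev[OF a])
    qed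
    then show ?thesis unfolding fip_quadratic_cols[OF S(1) Uc] by (intro sum.cong) auto
  qed
  finally have R: "fip S (U * U\<^sup>T) = (\<Sum>a<k. l a)" .
  define w where "w i = (\<Sum>a<d. (u i \<bullet> col P a)\<^sup>2)" for i
  have cP: "col P a \<in> carrier_vec d" if "a < d" for a using Pd that by auto
  have "fip S P = (\<Sum>a<d. \<Sum>i<d. l i * (u i \<bullet> col P a)\<^sup>2)"
    unfolding fip_proj[OF P S(1)] using quadratic_eigen[OF u S eig cP] by (intro sum.cong) (auto simp: l_def)
  also have "\<dots> = (\<Sum>i<d. l i * w i)" unfolding w_def by (subst sum.swap) (simp add: sum_distrib_left)
  finally have L: "fip S P = (\<Sum>i<d. l i * w i)" .
  have w0: "0 \<le> w i" for i by (simp add: w_def sum_nonneg)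
  have w1: "w i \<le> 1" if i: "i < d" for i
  proof -
    have "w i = (vnorm (P *\<^sub>v u i))\<^sup>2"
    proof -
      have "P *\<^sub>v u i = P\<^sup>T *\<^sub>v u i" using Pd by simp
      then have "(P *\<^sub>v u i) $ a = u i \<bullet> col P a" if a: "a < d" for a
        using Pd(1) ui[OF i] a cP[OF a] by (simp add: comm_scalar_prod[of _ d])
      moreover have "P *\<^sub>v u i \<in> carrier_vec d" using Pd ui[OF i] by simp
      note scalar_prod_eq_sum[OF carrier_vecD[OF this], of "P *\<^sub>v u i"]
      ultimately show ?thesis
        unfolding vnorm_sq w_def by (simp add: power2_eq_square del: index_mult_mat_vec)
    qed
    also have "\<dots> \<le> (vnorm (u i))\<^sup>2" by (intro power_mono proj_contraction(1)[OF P] ui i) auto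
    also have "\<dots> = 1" using u i by (simp add: vnorm_sq orthonormal_basis_def)
    finally show ?thesis .
  qed
  have "(\<Sum>i<d. w i) = (\<Sum>a<d. col P a \<bullet> col P a)"
    unfolding w_def by (subst sum.swap) (auto simp: parseval[OF u cP cP] power2_eq_square intro!: sum.cong)
  also have "\<dots> = real k" using fip_cols[OF Pd(1) Pd(1)] Pd(4) by simp
  finally have sw: "(\<Sum>i<d. w i) = real k" .
  show ?thesis
  \<comment> \<open>The threshold used for positive k is the eigenvalue with index k - 1.\<close>
  proof (cases "k = 0")
    case True
    then have "w i = 0" if "i < d" for i using sw w0 that by (simp add: sum_nonneg_eq_0_iff)
    then show ?thesis unfolding L R using True by simp
  next
    case False
    \<comment> \<open>After subtracting the smallest of the k leading eigenvalues, each product of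
      excess eigenvalue and excess weight is at most 0, and the shift cancels because both weight
      systems have total k.\<close>
    define c where "c = l (k - 1)"
    have "(\<Sum>i<d. (l i - c) * (w i - (if i < k then 1 else 0))) \<le> 0"
    proof (rule sum_nonpos)
      fix i assume "i \<in> {..<d}"
      then have i: "i < d" by simp
      show "(l i - c) * (w i - (if i < k then 1 else 0)) \<le> 0"
      proof (cases "i < k")
        case True
        then have "l i \<ge> c" using mono[of i "k - 1"] k by (simp add: l_def c_def)
        then show ?thesis using True w1[OF i] by (simp add: mult_nonneg_nonpos)
      next
        case False
        then have "l i \<le> c" using mono[of "k - 1" i] i by (simp add: l_def c_def)
        then show ?thesis using False w0[of i] by (simp add: mult_nonpos_nonneg)
      qed
    qed
    moreover have "(\<Sum>i<d. (l i - c) * (w i - (if i < k then 1 else 0)))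
        = (\<Sum>i<d. l i * w i) - c * (\<Sum>i<d. w i) - (\<Sum>i<d. if i < k then l i else 0) + c * (\<Sum>i<d. if i < k then 1 else 0)"
      unfolding sum_distrib_left sum_subtractf[symmetric] sum.distrib[symmetric]
      by (intro sum.cong) (auto simp: algebra_simps)
    moreover have "{..<d} \<inter> {i. i < k} = {..<k}" using k by auto
    then have "(\<Sum>i<d. if i < k then l i else 0) = (\<Sum>i<k. l i)" "(\<Sum>i<d. if i < k then 1 else (0::real)) = real k"
      by (simp_all add: sum.If_cases)
    ultimately show ?thesis unfolding L R using sw by simp
  qed
qed

lemma fip_proj_diff:
  assumes P: "is_proj d k P" and P': "is_proj d k P'"
  shows "fip (P - P') (P - P') = 2 * real k - 2 * fip P P'"
proof -
  note p = is_projD[OF P] and p' = is_projD[OF P']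
  show ?thesis
    using p p' by (simp add: fip_minus_left[of _ d d] fip_minus_right[of _ d d] fip_commute[of P' d d P])
qed

text \<open>A variational form of the argument: P' only has to do at least as well as P in
  maximizing the inner product with T. The population functional has curvature, <G, P - P'> \<ge> (L
  / 2) |P - P'|^2, while optimality bounds the same quantity by |T - G - c I| |P - P'|. No
  eigenvalue gap of T enters.\<close>

lemma davis_kahan:
  assumes P: "is_proj d k P" and P': "is_proj d k P'"
    and G: "G \<in> carrier_mat d d" "G * P = G" and L: "0 < L"
    and low: "\<And>v. v \<in> carrier_vec d \<Longrightarrow> L * (vnorm (P *\<^sub>v v))\<^sup>2 \<le> v \<bullet> (G *\<^sub>v v)"
    and T: "T \<in> carrier_mat d d" and le: "fip T P \<le> fip T P'"
  shows "frob_norm (P - P') \<le> 2 * frob_norm (T - (G + c \<cdot>\<^sub>m 1\<^sub>m d)) / L"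
proof -
  note p = is_projD[OF P] and p' = is_projD[OF P'] and q = is_proj_complement[OF P']
  let ?C = "1\<^sub>m d - P'"
  let ?E = "T - (G + c \<cdot>\<^sub>m 1\<^sub>m d)"
  have Gc: "G + c \<cdot>\<^sub>m 1\<^sub>m d \<in> carrier_mat d d" using G by simp
  have E: "?E \<in> carrier_mat d d" using T Gc by simp
  have PP': "P - P' \<in> carrier_mat d d" using p p' by simp
  have "fip G (P - P') = fip G P - fip G P'" using G p p' by (simp add: fip_minus_right[of _ d d])
  also have "fip G P = fip G (1\<^sub>m d)"
    using fip_mult_left2[OF G(1) p(1), of "1\<^sub>m d"] p G by simp
  also have "fip G (1\<^sub>m d) - fip G P' = fip G ?C" using G p' by (simp add: fip_minus_right[of _ d d])
  also have "\<dots> = fip (G * ?C) ?C" using fip_mult_left2[OF G(1) q(1) q(1)] q by simp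
  also have "\<dots> = (\<Sum>a<d. col ?C a \<bullet> (G *\<^sub>v col ?C a))" by (rule fip_quadratic_cols[OF G(1) q(1)])
  finally have 1: "fip G (P - P') = (\<Sum>a<d. col ?C a \<bullet> (G *\<^sub>v col ?C a))" .
  have "L * fip P ?C = L * fip (P * ?C) (P * ?C)"
  proof -
    have PC: "P * ?C \<in> carrier_mat d d" using p q by simp
    have "fip (P * ?C) (P * ?C) = fip P (P * ?C * ?C)" using fip_mult_left2[OF p(1) q(1) PC] q by simp
    also have "P * ?C * ?C = P * (?C * ?C)" by (rule assoc_mult_mat[OF p(1) q(1) q(1)])
    also have "\<dots> = P * ?C" using q by simp
    also have "fip P (P * ?C) = fip (P * P) ?C" using fip_mult_left[OF p(1) p(1) q(1)] p by simp
    finally show ?thesis using p by simp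
  qed
  also have "\<dots> = (\<Sum>a<d. L * (vnorm (P *\<^sub>v col ?C a))\<^sup>2)"
  proof -
    have PC: "P * ?C \<in> carrier_mat d d" using p q by simp
    have "col (P * ?C) a = P *\<^sub>v col ?C a" if "a < d" for a using p q that by (intro col_mult2) auto
    then show ?thesis by (simp add: fip_cols[OF PC PC] vnorm_sq sum_distrib_left)
  qed
  also have "\<dots> \<le> fip G (P - P')" unfolding 1 using q by (intro sum_mono low) auto
  finally have 2: "L * fip P ?C \<le> fip G (P - P')" .
  have "fip P ?C = fip (1\<^sub>m d) P - fip P P'"
    using p p' fip_commute[of P d d "1\<^sub>m d"] by (simp add: fip_minus_right[of _ d d])
  then have 3: "fip P ?C = fip (P - P') (P - P') / 2" using fip_proj_diff[OF P P'] p by simp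
  \<comment> \<open>Both projections have trace k, so a multiple of the identity is
    invisible.\<close>
  have 4: "fip (G + c \<cdot>\<^sub>m 1\<^sub>m d) (P - P') = fip G (P - P')"
    using G PP' p p' by (simp add: fip_add_left[of _ d d] fip_smult_left fip_minus_right[of _ d d])
  have "fip G (P - P') \<le> fip (G + c \<cdot>\<^sub>m 1\<^sub>m d) (P - P') - fip T (P - P')"
    using 4 le T p p' by (simp add: fip_minus_right[of _ d d])
  also have "\<dots> = - fip ?E (P - P')" using T Gc by (simp add: fip_minus_left[of _ d d])
  also have "\<dots> \<le> frob_norm ?E * frob_norm (P - P')" using fip_le_frob[OF E PP'] by linarith
  finally have "L * fip (P - P') (P - P') / 2 \<le> frob_norm ?E * frob_norm (P - P')" using 2 3 by simp
  then have "(L / 2 * frob_norm (P - P')) * frob_norm (P - P') \<le> frob_norm ?E * frob_norm (P - P')"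
    by (simp add: frob_sq[symmetric] power2_eq_square)
  then have "L / 2 * frob_norm (P - P') \<le> frob_norm ?E"
    using frob_ge0[of "P - P'"] frob_ge0[of ?E] L
    by (cases "frob_norm (P - P') = 0") (auto simp: mult_le_cancel_right)
  then show ?thesis using L by (simp add: field_simps)
qed

lemma quadratic_le_largest:
  assumes S: "S \<in> carrier_mat d d" "S\<^sup>T = S" and v: "v \<in> carrier_vec d"
  shows "v \<bullet> (S *\<^sub>v v) \<le> kth_eigenvalue S 1 * (v \<bullet> v)"
proof -
  obtain u where u: "orthonormal_basis d u"
    and eig: "\<And>i. i < d \<Longrightarrow> S *\<^sub>v u i = kth_eigenvalue S (Suc i) \<cdot>\<^sub>v u i"
    and mono: "\<And>i j. i \<le> j \<Longrightarrow> j < d \<Longrightarrow> kth_eigenvalue S (Suc j) \<le> kth_eigenvalue S (Suc i)"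
    using spectral_theorem[OF S] by blast
  have "v \<bullet> (S *\<^sub>v v) = (\<Sum>i<d. kth_eigenvalue S (Suc i) * (u i \<bullet> v)\<^sup>2)" by (rule quadratic_eigen[OF u S eig v])
  also have "\<dots> \<le> (\<Sum>i<d. kth_eigenvalue S 1 * (u i \<bullet> v)\<^sup>2)"
    using mono[of 0] by (intro sum_mono mult_right_mono) auto
  also have "\<dots> = kth_eigenvalue S 1 * (v \<bullet> v)"
    using parseval[OF u v v] by (simp add: sum_distrib_left power2_eq_square)
  finally show ?thesis .
qed

lemma kth_eigenvalue_nonneg:
  assumes S: "S \<in> carrier_mat d d" "S\<^sup>T = S" and psd: "\<And>v. v \<in> carrier_vec d \<Longrightarrow> 0 \<le> v \<bullet> (S *\<^sub>v v)" and i: "i < d"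
  shows "0 \<le> kth_eigenvalue S (Suc i)"
proof -
  obtain u where u: "orthonormal_basis d u"
    and eig: "\<And>i. i < d \<Longrightarrow> S *\<^sub>v u i = kth_eigenvalue S (Suc i) \<cdot>\<^sub>v u i"
    and "\<And>i j. i \<le> j \<Longrightarrow> j < d \<Longrightarrow> kth_eigenvalue S (Suc j) \<le> kth_eigenvalue S (Suc i)"
    using spectral_theorem[OF S] by blast
  have ui: "u i \<in> carrier_vec d" "u i \<bullet> u i = 1" using u i by (auto simp: orthonormal_basis_def)
  have "0 \<le> u i \<bullet> (S *\<^sub>v u i)" by (rule psd[OF ui(1)])
  then show ?thesis unfolding eig[OF i] using ui by simp
qed

text \<open>Since the k-th eigenvalue is positive and P G = G, the first k eigenvectors lie in the
  range of P. As P has rank k, it is the projection onto their span, and the quadratic form there is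
  at least the k-th eigenvalue.\<close>

lemma quadratic_ge_kth:
  assumes G: "G \<in> carrier_mat d d" "G\<^sup>T = G" and psd: "\<And>v. v \<in> carrier_vec d \<Longrightarrow> 0 \<le> v \<bullet> (G *\<^sub>v v)"
    and P: "is_proj d k P" and PG: "P * G = G" and k: "1 \<le> k" "k \<le> d" and pos: "0 < kth_eigenvalue G k"
    and v: "v \<in> carrier_vec d"
  shows "kth_eigenvalue G k * (vnorm (P *\<^sub>v v))\<^sup>2 \<le> v \<bullet> (G *\<^sub>v v)"
proof -
  obtain u where u: "orthonormal_basis d u"
    and eig: "\<And>i. i < d \<Longrightarrow> G *\<^sub>v u i = kth_eigenvalue G (Suc i) \<cdot>\<^sub>v u i"
    and mono: "\<And>i j. i \<le> j \<Longrightarrow> j < d \<Longrightarrow> kth_eigenvalue G (Suc j) \<le> kth_eigenvalue G (Suc i)"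
    using spectral_theorem[OF G] by blast
  note p = is_projD[OF P]
  define l where "l i = kth_eigenvalue G (Suc i)" for i
  have lk: "kth_eigenvalue G k = l (k - 1)" using k by (simp add: l_def)
  have lpos: "l (k - 1) \<le> l i" if "i < k" for i using mono[of i "k - 1"] that k by (simp add: l_def)
  have ui: "u i \<in> carrier_vec d" if "i < d" for i using u that by (auto simp: orthonormal_basis_def)
  have Pu: "P *\<^sub>v u i = u i" if i: "i < k" for i
  proof -
    have id: "i < d" using i k by simp
    have li: "l i > 0" using lpos[OF i] pos lk by simp
    have "l i \<cdot>\<^sub>v (P *\<^sub>v u i) = P *\<^sub>v (G *\<^sub>v u i)"
      using eig[OF id] p(1) ui[OF id] by (simp add: l_def mult_mat_vec[of P d d])
    also have "\<dots> = P * G *\<^sub>v u i" using p(1) G ui[OF id] by simp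
    also have "\<dots> = l i \<cdot>\<^sub>v u i" using PG eig[OF id] by (simp add: l_def)
    finally have e: "l i \<cdot>\<^sub>v (P *\<^sub>v u i) = l i \<cdot>\<^sub>v u i" .
    show ?thesis
      using arg_cong[OF e, of "\<lambda>w. (1 / l i) \<cdot>\<^sub>v w"] li by (simp add: smult_smult_assoc)
  qed
  define U where "U = mat d k (\<lambda>(a,i). u i $ a)"
  have U: "U \<in> carrier_mat d k" by (simp add: U_def)
  have cU: "col U i = u i" if "i < k" for i
    using that k ui[of i] by (intro eq_vecI) (auto simp: U_def)
  have UU: "U\<^sup>T * U = 1\<^sub>m k"
    using U u k by (intro eq_matI) (auto simp: cU orthonormal_basis_def)
  have PU: "P * U = U"
  proof (rule eq_matI)
    fix a i assume "a < dim_row U" "i < dim_col U"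
    then have ai: "a < d" "i < k" using U by auto
    have "(P * U) $$ (a,i) = (P *\<^sub>v u i) $ a" using p(1) U ai cU by simp
    then show "(P * U) $$ (a,i) = U $$ (a,i)" using Pu[OF ai(2)] ai by (simp add: U_def)
  qed (use p U in auto)
  have P': "is_proj d k (U * U\<^sup>T)" by (rule is_proj_orthonormal[OF U UU])
  note p' = is_projD[OF P']
  have UT: "U\<^sup>T \<in> carrier_mat k d" using U by simp
  \<comment> \<open>An inner product equal to the common rank means distance zero between the two
    projections.\<close>
  have "fip P (U * U\<^sup>T) = fip (U * U\<^sup>T) P" using p p' by (intro fip_commute)
  also have "\<dots> = fip U (P * U)" using fip_mult_left2[OF U UT p(1)] by simp
  also have "\<dots> = fip (U * U\<^sup>T) (1\<^sub>m d)" unfolding PU using fip_mult_left2[OF U UT, of "1\<^sub>m d"] U by simp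
  also have "\<dots> = real k" using p' fip_commute[of "1\<^sub>m d" d d "U * U\<^sup>T"] by simp
  finally have "fip (P - U * U\<^sup>T) (P - U * U\<^sup>T) = 0" using fip_proj_diff[OF P P'] by simp
  then have z: "P - U * U\<^sup>T = 0\<^sub>m d d"
    using p p' by (intro frob_eq_0) (auto simp: frob_eq_sqrt)
  have "A = B" if "A - B = 0\<^sub>m d d" "A \<in> carrier_mat d d" "B \<in> carrier_mat d d" for A B :: "real mat"
  proof (rule eq_matI)
    fix i j assume "i < dim_row B" "j < dim_col B"
    then show "A $$ (i,j) = B $$ (i,j)" using arg_cong[OF that(1), of "\<lambda>M. M $$ (i,j)"] that(2,3) by simp
  qed (use that in auto)
  from this[OF z p(1) p'(1)] have PU2: "P = U * U\<^sup>T" .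
  have Pv: "P *\<^sub>v v \<in> carrier_vec d" and UTv: "U\<^sup>T *\<^sub>v v \<in> carrier_vec k" using p(1) v U by auto
  have "(vnorm (P *\<^sub>v v))\<^sup>2 \<le> (vnorm (U\<^sup>T *\<^sub>v v))\<^sup>2"
  proof -
    have "(vnorm (P *\<^sub>v v))\<^sup>2 = v \<bullet> (P *\<^sub>v (P *\<^sub>v v))"
      unfolding vnorm_sq by (rule symmetric_scalar_prod[OF p(1,2) v Pv])
    also have "P *\<^sub>v (P *\<^sub>v v) = P *\<^sub>v v" using assoc_mult_mat_vec[OF p(1) p(1) v] p(3) by simp
    also have "v \<bullet> (P *\<^sub>v v) = v \<bullet> (U *\<^sub>v (U\<^sup>T *\<^sub>v v))"
      unfolding PU2 using U v by (intro arg_cong[of _ _ "\<lambda>w. v \<bullet> w"] assoc_mult_mat_vec) auto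
    also have "\<dots> = (U\<^sup>T *\<^sub>v v) \<bullet> (U\<^sup>T *\<^sub>v v)"
      by (rule transpose_vec_mult_scalar[OF U UTv v, symmetric])
    finally show ?thesis by (simp only: vnorm_sq order_refl)
  qed
  also have "(vnorm (U\<^sup>T *\<^sub>v v))\<^sup>2 = (\<Sum>i<k. (u i \<bullet> v)\<^sup>2)"
    unfolding vnorm_sq scalar_prod_eq_sum[OF carrier_vecD[OF UTv]]
    using U cU by (intro sum.cong) (auto simp: power2_eq_square)
  finally have 1: "(vnorm (P *\<^sub>v v))\<^sup>2 \<le> (\<Sum>i<k. (u i \<bullet> v)\<^sup>2)" .
  have "l (k - 1) * (vnorm (P *\<^sub>v v))\<^sup>2 \<le> (\<Sum>i<k. l (k - 1) * (u i \<bullet> v)\<^sup>2)"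
    unfolding sum_distrib_left[symmetric] using 1 pos lk by (intro mult_left_mono) auto
  also have "\<dots> \<le> (\<Sum>i<k. l i * (u i \<bullet> v)\<^sup>2)" using lpos by (intro sum_mono mult_right_mono) auto
  also have "\<dots> \<le> (\<Sum>i<d. l i * (u i \<bullet> v)\<^sup>2)"
    using k kth_eigenvalue_nonneg[OF G psd] by (intro sum_mono2) (auto simp: l_def)
  also have "\<dots> = v \<bullet> (G *\<^sub>v v)" using quadratic_eigen[OF u G eig v] by (simp add: l_def)
  finally show ?thesis by (simp add: lk)
qed

section \<open>Projections onto column and row spaces\<close>

lemma is_proj_range:
  assumes U: "U \<in> carrier_mat d k" and inj: "\<And>x. x \<in> carrier_vec k \<Longrightarrow> U *\<^sub>v x = 0\<^sub>v d \<Longrightarrow> x = 0\<^sub>v k"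
  defines "P \<equiv> U * mat_inv (U\<^sup>T * U) * U\<^sup>T"
  shows "is_proj d k P" "P * U = U"
proof -
  define A where "A = U\<^sup>T * U"
  have UT: "U\<^sup>T \<in> carrier_mat k d" using U by simp
  have A: "A \<in> carrier_mat k k" using U by (simp add: A_def)
  have AT: "A\<^sup>T = A" using transpose_mult[OF UT U] by (simp add: A_def)
  have injA: "x = 0\<^sub>v k" if x: "x \<in> carrier_vec k" "A *\<^sub>v x = 0\<^sub>v k" for x
  proof -
    have Ux: "U *\<^sub>v x \<in> carrier_vec d" using U x by simp
    have "(vnorm (U *\<^sub>v x))\<^sup>2 = x \<bullet> (A *\<^sub>v x)"
      using transpose_vec_mult_scalar[OF U x(1) Ux] comm_scalar_prod[of x k "U\<^sup>T *\<^sub>v (U *\<^sub>v x)"]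
        assoc_mult_mat_vec[OF UT U x(1)] x(1) U by (simp add: vnorm_sq A_def)
    then have "vnorm (U *\<^sub>v x) = 0" using x by simp
    then show ?thesis using vnorm_eq_0[OF Ux] inj[OF x(1)] by simp
  qed
  define G where "G = mat_inv A"
  note g = mat_inv_mult[OF A injA, folded G_def]
  have GT: "G\<^sup>T = G" by (rule symmetric_from_inverse[OF A AT g(1) g(2)])
  have Pd: "P = U * G * U\<^sup>T" by (simp add: P_def G_def A_def)
  have UG: "U * G \<in> carrier_mat d k" using U g by simp
  have P: "P \<in> carrier_mat d d" unfolding Pd using UG U by simp
  have "P * U = U * G * (U\<^sup>T * U)" unfolding Pd by (rule assoc_mult_mat[OF UG UT U])
  also have "\<dots> = U * (G * A)" unfolding A_def[symmetric] by (rule assoc_mult_mat[OF U g(1) A])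
  finally show PU: "P * U = U" using g U by simp
  have PP: "P * P = P"
  proof -
    have "P * (U * G * U\<^sup>T) = P * (U * G) * U\<^sup>T" by (rule assoc_mult_mat[OF P UG UT, symmetric])
    also have "P * (U * G) = P * U * G" by (rule assoc_mult_mat[OF P U g(1), symmetric])
    finally show ?thesis by (simp add: PU) (simp add: Pd)
  qed
  have GUT: "G * U\<^sup>T \<in> carrier_mat k d" using g U by simp
  have PT: "P\<^sup>T = P"
    unfolding Pd using transpose_mult[OF UG UT] transpose_mult[OF U g(1)] GT assoc_mult_mat[OF U g(1) UT] by simp
  have "fip P P = fip (1\<^sub>m d * P) P" using P by simp
  also have "\<dots> = fip (1\<^sub>m d) P" using fip_mult_left2[of "1\<^sub>m d" d d P d P] P PT PP by simp
  also have "\<dots> = fip P (1\<^sub>m d)" using P by (intro fip_commute) auto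
  also have "\<dots> = fip (U * G) U" unfolding Pd using fip_mult_left2[OF UG UT, of "1\<^sub>m d"] U by simp
  also have "\<dots> = fip G A" using fip_mult_left[OF U g(1) U] by (simp add: A_def)
  also have "\<dots> = fip (G * A) (1\<^sub>m k)" using fip_mult_left2[OF g(1) A, of "1\<^sub>m k"] A AT by simp
  also have "\<dots> = real k" using g by (simp add: fip_one)
  finally show "is_proj d k P" using P PT PP by (simp add: is_proj_def)
qed

text \<open>Bridges the abstract rank and concrete matrices: the columns of \<open>U\<close> are a
  maximal independent set among the columns of X, so there are exactly rank many and they span all
  of them.\<close>

lemma column_basis:
  assumes X: "X \<in> carrier_mat n p"
  obtains U where "U \<in> carrier_mat n (mat_rank X)"
    "\<And>x. x \<in> carrier_vec (mat_rank X) \<Longrightarrow> U *\<^sub>v x = 0\<^sub>v n \<Longrightarrow> x = 0\<^sub>v (mat_rank X)"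
    "set (cols U) \<subseteq> set (cols X)"
    "\<And>j. j < p \<Longrightarrow> \<exists>x\<in>carrier_vec (mat_rank X). U *\<^sub>v x = col X j"
proof -
  interpret vec_space "TYPE(real)" n .
  let ?P = "\<lambda>T. T \<subseteq> set (cols X) \<and> lin_indpt T"
  have cX: "set (cols X) \<subseteq> carrier_vec n" using X cols_dim by blast
  obtain S where S: "maximal S ?P" "finite S"
    using maximal_exists_superset[of "set (cols X)" ?P "{}"] by (auto simp: finite_lin_indpt2)
  have SX: "S \<subseteq> set (cols X)" and Si: "lin_indpt S" using S(1) by (auto simp: maximal_def)
  have "dim_row X = n" using X by simp
  then have rk: "mat_rank X = card S" using rank_card_indpt[OF X S(1)] by (simp add: mat_rank_def)
  obtain xs where xs: "set xs = S" "distinct xs" using finite_distinct_list[OF S(2)] by blast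
  define k where "k = card S"
  have len: "length xs = k" using xs distinct_card by (force simp: k_def)
  define U where "U = mat_of_cols n xs"
  have U: "U \<in> carrier_mat n k" by (simp add: U_def len[symmetric])
  have cols_of: "cols (mat_of_cols n ys) = ys" if "set ys \<subseteq> carrier_vec n" for ys :: "real vec list"
    using that by (rule cols_mat_of_cols)
  have xsn: "set xs \<subseteq> carrier_vec n" using xs SX cX by simp
  have cU: "cols U = xs" unfolding U_def by (rule cols_of[OF xsn])
  have inj: "x = 0\<^sub>v k" if "x \<in> carrier_vec k" "U *\<^sub>v x = 0\<^sub>v n" for x
    using lin_depI[OF U that(1) _ that(2)] cU xs Si by auto
  have rep: "\<exists>x\<in>carrier_vec k. U *\<^sub>v x = col X j" if j: "j < p" for j
  proof (cases "col X j \<in> S")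
    case True
    then obtain i where i: "i < k" "xs ! i = col X j" using xs len by (metis in_set_conv_nth)
    have "col U i = col X j" using i cU U by (metis carrier_matD(2) cols_nth)
    moreover have "U *\<^sub>v unit_vec k i = col U i"
      using U i(1) by (intro eq_vecI) (auto simp: scalar_prod_right_unit[of _ k])
    ultimately show ?thesis using i by (intro bexI[of _ "unit_vec k i"]) auto
  next
    case False
    define c where "c = col X j"
    have c: "c \<in> carrier_vec n" "c \<in> set (cols X)" using X j by (auto simp: c_def cols_def)
    \<comment> \<open>Maximality: adding a further column creates a dependence.\<close>
    have "\<not> ?P (insert c S)" using S(1) False by (auto simp: maximal_def c_def)
    then have dep: "lin_dep (set (xs @ [c]))" using SX c xs by auto
    define U' where "U' = mat_of_cols n (xs @ [c])"
    have U': "U' \<in> carrier_mat n (Suc k)" using mat_of_cols_carrier(1)[of n "xs @ [c]"] len by (simp add: U'_def)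
    have cU': "cols U' = xs @ [c]" unfolding U'_def using xsn c by (intro cols_of) auto
    obtain v where v: "v \<in> carrier_vec (Suc k)" "v \<noteq> 0\<^sub>v (Suc k)" "U' *\<^sub>v v = 0\<^sub>v n"
      using lin_depE[OF U'] dep xs False by (auto simp: cU' c_def)
    define x where "x = vec k (\<lambda>i. v $ i)"
    have x: "x \<in> carrier_vec k" by (simp add: x_def)
    have eq: "(U *\<^sub>v x) $ i + v $ k * c $ i = 0" if i: "i < n" for i
    proof -
      have "0 = (U' *\<^sub>v v) $ i" using v i by simp
      also have "\<dots> = (\<Sum>l<Suc k. U' $$ (i,l) * v $ l)" by (rule mult_mat_vec_index[OF U' v(1) i])
      also have "\<dots> = (\<Sum>l<k. U' $$ (i,l) * v $ l) + U' $$ (i,k) * v $ k" by simp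
      also have "(\<Sum>l<k. U' $$ (i,l) * v $ l) = (\<Sum>l<k. U $$ (i,l) * x $ l)"
        using i len by (intro sum.cong) (auto simp: U'_def U_def x_def mat_of_cols_index nth_append)
      also have "\<dots> = (U *\<^sub>v x) $ i" by (rule mult_mat_vec_index[OF U x i, symmetric])
      also have "U' $$ (i,k) = c $ i" using i len by (simp add: U'_def mat_of_cols_index nth_append)
      finally show ?thesis by (simp add: mult.commute)
    qed
    \<comment> \<open>The new column takes part in the dependence, since otherwise the old ones
      would be dependent; so one can solve for it.\<close>
    have vk: "v $ k \<noteq> 0"
    proof
      assume 0: "v $ k = 0"
      have "U *\<^sub>v x = 0\<^sub>v n" using eq U 0 by (intro eq_vecI) (auto simp del: index_mult_mat_vec)
      then have "x = 0\<^sub>v k" using inj[OF x] by simp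
      then have "v $ i = 0" if "i < k" for i using that by (metis x_def index_vec index_zero_vec(1))
      then have "v = 0\<^sub>v (Suc k)" using v(1) 0 by (intro eq_vecI) (auto simp: less_Suc_eq)
      then show False using v(2) by simp
    qed
    have "U *\<^sub>v ((- 1 / v $ k) \<cdot>\<^sub>v x) = (- 1 / v $ k) \<cdot>\<^sub>v (U *\<^sub>v x)" using U x by (rule mult_mat_vec)
    also have "\<dots> = c"
    proof (rule eq_vecI)
      fix i assume "i < dim_vec c"
      then have i: "i < n" using c by simp
      have "(U *\<^sub>v x) $ i = - (v $ k * c $ i)" using eq[OF i] by linarith
      then show "((- 1 / v $ k) \<cdot>\<^sub>v (U *\<^sub>v x)) $ i = c $ i" using i U vk by (simp del: index_mult_mat_vec)
    qed (use U c in auto)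
    finally show ?thesis using x by (intro bexI[of _ "(- 1 / v $ k) \<cdot>\<^sub>v x"]) (auto simp: c_def)
  qed
  show ?thesis
    by (rule that[of U]) (use U inj rep cU xs SX in \<open>auto simp: rk k_def\<close>)
qed

text \<open>Supplies the projection with which the trace of I - Q is bounded by the rank of the
  design.\<close>

lemma proj_column_space:
  assumes X: "X \<in> carrier_mat n p"
  obtains P where "is_proj n (mat_rank X) P" "P * X = X"
proof -
  obtain U where U: "U \<in> carrier_mat n (mat_rank X)"
    and inj: "\<And>x. x \<in> carrier_vec (mat_rank X) \<Longrightarrow> U *\<^sub>v x = 0\<^sub>v n \<Longrightarrow> x = 0\<^sub>v (mat_rank X)"
    and rep: "\<And>j. j < p \<Longrightarrow> \<exists>x\<in>carrier_vec (mat_rank X). U *\<^sub>v x = col X j"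
    using column_basis[OF X] by metis
  note PU = is_proj_range[OF U inj]
  define P where "P = U * mat_inv (U\<^sup>T * U) * U\<^sup>T"
  have P: "is_proj n (mat_rank X) P" "P * U = U" using PU by (auto simp: P_def)
  note p = is_projD[OF P(1)]
  have "P * X = X"
  proof (rule mat_col_eqI)
    fix j assume "j < dim_col X"
    then have j: "j < p" using X by simp
    obtain x where x: "x \<in> carrier_vec (mat_rank X)" "U *\<^sub>v x = col X j" using rep[OF j] by blast
    have "col (P * X) j = P *\<^sub>v col X j" by (rule col_mult2[OF p(1) X j])
    also have "\<dots> = P * U *\<^sub>v x" unfolding x(2)[symmetric] by (rule assoc_mult_mat_vec[OF p(1) U x(1), symmetric])
    finally show "col (P * X) j = col X j" using P x by simp
  qed (use p X in auto)
  then show ?thesis using that P by blast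
qed

text \<open>K independent columns of B form a nonsingular square matrix U, and the entries of U^T x
  are among those of B^T x.\<close>

lemma full_row_rank_injective:
  assumes B: "B \<in> carrier_mat K m" and rk: "mat_rank B = K"
    and x: "x \<in> carrier_vec K" "B\<^sup>T *\<^sub>v x = 0\<^sub>v m"
  shows "x = 0\<^sub>v K"
proof -
  obtain U where U: "U \<in> carrier_mat K K"
    and inj: "\<And>x. x \<in> carrier_vec K \<Longrightarrow> U *\<^sub>v x = 0\<^sub>v K \<Longrightarrow> x = 0\<^sub>v K"
    and sub: "set (cols U) \<subseteq> set (cols B)"
    using column_basis[OF B] unfolding rk by metis
  have "det U \<noteq> 0" using det_0_iff_vec_prod_zero_field[OF U] inj by blast
  then have d: "det U\<^sup>T \<noteq> 0" using det_transpose[OF U] by simp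
  have UTx: "U\<^sup>T *\<^sub>v x = 0\<^sub>v K"
  proof (rule eq_vecI)
    fix i assume "i < dim_vec (0\<^sub>v K :: real vec)"
    then have i: "i < K" by simp
    have "col U i \<in> set (cols U)" using U i by (auto simp: cols_def)
    then obtain j where j: "j < m" "col U i = col B j" using sub B by (auto simp: cols_def)
    have "(B\<^sup>T *\<^sub>v x) $ j = 0" using x j by simp
    then have "col B j \<bullet> x = 0" using B j by simp
    then show "(U\<^sup>T *\<^sub>v x) $ i = 0\<^sub>v K $ i" using U i j by simp
  qed (use U in simp)
  have UT: "U\<^sup>T \<in> carrier_mat K K" using U by simp
  show ?thesis using det_0_iff_vec_prod_zero_field[OF UT] d UTx x by blast
qed

lemma proj_rows_is_proj:
  assumes B: "B \<in> carrier_mat K m" and rk: "mat_rank B = K"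
  shows "is_proj m K (proj_rows B)" "proj_rows B * B\<^sup>T = B\<^sup>T" "B * proj_rows B = B"
proof -
  have BT: "B\<^sup>T \<in> carrier_mat m K" using B by simp
  have inj: "x = 0\<^sub>v K" if "x \<in> carrier_vec K" "B\<^sup>T *\<^sub>v x = 0\<^sub>v m" for x
    using full_row_rank_injective[OF B rk that] .
  show P: "is_proj m K (proj_rows B)" and PB: "proj_rows B * B\<^sup>T = B\<^sup>T"
    using is_proj_range[OF BT inj] by (simp_all add: proj_rows_def)
  show "B * proj_rows B = B"
    using arg_cong[OF PB, of transpose_mat] transpose_mult[OF is_projD(1)[OF P] BT] is_projD(2)[OF P] by simp
qed

section \<open>Sub-Gaussian random variables\<close>

context prob_space
begin

lemma subgaussian_rv: "subgaussian M g X \<Longrightarrow> random_variable borel X"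
  by (auto simp: subgaussian_def intro: borel_measurable_integrable)

lemma subgaussian_mono:
  assumes "subgaussian M g X" "\<bar>g\<bar> \<le> \<bar>g'\<bar>"
  shows "subgaussian M g' X"
proof -
  have "g\<^sup>2 * t\<^sup>2 / 2 \<le> g'\<^sup>2 * t\<^sup>2 / 2" for t :: real
    using assms(2) by (intro divide_right_mono mult_right_mono) (auto simp: abs_le_square_iff)
  then have "exp (g\<^sup>2 * t\<^sup>2 / 2) \<le> exp (g'\<^sup>2 * t\<^sup>2 / 2)" for t :: real by simp
  then show ?thesis using assms(1) unfolding subgaussian_def by (meson order_trans)
qed

lemma subgaussian_scale:
  assumes "subgaussian M g X"
  shows "subgaussian M (c * g) (\<lambda>\<omega>. c * X \<omega>)"
  unfolding subgaussian_def
proof (intro conjI allI)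
  show "integrable M (\<lambda>\<omega>. c * X \<omega>)" "expectation (\<lambda>\<omega>. c * X \<omega>) = 0"
    using assms by (auto simp: subgaussian_def)
  fix t
  have e: "exp (t * (c * X \<omega>)) = exp ((t * c) * X \<omega>)" for \<omega> by (simp add: mult.assoc)
  show "integrable M (\<lambda>\<omega>. exp (t * (c * X \<omega>)))" unfolding e using assms by (auto simp: subgaussian_def)
  have "expectation (\<lambda>\<omega>. exp (t * (c * X \<omega>))) \<le> exp (g\<^sup>2 * (t * c)\<^sup>2 / 2)"
    unfolding e using assms by (auto simp: subgaussian_def)
  then show "expectation (\<lambda>\<omega>. exp (t * (c * X \<omega>))) \<le> exp ((c * g)\<^sup>2 * t\<^sup>2 / 2)"
    by (simp add: power_mult_distrib mult_ac)
qed

lemma subgaussian_zero: "subgaussian M 0 (\<lambda>_. 0)"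
  by (simp add: subgaussian_def prob_space)

lemma subgaussian_add:
  assumes X: "subgaussian M g X" and Y: "subgaussian M h Y" and ind: "indep_var borel X borel Y"
  shows "subgaussian M (sqrt (g\<^sup>2 + h\<^sup>2)) (\<lambda>\<omega>. X \<omega> + Y \<omega>)"
  unfolding subgaussian_def
proof (intro conjI allI)
  show "integrable M (\<lambda>\<omega>. X \<omega> + Y \<omega>)" "expectation (\<lambda>\<omega>. X \<omega> + Y \<omega>) = 0"
    using X Y by (auto simp: subgaussian_def)
  fix t
  have ind': "indep_var borel (\<lambda>\<omega>. exp (t * X \<omega>)) borel (\<lambda>\<omega>. exp (t * Y \<omega>))"
    using indep_var_compose[OF ind, of "\<lambda>x. exp (t * x)" borel "\<lambda>x. exp (t * x)" borel]
    by (simp add: comp_def)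
  have e: "exp (t * (X \<omega> + Y \<omega>)) = exp (t * X \<omega>) * exp (t * Y \<omega>)" for \<omega>
    by (simp add: distrib_left exp_add)
  have i: "integrable M (\<lambda>\<omega>. exp (t * X \<omega>))" "integrable M (\<lambda>\<omega>. exp (t * Y \<omega>))"
    using X Y by (auto simp: subgaussian_def)
  show "integrable M (\<lambda>\<omega>. exp (t * (X \<omega> + Y \<omega>)))"
    unfolding e by (rule indep_var_integrable[OF ind' i])
  have "expectation (\<lambda>\<omega>. exp (t * (X \<omega> + Y \<omega>))) = expectation (\<lambda>\<omega>. exp (t * X \<omega>)) * expectation (\<lambda>\<omega>. exp (t * Y \<omega>))"
    unfolding e by (rule indep_var_lebesgue_integral[OF ind' i])
  also have "\<dots> \<le> exp (g\<^sup>2 * t\<^sup>2 / 2) * exp (h\<^sup>2 * t\<^sup>2 / 2)"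
    using X Y by (intro mult_mono) (auto simp: subgaussian_def intro!: integral_nonneg)
  also have "\<dots> = exp ((sqrt (g\<^sup>2 + h\<^sup>2))\<^sup>2 * t\<^sup>2 / 2)"
    by (simp add: exp_add[symmetric] field_simps)
  finally show "expectation (\<lambda>\<omega>. exp (t * (X \<omega> + Y \<omega>))) \<le> exp ((sqrt (g\<^sup>2 + h\<^sup>2))\<^sup>2 * t\<^sup>2 / 2)" .
qed

lemma subgaussian_sum:
  assumes "finite I" "indep_vars (\<lambda>_. borel) X I" "\<And>i. i \<in> I \<Longrightarrow> subgaussian M (g i) (X i)"
  shows "subgaussian M (sqrt (\<Sum>i\<in>I. (g i)\<^sup>2)) (\<lambda>\<omega>. \<Sum>i\<in>I. X i \<omega>)"
  using assms
proof (induction I rule: finite_induct)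
  case empty
  then show ?case using subgaussian_zero by simp
next
  case (insert j I)
  have "subgaussian M (sqrt (\<Sum>i\<in>I. (g i)\<^sup>2)) (\<lambda>\<omega>. \<Sum>i\<in>I. X i \<omega>)"
    using insert by (intro insert.IH indep_vars_subset[OF insert.prems(1)]) auto
  then have "subgaussian M (sqrt ((g j)\<^sup>2 + (sqrt (\<Sum>i\<in>I. (g i)\<^sup>2))\<^sup>2)) (\<lambda>\<omega>. X j \<omega> + (\<Sum>i\<in>I. X i \<omega>))"
    using insert by (intro subgaussian_add indep_vars_sum) auto
  then show ?case using insert by (simp add: sum_nonneg)
qed

lemma subgaussian_lincomb:
  assumes "finite I" "indep_vars (\<lambda>_. borel) X I" "\<And>i. i \<in> I \<Longrightarrow> subgaussian M g (X i)"
  shows "subgaussian M (sqrt (\<Sum>i\<in>I. (u i)\<^sup>2) * g) (\<lambda>\<omega>. \<Sum>i\<in>I. u i * X i \<omega>)"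
proof -
  have ind: "indep_vars (\<lambda>_. borel) (\<lambda>i \<omega>. u i * X i \<omega>) I"
    by (rule indep_vars_compose2[OF assms(2)]) simp
  have "subgaussian M (sqrt (\<Sum>i\<in>I. (u i * g)\<^sup>2)) (\<lambda>\<omega>. \<Sum>i\<in>I. u i * X i \<omega>)"
    using assms by (intro subgaussian_sum[OF _ ind] subgaussian_scale) auto
  then show ?thesis
    by (rule subgaussian_mono) (simp add: power_mult_distrib real_sqrt_mult abs_mult flip: sum_distrib_right)
qed

section \<open>Tails, moments and Markov's inequality\<close>

lemma subgaussian_tail_upper:
  assumes X: "subgaussian M g X" and g: "0 < g" and T: "0 < T"
  shows "prob {\<omega> \<in> space M. g * sqrt (2 * T) \<le> X \<omega>} \<le> exp (- T)"
proof -
  \<comment> \<open>The minimizer of the Chernoff exponent g^2 t^2 / 2 - t g sqrt(2 T), with minimum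
    - T.\<close>
  define t where "t = sqrt (2 * T) / g"
  have t: "0 < t" using g T by (simp add: t_def)
  have "prob {\<omega> \<in> space M. g * sqrt (2 * T) \<le> X \<omega>} = prob {\<omega> \<in> space M. exp (t * (g * sqrt (2 * T))) \<le> exp (t * X \<omega>)}"
    using t by simp
  also have "\<dots> \<le> expectation (\<lambda>\<omega>. exp (t * X \<omega>)) / exp (t * (g * sqrt (2 * T)))"
    using X by (intro integral_Markov_inequality_measure[of _ _ "space M"]) (auto simp: subgaussian_def)
  also have "\<dots> \<le> exp (g\<^sup>2 * t\<^sup>2 / 2) / exp (t * (g * sqrt (2 * T)))"
    using X by (intro divide_right_mono) (auto simp: subgaussian_def)
  also have "\<dots> = exp (g\<^sup>2 * t\<^sup>2 / 2 - t * (g * sqrt (2 * T)))" by (simp add: exp_diff)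
  also have "g\<^sup>2 * t\<^sup>2 / 2 - t * (g * sqrt (2 * T)) = - T"
    using g T by (simp add: t_def power_divide power2_eq_square)
  finally show ?thesis .
qed

lemma subgaussian_tail:
  assumes X: "subgaussian M g X" and g: "0 < g" and T: "0 < T"
  shows "prob {\<omega> \<in> space M. g * sqrt (2 * T) \<le> \<bar>X \<omega>\<bar>} \<le> 2 * exp (- T)"
proof -
  have X': "subgaussian M g (\<lambda>\<omega>. - X \<omega>)"
    by (rule subgaussian_mono[OF subgaussian_scale[OF X, of "-1", simplified]]) simp
  have [measurable]: "random_variable borel X" by (rule subgaussian_rv[OF X])
  have "prob {\<omega> \<in> space M. g * sqrt (2 * T) \<le> \<bar>X \<omega>\<bar>} = prob ({\<omega> \<in> space M. g * sqrt (2 * T) \<le> X \<omega>} \<union> {\<omega> \<in> space M. g * sqrt (2 * T) \<le> - X \<omega>})"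
    by (rule arg_cong[of _ _ prob]) auto
  also have "\<dots> \<le> prob {\<omega> \<in> space M. g * sqrt (2 * T) \<le> X \<omega>} + prob {\<omega> \<in> space M. g * sqrt (2 * T) \<le> - X \<omega>}"
    by (rule measure_Un_le) measurable
  also have "\<dots> \<le> exp (- T) + exp (- T)"
    by (intro add_mono subgaussian_tail_upper X X' g T)
  finally show ?thesis by simp
qed

text \<open>Crude but explicit: y^k \<le> k^k (e^y + e^-y) for even k, applied to y = X / g, where
  the expectation of the bracket is at most 2 sqrt e \<le> 4. So the constants are 4 * 4^4 and 4 *
  2^2.\<close>

lemma subgaussian_moments:
  assumes X: "subgaussian M g X" and g: "0 < g"
  shows "integrable M (\<lambda>\<omega>. (X \<omega>)^4)" "expectation (\<lambda>\<omega>. (X \<omega>)^4) \<le> 1024 * g^4"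
    "integrable M (\<lambda>\<omega>. (X \<omega>)\<^sup>2)" "expectation (\<lambda>\<omega>. (X \<omega>)\<^sup>2) \<le> 16 * g\<^sup>2"
proof -
  have [measurable]: "random_variable borel X" by (rule subgaussian_rv[OF X])
  have sgi: "integrable M (\<lambda>\<omega>. exp (t * X \<omega>))"
    and sgE: "expectation (\<lambda>\<omega>. exp (t * X \<omega>)) \<le> exp (g\<^sup>2 * t\<^sup>2 / 2)" for t
    using X by (auto simp: subgaussian_def)
  define h where "h \<omega> = exp (1 / g * X \<omega>) + exp (- 1 / g * X \<omega>)" for \<omega>
  have hi: "integrable M h" unfolding h_def by (intro Bochner_Integration.integrable_add sgi)
  have "expectation h = expectation (\<lambda>\<omega>. exp (1 / g * X \<omega>)) + expectation (\<lambda>\<omega>. exp (- 1 / g * X \<omega>))"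
    unfolding h_def by (intro Bochner_Integration.integral_add sgi)
  also have "\<dots> \<le> exp (g\<^sup>2 * (1 / g)\<^sup>2 / 2) + exp (g\<^sup>2 * (- 1 / g)\<^sup>2 / 2)"
    by (intro add_mono sgE)
  also have "\<dots> = 2 * exp (1 / 2)" using g by (simp add: power_divide)
  also have "\<dots> \<le> 4"
  proof -
    have "exp (1/2) \<le> (2 :: real)"
      using exp_bound_half[of "1/2 :: real"] by simp
    then show ?thesis by simp
  qed
  finally have hE: "expectation h \<le> 4" .
  have pw: "y ^ k \<le> real k ^ k * (exp y + exp (- y))" if "even k" "0 < k" for y :: real and k
  proof -
    have "(\<bar>y\<bar> / real k) ^ k \<le> (1 + \<bar>y\<bar> / real k) ^ k" by (intro power_mono) auto
    also have "\<dots> \<le> exp \<bar>y\<bar>" using that by (intro exp_ge_one_plus_x_over_n_power_n) auto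
    also have "\<dots> \<le> exp y + exp (- y)" by (cases "0 \<le> y") auto
    finally have "\<bar>y\<bar> ^ k / real k ^ k \<le> exp y + exp (- y)" by (simp add: power_divide)
    then show ?thesis using that by (simp add: field_simps power_even_abs)
  qed
  have b: "(X \<omega>) ^ k \<le> g ^ k * (real k ^ k * h \<omega>)" if "even k" "0 < k" for k \<omega>
  proof -
    have "(X \<omega> / g) ^ k \<le> real k ^ k * (exp (X \<omega> / g) + exp (- (X \<omega> / g)))" by (rule pw[OF that])
    then have "g ^ k * (X \<omega> / g) ^ k \<le> g ^ k * (real k ^ k * h \<omega>)"
      using g by (intro mult_left_mono) (auto simp: h_def)
    then show ?thesis using g by (simp add: power_divide)
  qed
  have I: "integrable M (\<lambda>\<omega>. (X \<omega>) ^ k)" and Ex: "expectation (\<lambda>\<omega>. (X \<omega>) ^ k) \<le> g ^ k * (real k ^ k * 4)"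
    if k: "even k" "0 < k" for k
  proof -
    have bi: "integrable M (\<lambda>\<omega>. g ^ k * (real k ^ k * h \<omega>))" using hi by simp
    show I: "integrable M (\<lambda>\<omega>. (X \<omega>) ^ k)"
    proof (rule Bochner_Integration.integrable_bound[OF bi])
      show "AE \<omega> in M. norm ((X \<omega>) ^ k) \<le> norm (g ^ k * (real k ^ k * h \<omega>))"
      proof (rule AE_I2)
        fix \<omega>
        have "0 \<le> (X \<omega>) ^ k" using k by (simp add: zero_le_even_power)
        then show "norm ((X \<omega>) ^ k) \<le> norm (g ^ k * (real k ^ k * h \<omega>))" using b[OF k, of \<omega>] by simp
      qed
    qed simp
    have "expectation (\<lambda>\<omega>. (X \<omega>) ^ k) \<le> expectation (\<lambda>\<omega>. g ^ k * (real k ^ k * h \<omega>))"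
      by (intro integral_mono I bi b k)
    also have "\<dots> = g ^ k * (real k ^ k * expectation h)" by simp
    also have "\<dots> \<le> g ^ k * (real k ^ k * 4)" using hE g by (intro mult_left_mono) auto
    finally show "expectation (\<lambda>\<omega>. (X \<omega>) ^ k) \<le> g ^ k * (real k ^ k * 4)" .
  qed
  show "integrable M (\<lambda>\<omega>. (X \<omega>)^4)" "expectation (\<lambda>\<omega>. (X \<omega>)^4) \<le> 1024 * g^4"
    "integrable M (\<lambda>\<omega>. (X \<omega>)\<^sup>2)" "expectation (\<lambda>\<omega>. (X \<omega>)\<^sup>2) \<le> 16 * g\<^sup>2"
    using I[of 4] Ex[of 4] I[of 2] Ex[of 2] by (simp_all add: mult.commute)
qed

text \<open>The factors may be dependent, as two coordinates of one noise row are, so the product is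
  split by the arithmetic-geometric mean inequality. The weights h^2 / g^2 and its inverse make both
  fourth moments contribute the same multiple of g^2 h^2.\<close>

lemma subgaussian_prod_square:
  assumes X: "subgaussian M g X" and Y: "subgaussian M h Y" and g: "0 < g" "0 < h"
  shows "integrable M (\<lambda>\<omega>. (X \<omega> * Y \<omega>)\<^sup>2)" "expectation (\<lambda>\<omega>. (X \<omega> * Y \<omega>)\<^sup>2) \<le> 1024 * g\<^sup>2 * h\<^sup>2"
    "integrable M (\<lambda>\<omega>. X \<omega> * Y \<omega>)"
proof -
  have [measurable]: "random_variable borel X" "random_variable borel Y" by (rule subgaussian_rv[OF X], rule subgaussian_rv[OF Y])
  note mX = subgaussian_moments[OF X g(1)] and mY = subgaussian_moments[OF Y g(2)]
  define f where "f \<omega> = (h\<^sup>2 / g\<^sup>2 * (X \<omega>)^4 + g\<^sup>2 / h\<^sup>2 * (Y \<omega>)^4) / 2" for \<omega>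
  have fi: "integrable M f" unfolding f_def using mX mY by simp
  have b: "(X \<omega> * Y \<omega>)\<^sup>2 \<le> f \<omega>" for \<omega>
  proof -
    have "0 \<le> (h / g * (X \<omega>)\<^sup>2 - g / h * (Y \<omega>)\<^sup>2)\<^sup>2" by simp
    also have "\<dots> = h\<^sup>2 / g\<^sup>2 * (X \<omega>)^4 + g\<^sup>2 / h\<^sup>2 * (Y \<omega>)^4 - 2 * (X \<omega> * Y \<omega>)\<^sup>2"
      using g by (simp add: power2_diff power_mult_distrib power_divide)
    finally show ?thesis by (simp add: f_def)
  qed
  show I: "integrable M (\<lambda>\<omega>. (X \<omega> * Y \<omega>)\<^sup>2)"
    by (rule Bochner_Integration.integrable_bound[OF fi]) (auto intro!: AE_I2 order.trans[OF b])
  show "integrable M (\<lambda>\<omega>. X \<omega> * Y \<omega>)" by (rule square_integrable_imp_integrable[OF _ I]) measurable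
  have "expectation (\<lambda>\<omega>. (X \<omega> * Y \<omega>)\<^sup>2) \<le> expectation f" by (intro integral_mono I fi b)
  also have "\<dots> = (h\<^sup>2 / g\<^sup>2 * expectation (\<lambda>\<omega>. (X \<omega>)^4) + g\<^sup>2 / h\<^sup>2 * expectation (\<lambda>\<omega>. (Y \<omega>)^4)) / 2"
    unfolding f_def using mX mY by simp
  also have "\<dots> \<le> (h\<^sup>2 / g\<^sup>2 * (1024 * g^4) + g\<^sup>2 / h\<^sup>2 * (1024 * h^4)) / 2"
    using mX mY by (intro divide_right_mono add_mono mult_left_mono) auto
  also have "\<dots> = 1024 * g\<^sup>2 * h\<^sup>2" using g by (simp add: power2_eq_square power4_eq_xxxx)
  finally show "expectation (\<lambda>\<omega>. (X \<omega> * Y \<omega>)\<^sup>2) \<le> 1024 * g\<^sup>2 * h\<^sup>2" .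
qed

lemma square_integrable_prod:
  fixes X Y :: "'a \<Rightarrow> real"
  assumes [measurable]: "random_variable borel X" "random_variable borel Y"
    and "integrable M (\<lambda>\<omega>. (X \<omega>)\<^sup>2)" "integrable M (\<lambda>\<omega>. (Y \<omega>)\<^sup>2)"
  shows "integrable M (\<lambda>\<omega>. X \<omega> * Y \<omega>)"
proof (rule Bochner_Integration.integrable_bound)
  show "integrable M (\<lambda>\<omega>. ((X \<omega>)\<^sup>2 + (Y \<omega>)\<^sup>2))" using assms by simp
  have "\<bar>a * b\<bar> \<le> a\<^sup>2 + b\<^sup>2" for a b :: real
  proof -
    have "0 \<le> \<bar>a\<bar> * \<bar>b\<bar>" by simp
    moreover have "2 * (\<bar>a\<bar> * \<bar>b\<bar>) \<le> a\<^sup>2 + b\<^sup>2" using sum_squares_bound[of "\<bar>a\<bar>" "\<bar>b\<bar>"] by (simp add: mult.assoc)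
    ultimately show ?thesis unfolding abs_mult by linarith
  qed
  then show "AE \<omega> in M. norm (X \<omega> * Y \<omega>) \<le> norm ((X \<omega>)\<^sup>2 + (Y \<omega>)\<^sup>2)" by (auto intro!: AE_I2)
qed simp

lemma orthogonal_sum_second_moment:
  fixes f :: "'i \<Rightarrow> 'a \<Rightarrow> real"
  assumes I: "finite I" and rv: "\<And>i. i \<in> I \<Longrightarrow> random_variable borel (f i)"
    and sq: "\<And>i. i \<in> I \<Longrightarrow> integrable M (\<lambda>\<omega>. (f i \<omega>)\<^sup>2)"
    and orth: "\<And>i j. i \<in> I \<Longrightarrow> j \<in> I \<Longrightarrow> i \<noteq> j \<Longrightarrow> expectation (\<lambda>\<omega>. f i \<omega> * f j \<omega>) = 0"
  shows "integrable M (\<lambda>\<omega>. (\<Sum>i\<in>I. f i \<omega>)\<^sup>2)"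
    "expectation (\<lambda>\<omega>. (\<Sum>i\<in>I. f i \<omega>)\<^sup>2) = (\<Sum>i\<in>I. expectation (\<lambda>\<omega>. (f i \<omega>)\<^sup>2))"
proof -
  have e: "(\<Sum>i\<in>I. f i \<omega>)\<^sup>2 = (\<Sum>i\<in>I. \<Sum>j\<in>I. f i \<omega> * f j \<omega>)" for \<omega>
    by (simp add: power2_eq_square sum_product)
  have ij: "integrable M (\<lambda>\<omega>. f i \<omega> * f j \<omega>)" if "i \<in> I" "j \<in> I" for i j
    using that by (intro square_integrable_prod rv sq)
  show "integrable M (\<lambda>\<omega>. (\<Sum>i\<in>I. f i \<omega>)\<^sup>2)" unfolding e using ij by auto
  have "expectation (\<lambda>\<omega>. (\<Sum>i\<in>I. f i \<omega>)\<^sup>2) = (\<Sum>i\<in>I. \<Sum>j\<in>I. expectation (\<lambda>\<omega>. f i \<omega> * f j \<omega>))"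
    unfolding e using ij by (simp add: integrable_sum)
  also have "\<dots> = (\<Sum>i\<in>I. \<Sum>j\<in>I. if i = j then expectation (\<lambda>\<omega>. (f i \<omega>)\<^sup>2) else 0)"
    using orth by (intro sum.cong refl) (auto simp: power2_eq_square)
  also have "\<dots> = (\<Sum>i\<in>I. expectation (\<lambda>\<omega>. (f i \<omega>)\<^sup>2))" using I by simp
  finally show "expectation (\<lambda>\<omega>. (\<Sum>i\<in>I. f i \<omega>)\<^sup>2) = (\<Sum>i\<in>I. expectation (\<lambda>\<omega>. (f i \<omega>)\<^sup>2))" .
qed

lemma indep_vars_expectation_mult:
  fixes f :: "'i \<Rightarrow> 'a \<Rightarrow> real"
  assumes "indep_vars (\<lambda>_. borel) f I" "i \<in> I" "j \<in> I" "i \<noteq> j" "integrable M (f i)" "integrable M (f j)"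
  shows "expectation (\<lambda>\<omega>. f i \<omega> * f j \<omega>) = expectation (f i) * expectation (f j)"
proof -
  have "indep_vars (\<lambda>_. borel) f {i,j}" by (rule indep_vars_subset[OF assms(1)]) (use assms in auto)
  from indep_vars_lebesgue_integral[OF _ this] show ?thesis using assms by auto
qed

lemma markov_bound:
  assumes i: "integrable M f" and pos: "\<And>\<omega>. 0 \<le> f \<omega>" and E: "expectation f \<le> B" and B: "0 \<le> B" and d: "0 < d"
  shows "prob {\<omega> \<in> space M. \<not> f \<omega> \<le> B / d} \<le> d"
\<comment> \<open>With threshold 0 the Markov quotient says nothing; instead \<open>f\<close>
  vanishes almost surely.\<close>
proof (cases "B = 0")
  case True
  have "expectation f = 0" using E True pos by (intro antisym integral_nonneg) auto
  then have "AE \<omega> in M. f \<omega> = 0" using integral_nonneg_eq_0_iff_AE[OF i] pos by simp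
  then have "AE \<omega> in M. \<omega> \<notin> {\<omega> \<in> space M. \<not> f \<omega> \<le> B / d}" by (rule AE_mp) (auto intro!: AE_I2 simp: True)
  moreover have "{\<omega> \<in> space M. \<not> f \<omega> \<le> B / d} \<in> events"
    using borel_measurable_integrable[OF i] by measurable
  ultimately have "prob {\<omega> \<in> space M. \<not> f \<omega> \<le> B / d} = 0" by (simp add: prob_eq_0)
  then show ?thesis using d by simp
next
  case False
  then have B0: "0 < B" using B by simp
  have [measurable]: "random_variable borel f" by (rule borel_measurable_integrable[OF i])
  have "prob {\<omega> \<in> space M. \<not> f \<omega> \<le> B / d} \<le> prob {\<omega> \<in> space M. B / d \<le> f \<omega>}"
    by (rule finite_measure_mono) auto
  also have "\<dots> \<le> expectation f / (B / d)"
    using B0 d pos by (intro integral_Markov_inequality_measure[OF i]) (auto)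
  also have "\<dots> \<le> B / (B / d)" using E B0 d by (intro divide_right_mono) auto
  finally show ?thesis using B0 by simp
qed

end

section \<open>The inverse square root\<close>

lemma symmetric_eq_on_basis:
  assumes u: "orthonormal_basis d u" and A: "A \<in> carrier_mat d d" "A\<^sup>T = A" and B: "B \<in> carrier_mat d d" "B\<^sup>T = B"
    and eq: "\<And>i. i < d \<Longrightarrow> A *\<^sub>v u i = B *\<^sub>v u i"
  shows "A = B"
proof (rule eq_matI)
  fix a b assume "a < dim_row B" "b < dim_col B"
  then have ab: "a < d" "b < d" using B by auto
  have ea: "unit_vec d a \<in> carrier_vec d" and eb: "unit_vec d b \<in> carrier_vec d" by auto
  have ui: "u i \<in> carrier_vec d" if "i < d" for i using u that by (auto simp: orthonormal_basis_def)
  have ent: "M $$ (a,b) = unit_vec d a \<bullet> (M *\<^sub>v unit_vec d b)" if "M \<in> carrier_mat d d" for M :: "real mat"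
    using that ab by (simp add: scalar_prod_left_unit[of _ d])
  have "u i \<bullet> (A *\<^sub>v unit_vec d b) = u i \<bullet> (B *\<^sub>v unit_vec d b)" if i: "i < d" for i
    using symmetric_scalar_prod[OF A ui[OF i] eb] symmetric_scalar_prod[OF B ui[OF i] eb] eq[OF i] by simp
  then show "A $$ (a,b) = B $$ (a,b)"
    unfolding ent[OF A(1)] ent[OF B(1)] using parseval[OF u ea] A B eb by simp
qed (use A B in auto)

lemma smult_eq_imp: "l \<cdot>\<^sub>v x = w \<Longrightarrow> c * l = 1 \<Longrightarrow> x = c \<cdot>\<^sub>v (w :: real vec)"
  by (metis smult_smult_assoc one_smult_vec)

lemma smult_minus_aux:
  "y \<in> carrier_vec d \<Longrightarrow> w \<in> carrier_vec d \<Longrightarrow> (c * c) \<cdot>\<^sub>v w - c \<cdot>\<^sub>v y = (- c) \<cdot>\<^sub>v (y - c \<cdot>\<^sub>v (w :: real vec))"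
  by (intro eq_vecI) (auto simp: algebra_simps)

lemma minus_eq_zero_vec:
  assumes "y \<in> carrier_vec d" "w \<in> carrier_vec d" "y - w = 0\<^sub>v d"
  shows "y = (w :: real vec)"
proof (rule eq_vecI)
  fix a assume "a < dim_vec w"
  then show "y $ a = w $ a" using arg_cong[OF assms(3), of "\<lambda>v. v $ a"] assms(1,2) by simp
qed (use assms in auto)

text \<open>The definition is a definite description, so existence and uniqueness are both required.
  Existence is the spectral formula. For uniqueness, any candidate R' satisfies R'^2 u = \<mu>^2 u
  on an eigenvector u; then z = R' u - \<mu> u satisfies R' z = - \<mu> z, which positive
  semidefiniteness allows only for z = 0.\<close>

lemma inv_sqrt_mat_exists:
  assumes S: "S \<in> carrier_mat d d" "S\<^sup>T = S" and pd: "\<And>v. v \<in> carrier_vec d \<Longrightarrow> v \<noteq> 0\<^sub>v d \<Longrightarrow> 0 < v \<bullet> (S *\<^sub>v v)"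
  shows "inv_sqrt_mat S \<in> carrier_mat d d" "(inv_sqrt_mat S)\<^sup>T = inv_sqrt_mat S"
    "inv_sqrt_mat S * S * inv_sqrt_mat S = 1\<^sub>m d"
proof -
  obtain u where u: "orthonormal_basis d u"
    and eig: "\<And>i. i < d \<Longrightarrow> S *\<^sub>v u i = kth_eigenvalue S (Suc i) \<cdot>\<^sub>v u i"
    and "\<And>i j. i \<le> j \<Longrightarrow> j < d \<Longrightarrow> kth_eigenvalue S (Suc j) \<le> kth_eigenvalue S (Suc i)"
    using spectral_theorem[OF S] by blast
  define l where "l i = kth_eigenvalue S (Suc i)" for i
  have ui: "u i \<in> carrier_vec d" if "i < d" for i using u that by (auto simp: orthonormal_basis_def)
  have uu: "u i \<bullet> u j = (if i = j then 1 else 0)" if "i < d" "j < d" for i j using u that by (auto simp: orthonormal_basis_def)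
  have lpos: "0 < l i" if i: "i < d" for i
  proof -
    have "u i \<noteq> 0\<^sub>v d" using uu[OF i i] by auto
    then have "0 < u i \<bullet> (S *\<^sub>v u i)" by (rule pd[OF ui[OF i]])
    then show ?thesis unfolding eig[OF i] using ui[OF i] uu[OF i i] by (simp add: l_def)
  qed
  define R where "R = mat d d (\<lambda>(a,b). \<Sum>i<d. u i $ a * u i $ b / sqrt (l i))"
  have R: "R \<in> carrier_mat d d" by (simp add: R_def)
  have RT: "R\<^sup>T = R" by (intro eq_matI) (auto simp: R_def mult.commute)
  have Rv: "(R *\<^sub>v v) $ a = (\<Sum>i<d. (u i \<bullet> v) / sqrt (l i) * u i $ a)" if v: "v \<in> carrier_vec d" and a: "a < d" for v a
  proof -
    have "(R *\<^sub>v v) $ a = (\<Sum>b<d. (\<Sum>i<d. u i $ a * u i $ b / sqrt (l i)) * v $ b)"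
      using mult_mat_vec_index[OF R v a] a by (simp add: R_def)
    also have "\<dots> = (\<Sum>i<d. \<Sum>b<d. u i $ a * u i $ b / sqrt (l i) * v $ b)"
      by (simp add: sum_distrib_right) (rule sum.swap)
    also have "\<dots> = (\<Sum>i<d. (u i \<bullet> v) / sqrt (l i) * u i $ a)"
      using v by (simp add: scalar_prod_eq_sum[of v d] sum_distrib_left sum_distrib_right sum_divide_distrib mult_ac)
    finally show ?thesis .
  qed
  have Ru: "R *\<^sub>v u j = (1 / sqrt (l j)) \<cdot>\<^sub>v u j" if j: "j < d" for j
  proof (rule eq_vecI)
    fix a assume "a < dim_vec ((1 / sqrt (l j)) \<cdot>\<^sub>v u j)"
    then have a: "a < d" using ui[OF j] by simp
    have "(R *\<^sub>v u j) $ a = (\<Sum>i<d. if i = j then 1 / sqrt (l j) * u j $ a else 0)"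
      unfolding Rv[OF ui[OF j] a] by (intro sum.cong) (auto simp: uu j)
    then show "(R *\<^sub>v u j) $ a = ((1 / sqrt (l j)) \<cdot>\<^sub>v u j) $ a" using j ui[OF j] a by simp
  qed (use R ui[OF j] in auto)
  have psd: "0 \<le> v \<bullet> (R *\<^sub>v v)" if v: "v \<in> carrier_vec d" for v
  proof -
    have "v \<bullet> (R *\<^sub>v v) = (\<Sum>i<d. (1 / sqrt (l i)) * (u i \<bullet> v)\<^sup>2)" by (rule quadratic_eigen[OF u R RT Ru v])
    then show ?thesis using lpos by (auto intro!: sum_nonneg simp: less_imp_le)
  qed
  have RS: "R * S \<in> carrier_mat d d" using R S by simp
  have RSR: "R * S * R = 1\<^sub>m d"
  proof (rule symmetric_eq_on_basis[OF u])
    have SR: "S * R \<in> carrier_mat d d" using S R by simp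
    have "(R * S * R)\<^sup>T = R\<^sup>T * (R * S)\<^sup>T" by (rule transpose_mult[OF RS R])
    also have "(R * S)\<^sup>T = S * R" using transpose_mult[OF R S(1)] S RT by simp
    finally show "(R * S * R)\<^sup>T = R * S * R" using assoc_mult_mat[OF R S(1) R] RT by simp
    fix i assume i: "i < d"
    have sq: "sqrt (l i) * sqrt (l i) = l i" using lpos[OF i] by simp
    have "R * S * R *\<^sub>v u i = R * S *\<^sub>v (R *\<^sub>v u i)" by (rule assoc_mult_mat_vec[OF RS R ui[OF i]])
    also have "\<dots> = (1 / sqrt (l i)) \<cdot>\<^sub>v (R * S *\<^sub>v u i)" unfolding Ru[OF i] by (rule mult_mat_vec[OF RS ui[OF i]])
    also have "R * S *\<^sub>v u i = R *\<^sub>v (S *\<^sub>v u i)" by (rule assoc_mult_mat_vec[OF R S(1) ui[OF i]])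
    also have "\<dots> = l i \<cdot>\<^sub>v ((1 / sqrt (l i)) \<cdot>\<^sub>v u i)"
      unfolding eig[OF i] Ru[OF i, symmetric] l_def[symmetric] by (rule mult_mat_vec[OF R ui[OF i]])
    also have "(1 / sqrt (l i)) \<cdot>\<^sub>v (l i \<cdot>\<^sub>v ((1 / sqrt (l i)) \<cdot>\<^sub>v u i)) = ((1 / sqrt (l i)) * (l i * (1 / sqrt (l i)))) \<cdot>\<^sub>v u i"
      by (simp add: smult_smult_assoc)
    also have "(1 / sqrt (l i)) * (l i * (1 / sqrt (l i))) = 1" using sq lpos[OF i] by (simp add: field_simps)
    finally show "R * S * R *\<^sub>v u i = 1\<^sub>m d *\<^sub>v u i" using ui[OF i] by simp
  qed (use R S in auto)
  have dS: "dim_row S = d" using S by simp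
  define Pr where "Pr R' \<longleftrightarrow> R' \<in> carrier_mat d d \<and> R'\<^sup>T = R' \<and> (\<forall>v\<in>carrier_vec d. 0 \<le> v \<bullet> (R' *\<^sub>v v)) \<and> R' * S * R' = 1\<^sub>m d" for R'
  have PrR: "Pr R" using R RT psd RSR by (simp add: Pr_def)
  have uniq: "R' = R" if R': "Pr R'" for R'
  proof (rule symmetric_eq_on_basis[OF u])
    have c: "R' \<in> carrier_mat d d" "R'\<^sup>T = R'" and p: "\<And>v. v \<in> carrier_vec d \<Longrightarrow> 0 \<le> v \<bullet> (R' *\<^sub>v v)"
      and e: "R' * S * R' = 1\<^sub>m d" using R' by (auto simp: Pr_def)
    show "R' \<in> carrier_mat d d" "R'\<^sup>T = R'" "R \<in> carrier_mat d d" "R\<^sup>T = R" using c R RT by auto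
    fix i assume i: "i < d"
    define \<mu> where "\<mu> = 1 / sqrt (l i)"
    have mu: "0 < \<mu>" "\<mu> * \<mu> * l i = 1" using lpos[OF i] by (auto simp: \<mu>_def)
    have R'S: "R' * S \<in> carrier_mat d d" using c S by simp
    \<comment> \<open>A one-sided inverse of a square matrix is two-sided, so the factors may be
      swapped and a genuine square of R' appears.\<close>
    have "R' * (R' * S) = 1\<^sub>m d" by (rule mat_mult_left_right_inverse[OF R'S c(1) e])
    then have "R' *\<^sub>v (R' *\<^sub>v (S *\<^sub>v u i)) = u i"
      using assoc_mult_mat_vec[OF c(1) R'S ui[OF i]] assoc_mult_mat_vec[OF c(1) S(1) ui[OF i]] ui[OF i] by simp
    then have "l i \<cdot>\<^sub>v (R' *\<^sub>v (R' *\<^sub>v u i)) = u i"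
      unfolding eig[OF i] l_def[symmetric] using c(1) ui[OF i] by (simp add: mult_mat_vec[of R' d d])
    then have sq: "R' *\<^sub>v (R' *\<^sub>v u i) = (\<mu> * \<mu>) \<cdot>\<^sub>v u i"
      by (rule smult_eq_imp) (rule mu(2))
    define z where "z = R' *\<^sub>v u i - \<mu> \<cdot>\<^sub>v u i"
    have R'u: "R' *\<^sub>v u i \<in> carrier_vec d" using c(1) ui[OF i] by simp
    have z: "z \<in> carrier_vec d" using R'u ui[OF i] by (simp add: z_def)
    have "R' *\<^sub>v z = R' *\<^sub>v (R' *\<^sub>v u i) - R' *\<^sub>v (\<mu> \<cdot>\<^sub>v u i)"
      unfolding z_def using c(1) R'u ui[OF i] by (intro mult_minus_distrib_mat_vec) auto
    also have "R' *\<^sub>v (\<mu> \<cdot>\<^sub>v u i) = \<mu> \<cdot>\<^sub>v (R' *\<^sub>v u i)" by (rule mult_mat_vec[OF c(1) ui[OF i]])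
    also have "R' *\<^sub>v (R' *\<^sub>v u i) - \<mu> \<cdot>\<^sub>v (R' *\<^sub>v u i) = (- \<mu>) \<cdot>\<^sub>v z"
      unfolding sq z_def by (rule smult_minus_aux[OF R'u ui[OF i]])
    finally have "z \<bullet> (R' *\<^sub>v z) = - \<mu> * (z \<bullet> z)" using z by simp
    then have "0 \<le> - \<mu> * (z \<bullet> z)" using p[OF z] by simp
    then have "z \<bullet> z \<le> 0" using mu(1) by (simp add: mult_le_0_iff)
    then have "z = 0\<^sub>v d" using scalar_prod_self_pos[OF z] by fastforce
    then have "R' *\<^sub>v u i = \<mu> \<cdot>\<^sub>v u i"
      unfolding z_def by (intro minus_eq_zero_vec[OF R'u]) (use ui[OF i] in auto)
    then show "R' *\<^sub>v u i = R *\<^sub>v u i" unfolding Ru[OF i] by (simp add: \<mu>_def)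
  qed
  have "inv_sqrt_mat S = (THE R'. Pr R')" unfolding inv_sqrt_mat_def dS Pr_def ..
  also have "\<dots> = R" by (rule the_equality[where P = Pr, OF PrR uniq])
  finally show "inv_sqrt_mat S \<in> carrier_mat d d" "(inv_sqrt_mat S)\<^sup>T = inv_sqrt_mat S"
    "inv_sqrt_mat S * S * inv_sqrt_mat S = 1\<^sub>m d" using R RT RSR by simp_all
qed

section \<open>Measurability\<close>

lemma measurable_vec_index: "k < d \<Longrightarrow> (\<lambda>v. v $ k) \<in> borel_measurable (vec_borel d)"
proof -
  assume k: "k < d"
  have f: "(\<lambda>v. \<lambda>i\<in>{..<d}. v $ i) \<in> measurable (vec_borel d) (\<Pi>\<^sub>M i\<in>{..<d}. borel)"
    unfolding vec_borel_def by (rule measurable_vimage_algebra1) (auto simp: space_PiM)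
  have "(\<lambda>v. (\<lambda>i\<in>{..<d}. v $ i) k) \<in> borel_measurable (vec_borel d)"
    by (rule measurable_compose[OF f measurable_component_singleton]) (use k in auto)
  then show ?thesis using k by simp
qed

lemma measurable_mat_index: "i < r \<Longrightarrow> j < c \<Longrightarrow> (\<lambda>A. A $$ (i,j)) \<in> borel_measurable (mat_borel r c)"
proof -
  assume k: "i < r" "j < c"
  have f: "(\<lambda>A. \<lambda>ij\<in>{..<r} \<times> {..<c}. A $$ ij) \<in> measurable (mat_borel r c) (\<Pi>\<^sub>M ij\<in>{..<r} \<times> {..<c}. borel)"
    unfolding mat_borel_def by (rule measurable_vimage_algebra1) (auto simp: space_PiM)
  have "(\<lambda>A. (\<lambda>ij\<in>{..<r} \<times> {..<c}. A $$ ij) (i,j)) \<in> borel_measurable (mat_borel r c)"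
    by (rule measurable_compose[OF f measurable_component_singleton]) (use k in auto)
  then show ?thesis using k by simp
qed

lemma space_vec_borel: "space (vec_borel d) = carrier_vec d" by (simp add: vec_borel_def)

lemma space_mat_borel: "space (mat_borel r c) = carrier_mat r c" by (simp add: mat_borel_def)

lemma measurable_scalar_prod: "a \<in> carrier_vec d \<Longrightarrow> (\<lambda>v. a \<bullet> v) \<in> borel_measurable (vec_borel d)"
proof -
  assume a: "a \<in> carrier_vec d"
  have "(\<lambda>v. \<Sum>k<d. a $ k * v $ k) \<in> borel_measurable (vec_borel d)"
    by (intro borel_measurable_sum borel_measurable_times measurable_vec_index borel_measurable_const) auto
  then show ?thesis
    by (rule measurable_cong[THEN iffD1, rotated]) (simp add: space_vec_borel scalar_prod_eq_sum)
qed

section \<open>Moments of the noise\<close>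

lemma (in prob_space) subgaussian_cong:
  assumes "\<And>\<omega>. \<omega> \<in> space M \<Longrightarrow> X \<omega> = Y \<omega>"
  shows "subgaussian M g X \<longleftrightarrow> subgaussian M g Y"
proof -
  have 1: "integrable M (\<lambda>\<omega>. f (X \<omega>)) \<longleftrightarrow> integrable M (\<lambda>\<omega>. f (Y \<omega>))" for f :: "real \<Rightarrow> real"
    by (intro Bochner_Integration.integrable_cong) (auto simp: assms)
  have 2: "expectation (\<lambda>\<omega>. f (X \<omega>)) = expectation (\<lambda>\<omega>. f (Y \<omega>))" for f :: "real \<Rightarrow> real"
    by (intro Bochner_Integration.integral_cong) (auto simp: assms)
  show ?thesis
    unfolding subgaussian_def using 1[of "\<lambda>x. x"] 2[of "\<lambda>x. x"] 1[of "\<lambda>x. exp (_ * x)"] 2[of "\<lambda>x. exp (_ * x)"]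
    by simp
qed

lemma (in prob_space) expectation_double_sum:
  fixes f :: "nat \<Rightarrow> nat \<Rightarrow> 'a \<Rightarrow> real"
  assumes I: "\<And>a b. a < k \<Longrightarrow> b < l \<Longrightarrow> integrable M (f a b)"
  shows "integrable M (\<lambda>\<omega>. \<Sum>a<k. \<Sum>b<l. c a b * f a b \<omega>)"
    "expectation (\<lambda>\<omega>. \<Sum>a<k. \<Sum>b<l. c a b * f a b \<omega>) = (\<Sum>a<k. \<Sum>b<l. c a b * expectation (f a b))"
proof -
  have i: "integrable M (\<lambda>\<omega>. c a b * f a b \<omega>)" if "a < k" "b < l" for a b
    by (intro integrable_mult_right I that)
  show "integrable M (\<lambda>\<omega>. \<Sum>a<k. \<Sum>b<l. c a b * f a b \<omega>)"
    by (intro Bochner_Integration.integrable_sum i) auto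
  have "expectation (\<lambda>\<omega>. \<Sum>a<k. \<Sum>b<l. c a b * f a b \<omega>) = (\<Sum>a<k. expectation (\<lambda>\<omega>. \<Sum>b<l. c a b * f a b \<omega>))"
    by (intro Bochner_Integration.integral_sum Bochner_Integration.integrable_sum i) auto
  also have "\<dots> = (\<Sum>a<k. \<Sum>b<l. expectation (\<lambda>\<omega>. c a b * f a b \<omega>))"
    by (intro sum.cong refl Bochner_Integration.integral_sum i) auto
  finally show "expectation (\<lambda>\<omega>. \<Sum>a<k. \<Sum>b<l. c a b * f a b \<omega>) = (\<Sum>a<k. \<Sum>b<l. c a b * expectation (f a b))"
    by simp
qed

locale hv_noise = prob_space M for M :: "'a measure" +
  fixes n K m :: nat and \<gamma>w \<gamma>e :: real and \<Sigma>W :: "real mat" and \<tau> :: real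
    and W E :: "'a \<Rightarrow> real mat" and B :: "real mat"
  assumes noise: "noise_model M n K m \<gamma>w \<gamma>e \<Sigma>W \<tau> W E"
    and B: "B \<in> carrier_mat K m" and n: "1 \<le> n" and gw: "0 < \<gamma>w" and ge: "0 < \<gamma>e"
begin

definition G :: "real mat" where "G = B\<^sup>T * \<Sigma>W * B"
definition R :: "real mat" where "R = inv_sqrt_mat \<Sigma>W"
text \<open>As R is the inverse square root of the covariance, N is its square root.\<close>

definition N :: "real mat" where "N = R * \<Sigma>W"
text \<open>The entries of W B and of E are written as functions of a row, because independence is
  given for whole rows.\<close>

definition w :: "nat \<Rightarrow> nat \<Rightarrow> 'a \<Rightarrow> real" where "w i k \<omega> = col B k \<bullet> row (W \<omega>) i"
definition e :: "nat \<Rightarrow> nat \<Rightarrow> 'a \<Rightarrow> real" where "e i k \<omega> = row (E \<omega>) i $ k"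
text \<open>The square of \<open>g k\<close> is the k-th diagonal entry of \<open>Gamma_eps\<close>,
  so that V below is its trace.\<close>

definition g :: "nat \<Rightarrow> real" where "g k = sqrt (\<gamma>w\<^sup>2 * G $$ (k,k) + \<gamma>e\<^sup>2)"
definition V :: real where "V = (\<Sum>k<m. (g k)\<^sup>2)"

lemma measurable_W: "W \<in> measurable M (mat_borel n K)" and measurable_E: "E \<in> measurable M (mat_borel n m)"
  and indep_WE: "indep_var (mat_borel n K) W (mat_borel n m) E"
  and S: "\<Sigma>W \<in> carrier_mat K K"
  using noise by (auto simp: noise_model_def)

lemma W: "\<omega> \<in> space M \<Longrightarrow> W \<omega> \<in> carrier_mat n K" and E: "\<omega> \<in> space M \<Longrightarrow> E \<omega> \<in> carrier_mat n m"
  using measurable_space[OF measurable_W] measurable_space[OF measurable_E] by (auto simp: space_mat_borel)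

lemma indep_rows_W: "indep_vars (\<lambda>_. vec_borel K) (\<lambda>i \<omega>. row (W \<omega>) i) {..<n}"
  and indep_rows_E: "indep_vars (\<lambda>_. vec_borel m) (\<lambda>i \<omega>. row (E \<omega>) i) {..<n}"
  using noise by (auto simp: noise_model_def iid_rows_def)

lemma colB: "k < m \<Longrightarrow> col B k \<in> carrier_vec K" using B by auto

lemma W_moments:
  assumes "i < n" "a < K"
  shows "integrable M (\<lambda>\<omega>. row (W \<omega>) i $ a)" "expectation (\<lambda>\<omega>. row (W \<omega>) i $ a) = 0"
    "integrable M (\<lambda>\<omega>. (row (W \<omega>) i $ a)\<^sup>2)"
proof -
  have eq: "row (W \<omega>) i $ a = W \<omega> $$ (i,a)" if "\<omega> \<in> space M" for \<omega> using W[OF that] assms by simp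
  have z: "integrable M (\<lambda>\<omega>. W \<omega> $$ (i,a))" "expectation (\<lambda>\<omega>. W \<omega> $$ (i,a)) = 0" "integrable M (\<lambda>\<omega>. (W \<omega> $$ (i,a))\<^sup>2)"
    using noise assms by (auto simp: noise_model_def mean_zero_sq_integrable_def)
  show "integrable M (\<lambda>\<omega>. row (W \<omega>) i $ a)"
    using z(1) Bochner_Integration.integrable_cong[of M M "\<lambda>\<omega>. row (W \<omega>) i $ a" "\<lambda>\<omega>. W \<omega> $$ (i,a)"] eq by simp
  show "expectation (\<lambda>\<omega>. row (W \<omega>) i $ a) = 0"
    using z(2) Bochner_Integration.integral_cong[of M M "\<lambda>\<omega>. row (W \<omega>) i $ a" "\<lambda>\<omega>. W \<omega> $$ (i,a)"] eq by simp
  show "integrable M (\<lambda>\<omega>. (row (W \<omega>) i $ a)\<^sup>2)"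
    using z(3) Bochner_Integration.integrable_cong[of M M "\<lambda>\<omega>. (row (W \<omega>) i $ a)\<^sup>2" "\<lambda>\<omega>. (W \<omega> $$ (i,a))\<^sup>2"] eq by simp
qed

lemma E_moments:
  assumes "i < n" "a < m"
  shows "integrable M (\<lambda>\<omega>. row (E \<omega>) i $ a)" "expectation (\<lambda>\<omega>. row (E \<omega>) i $ a) = 0"
    "integrable M (\<lambda>\<omega>. (row (E \<omega>) i $ a)\<^sup>2)"
proof -
  have eq: "row (E \<omega>) i $ a = E \<omega> $$ (i,a)" if "\<omega> \<in> space M" for \<omega> using E[OF that] assms by simp
  have z: "integrable M (\<lambda>\<omega>. E \<omega> $$ (i,a))" "expectation (\<lambda>\<omega>. E \<omega> $$ (i,a)) = 0" "integrable M (\<lambda>\<omega>. (E \<omega> $$ (i,a))\<^sup>2)"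
    using noise assms by (auto simp: noise_model_def mean_zero_sq_integrable_def)
  show "integrable M (\<lambda>\<omega>. row (E \<omega>) i $ a)"
    using z(1) Bochner_Integration.integrable_cong[of M M "\<lambda>\<omega>. row (E \<omega>) i $ a" "\<lambda>\<omega>. E \<omega> $$ (i,a)"] eq by simp
  show "expectation (\<lambda>\<omega>. row (E \<omega>) i $ a) = 0"
    using z(2) Bochner_Integration.integral_cong[of M M "\<lambda>\<omega>. row (E \<omega>) i $ a" "\<lambda>\<omega>. E \<omega> $$ (i,a)"] eq by simp
  show "integrable M (\<lambda>\<omega>. (row (E \<omega>) i $ a)\<^sup>2)"
    using z(3) Bochner_Integration.integrable_cong[of M M "\<lambda>\<omega>. (row (E \<omega>) i $ a)\<^sup>2" "\<lambda>\<omega>. (E \<omega> $$ (i,a))\<^sup>2"] eq by simp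
qed

lemma W_cov:
  assumes i: "i < n" and ab: "a < K" "b < K"
  shows "\<Sigma>W $$ (a,b) = expectation (\<lambda>\<omega>. row (W \<omega>) i $ a * row (W \<omega>) i $ b)"
proof -
  have "\<Sigma>W = cov_mat M K (\<lambda>\<omega>. row (W \<omega>) i)" using noise i by (auto simp: noise_model_def)
  then have "\<Sigma>W $$ (a,b) = cov_mat M K (\<lambda>\<omega>. row (W \<omega>) i) $$ (a,b)" by simp
  also have "\<dots> = expectation (\<lambda>\<omega>. row (W \<omega>) i $ a * row (W \<omega>) i $ b)"
    using ab by (simp add: cov_mat_def W_moments(2)[OF i])
  finally show ?thesis .
qed

lemma E_cov:
  assumes i: "i < n" and ab: "a < m" "b < m"
  shows "expectation (\<lambda>\<omega>. e i a \<omega> * e i b \<omega>) = (if a = b then \<tau>\<^sup>2 else 0)"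
proof -
  have "cov_mat M m (\<lambda>\<omega>. row (E \<omega>) i) = \<tau>\<^sup>2 \<cdot>\<^sub>m 1\<^sub>m m" using noise i by (auto simp: noise_model_def)
  then have "cov_mat M m (\<lambda>\<omega>. row (E \<omega>) i) $$ (a,b) = (\<tau>\<^sup>2 \<cdot>\<^sub>m 1\<^sub>m m) $$ (a,b)" by simp
  moreover have "cov_mat M m (\<lambda>\<omega>. row (E \<omega>) i) $$ (a,b) = expectation (\<lambda>\<omega>. row (E \<omega>) i $ a * row (E \<omega>) i $ b)"
    using ab by (simp add: cov_mat_def E_moments(2)[OF i])
  ultimately show ?thesis using ab by (simp add: e_def)
qed

lemma scalar_row_W: "\<omega> \<in> space M \<Longrightarrow> i < n \<Longrightarrow> v \<bullet> row (W \<omega>) i = (\<Sum>a<K. v $ a * row (W \<omega>) i $ a)"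
  using W[of \<omega>] by (subst scalar_prod_eq_sum[of _ K]) auto

lemma W_bilinear:
  assumes i: "i < n" and v: "v \<in> carrier_vec K" and x: "x \<in> carrier_vec K"
  shows "integrable M (\<lambda>\<omega>. (v \<bullet> row (W \<omega>) i) * (x \<bullet> row (W \<omega>) i))"
    "expectation (\<lambda>\<omega>. (v \<bullet> row (W \<omega>) i) * (x \<bullet> row (W \<omega>) i)) = v \<bullet> (\<Sigma>W *\<^sub>v x)"
proof -
  have eq: "(v \<bullet> row (W \<omega>) i) * (x \<bullet> row (W \<omega>) i) = (\<Sum>a<K. \<Sum>b<K. v $ a * x $ b * (row (W \<omega>) i $ a * row (W \<omega>) i $ b))"
    if "\<omega> \<in> space M" for \<omega>
    unfolding scalar_row_W[OF that i] sum_product by (intro sum.cong refl) (simp add: mult_ac)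
  have I: "integrable M (\<lambda>\<omega>. row (W \<omega>) i $ a * row (W \<omega>) i $ b)" if "a < K" "b < K" for a b
    using W_moments[OF i that(1)] W_moments[OF i that(2)] by (intro square_integrable_prod) (auto intro: borel_measurable_integrable)
  note ds = expectation_double_sum[where f = "\<lambda>a b \<omega>. row (W \<omega>) i $ a * row (W \<omega>) i $ b", OF I]
  have "integrable M (\<lambda>\<omega>. (v \<bullet> row (W \<omega>) i) * (x \<bullet> row (W \<omega>) i)) \<longleftrightarrow>
    integrable M (\<lambda>\<omega>. \<Sum>a<K. \<Sum>b<K. v $ a * x $ b * (row (W \<omega>) i $ a * row (W \<omega>) i $ b))"
    by (intro Bochner_Integration.integrable_cong refl eq)
  then show "integrable M (\<lambda>\<omega>. (v \<bullet> row (W \<omega>) i) * (x \<bullet> row (W \<omega>) i))" by (rule iffD2) (rule ds(1))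
  have "expectation (\<lambda>\<omega>. (v \<bullet> row (W \<omega>) i) * (x \<bullet> row (W \<omega>) i))
      = expectation (\<lambda>\<omega>. \<Sum>a<K. \<Sum>b<K. v $ a * x $ b * (row (W \<omega>) i $ a * row (W \<omega>) i $ b))"
    by (intro Bochner_Integration.integral_cong refl eq)
  also have "\<dots> = (\<Sum>a<K. \<Sum>b<K. v $ a * x $ b * expectation (\<lambda>\<omega>. row (W \<omega>) i $ a * row (W \<omega>) i $ b))"
    by (rule ds(2))
  also have "\<dots> = (\<Sum>a<K. v $ a * (\<Sum>b<K. \<Sigma>W $$ (a,b) * x $ b))"
    by (simp add: W_cov[OF i, symmetric] sum_distrib_left mult_ac)
  also have "\<dots> = v \<bullet> (\<Sigma>W *\<^sub>v x)"
  proof -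
    have c: "\<Sigma>W *\<^sub>v x \<in> carrier_vec K" using S x by simp
    show ?thesis unfolding scalar_prod_eq_sum[OF carrier_vecD[OF c]]
      by (intro sum.cong refl) (simp add: mult_mat_vec_index[OF S x] del: index_mult_mat_vec)
  qed
  finally show "expectation (\<lambda>\<omega>. (v \<bullet> row (W \<omega>) i) * (x \<bullet> row (W \<omega>) i)) = v \<bullet> (\<Sigma>W *\<^sub>v x)" .
qed

lemma S_sym: "\<Sigma>W\<^sup>T = \<Sigma>W"
  using S n by (intro eq_matI) (auto simp: W_cov[of 0] mult.commute)

lemma S_psd: "v \<in> carrier_vec K \<Longrightarrow> 0 \<le> v \<bullet> (\<Sigma>W *\<^sub>v v)"
  using W_bilinear(2)[of 0 v v] n Bochner_Integration.integral_nonneg[of M "\<lambda>\<omega>. (v \<bullet> row (W \<omega>) 0) * (v \<bullet> row (W \<omega>) 0)"] by simp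

text \<open>A null direction v makes the product of v with a row of W vanish almost surely; hence
  its covariance with any other linear functional vanishes and \<Sigma> v = 0, against full
  rank.\<close>

lemma S_pd:
  assumes v: "v \<in> carrier_vec K" "v \<noteq> 0\<^sub>v K"
  shows "0 < v \<bullet> (\<Sigma>W *\<^sub>v v)"
proof (rule ccontr)
  assume "\<not> ?thesis"
  then have z: "v \<bullet> (\<Sigma>W *\<^sub>v v) = 0" using S_psd[OF v(1)] by simp
  have n0: "0 < n" using n by simp
  have Sv: "\<Sigma>W *\<^sub>v v \<in> carrier_vec K" using S v by simp
  have "expectation (\<lambda>\<omega>. (v \<bullet> row (W \<omega>) 0) * (v \<bullet> row (W \<omega>) 0)) = 0" using W_bilinear(2)[OF n0 v(1) v(1)] z by simp
  then have "AE \<omega> in M. (v \<bullet> row (W \<omega>) 0) * (v \<bullet> row (W \<omega>) 0) = 0"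
    using integral_nonneg_eq_0_iff_AE[OF W_bilinear(1)[OF n0 v(1) v(1)]] by simp
  then have "AE \<omega> in M. ((\<Sigma>W *\<^sub>v v) \<bullet> row (W \<omega>) 0) * (v \<bullet> row (W \<omega>) 0) = 0"
    by (rule AE_mp) (auto intro!: AE_I2)
  then have "expectation (\<lambda>\<omega>. ((\<Sigma>W *\<^sub>v v) \<bullet> row (W \<omega>) 0) * (v \<bullet> row (W \<omega>) 0)) = 0" by (rule integral_eq_zero_AE)
  then have "vnorm (\<Sigma>W *\<^sub>v v) = 0" using W_bilinear(2)[OF n0 Sv v(1)] vnorm_sq[of "\<Sigma>W *\<^sub>v v"] by simp
  then have "\<Sigma>W\<^sup>T *\<^sub>v v = 0\<^sub>v K" using vnorm_eq_0[OF Sv] S_sym by simp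
  moreover have "mat_rank \<Sigma>W = K" using noise by (simp add: noise_model_def)
  ultimately show False using full_row_rank_injective[OF S _ v(1)] v(2) by simp
qed

lemma R: "R \<in> carrier_mat K K" and R_sym: "R\<^sup>T = R" and RSR: "R * \<Sigma>W * R = 1\<^sub>m K"
  unfolding R_def by (rule inv_sqrt_mat_exists[OF S S_sym S_pd]; simp)+

lemma N: "N \<in> carrier_mat K K" and NR: "N * R = 1\<^sub>m K" and RN: "R * N = 1\<^sub>m K" and N_sym: "N\<^sup>T = N" and NN: "N * N = \<Sigma>W"
proof -
  show N: "N \<in> carrier_mat K K" using R S by (simp add: N_def)
  show NR: "N * R = 1\<^sub>m K" unfolding N_def by (rule RSR)
  show RN: "R * N = 1\<^sub>m K" by (rule mat_mult_left_right_inverse[OF N R NR])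
  show "N\<^sup>T = N" by (rule symmetric_from_inverse[OF R R_sym N RN])
  have "N * N = N * (R * \<Sigma>W)" by (simp add: N_def)
  also have "\<dots> = N * R * \<Sigma>W" by (rule assoc_mult_mat[OF N R S, symmetric])
  finally show "N * N = \<Sigma>W" using NR S by simp
qed

lemma vnorm_N: "y \<in> carrier_vec K \<Longrightarrow> (vnorm (N *\<^sub>v y))\<^sup>2 = y \<bullet> (\<Sigma>W *\<^sub>v y)"
proof -
  assume y: "y \<in> carrier_vec K"
  have Ny: "N *\<^sub>v y \<in> carrier_vec K" using N y by simp
  have "(vnorm (N *\<^sub>v y))\<^sup>2 = y \<bullet> (N *\<^sub>v (N *\<^sub>v y))" unfolding vnorm_sq by (rule symmetric_scalar_prod[OF N N_sym y Ny])
  also have "N *\<^sub>v (N *\<^sub>v y) = \<Sigma>W *\<^sub>v y" using assoc_mult_mat_vec[OF N N y] NN by simp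
  finally show ?thesis .
qed

lemma G: "G \<in> carrier_mat m m" using B S by (simp add: G_def)

lemma G_entry: "k < m \<Longrightarrow> l < m \<Longrightarrow> G $$ (k,l) = col B k \<bullet> (\<Sigma>W *\<^sub>v col B l)"
proof -
  assume kl: "k < m" "l < m"
  have BT: "B\<^sup>T \<in> carrier_mat m K" and SB: "\<Sigma>W * B \<in> carrier_mat K m" using B S by auto
  have "G = B\<^sup>T * (\<Sigma>W * B)" unfolding G_def by (rule assoc_mult_mat[OF BT S B])
  then have "G $$ (k,l) = col B k \<bullet> col (\<Sigma>W * B) l" using B SB kl by simp
  also have "col (\<Sigma>W * B) l = \<Sigma>W *\<^sub>v col B l" by (rule col_mult2[OF S B kl(2)])
  finally show ?thesis .
qed

lemma G_diag: "k < m \<Longrightarrow> G $$ (k,k) = (vnorm (N *\<^sub>v col B k))\<^sup>2"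
  using G_entry[of k k] vnorm_N[OF colB] by simp

lemma g_sq: "k < m \<Longrightarrow> (g k)\<^sup>2 = \<gamma>w\<^sup>2 * G $$ (k,k) + \<gamma>e\<^sup>2" and g_pos: "k < m \<Longrightarrow> 0 < g k" and ge_le_g: "k < m \<Longrightarrow> \<gamma>e \<le> g k"
  and gw_le_g: "k < m \<Longrightarrow> \<gamma>w * vnorm (N *\<^sub>v col B k) \<le> g k"
proof -
  assume k: "k < m"
  have p: "0 < \<gamma>w\<^sup>2 * G $$ (k,k) + \<gamma>e\<^sup>2" unfolding G_diag[OF k] using ge by (intro add_nonneg_pos) auto
  then show "(g k)\<^sup>2 = \<gamma>w\<^sup>2 * G $$ (k,k) + \<gamma>e\<^sup>2" "0 < g k" by (auto simp: g_def)
  show "\<gamma>e \<le> g k" unfolding g_def G_diag[OF k] by (intro real_le_rsqrt) auto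
  show "\<gamma>w * vnorm (N *\<^sub>v col B k) \<le> g k" unfolding g_def G_diag[OF k] by (intro real_le_rsqrt) (auto simp: power_mult_distrib)
qed

text \<open>The assumption concerns whitened rows and unit vectors. Undoing the whitening replaces y
  by N y, and normalizing N y produces the factor |N y|.\<close>

lemma subgaussian_W:
  assumes i: "i < n" and y: "y \<in> carrier_vec K"
  shows "subgaussian M (\<gamma>w * vnorm (N *\<^sub>v y)) (\<lambda>\<omega>. y \<bullet> row (W \<omega>) i)"
proof -
  define x where "x = N *\<^sub>v y"
  have x: "x \<in> carrier_vec K" using N y by (simp add: x_def)
  have eq: "y \<bullet> row (W \<omega>) i = x \<bullet> (R *\<^sub>v row (W \<omega>) i)" if "\<omega> \<in> space M" for \<omega>
  proof -
    have r: "row (W \<omega>) i \<in> carrier_vec K" using W[OF that] i by auto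
    have "x \<bullet> (R *\<^sub>v row (W \<omega>) i) = (R *\<^sub>v x) \<bullet> row (W \<omega>) i" by (rule symmetric_scalar_prod[OF R R_sym x r, symmetric])
    also have "R *\<^sub>v x = y" unfolding x_def using assoc_mult_mat_vec[OF R N y] RN y by simp
    finally show ?thesis by simp
  qed
  have unit: "subgaussian M \<gamma>w (\<lambda>\<omega>. u \<bullet> (R *\<^sub>v row (W \<omega>) i))" if "u \<in> carrier_vec K" "vnorm u = 1" for u
    using noise i that by (auto simp: noise_model_def subgaussian_vec_def R_def)
  have "subgaussian M (\<gamma>w * vnorm x) (\<lambda>\<omega>. x \<bullet> (R *\<^sub>v row (W \<omega>) i))"
  proof (cases "vnorm x = 0")
    case True
    have "x = 0\<^sub>v K" by (rule vnorm_eq_0[OF x True])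
    moreover have "R *\<^sub>v row (W \<omega>) i \<in> carrier_vec K" for \<omega> using R by (simp add: carrier_vecI)
    ultimately show ?thesis using subgaussian_zero True by simp
  next
    case False
    define u where "u = (1 / vnorm x) \<cdot>\<^sub>v x"
    have u: "u \<in> carrier_vec K" "vnorm u = 1" using x False by (auto simp: u_def vnorm_smult)
    have "x \<bullet> (R *\<^sub>v row (W \<omega>) i) = vnorm x * (u \<bullet> (R *\<^sub>v row (W \<omega>) i))" for \<omega>
    proof -
      have "R *\<^sub>v row (W \<omega>) i \<in> carrier_vec K" using R by (simp add: carrier_vecI)
      then show ?thesis using x False by (simp add: u_def)
    qed
    then have "(\<lambda>\<omega>. x \<bullet> (R *\<^sub>v row (W \<omega>) i)) = (\<lambda>\<omega>. vnorm x * (u \<bullet> (R *\<^sub>v row (W \<omega>) i)))" by auto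
    then show ?thesis using subgaussian_scale[OF unit[OF u], of "vnorm x"] by (simp add: mult.commute)
  qed
  then show ?thesis unfolding x_def[symmetric] using subgaussian_cong[of "\<lambda>\<omega>. y \<bullet> row (W \<omega>) i" "\<lambda>\<omega>. x \<bullet> (R *\<^sub>v row (W \<omega>) i)"] eq by blast
qed

lemma subgaussian_e: "i < n \<Longrightarrow> k < m \<Longrightarrow> subgaussian M \<gamma>e (e i k)"
proof -
  assume ik: "i < n" "k < m"
  have "subgaussian M \<gamma>e (\<lambda>\<omega>. E \<omega> $$ (i,k))" using noise ik by (auto simp: noise_model_def)
  moreover have "e i k \<omega> = E \<omega> $$ (i,k)" if "\<omega> \<in> space M" for \<omega> using E[OF that] ik by (simp add: e_def)
  ultimately show ?thesis using subgaussian_cong[of "e i k" "\<lambda>\<omega>. E \<omega> $$ (i,k)"] by blast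
qed

lemma subgaussian_w: "i < n \<Longrightarrow> k < m \<Longrightarrow> subgaussian M (\<gamma>w * vnorm (N *\<^sub>v col B k)) (w i k)"
  using subgaussian_W[OF _ colB] by (simp add: w_def[abs_def])

lemma subgaussian_w_g: "i < n \<Longrightarrow> k < m \<Longrightarrow> subgaussian M (g k) (w i k)"
  using gw g_pos[of k] gw_le_g[of k] by (intro subgaussian_mono[OF subgaussian_w]) auto

lemma subgaussian_e_g: "i < n \<Longrightarrow> k < m \<Longrightarrow> subgaussian M (g k) (e i k)"
  using ge g_pos[of k] ge_le_g[of k] by (intro subgaussian_mono[OF subgaussian_e]) auto

lemma indep_w:
  assumes "\<And>i. f i \<in> borel_measurable (vec_borel K)"
  shows "indep_vars (\<lambda>_. borel) (\<lambda>i \<omega>. f i (row (W \<omega>) i)) {..<n}"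
  by (rule indep_vars_compose2[OF indep_rows_W]) (rule assms)

lemma indep_e:
  assumes "\<And>i. f i \<in> borel_measurable (vec_borel m)"
  shows "indep_vars (\<lambda>_. borel) (\<lambda>i \<omega>. f i (row (E \<omega>) i)) {..<n}"
  by (rule indep_vars_compose2[OF indep_rows_E]) (rule assms)

lemma measurable_row_W:
  assumes "i < n" "y \<in> carrier_vec K" shows "(\<lambda>A. y \<bullet> row A i) \<in> borel_measurable (mat_borel n K)"
proof -
  have "(\<lambda>A. \<Sum>a<K. y $ a * A $$ (i,a)) \<in> borel_measurable (mat_borel n K)"
    using assms by (intro borel_measurable_sum borel_measurable_times measurable_mat_index borel_measurable_const) auto
  then show ?thesis
    by (rule measurable_cong[THEN iffD1, rotated]) (use assms in \<open>auto simp: space_mat_borel scalar_prod_eq_sum[of _ K]\<close>)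
qed

lemma measurable_row_E:
  assumes "i < n" "k < m" shows "(\<lambda>A. row A i $ k) \<in> borel_measurable (mat_borel n m)"
  by (rule measurable_cong[THEN iffD1, OF _ measurable_mat_index[OF assms]]) (use assms in \<open>auto simp: space_mat_borel\<close>)

lemma indep_we:
  assumes "f \<in> borel_measurable (mat_borel n K)" "h \<in> borel_measurable (mat_borel n m)"
  shows "indep_var borel (\<lambda>\<omega>. f (W \<omega>)) borel (\<lambda>\<omega>. h (E \<omega>))"
  using indep_var_compose[OF indep_WE assms] by (simp add: comp_def)

lemma subgaussian_lin_W:
  assumes y: "y \<in> carrier_vec K"
  shows "subgaussian M (sqrt (\<Sum>i<n. (u i)\<^sup>2) * (\<gamma>w * vnorm (N *\<^sub>v y))) (\<lambda>\<omega>. \<Sum>i<n. u i * (y \<bullet> row (W \<omega>) i))"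
  using subgaussian_W[OF _ y] by (intro subgaussian_lincomb indep_w measurable_scalar_prod y) auto

lemma subgaussian_lin_e:
  assumes k: "k < m"
  shows "subgaussian M (sqrt (\<Sum>i<n. (u i)\<^sup>2) * \<gamma>e) (\<lambda>\<omega>. \<Sum>i<n. u i * e i k \<omega>)"
  using subgaussian_e[OF _ k] indep_e[OF measurable_vec_index[OF k]]
  by (intro subgaussian_lincomb) (auto simp: e_def[abs_def])

text \<open>The contributions of W and of E are independent, so their variance proxies add up to
  |u|^2 times a diagonal entry of \<open>Gamma_eps\<close>.\<close>

lemma subgaussian_lin:
  assumes k: "k < m"
  shows "subgaussian M (sqrt (\<Sum>i<n. (u i)\<^sup>2) * g k) (\<lambda>\<omega>. \<Sum>i<n. u i * (w i k \<omega> + e i k \<omega>))"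
proof -
  define s where "s = sqrt (\<Sum>i<n. (u i)\<^sup>2)"
  have "indep_var borel (\<lambda>\<omega>. (\<lambda>A. \<Sum>i<n. u i * (col B k \<bullet> row A i)) (W \<omega>)) borel (\<lambda>\<omega>. (\<lambda>A. \<Sum>i<n. u i * row A i $ k) (E \<omega>))"
    by (intro indep_we borel_measurable_sum borel_measurable_times borel_measurable_const measurable_row_W measurable_row_E colB) (use k in auto)
  then have "subgaussian M (sqrt ((s * (\<gamma>w * vnorm (N *\<^sub>v col B k)))\<^sup>2 + (s * \<gamma>e)\<^sup>2)) (\<lambda>\<omega>. (\<Sum>i<n. u i * (col B k \<bullet> row (W \<omega>) i)) + (\<Sum>i<n. u i * e i k \<omega>))"
    unfolding s_def by (intro subgaussian_add subgaussian_lin_W subgaussian_lin_e colB k) (simp add: e_def)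
  moreover have "(s * (\<gamma>w * vnorm (N *\<^sub>v col B k)))\<^sup>2 + (s * \<gamma>e)\<^sup>2 = s\<^sup>2 * (g k)\<^sup>2"
    unfolding g_sq[OF k] G_diag[OF k] by (simp add: power_mult_distrib algebra_simps)
  moreover have "0 \<le> s" by (simp add: s_def sum_nonneg)
  ultimately show ?thesis using g_pos[OF k]
    by (simp add: real_sqrt_mult s_def[symmetric] w_def distrib_left sum.distrib)
qed

lemma expect_w_e: "i < n \<Longrightarrow> k < m \<Longrightarrow> expectation (w i k) = 0" "i < n \<Longrightarrow> k < m \<Longrightarrow> expectation (e i k) = 0"
  using subgaussian_w_g subgaussian_e_g by (auto simp: subgaussian_def)

lemma int_w_e: "i < n \<Longrightarrow> k < m \<Longrightarrow> integrable M (w i k)" "i < n \<Longrightarrow> k < m \<Longrightarrow> integrable M (e i k)"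
  using subgaussian_w_g subgaussian_e_g by (auto simp: subgaussian_def)

lemma rv_w_e: "i < n \<Longrightarrow> k < m \<Longrightarrow> random_variable borel (w i k)" "i < n \<Longrightarrow> k < m \<Longrightarrow> random_variable borel (e i k)"
  using int_w_e by auto

lemma w_cov: "i < n \<Longrightarrow> k < m \<Longrightarrow> l < m \<Longrightarrow> expectation (\<lambda>\<omega>. w i k \<omega> * w i l \<omega>) = G $$ (k,l)"
  unfolding w_def by (simp add: W_bilinear(2)[OF _ colB colB] G_entry)

lemma w_orth: "i < n \<Longrightarrow> j < n \<Longrightarrow> i \<noteq> j \<Longrightarrow> k < m \<Longrightarrow> expectation (\<lambda>\<omega>. w i k \<omega> * w j k \<omega>) = 0"
  using indep_vars_expectation_mult[of "\<lambda>i. w i k" "{..<n}" i j] indep_w[OF measurable_scalar_prod[OF colB]]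
    int_w_e[of i k] int_w_e[of j k] expect_w_e(1)[of i k] by (simp add: w_def[abs_def])

lemma e_orth: "i < n \<Longrightarrow> j < n \<Longrightarrow> i \<noteq> j \<Longrightarrow> k < m \<Longrightarrow> expectation (\<lambda>\<omega>. e i k \<omega> * e j k \<omega>) = 0"
  using indep_vars_expectation_mult[of "\<lambda>i. e i k" "{..<n}" i j] indep_e[OF measurable_vec_index]
    int_w_e[of i k] int_w_e[of j k] expect_w_e(2)[of i k] by (simp add: e_def[abs_def])

lemma we_orth: "i < n \<Longrightarrow> j < n \<Longrightarrow> k < m \<Longrightarrow> l < m \<Longrightarrow> expectation (\<lambda>\<omega>. w i k \<omega> * e j l \<omega>) = 0"
  using indep_var_lebesgue_integral[OF indep_we[OF measurable_row_W[OF _ colB] measurable_row_E], of i k j l]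
    int_w_e(1)[of i k] int_w_e(2)[of j l] expect_w_e(1)[of i k] by (simp add: w_def[abs_def] e_def[abs_def])

text \<open>The rows are independent, so only the diagonal terms of the square survive.\<close>

lemma gram_second_moment:
  fixes x :: "nat \<Rightarrow> nat \<Rightarrow> 'a \<Rightarrow> real"
  assumes sg: "\<And>i k. i < n \<Longrightarrow> k < m \<Longrightarrow> subgaussian M (g k) (x i k)"
    and ind: "\<And>k l. k < m \<Longrightarrow> l < m \<Longrightarrow> indep_vars (\<lambda>_. borel) (\<lambda>i \<omega>. x i k \<omega> * x i l \<omega>) {..<n}"
    and cov: "\<And>i k l. i < n \<Longrightarrow> k < m \<Longrightarrow> l < m \<Longrightarrow> expectation (\<lambda>\<omega>. x i k \<omega> * x i l \<omega>) = C k l"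
    and kl: "k < m" "l < m"
  shows "integrable M (\<lambda>\<omega>. (\<Sum>i<n. x i k \<omega> * x i l \<omega> - C k l)\<^sup>2)"
    "expectation (\<lambda>\<omega>. (\<Sum>i<n. x i k \<omega> * x i l \<omega> - C k l)\<^sup>2) \<le> real n * (1024 * (g k)\<^sup>2 * (g l)\<^sup>2)"
proof -
  define f where "f i \<omega> = x i k \<omega> * x i l \<omega> - C k l" for i \<omega>
  note sq = subgaussian_prod_square[OF sg[OF _ kl(1)] sg[OF _ kl(2)] g_pos[OF kl(1)] g_pos[OF kl(2)]]
  have fi: "integrable M (f i)" and f0: "expectation (f i) = 0" and fs: "integrable M (\<lambda>\<omega>. (f i \<omega>)\<^sup>2)"
    and fE: "expectation (\<lambda>\<omega>. (f i \<omega>)\<^sup>2) \<le> 1024 * (g k)\<^sup>2 * (g l)\<^sup>2" if i: "i < n" for i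
  proof -
    note s = sq[OF i i]
    show "integrable M (f i)" unfolding f_def using s(3) by simp
    show "expectation (f i) = 0" unfolding f_def using s(3) cov[OF i kl] by (simp add: prob_space)
    have e: "(f i \<omega>)\<^sup>2 = (x i k \<omega> * x i l \<omega>)\<^sup>2 - 2 * C k l * (x i k \<omega> * x i l \<omega>) + (C k l)\<^sup>2" for \<omega>
      unfolding f_def by (simp add: power2_diff)
    show "integrable M (\<lambda>\<omega>. (f i \<omega>)\<^sup>2)" unfolding e using s by simp
    have "expectation (\<lambda>\<omega>. (f i \<omega>)\<^sup>2) = expectation (\<lambda>\<omega>. (x i k \<omega> * x i l \<omega>)\<^sup>2) - (C k l)\<^sup>2"
      unfolding e using s cov[OF i kl] by (simp add: prob_space power2_eq_square)
    also have "\<dots> \<le> 1024 * (g k)\<^sup>2 * (g l)\<^sup>2" using s(2) zero_le_power2[of "C k l"] by linarith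
    finally show "expectation (\<lambda>\<omega>. (f i \<omega>)\<^sup>2) \<le> 1024 * (g k)\<^sup>2 * (g l)\<^sup>2" .
  qed
  have indf: "indep_vars (\<lambda>_. borel) f {..<n}"
    unfolding f_def using indep_vars_compose2[OF ind[OF kl], of "\<lambda>_ z. z - C k l" "\<lambda>_. borel"] by simp
  have orth: "expectation (\<lambda>\<omega>. f i \<omega> * f j \<omega>) = 0" if "i < n" "j < n" "i \<noteq> j" for i j
    using indep_vars_expectation_mult[OF indf, of i j] that fi f0 by simp
  note os = orthogonal_sum_second_moment[of "{..<n}" f]
  show "integrable M (\<lambda>\<omega>. (\<Sum>i<n. x i k \<omega> * x i l \<omega> - C k l)\<^sup>2)"
    using os(1) fi fs orth by (simp add: f_def)
  have "expectation (\<lambda>\<omega>. (\<Sum>i<n. f i \<omega>)\<^sup>2) = (\<Sum>i<n. expectation (\<lambda>\<omega>. (f i \<omega>)\<^sup>2))"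
    using fi fs orth by (intro os(2)) auto
  also have "\<dots> \<le> real n * (1024 * (g k)\<^sup>2 * (g l)\<^sup>2)" using sum_bounded_above[of "{..<n}", OF fE] by simp
  finally show "expectation (\<lambda>\<omega>. (\<Sum>i<n. x i k \<omega> * x i l \<omega> - C k l)\<^sup>2) \<le> real n * (1024 * (g k)\<^sup>2 * (g l)\<^sup>2)"
    by (simp add: f_def)
qed

text \<open>Terms from different rows are orthogonal: by independence of W and E the expectation
  factors, and its W part vanishes because the rows of W are independent and centered.\<close>

lemma cross_second_moment:
  assumes kl: "k < m" "l < m"
  shows "integrable M (\<lambda>\<omega>. (\<Sum>i<n. w i k \<omega> * e i l \<omega>)\<^sup>2)"
    "expectation (\<lambda>\<omega>. (\<Sum>i<n. w i k \<omega> * e i l \<omega>)\<^sup>2) \<le> real n * (1024 * (g k)\<^sup>2 * (g l)\<^sup>2)"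
proof -
  define f where "f i \<omega> = w i k \<omega> * e i l \<omega>" for i \<omega>
  note sq = subgaussian_prod_square[OF subgaussian_w_g[OF _ kl(1)] subgaussian_e_g[OF _ kl(2)] g_pos[OF kl(1)] g_pos[OF kl(2)]]
  have fi: "integrable M (f i)" and fs: "integrable M (\<lambda>\<omega>. (f i \<omega>)\<^sup>2)"
    and fE: "expectation (\<lambda>\<omega>. (f i \<omega>)\<^sup>2) \<le> 1024 * (g k)\<^sup>2 * (g l)\<^sup>2" if i: "i < n" for i
    using sq[OF i i] by (auto simp: f_def[abs_def])
  have orth: "expectation (\<lambda>\<omega>. f i \<omega> * f j \<omega>) = 0" if ij: "i < n" "j < n" "i \<noteq> j" for i j
  proof -
    have ww: "integrable M (\<lambda>\<omega>. w i k \<omega> * w j k \<omega>)" and ee: "integrable M (\<lambda>\<omega>. e i l \<omega> * e j l \<omega>)"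
      using subgaussian_prod_square(3)[OF subgaussian_w_g subgaussian_w_g g_pos g_pos, of i k j k]
        subgaussian_prod_square(3)[OF subgaussian_e_g subgaussian_e_g g_pos g_pos, of i l j l] ij kl by auto
    have ind: "indep_var borel (\<lambda>\<omega>. (\<lambda>A. (col B k \<bullet> row A i) * (col B k \<bullet> row A j)) (W \<omega>)) borel
      (\<lambda>\<omega>. (\<lambda>A. row A i $ l * row A j $ l) (E \<omega>))"
      by (intro indep_we borel_measurable_times measurable_row_W measurable_row_E colB ij kl)
    have "expectation (\<lambda>\<omega>. f i \<omega> * f j \<omega>) = expectation (\<lambda>\<omega>. (w i k \<omega> * w j k \<omega>) * (e i l \<omega> * e j l \<omega>))"
      by (simp add: f_def mult_ac)
    also have "\<dots> = expectation (\<lambda>\<omega>. w i k \<omega> * w j k \<omega>) * expectation (\<lambda>\<omega>. e i l \<omega> * e j l \<omega>)"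
      using indep_var_lebesgue_integral[OF ind] ww ee by (simp add: w_def e_def)
    finally show ?thesis using w_orth[OF ij kl(1)] by simp
  qed
  note os = orthogonal_sum_second_moment[of "{..<n}" f]
  show "integrable M (\<lambda>\<omega>. (\<Sum>i<n. w i k \<omega> * e i l \<omega>)\<^sup>2)"
    using os(1) fi fs orth by (simp add: f_def)
  have "expectation (\<lambda>\<omega>. (\<Sum>i<n. f i \<omega>)\<^sup>2) = (\<Sum>i<n. expectation (\<lambda>\<omega>. (f i \<omega>)\<^sup>2))"
    using fi fs orth by (intro os(2)) auto
  also have "\<dots> \<le> real n * (1024 * (g k)\<^sup>2 * (g l)\<^sup>2)" using sum_bounded_above[of "{..<n}", OF fE] by simp
  finally show "expectation (\<lambda>\<omega>. (\<Sum>i<n. w i k \<omega> * e i l \<omega>)\<^sup>2) \<le> real n * (1024 * (g k)\<^sup>2 * (g l)\<^sup>2)"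
    by (simp add: f_def)
qed

definition eps :: "nat \<Rightarrow> nat \<Rightarrow> 'a \<Rightarrow> real" where "eps i k \<omega> = w i k \<omega> + e i k \<omega>"

text \<open>Four sums are estimated separately: W with W, the two mixed ones, and E with E. The
  constant is 4 * 4 * 1024: the square of a sum of four terms, four terms, and the fourth-moment
  constant.\<close>

lemma noise_gram_entry:
  assumes kl: "k < m" "l < m"
  defines "c \<equiv> G $$ (k,l) + (if k = l then \<tau>\<^sup>2 else 0)"
  shows "integrable M (\<lambda>\<omega>. ((\<Sum>i<n. eps i k \<omega> * eps i l \<omega>) / real n - c)\<^sup>2)"
    "expectation (\<lambda>\<omega>. ((\<Sum>i<n. eps i k \<omega> * eps i l \<omega>) / real n - c)\<^sup>2) \<le> 16384 * (g k)\<^sup>2 * (g l)\<^sup>2 / real n"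
proof -
  have n0: "0 < real n" using n by simp
  define f1 where "f1 \<omega> = (\<Sum>i<n. w i k \<omega> * w i l \<omega> - G $$ (k,l))" for \<omega>
  define f2 where "f2 \<omega> = (\<Sum>i<n. w i k \<omega> * e i l \<omega>)" for \<omega>
  define f3 where "f3 \<omega> = (\<Sum>i<n. w i l \<omega> * e i k \<omega>)" for \<omega>
  define f4 where "f4 \<omega> = (\<Sum>i<n. e i k \<omega> * e i l \<omega> - (if k = l then \<tau>\<^sup>2 else 0))" for \<omega>
  define b where "b = real n * (1024 * (g k)\<^sup>2 * (g l)\<^sup>2)"
  have m1: "integrable M (\<lambda>\<omega>. (f1 \<omega>)\<^sup>2)" "expectation (\<lambda>\<omega>. (f1 \<omega>)\<^sup>2) \<le> b"
  proof -
    have "indep_vars (\<lambda>_. borel) (\<lambda>i \<omega>. w i k \<omega> * w i l \<omega>) {..<n}" if "k < m" "l < m" for k l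
      unfolding w_def by (rule indep_w[of "\<lambda>i v. (col B k \<bullet> v) * (col B l \<bullet> v)"])
        (intro borel_measurable_times measurable_scalar_prod colB that)
    note gram_second_moment[OF subgaussian_w_g this w_cov kl]
    then show "integrable M (\<lambda>\<omega>. (f1 \<omega>)\<^sup>2)" "expectation (\<lambda>\<omega>. (f1 \<omega>)\<^sup>2) \<le> b" by (auto simp: f1_def b_def)
  qed
  have m4: "integrable M (\<lambda>\<omega>. (f4 \<omega>)\<^sup>2)" "expectation (\<lambda>\<omega>. (f4 \<omega>)\<^sup>2) \<le> b"
  proof -
    have "indep_vars (\<lambda>_. borel) (\<lambda>i \<omega>. e i k \<omega> * e i l \<omega>) {..<n}" if "k < m" "l < m" for k l
      unfolding e_def by (rule indep_e[of "\<lambda>i v. v $ k * v $ l"])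
        (intro borel_measurable_times measurable_vec_index that)
    note gram_second_moment[OF subgaussian_e_g this E_cov kl]
    then show "integrable M (\<lambda>\<omega>. (f4 \<omega>)\<^sup>2)" "expectation (\<lambda>\<omega>. (f4 \<omega>)\<^sup>2) \<le> b" by (auto simp: f4_def b_def)
  qed
  have m2: "integrable M (\<lambda>\<omega>. (f2 \<omega>)\<^sup>2)" "expectation (\<lambda>\<omega>. (f2 \<omega>)\<^sup>2) \<le> b"
    using cross_second_moment[OF kl] by (auto simp: f2_def b_def)
  have m3: "integrable M (\<lambda>\<omega>. (f3 \<omega>)\<^sup>2)" "expectation (\<lambda>\<omega>. (f3 \<omega>)\<^sup>2) \<le> b"
    using cross_second_moment[OF kl(2,1)] by (auto simp: f3_def b_def mult_ac)
  have rv: "random_variable borel (\<lambda>\<omega>. (\<Sum>i<n. eps i k \<omega> * eps i l \<omega>) / real n - c)"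
    unfolding eps_def using rv_w_e kl by auto
  have eq: "(\<Sum>i<n. eps i k \<omega> * eps i l \<omega>) / real n - c = (f1 \<omega> + f2 \<omega> + f3 \<omega> + f4 \<omega>) / real n" for \<omega>
  proof -
    have "f1 \<omega> + f2 \<omega> + f3 \<omega> + f4 \<omega> = (\<Sum>i<n. eps i k \<omega> * eps i l \<omega> - c)"
      unfolding f1_def f2_def f3_def f4_def sum.distrib[symmetric] eps_def c_def
      by (intro sum.cong refl) (simp add: algebra_simps)
    then show ?thesis using n0 by (simp add: sum_subtractf field_simps)
  qed
  define F where "F \<omega> = 4 * ((f1 \<omega>)\<^sup>2 + (f2 \<omega>)\<^sup>2 + (f3 \<omega>)\<^sup>2 + (f4 \<omega>)\<^sup>2) / (real n)\<^sup>2" for \<omega>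
  have Fi: "integrable M F" unfolding F_def using m1 m2 m3 m4 by simp
  have le: "((\<Sum>i<n. eps i k \<omega> * eps i l \<omega>) / real n - c)\<^sup>2 \<le> F \<omega>" for \<omega>
  proof -
    have "(a + b + c + d)\<^sup>2 \<le> 4 * (a\<^sup>2 + b\<^sup>2 + c\<^sup>2 + d\<^sup>2)" for a b c d :: real
    proof -
      have "0 \<le> (a-b)\<^sup>2 + (a-c)\<^sup>2 + (a-d)\<^sup>2 + (b-c)\<^sup>2 + (b-d)\<^sup>2 + (c-d)\<^sup>2" by simp
      then show ?thesis by (simp add: power2_eq_square algebra_simps)
    qed
    then show ?thesis unfolding eq F_def power_divide by (rule divide_right_mono) simp
  qed
  show I: "integrable M (\<lambda>\<omega>. ((\<Sum>i<n. eps i k \<omega> * eps i l \<omega>) / real n - c)\<^sup>2)"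
    by (rule Bochner_Integration.integrable_bound[OF Fi])
      (use rv le in \<open>auto intro!: AE_I2 borel_measurable_power simp: F_def\<close>)
  have "expectation (\<lambda>\<omega>. ((\<Sum>i<n. eps i k \<omega> * eps i l \<omega>) / real n - c)\<^sup>2) \<le> expectation F"
    by (intro integral_mono I Fi le)
  also have "\<dots> = 4 * (expectation (\<lambda>\<omega>. (f1 \<omega>)\<^sup>2) + expectation (\<lambda>\<omega>. (f2 \<omega>)\<^sup>2) + expectation (\<lambda>\<omega>. (f3 \<omega>)\<^sup>2) + expectation (\<lambda>\<omega>. (f4 \<omega>)\<^sup>2)) / (real n)\<^sup>2"
    unfolding F_def using m1 m2 m3 m4 by simp
  also have "\<dots> \<le> 4 * (b + b + b + b) / (real n)\<^sup>2"
    using m1 m2 m3 m4 by (intro divide_right_mono mult_left_mono add_mono) auto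
  also have "\<dots> = 16384 * (g k)\<^sup>2 * (g l)\<^sup>2 / real n" using n0 by (simp add: b_def power2_eq_square)
  finally show "expectation (\<lambda>\<omega>. ((\<Sum>i<n. eps i k \<omega> * eps i l \<omega>) / real n - c)\<^sup>2) \<le> 16384 * (g k)\<^sup>2 * (g l)\<^sup>2 / real n" .
qed

lemma subgaussian_eps: "i < n \<Longrightarrow> k < m \<Longrightarrow> subgaussian M (g k) (eps i k)"
proof -
  assume ik: "i < n" "k < m"
  have "(\<Sum>j<n. (if j = i then 1 else 0) * (w j k \<omega> + e j k \<omega>)) = eps i k \<omega>" for \<omega>
    using ik by (simp add: eps_def if_distrib[of "\<lambda>x. x * _"] cong: if_cong)
  moreover have "(\<Sum>j<n. (if j = i then 1 else (0::real))\<^sup>2) = 1" using ik by (simp add: if_distrib[of "\<lambda>x. x\<^sup>2"] cong: if_cong)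
  ultimately show ?thesis using subgaussian_lin[OF ik(2), of "\<lambda>j. if j = i then 1 else 0"] by (simp add: eta_contract_eq)
qed

lemma eps_orth:
  assumes "i < n" "j < n" "i \<noteq> j" "k < m"
  shows "expectation (\<lambda>\<omega>. eps i k \<omega> * eps j k \<omega>) = 0"
proof -
  note k = assms(4)
  have ww: "integrable M (\<lambda>\<omega>. w i k \<omega> * w j k \<omega>)" "integrable M (\<lambda>\<omega>. e i k \<omega> * e j k \<omega>)"
    "integrable M (\<lambda>\<omega>. w i k \<omega> * e j k \<omega>)" "integrable M (\<lambda>\<omega>. w j k \<omega> * e i k \<omega>)"
    using subgaussian_prod_square(3)[OF subgaussian_w_g subgaussian_w_g g_pos g_pos, of i k j k]
      subgaussian_prod_square(3)[OF subgaussian_e_g subgaussian_e_g g_pos g_pos, of i k j k]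
      subgaussian_prod_square(3)[OF subgaussian_w_g subgaussian_e_g g_pos g_pos, of i k j k]
      subgaussian_prod_square(3)[OF subgaussian_w_g subgaussian_e_g g_pos g_pos, of j k i k] assms by auto
  have "expectation (\<lambda>\<omega>. eps i k \<omega> * eps j k \<omega>) = expectation (\<lambda>\<omega>. w i k \<omega> * w j k \<omega> + w i k \<omega> * e j k \<omega> + w j k \<omega> * e i k \<omega> + e i k \<omega> * e j k \<omega>)"
    by (simp add: eps_def algebra_simps)
  also have "\<dots> = 0" using ww w_orth[OF assms] e_orth[OF assms] we_orth[OF assms(1,2) k k] we_orth[OF assms(2,1) k k] by simp
  finally show ?thesis .
qed

text \<open>Distinct rows are uncorrelated, so the mean of tr(\<epsilon>^T H \<epsilon>) sees only
  the diagonal of H. With H = I - Q this is where the effective degrees of freedom come from; 16 is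
  the second-moment constant.\<close>

lemma quadratic_form_expectation:
  assumes H0: "\<And>i. i < n \<Longrightarrow> 0 \<le> H i i"
  shows "integrable M (\<lambda>\<omega>. \<Sum>k<m. \<Sum>i<n. \<Sum>j<n. H i j * (eps i k \<omega> * eps j k \<omega>))"
    "expectation (\<lambda>\<omega>. \<Sum>k<m. \<Sum>i<n. \<Sum>j<n. H i j * (eps i k \<omega> * eps j k \<omega>)) \<le> 16 * V * (\<Sum>i<n. H i i)"
proof -
  have I: "integrable M (\<lambda>\<omega>. eps i k \<omega> * eps j k \<omega>)" if "i < n" "j < n" "k < m" for i j k
    using subgaussian_prod_square(3)[OF subgaussian_eps subgaussian_eps g_pos g_pos] that by auto
  show "integrable M (\<lambda>\<omega>. \<Sum>k<m. \<Sum>i<n. \<Sum>j<n. H i j * (eps i k \<omega> * eps j k \<omega>))"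
    using I by (intro Bochner_Integration.integrable_sum Bochner_Integration.integrable_mult_right) auto
  have "expectation (\<lambda>\<omega>. \<Sum>k<m. \<Sum>i<n. \<Sum>j<n. H i j * (eps i k \<omega> * eps j k \<omega>))
    = (\<Sum>k<m. \<Sum>i<n. \<Sum>j<n. H i j * expectation (\<lambda>\<omega>. eps i k \<omega> * eps j k \<omega>))"
  proof -
    have ds: "integrable M (\<lambda>\<omega>. \<Sum>i<n. \<Sum>j<n. H i j * (eps i k \<omega> * eps j k \<omega>))"
      "expectation (\<lambda>\<omega>. \<Sum>i<n. \<Sum>j<n. H i j * (eps i k \<omega> * eps j k \<omega>))
        = (\<Sum>i<n. \<Sum>j<n. H i j * expectation (\<lambda>\<omega>. eps i k \<omega> * eps j k \<omega>))" if "k < m" for k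
      using expectation_double_sum[where f = "\<lambda>i j \<omega>. eps i k \<omega> * eps j k \<omega>" and c = H and k = n and l = n, OF I[OF _ _ that]]
      by auto
    have "expectation (\<lambda>\<omega>. \<Sum>k<m. \<Sum>i<n. \<Sum>j<n. H i j * (eps i k \<omega> * eps j k \<omega>))
      = (\<Sum>k<m. expectation (\<lambda>\<omega>. \<Sum>i<n. \<Sum>j<n. H i j * (eps i k \<omega> * eps j k \<omega>)))"
      by (intro Bochner_Integration.integral_sum ds(1)) auto
    also have "\<dots> = (\<Sum>k<m. \<Sum>i<n. \<Sum>j<n. H i j * expectation (\<lambda>\<omega>. eps i k \<omega> * eps j k \<omega>))"
      by (intro sum.cong refl ds(2)) auto
    finally show ?thesis .
  qed
  also have "\<dots> = (\<Sum>k<m. \<Sum>i<n. H i i * expectation (\<lambda>\<omega>. (eps i k \<omega>)\<^sup>2))"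
  proof (intro sum.cong refl)
    fix k i assume "k \<in> {..<m}" "i \<in> {..<n}"
    then have ki: "k < m" "i < n" by auto
    have "(\<Sum>j<n. H i j * expectation (\<lambda>\<omega>. eps i k \<omega> * eps j k \<omega>)) = (\<Sum>j<n. if j = i then H i i * expectation (\<lambda>\<omega>. (eps i k \<omega>)\<^sup>2) else 0)"
      using eps_orth[of i _ k] ki by (intro sum.cong refl) (auto simp: power2_eq_square)
    then show "(\<Sum>j<n. H i j * expectation (\<lambda>\<omega>. eps i k \<omega> * eps j k \<omega>)) = H i i * expectation (\<lambda>\<omega>. (eps i k \<omega>)\<^sup>2)"
      using ki by simp
  qed
  also have "\<dots> \<le> (\<Sum>k<m. \<Sum>i<n. H i i * (16 * (g k)\<^sup>2))"
    using subgaussian_moments(4)[OF subgaussian_eps g_pos] H0 by (intro sum_mono mult_left_mono) auto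
  also have "\<dots> = 16 * V * (\<Sum>i<n. H i i)"
    by (simp add: V_def sum_distrib_left sum_distrib_right mult_ac)
  finally show "expectation (\<lambda>\<omega>. \<Sum>k<m. \<Sum>i<n. \<Sum>j<n. H i j * (eps i k \<omega> * eps j k \<omega>)) \<le> 16 * V * (\<Sum>i<n. H i i)" .
qed

end

section \<open>Concentration of the noise\<close>

text \<open>A net of the unit ball: rounding every coordinate of \<open>v\<close> to the grid \<open>\<int> / \<surd>d\<close> in the
  direction of the sign of \<open>a\<close> does not decrease \<open>a \<bullet> v\<close>, so a linear functional is dominated
  by its values on the grid, without any loss in the constant.\<close>

definition grid :: "nat \<Rightarrow> (nat \<Rightarrow> int) set" where
  "grid d = {z \<in> PiE {..<d} (\<lambda>_. {- (2 * int d)..2 * int d}). (\<Sum>i<d. (z i)\<^sup>2) \<le> 4 * int d}"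

definition grid_vec :: "nat \<Rightarrow> (nat \<Rightarrow> int) \<Rightarrow> real vec" where
  "grid_vec d z = vec d (\<lambda>i. real_of_int (z i) / sqrt (real d))"

lemma grid_vec_carrier [simp]: "grid_vec d z \<in> carrier_vec d"
  by (simp add: grid_vec_def)

lemma finite_grid: "finite (grid d)"
  by (rule finite_subset[of _ "PiE {..<d} (\<lambda>_. {- (2 * int d)..2 * int d})"]) (auto simp: grid_def finite_PiE)

lemma vnorm_grid_vec:
  assumes "z \<in> grid d" "0 < d" shows "vnorm (grid_vec d z) \<le> 2"
proof -
  have "(vnorm (grid_vec d z))\<^sup>2 = (\<Sum>i<d. (real_of_int (z i))\<^sup>2 / real d)"
    unfolding vnorm_sq scalar_prod_eq_sum[OF carrier_vecD[OF grid_vec_carrier]]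
    using assms(2) by (auto simp: grid_vec_def power2_eq_square intro!: sum.cong)
  also have "\<dots> = real_of_int (\<Sum>i<d. (z i)\<^sup>2) / real d" by (simp add: sum_divide_distrib)
  also have "\<dots> \<le> real_of_int (4 * int d) / real d"
    using assms by (intro divide_right_mono) (auto simp: grid_def simp del: of_int_sum)
  also have "\<dots> = 2\<^sup>2" using assms(2) by simp
  finally show ?thesis by (rule power2_le_imp_le) simp
qed

text \<open>The weights are dominated by two geometric series of ratio 1/2, with total 4, and 4
  \<le> exp 2.\<close>

lemma sum_exp_neg_square_le: "(\<Sum>z\<in>{- int N..int N}. exp (- (real_of_int z)\<^sup>2)) \<le> exp 2"
proof -
  have e: "exp (- (real k)\<^sup>2) \<le> (1/2) ^ k" for k :: nat
  proof -
    have "real k \<le> (real k)\<^sup>2" by (cases k) (auto simp: power2_eq_square)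
    then have "exp (- (real k)\<^sup>2) \<le> exp (- real k)" by simp
    also have "\<dots> = (exp (- 1)) ^ k" by (simp flip: exp_of_nat_mult)
    also have "\<dots> \<le> (1/2) ^ k"
      using exp_ge_add_one_self[of 1] by (intro power_mono) (auto simp: exp_minus field_simps)
    finally show ?thesis .
  qed
  have g: "(\<Sum>k\<le>N. (1/2) ^ k) \<le> (2::real)"
    using sum_le_suminf[of "\<lambda>k. (1/2::real) ^ k" "{..N}"] suminf_geometric[of "1/2::real"] by (simp add: summable_geometric)
  have "{- int N..int N} \<subseteq> int ` {..N} \<union> (\<lambda>k. - int k) ` {..N}"
  proof
    fix z assume z: "z \<in> {- int N..int N}"
    show "z \<in> int ` {..N} \<union> (\<lambda>k. - int k) ` {..N}"
    proof (cases "0 \<le> z")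
      case True
      then show ?thesis using z by (intro UnI1 image_eqI[of _ _ "nat z"]) auto
    next
      case False
      then show ?thesis using z by (intro UnI2 image_eqI[of _ _ "nat (- z)"]) auto
    qed
  qed
  then have "(\<Sum>z\<in>{- int N..int N}. exp (- (real_of_int z)\<^sup>2))
      \<le> (\<Sum>z\<in>int ` {..N} \<union> (\<lambda>k. - int k) ` {..N}. exp (- (real_of_int z)\<^sup>2))"
    by (intro sum_mono2) auto
  also have "\<dots> \<le> (\<Sum>z\<in>int ` {..N}. exp (- (real_of_int z)\<^sup>2)) + (\<Sum>z\<in>(\<lambda>k. - int k) ` {..N}. exp (- (real_of_int z)\<^sup>2))"
    by (subst sum_Un) (auto intro!: sum_nonneg)
  also have "\<dots> = (\<Sum>k\<le>N. exp (- (real k)\<^sup>2)) + (\<Sum>k\<le>N. exp (- (real k)\<^sup>2))"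
    by (subst (1 2) sum.reindex) (auto simp: inj_on_def)
  also have "\<dots> \<le> (\<Sum>k\<le>N. (1/2) ^ k) + (\<Sum>k\<le>N. (1/2) ^ k)" by (intro add_mono sum_mono e)
  also have "\<dots> \<le> 4" using g by simp
  also have "(4::real) \<le> exp 2"
  proof -
    have "(2::real)\<^sup>2 \<le> (exp 1)\<^sup>2" using exp_ge_add_one_self[of 1] by (intro power_mono) auto
    then show ?thesis by (simp add: exp_double[symmetric])
  qed
  finally show ?thesis .
qed

text \<open>Lattice points in a ball are counted by an exponential weight: each of them satisfies 1
  \<le> exp(4 d - |z|^2), and the sum of the weights over the box factors into d one-dimensional
  sums, each at most exp 2. The result is exp(4 d + 2 d).\<close>

lemma card_grid: "real (card (grid d)) \<le> exp (6 * real d)"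
proof -
  let ?P = "PiE {..<d} (\<lambda>_. {- int (2 * d)..int (2 * d)})"
  have sub: "grid d \<subseteq> ?P" by (auto simp: grid_def)
  have fin: "finite ?P" by (intro finite_PiE) auto
  have "real (card (grid d)) = (\<Sum>z\<in>grid d. 1)" by simp
  also have "\<dots> \<le> (\<Sum>z\<in>grid d. exp (4 * real d - (\<Sum>i<d. (real_of_int (z i))\<^sup>2)))"
  proof (rule sum_mono)
    fix z assume "z \<in> grid d"
    then have "real_of_int (\<Sum>i<d. (z i)\<^sup>2) \<le> real_of_int (4 * int d)" by (auto simp: grid_def simp del: of_int_sum)
    then show "1 \<le> exp (4 * real d - (\<Sum>i<d. (real_of_int (z i))\<^sup>2))" by simp
  qed
  also have "\<dots> \<le> (\<Sum>z\<in>?P. exp (4 * real d - (\<Sum>i<d. (real_of_int (z i))\<^sup>2)))"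
    by (intro sum_mono2 fin sub) auto
  also have "\<dots> = exp (4 * real d) * (\<Sum>z\<in>?P. \<Prod>i<d. exp (- (real_of_int (z i))\<^sup>2))"
    by (simp add: exp_diff exp_minus sum_distrib_left exp_sum prod_inversef[symmetric] divide_inverse comp_def)
  also have "(\<Sum>z\<in>?P. \<Prod>i<d. exp (- (real_of_int (z i))\<^sup>2)) = (\<Prod>i<d. \<Sum>z\<in>{- int (2 * d)..int (2 * d)}. exp (- (real_of_int z)\<^sup>2))"
    by (rule prod_sum_PiE[symmetric]) auto
  also have "\<dots> \<le> (\<Prod>i<d. exp 2)" by (intro prod_mono conjI sum_nonneg sum_exp_neg_square_le) auto
  also have "(\<Prod>i<d. exp 2) = exp (2 * real d)" by (simp add: exp_of_nat_mult[symmetric] mult.commute)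
  finally show ?thesis by (simp add: exp_add[symmetric])
qed

lemma grid_rounding:
  assumes v: "v \<in> carrier_vec d" "vnorm v \<le> 1" and a: "a \<in> carrier_vec d" and d: "0 < d"
  obtains z where "z \<in> grid d" "a \<bullet> v \<le> a \<bullet> grid_vec d z"
proof -
  define r where "r = sqrt (real d)"
  have r: "0 < r" "r * r = real d" using d by (auto simp: r_def)
  define z where "z = (\<lambda>i\<in>{..<d}. if 0 \<le> a $ i then \<lceil>r * v $ i\<rceil> else \<lfloor>r * v $ i\<rfloor>)"
  have zi: "\<bar>real_of_int (z i) - r * v $ i\<bar> \<le> 1" "a $ i * (r * v $ i) \<le> a $ i * real_of_int (z i)" if "i < d" for i
  proof -
    show "\<bar>real_of_int (z i) - r * v $ i\<bar> \<le> 1"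
      using that unfolding z_def by (auto; linarith)
    show "a $ i * (r * v $ i) \<le> a $ i * real_of_int (z i)"
      using that unfolding z_def by (auto intro: mult_left_mono mult_left_mono_neg)
  qed
  let ?z = "grid_vec d z"
  have "vnorm (?z - v) \<le> 1"
  proof -
    have c: "?z - v \<in> carrier_vec d" using v by simp
    have "(vnorm (?z - v))\<^sup>2 = (\<Sum>i<d. ((?z - v) $ i)\<^sup>2)"
      unfolding vnorm_sq scalar_prod_eq_sum[OF carrier_vecD[OF c]] by (simp add: power2_eq_square)
    also have "\<dots> \<le> (\<Sum>i<d. 1 / real d)"
    proof (rule sum_mono)
      fix i assume "i \<in> {..<d}"
      then have i: "i < d" by simp
      have "(?z - v) $ i = (real_of_int (z i) - r * v $ i) / r"
        using i v r by (simp add: grid_vec_def r_def[symmetric] diff_divide_distrib)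
      then have "((?z - v) $ i)\<^sup>2 = \<bar>real_of_int (z i) - r * v $ i\<bar>\<^sup>2 / real d"
        using r by (simp add: power_divide power2_eq_square)
      also have "\<dots> \<le> 1\<^sup>2 / real d" using zi(1)[OF i] by (intro divide_right_mono power_mono) auto
      finally show "((?z - v) $ i)\<^sup>2 \<le> 1 / real d" by simp
    qed
    also have "\<dots> = 1\<^sup>2" using d by simp
    finally show ?thesis by (rule power2_le_imp_le) simp
  qed
  moreover have "?z = v + (?z - v)" using v by (auto intro!: eq_vecI simp: grid_vec_def)
  then have "vnorm ?z \<le> vnorm v + vnorm (?z - v)"
    using vnorm_add[of v d "?z - v"] v by (metis grid_vec_carrier minus_carrier_vec)
  ultimately have n2: "vnorm ?z \<le> 2" using v(2) by simp
  have "real_of_int (\<Sum>i<d. (z i)\<^sup>2) = real d * (vnorm ?z)\<^sup>2"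
    unfolding vnorm_sq scalar_prod_eq_sum[OF carrier_vecD[OF grid_vec_carrier]]
    using d by (simp add: grid_vec_def power2_eq_square sum_distrib_left)
  also have "\<dots> \<le> real d * 2\<^sup>2" using n2 by (intro mult_left_mono power_mono) auto
  finally have "real_of_int (\<Sum>i<d. (z i)\<^sup>2) \<le> real_of_int (4 * int d)" by simp
  then have s: "(\<Sum>i<d. (z i)\<^sup>2) \<le> 4 * int d" by (simp only: of_int_le_iff)
  have "z \<in> grid d"
  proof -
    have "z i \<in> {- (2 * int d)..2 * int d}" if i: "i < d" for i
    proof -
      have "(z i)\<^sup>2 \<le> (\<Sum>i<d. (z i)\<^sup>2)" using i by (intro member_le_sum) auto
      also have "\<dots> \<le> 4 * int d" by (rule s)
      also have "\<dots> \<le> 4 * (int d * int d)" using d by (intro mult_left_mono) (cases d; auto)+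
      also have "\<dots> = (2 * int d)\<^sup>2" by (simp add: power2_eq_square)
      finally have "\<bar>z i\<bar> \<le> \<bar>2 * int d\<bar>" by (simp only: abs_le_square_iff)
      then show ?thesis by auto
    qed
    then show ?thesis using s by (auto simp: grid_def z_def)
  qed
  moreover have "a \<bullet> v \<le> a \<bullet> ?z"
  proof -
    have "a $ i * v $ i \<le> a $ i * (real_of_int (z i) / r)" if "i < d" for i
      using zi(2)[OF that] r by (simp add: field_simps)
    then show ?thesis
      using v by (simp add: scalar_prod_eq_sum[of _ d] grid_vec_def r_def[symmetric]) (intro sum_mono, simp)
  qed
  ultimately show ?thesis using that by blast
qed

text \<open>The scale 0 occurs for zero vectors and has to be covered without exceptional cases
  later.\<close>

lemma (in prob_space) subgaussian_tail':
  assumes X: "subgaussian M g X" and g: "0 \<le> g" and T: "0 < T"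
  shows "{\<omega> \<in> space M. \<not> \<bar>X \<omega>\<bar> \<le> g * sqrt (2 * T)} \<in> events"
    "prob {\<omega> \<in> space M. \<not> \<bar>X \<omega>\<bar> \<le> g * sqrt (2 * T)} \<le> 2 * exp (- T)"
proof -
  have [measurable]: "random_variable borel X" by (rule subgaussian_rv[OF X])
  show ev: "{\<omega> \<in> space M. \<not> \<bar>X \<omega>\<bar> \<le> g * sqrt (2 * T)} \<in> events" by measurable
  show "prob {\<omega> \<in> space M. \<not> \<bar>X \<omega>\<bar> \<le> g * sqrt (2 * T)} \<le> 2 * exp (- T)"
  proof (cases "g = 0")
    \<comment> \<open>With constant 0 the variable is sub-Gaussian for every positive constant;
      letting it tend to 0 kills the second moment, so the variable vanishes almost surely.\<close>
    case True
    have m: "integrable M (\<lambda>\<omega>. (X \<omega>)\<^sup>2)" "expectation (\<lambda>\<omega>. (X \<omega>)\<^sup>2) \<le> 16 * h\<^sup>2" if "0 < h" for h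
      using subgaussian_moments(3,4)[OF subgaussian_mono[OF X, of h] that] True by auto
    have "expectation (\<lambda>\<omega>. (X \<omega>)\<^sup>2) \<le> 0"
    proof (rule field_le_epsilon)
      fix y :: real assume "0 < y"
      then show "expectation (\<lambda>\<omega>. (X \<omega>)\<^sup>2) \<le> 0 + y" using m(2)[of "sqrt (y / 16)"] by simp
    qed
    then have "expectation (\<lambda>\<omega>. (X \<omega>)\<^sup>2) = 0" by (intro antisym Bochner_Integration.integral_nonneg) auto
    then have "AE \<omega> in M. (X \<omega>)\<^sup>2 = 0" using integral_nonneg_eq_0_iff_AE[OF m(1)[of 1]] by simp
    then have "AE \<omega> in M. \<omega> \<notin> {\<omega> \<in> space M. \<not> \<bar>X \<omega>\<bar> \<le> g * sqrt (2 * T)}"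
      by (rule AE_mp) (auto intro!: AE_I2 simp: True)
    then have "prob {\<omega> \<in> space M. \<not> \<bar>X \<omega>\<bar> \<le> g * sqrt (2 * T)} = 0" using ev by (simp add: prob_eq_0)
    then show ?thesis by simp
  next
    case False
    have "prob {\<omega> \<in> space M. \<not> \<bar>X \<omega>\<bar> \<le> g * sqrt (2 * T)} \<le> prob {\<omega> \<in> space M. g * sqrt (2 * T) \<le> \<bar>X \<omega>\<bar>}"
      by (rule finite_measure_mono) auto
    also have "\<dots> \<le> 2 * exp (- T)" using False g by (intro subgaussian_tail X T) auto
    finally show ?thesis .
  qed
qed

lemma (in prob_space) union_bound:
  assumes "finite I" "\<And>i. i \<in> I \<Longrightarrow> A i \<in> events" "\<And>i. i \<in> I \<Longrightarrow> prob (A i) \<le> c"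
  shows "(\<Union>i\<in>I. A i) \<in> events" "prob (\<Union>i\<in>I. A i) \<le> real (card I) * c"
proof -
  show "(\<Union>i\<in>I. A i) \<in> events" using assms by auto
  have "prob (\<Union>i\<in>I. A i) \<le> (\<Sum>i\<in>I. prob (A i))" using assms by (intro finite_measure_subadditive_finite) auto
  also have "\<dots> \<le> real (card I) * c" using sum_bounded_above[of I "\<lambda>i. prob (A i)" c] assms by simp
  finally show "prob (\<Union>i\<in>I. A i) \<le> real (card I) * c" .
qed

section \<open>Exceptional sets of small probability\<close>

context hv_noise
begin

definition noise_mat :: "'a \<Rightarrow> real mat" where "noise_mat \<omega> = W \<omega> * B + E \<omega>"

lemma noise_mat: "\<omega> \<in> space M \<Longrightarrow> noise_mat \<omega> \<in> carrier_mat n m"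
  using W[of \<omega>] E[of \<omega>] B by (simp add: noise_mat_def)

lemma noise_mat_entry: "\<omega> \<in> space M \<Longrightarrow> i < n \<Longrightarrow> k < m \<Longrightarrow> noise_mat \<omega> $$ (i,k) = eps i k \<omega>"
  using W[of \<omega>] E[of \<omega>] B by (simp add: noise_mat_def eps_def w_def e_def comm_scalar_prod[of _ K])

text \<open>This lemma and its companions return a measurable exceptional set and a pointwise bound
  off it. In this way the estimates are uniform in the quantified vectors, and no measurability of
  the good event itself has to be shown.\<close>

lemma bad_lin:
  assumes U: "finite U" "U \<subseteq> carrier_vec n" and T: "0 < T"
  obtains F where "F \<in> events" "prob F \<le> real (card U) * real m * (2 * exp (- T))"
    "\<And>\<omega> u k. \<omega> \<in> space M - F \<Longrightarrow> u \<in> U \<Longrightarrow> k < m \<Longrightarrow> \<bar>u \<bullet> col (noise_mat \<omega>) k\<bar> \<le> vnorm u * g k * sqrt (2 * T)"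
proof -
  define X where "X = (\<lambda>(u,k) \<omega>. \<Sum>i<n. u $ i * (w i k \<omega> + e i k \<omega>))"
  define F where "F = (\<Union>uk\<in>U \<times> {..<m}. {\<omega> \<in> space M. \<not> \<bar>X uk \<omega>\<bar> \<le> (vnorm (fst uk) * g (snd uk)) * sqrt (2 * T)})"
  have sg: "subgaussian M (vnorm (fst uk) * g (snd uk)) (X uk)" "0 \<le> vnorm (fst uk) * g (snd uk)" if uk: "uk \<in> U \<times> {..<m}" for uk
  proof -
    obtain u k where [simp]: "uk = (u,k)" and u: "u \<in> carrier_vec n" and k: "k < m" using uk U by auto
    have "vnorm u = sqrt (\<Sum>i<n. (u $ i)\<^sup>2)" using u by (simp add: vnorm_L2 L2_set_def)
    then show "subgaussian M (vnorm (fst uk) * g (snd uk)) (X uk)" using subgaussian_lin[OF k, of "\<lambda>i. u $ i"] by (simp add: X_def)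
    show "0 \<le> vnorm (fst uk) * g (snd uk)" using g_pos[OF k] by simp
  qed
  note ub = union_bound[of "U \<times> {..<m}" "\<lambda>uk. {\<omega> \<in> space M. \<not> \<bar>X uk \<omega>\<bar> \<le> (vnorm (fst uk) * g (snd uk)) * sqrt (2 * T)}" "2 * exp (- T)",
     OF _ subgaussian_tail'(1)[OF sg T] subgaussian_tail'(2)[OF sg T], folded F_def]
  show ?thesis
  proof (rule that[of F])
    show "F \<in> events" using ub(1) U by auto
    show "prob F \<le> real (card U) * real m * (2 * exp (- T))" using ub(2) U by simp
    fix \<omega> u k assume a: "\<omega> \<in> space M - F" "u \<in> U" "k < m"
    have "noise_mat \<omega> \<in> carrier_mat n m" using a noise_mat by simp
    then have "u \<bullet> col (noise_mat \<omega>) k = X (u,k) \<omega>"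
      using a U by (auto simp: X_def scalar_prod_eq_sum[of _ n] noise_mat_entry eps_def intro!: sum.cong)
    then show "\<bar>u \<bullet> col (noise_mat \<omega>) k\<bar> \<le> vnorm u * g k * sqrt (2 * T)" using a by (force simp: F_def)
  qed
qed

lemma bad_lin_E:
  assumes U: "finite U" "U \<subseteq> carrier_vec n" and T: "0 < T"
  obtains F where "F \<in> events" "prob F \<le> real (card U) * real m * (2 * exp (- T))"
    "\<And>\<omega> u k. \<omega> \<in> space M - F \<Longrightarrow> u \<in> U \<Longrightarrow> k < m \<Longrightarrow> \<bar>u \<bullet> col (E \<omega>) k\<bar> \<le> vnorm u * \<gamma>e * sqrt (2 * T)"
proof -
  define X where "X = (\<lambda>(u,k) \<omega>. \<Sum>i<n. u $ i * e i k \<omega>)"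
  define F where "F = (\<Union>uk\<in>U \<times> {..<m}. {\<omega> \<in> space M. \<not> \<bar>X uk \<omega>\<bar> \<le> (vnorm (fst uk) * \<gamma>e) * sqrt (2 * T)})"
  have sg: "subgaussian M (vnorm (fst uk) * \<gamma>e) (X uk)" "0 \<le> vnorm (fst uk) * \<gamma>e" if uk: "uk \<in> U \<times> {..<m}" for uk
  proof -
    obtain u k where [simp]: "uk = (u,k)" and u: "u \<in> carrier_vec n" and k: "k < m" using uk U by auto
    have "vnorm u = sqrt (\<Sum>i<n. (u $ i)\<^sup>2)" using u by (simp add: vnorm_L2 L2_set_def)
    then show "subgaussian M (vnorm (fst uk) * \<gamma>e) (X uk)" using subgaussian_lin_e[OF k, of "\<lambda>i. u $ i"] by (simp add: X_def)
    show "0 \<le> vnorm (fst uk) * \<gamma>e" using ge by simp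
  qed
  note ub = union_bound[of "U \<times> {..<m}" "\<lambda>uk. {\<omega> \<in> space M. \<not> \<bar>X uk \<omega>\<bar> \<le> (vnorm (fst uk) * \<gamma>e) * sqrt (2 * T)}" "2 * exp (- T)",
     OF _ subgaussian_tail'(1)[OF sg T] subgaussian_tail'(2)[OF sg T], folded F_def]
  show ?thesis
  proof (rule that[of F])
    show "F \<in> events" using ub(1) U by auto
    show "prob F \<le> real (card U) * real m * (2 * exp (- T))" using ub(2) U by simp
    fix \<omega> u k assume a: "\<omega> \<in> space M - F" "u \<in> U" "k < m"
    have "E \<omega> \<in> carrier_mat n m" using a E by simp
    then have "u \<bullet> col (E \<omega>) k = X (u,k) \<omega>"
      using a U by (auto simp: X_def scalar_prod_eq_sum[of _ n] e_def intro!: sum.cong)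
    then show "\<bar>u \<bullet> col (E \<omega>) k\<bar> \<le> vnorm u * \<gamma>e * sqrt (2 * T)" using a by (force simp: F_def)
  qed
qed

text \<open>Rounding is done twice in the bilinear form u . (W R x): first the direction u of the
  image, then x. Neither rounding decreases the form, so its values on pairs of grid points dominate
  the operator norm.\<close>

lemma op_bound_from_grid:
  assumes K: "0 < K" and \<omega>: "\<omega> \<in> space M"
    and grid: "\<And>z y. z \<in> grid n \<Longrightarrow> y \<in> grid K \<Longrightarrow> (\<Sum>i<n. grid_vec n z $ i * ((R *\<^sub>v grid_vec K y) \<bullet> row (W \<omega>) i)) \<le> t"
    and x: "x \<in> carrier_vec K" and t: "0 \<le> t"
  shows "vnorm (W \<omega> *\<^sub>v (R *\<^sub>v x)) \<le> t * vnorm x"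
proof -
  have n0: "0 < n" using n by simp
  have Wc: "W \<omega> \<in> carrier_mat n K" by (rule W[OF \<omega>])
  have bil: "u \<bullet> (W \<omega> *\<^sub>v (R *\<^sub>v x)) = (\<Sum>i<n. u $ i * ((R *\<^sub>v x) \<bullet> row (W \<omega>) i))" if "x \<in> carrier_vec K" for u x
  proof -
    have Rx: "R *\<^sub>v x \<in> carrier_vec K" using R that by simp
    have c: "W \<omega> *\<^sub>v (R *\<^sub>v x) \<in> carrier_vec n" using Wc Rx by simp
    have "(W \<omega> *\<^sub>v (R *\<^sub>v x)) $ i = (R *\<^sub>v x) \<bullet> row (W \<omega>) i" if "i < n" for i
      using that Wc Rx comm_scalar_prod[of "row (W \<omega>) i" K "R *\<^sub>v x"] by auto
    then show ?thesis unfolding scalar_prod_eq_sum[OF carrier_vecD[OF c]] by simp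
  qed
  have unit: "vnorm (W \<omega> *\<^sub>v (R *\<^sub>v x)) \<le> t" if x: "x \<in> carrier_vec K" "vnorm x \<le> 1" for x
  proof -
    define a where "a = W \<omega> *\<^sub>v (R *\<^sub>v x)"
    have Rx: "R *\<^sub>v x \<in> carrier_vec K" using R x by simp
    have a: "a \<in> carrier_vec n" using Wc Rx by (simp add: a_def)
    \<comment> \<open>For a = 0 the quotient is 0, so u = 0 is still admissible.\<close>
    define u where "u = (1 / vnorm a) \<cdot>\<^sub>v a"
    have u: "u \<in> carrier_vec n" "vnorm u \<le> 1" using a by (auto simp: u_def vnorm_smult)
    have au: "vnorm a = a \<bullet> u"
      using a by (simp add: u_def vnorm_sq[symmetric] power2_eq_square)
    obtain z where z: "z \<in> grid n" "a \<bullet> u \<le> a \<bullet> grid_vec n z" using grid_rounding[OF u a n0] by blast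
    define b where "b = R *\<^sub>v ((W \<omega>)\<^sup>T *\<^sub>v grid_vec n z)"
    have WTz: "(W \<omega>)\<^sup>T *\<^sub>v grid_vec n z \<in> carrier_vec K" using Wc by simp
    have b: "b \<in> carrier_vec K" using R WTz by (simp add: b_def)
    have bx: "grid_vec n z \<bullet> (W \<omega> *\<^sub>v (R *\<^sub>v x)) = b \<bullet> x" if "x \<in> carrier_vec K" for x
    proof -
      have Rx: "R *\<^sub>v x \<in> carrier_vec K" using R that by simp
      have "grid_vec n z \<bullet> (W \<omega> *\<^sub>v (R *\<^sub>v x)) = ((W \<omega>)\<^sup>T *\<^sub>v grid_vec n z) \<bullet> (R *\<^sub>v x)"
        by (rule transpose_vec_mult_scalar[OF Wc Rx grid_vec_carrier, symmetric])
      also have "\<dots> = b \<bullet> x" unfolding b_def by (rule symmetric_scalar_prod[OF R R_sym WTz that, symmetric])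
      finally show ?thesis .
    qed
    obtain y where y: "y \<in> grid K" "b \<bullet> x \<le> b \<bullet> grid_vec K y" using grid_rounding[OF x b K] by blast
    have "vnorm a \<le> a \<bullet> grid_vec n z" using au z by simp
    also have "\<dots> = grid_vec n z \<bullet> a" using a by (intro comm_scalar_prod[of _ n]) auto
    also have "\<dots> = b \<bullet> x" unfolding a_def by (rule bx[OF x(1)])
    also have "\<dots> \<le> b \<bullet> grid_vec K y" by (rule y(2))
    also have "\<dots> = grid_vec n z \<bullet> (W \<omega> *\<^sub>v (R *\<^sub>v grid_vec K y))" by (rule bx[symmetric]) simp
    also have "\<dots> = (\<Sum>i<n. grid_vec n z $ i * ((R *\<^sub>v grid_vec K y) \<bullet> row (W \<omega>) i))" by (rule bil) simp
    also have "\<dots> \<le> t" by (rule grid[OF z(1) y(1)])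
    finally show ?thesis by (simp add: a_def)
  qed
  show ?thesis
  proof (cases "vnorm x = 0")
    case True
    have "vnorm (W \<omega> *\<^sub>v (R *\<^sub>v x)) \<le> frob_norm (W \<omega>) * (frob_norm R * vnorm x)"
      using R x by (intro order.trans[OF vnorm_mult_le_frob[OF Wc]] mult_left_mono vnorm_mult_le_frob[OF R]) auto
    then show ?thesis using True by simp
  next
    case False
    define x' where "x' = (1 / vnorm x) \<cdot>\<^sub>v x"
    have x': "x' \<in> carrier_vec K" "vnorm x' \<le> 1" using x False by (auto simp: x'_def vnorm_smult)
    have "x = vnorm x \<cdot>\<^sub>v x'" using False by (simp add: x'_def smult_smult_assoc)
    then have "W \<omega> *\<^sub>v (R *\<^sub>v x) = vnorm x \<cdot>\<^sub>v (W \<omega> *\<^sub>v (R *\<^sub>v x'))"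
      using R x' Wc by (metis mult_mat_vec mult_mat_vec_carrier)
    then show ?thesis using mult_left_mono[OF unit[OF x'], of "vnorm x"] by (simp add: vnorm_smult mult.commute)
  qed
qed

text \<open>There are at most exp(6 n + 6 K) pairs of grid points, which the shifted level T' pays
  for; the factor 4 is the product of the two grid radii. The bound is relative to sqrt(v . G v)
  because W B v = (W R) (N B v), where |N B v|^2 = v . G v.\<close>

lemma bad_op:
  assumes K: "0 < K" and T: "0 < T"
  obtains F where "F \<in> events" "prob F \<le> 2 * exp (- T)"
    "\<And>\<omega> v. \<omega> \<in> space M - F \<Longrightarrow> v \<in> carrier_vec m \<Longrightarrow>
      vnorm (W \<omega> * B *\<^sub>v v) \<le> 4 * \<gamma>w * sqrt (2 * (6 * real n + 6 * real K + T)) * sqrt (v \<bullet> (G *\<^sub>v v))"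
proof -
  have n0: "0 < n" using n by simp
  define T' where "T' = 6 * real n + 6 * real K + T"
  have T': "0 < T'" using T by (simp add: T'_def add_nonneg_pos)
  define X where "X = (\<lambda>(z,y) \<omega>. \<Sum>i<n. grid_vec n z $ i * ((R *\<^sub>v grid_vec K y) \<bullet> row (W \<omega>) i))"
  define A where "A zy = {\<omega> \<in> space M. \<not> \<bar>X zy \<omega>\<bar> \<le> (4 * \<gamma>w) * sqrt (2 * T')}" for zy
  define F where "F = (\<Union>zy\<in>grid n \<times> grid K. A zy)"
  have sg: "subgaussian M (4 * \<gamma>w) (X zy)" if zy: "zy \<in> grid n \<times> grid K" for zy
  proof -
    obtain z y where [simp]: "zy = (z,y)" and z: "z \<in> grid n" and y: "y \<in> grid K" using zy by auto
    have c: "R *\<^sub>v grid_vec K y \<in> carrier_vec K" using R by simp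
    have NRy: "N *\<^sub>v (R *\<^sub>v grid_vec K y) = grid_vec K y"
      using assoc_mult_mat_vec[OF N R grid_vec_carrier] NR by simp
    have vz: "sqrt (\<Sum>i<n. (grid_vec n z $ i)\<^sup>2) = vnorm (grid_vec n z)"
      using vnorm_L2[OF grid_vec_carrier, of n z] by (simp add: L2_set_def)
    have "subgaussian M (vnorm (grid_vec n z) * (\<gamma>w * vnorm (grid_vec K y))) (X zy)"
      using subgaussian_lin_W[OF c, of "\<lambda>i. grid_vec n z $ i"] unfolding NRy vz by (simp add: X_def)
    moreover have "vnorm (grid_vec n z) * (\<gamma>w * vnorm (grid_vec K y)) \<le> 2 * (\<gamma>w * 2)"
      using gw by (intro mult_mono vnorm_grid_vec z y n0 K) auto
    ultimately show ?thesis using gw by (elim subgaussian_mono) (simp add: abs_mult)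
  qed
  have g0: "0 \<le> 4 * \<gamma>w" using gw by simp
  have fin: "finite (grid n \<times> grid K)" using finite_grid by simp
  have Aev: "A zy \<in> events" "prob (A zy) \<le> 2 * exp (- T')" if "zy \<in> grid n \<times> grid K" for zy
    unfolding A_def by (rule subgaussian_tail'(1)[OF sg[OF that] g0 T'], rule subgaussian_tail'(2)[OF sg[OF that] g0 T'])
  note ub = union_bound[of "grid n \<times> grid K" A "2 * exp (- T')", OF fin Aev, folded F_def]
  show ?thesis
  proof (rule that[of F])
    show "F \<in> events" by (rule ub(1))
    have "prob F \<le> real (card (grid n \<times> grid K)) * (2 * exp (- T'))" by (rule ub(2))
    also have "\<dots> \<le> (exp (6 * real n) * exp (6 * real K)) * (2 * exp (- T'))"
      using mult_mono[OF card_grid[of n] card_grid[of K]] by (intro mult_right_mono) (auto simp: card_cartesian_product)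
    also have "\<dots> = 2 * exp (- T)" by (simp add: T'_def exp_add[symmetric] mult_exp_exp)
    finally show "prob F \<le> 2 * exp (- T)" .
    fix \<omega> and v :: "real vec" assume \<omega>: "\<omega> \<in> space M - F" and v: "v \<in> carrier_vec m"
    then have \<omega>': "\<omega> \<in> space M" by simp
    have grid: "(\<Sum>i<n. grid_vec n z $ i * ((R *\<^sub>v grid_vec K y) \<bullet> row (W \<omega>) i)) \<le> (4 * \<gamma>w) * sqrt (2 * T')"
      if "z \<in> grid n" "y \<in> grid K" for z y
    proof -
      have "\<bar>X (z,y) \<omega>\<bar> \<le> (4 * \<gamma>w) * sqrt (2 * T')" using \<omega> that by (auto simp: F_def A_def)
      then show ?thesis by (simp add: X_def)
    qed
    have Bv: "B *\<^sub>v v \<in> carrier_vec K" using B v by simp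
    have NBv: "N *\<^sub>v (B *\<^sub>v v) \<in> carrier_vec K" using N Bv by simp
    have "R *\<^sub>v (N *\<^sub>v (B *\<^sub>v v)) = B *\<^sub>v v" using assoc_mult_mat_vec[OF R N Bv] RN Bv by simp
    then have "W \<omega> * B *\<^sub>v v = W \<omega> *\<^sub>v (R *\<^sub>v (N *\<^sub>v (B *\<^sub>v v)))"
      using assoc_mult_mat_vec[OF W[OF \<omega>'] B v] by simp
    then have "vnorm (W \<omega> * B *\<^sub>v v) \<le> (4 * \<gamma>w) * sqrt (2 * T') * vnorm (N *\<^sub>v (B *\<^sub>v v))"
      using op_bound_from_grid[OF K \<omega>' grid NBv] gw T' by simp
    also have "vnorm (N *\<^sub>v (B *\<^sub>v v)) = sqrt (v \<bullet> (G *\<^sub>v v))"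
    proof -
      have BT: "B\<^sup>T \<in> carrier_mat m K" and SB: "\<Sigma>W * B \<in> carrier_mat K m" and SBv: "\<Sigma>W *\<^sub>v (B *\<^sub>v v) \<in> carrier_vec K"
        using B S Bv by auto
      have "G = B\<^sup>T * (\<Sigma>W * B)" unfolding G_def by (rule assoc_mult_mat[OF BT S B])
      then have "G *\<^sub>v v = B\<^sup>T *\<^sub>v (\<Sigma>W *\<^sub>v (B *\<^sub>v v))"
        using assoc_mult_mat_vec[OF BT SB v] assoc_mult_mat_vec[OF S B v] by simp
      then have "v \<bullet> (G *\<^sub>v v) = (B\<^sup>T *\<^sub>v (\<Sigma>W *\<^sub>v (B *\<^sub>v v))) \<bullet> v"
        using v BT SBv comm_scalar_prod[of v m "B\<^sup>T *\<^sub>v (\<Sigma>W *\<^sub>v (B *\<^sub>v v))"] by simp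
      also have "\<dots> = (\<Sigma>W *\<^sub>v (B *\<^sub>v v)) \<bullet> (B *\<^sub>v v)" by (rule transpose_vec_mult_scalar[OF B v SBv])
      also have "\<dots> = (B *\<^sub>v v) \<bullet> (\<Sigma>W *\<^sub>v (B *\<^sub>v v))" using SBv Bv by (rule comm_scalar_prod)
      also have "\<dots> = (vnorm (N *\<^sub>v (B *\<^sub>v v)))\<^sup>2" by (rule vnorm_N[OF Bv, symmetric])
      finally show ?thesis by simp
    qed
    finally show "vnorm (W \<omega> * B *\<^sub>v v) \<le> 4 * \<gamma>w * sqrt (2 * (6 * real n + 6 * real K + T)) * sqrt (v \<bullet> (G *\<^sub>v v))"
      by (simp add: T'_def)
  qed
qed

text \<open>Markov's inequality for the squared Frobenius norm: the entrywise second moments are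
  proportional to \<open>(g k)\<^sup>2 * (g l)\<^sup>2\<close>, and the double sum factors into
  V^2.\<close>

lemma bad_gram:
  assumes d: "0 < d"
  obtains F where "F \<in> events" "prob F \<le> d"
    "\<And>\<omega>. \<omega> \<in> space M - F \<Longrightarrow>
      (frob_norm ((1 / real n) \<cdot>\<^sub>m ((noise_mat \<omega>)\<^sup>T * noise_mat \<omega>) - (G + \<tau>\<^sup>2 \<cdot>\<^sub>m 1\<^sub>m m)))\<^sup>2 \<le> 16384 * V\<^sup>2 / real n / d"
proof -
  define c where "c k l = G $$ (k,l) + (if k = l then \<tau>\<^sup>2 else 0)" for k l
  define h where "h k l \<omega> = ((\<Sum>i<n. eps i k \<omega> * eps i l \<omega>) / real n - c k l)\<^sup>2" for k l \<omega>
  define f where "f \<omega> = (\<Sum>k<m. \<Sum>l<m. h k l \<omega>)" for \<omega>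
  have h: "integrable M (h k l)" "expectation (h k l) \<le> 16384 * (g k)\<^sup>2 * (g l)\<^sup>2 / real n" if "k < m" "l < m" for k l
    using noise_gram_entry[OF that] by (auto simp: h_def[abs_def] c_def)
  have fi: "integrable M f" unfolding f_def using h by (intro Bochner_Integration.integrable_sum) auto
  have f0: "0 \<le> f \<omega>" for \<omega> by (auto simp: f_def h_def intro!: sum_nonneg)
  have "expectation f = (\<Sum>k<m. \<Sum>l<m. expectation (h k l))"
    using expectation_double_sum(2)[of m m h "\<lambda>_ _. 1"] h(1) by (simp add: f_def[abs_def])
  also have "\<dots> \<le> (\<Sum>k<m. \<Sum>l<m. 16384 * (g k)\<^sup>2 * (g l)\<^sup>2 / real n)" using h(2) by (intro sum_mono) auto
  also have "\<dots> = 16384 * V\<^sup>2 / real n"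
    unfolding V_def power2_eq_square[of "sum _ _"] sum_product by (simp add: sum_distrib_left sum_divide_distrib mult_ac)
  finally have fE: "expectation f \<le> 16384 * V\<^sup>2 / real n" .
  define F where "F = {\<omega> \<in> space M. \<not> f \<omega> \<le> 16384 * V\<^sup>2 / real n / d}"
  show ?thesis
  proof (rule that[of F])
    show "F \<in> events" unfolding F_def using borel_measurable_integrable[OF fi] by measurable
    show "prob F \<le> d" unfolding F_def by (rule markov_bound[OF fi f0 fE _ d]) simp
    fix \<omega> assume \<omega>: "\<omega> \<in> space M - F"
    have Z: "noise_mat \<omega> \<in> carrier_mat n m" using noise_mat \<omega> by simp
    have ZT: "(noise_mat \<omega>)\<^sup>T \<in> carrier_mat m n" using Z by simp
    define D where "D = (1 / real n) \<cdot>\<^sub>m ((noise_mat \<omega>)\<^sup>T * noise_mat \<omega>) - (G + \<tau>\<^sup>2 \<cdot>\<^sub>m 1\<^sub>m m)"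
    have D: "D \<in> carrier_mat m m" using G by (simp add: D_def)
    have Dkl: "D $$ (k,l) = (\<Sum>i<n. eps i k \<omega> * eps i l \<omega>) / real n - c k l" if kl: "k < m" "l < m" for k l
    proof -
      have "((noise_mat \<omega>)\<^sup>T * noise_mat \<omega>) $$ (k,l) = (\<Sum>i<n. (noise_mat \<omega>)\<^sup>T $$ (k,i) * noise_mat \<omega> $$ (i,l))"
        by (rule mult_mat_index[OF ZT Z kl])
      also have "\<dots> = (\<Sum>i<n. eps i k \<omega> * eps i l \<omega>)"
        using Z kl \<omega> by (intro sum.cong refl) (auto simp: noise_mat_entry)
      finally show ?thesis using kl Z G by (simp add: D_def c_def)
    qed
    have "(frob_norm D)\<^sup>2 = f \<omega>"
      unfolding frob_sq fip_eq[OF D] f_def h_def by (intro sum.cong refl) (simp add: Dkl power2_eq_square)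
    also have "\<dots> \<le> 16384 * V\<^sup>2 / real n / d" using \<omega> by (auto simp: F_def)
    finally show "(frob_norm ((1 / real n) \<cdot>\<^sub>m ((noise_mat \<omega>)\<^sup>T * noise_mat \<omega>) - (G + \<tau>\<^sup>2 \<cdot>\<^sub>m 1\<^sub>m m)))\<^sup>2 \<le> 16384 * V\<^sup>2 / real n / d"
      by (simp add: D_def)
  qed
qed

lemma bad_quadratic:
  assumes d: "0 < d" and H: "H \<in> carrier_mat n n" and psd: "\<And>Z k. Z \<in> carrier_mat n k \<Longrightarrow> 0 \<le> fip Z (H * Z)"
  obtains F where "F \<in> events" "prob F \<le> d"
    "\<And>\<omega>. \<omega> \<in> space M - F \<Longrightarrow> fip (noise_mat \<omega>) (H * noise_mat \<omega>) \<le> 16 * V * fip (1\<^sub>m n) H / d"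
proof -
  define f where "f \<omega> = (\<Sum>k<m. \<Sum>i<n. \<Sum>j<n. H $$ (i,j) * (eps i k \<omega> * eps j k \<omega>))" for \<omega>
  have quad: "fip Z (H * Z) = (\<Sum>k<l. \<Sum>i<n. \<Sum>j<n. H $$ (i,j) * (Z $$ (i,k) * Z $$ (j,k)))" if Z: "Z \<in> carrier_mat n l" for Z l
  proof -
    have "fip Z (H * Z) = (\<Sum>i<n. \<Sum>k<l. Z $$ (i,k) * (\<Sum>j<n. H $$ (i,j) * Z $$ (j,k)))"
      unfolding fip_eq[OF Z] by (intro sum.cong refl) (simp add: mult_mat_index[OF H Z] del: index_mult_mat)
    also have "\<dots> = (\<Sum>k<l. \<Sum>i<n. Z $$ (i,k) * (\<Sum>j<n. H $$ (i,j) * Z $$ (j,k)))" by (rule sum.swap)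
    finally show ?thesis by (simp add: sum_distrib_left mult_ac)
  qed
  have f0: "0 \<le> f \<omega>" for \<omega>
  proof -
    define Z where "Z = mat n m (\<lambda>(i,k). eps i k \<omega>)"
    have Z: "Z \<in> carrier_mat n m" by (simp add: Z_def)
    have "f \<omega> = fip Z (H * Z)" unfolding quad[OF Z] f_def by (simp add: Z_def)
    then show ?thesis using psd[OF Z] by simp
  qed
  have H0: "0 \<le> H $$ (i,i)" if i: "i < n" for i
  proof -
    \<comment> \<open>Semidefiniteness is tested on a one-column matrix to read off a diagonal
      entry.\<close>
    define Z where "Z = mat n 1 (\<lambda>(j,_). if j = i then 1 else (0::real))"
    have Z: "Z \<in> carrier_mat n 1" by (simp add: Z_def)
    have "fip Z (H * Z) = (\<Sum>a<n. \<Sum>j<n. H $$ (a,j) * (Z $$ (a,0) * Z $$ (j,0)))"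
      unfolding quad[OF Z] by simp
    also have "\<dots> = (\<Sum>a<n. \<Sum>j<n. if j = i then (if a = i then H $$ (i,i) else 0) else 0)"
      by (intro sum.cong refl) (auto simp: Z_def)
    also have "\<dots> = H $$ (i,i)" using i by simp
    finally show ?thesis using psd[OF Z] by simp
  qed
  have tr: "fip (1\<^sub>m n) H = (\<Sum>i<n. H $$ (i,i))"
  proof -
    have "fip (1\<^sub>m n) H = (\<Sum>i<n. \<Sum>j<n. if j = i then H $$ (i,i) else 0)"
      unfolding fip_eq[OF one_carrier_mat]
    proof (rule sum.cong[OF refl])
      fix i assume "i \<in> {..<n}"
      then show "(\<Sum>j<n. 1\<^sub>m n $$ (i,j) * H $$ (i,j)) = (\<Sum>j<n. if j = i then H $$ (i,i) else 0)"
        by (intro sum.cong refl) auto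
    qed
    then show ?thesis by simp
  qed
  note q = quadratic_form_expectation[of "\<lambda>i j. H $$ (i,j)", OF H0]
  have fi: "integrable M f" unfolding f_def by (rule q(1))
  have fE: "expectation f \<le> 16 * V * fip (1\<^sub>m n) H" using q(2) by (simp add: f_def[abs_def] tr)
  have B0: "0 \<le> 16 * V * fip (1\<^sub>m n) H" unfolding tr V_def by (intro mult_nonneg_nonneg sum_nonneg) (auto intro: H0)
  define F where "F = {\<omega> \<in> space M. \<not> f \<omega> \<le> 16 * V * fip (1\<^sub>m n) H / d}"
  show ?thesis
  proof (rule that[of F])
    show "F \<in> events" unfolding F_def using borel_measurable_integrable[OF fi] by measurable
    show "prob F \<le> d" unfolding F_def by (rule markov_bound[OF fi f0 fE B0 d])
    fix \<omega> assume \<omega>: "\<omega> \<in> space M - F"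
    have Z: "noise_mat \<omega> \<in> carrier_mat n m" using noise_mat \<omega> by simp
    have "fip (noise_mat \<omega>) (H * noise_mat \<omega>) = f \<omega>"
      unfolding quad[OF Z] f_def using \<omega> by (intro sum.cong refl) (simp add: noise_mat_entry)
    then show "fip (noise_mat \<omega>) (H * noise_mat \<omega>) \<le> 16 * V * fip (1\<^sub>m n) H / d" using \<omega> by (auto simp: F_def)
  qed
qed

end

section \<open>The model for a fixed sample size\<close>

context hv_noise
begin

lemma quad_G: "v \<in> carrier_vec m \<Longrightarrow> v \<bullet> (G *\<^sub>v v) = (vnorm (N *\<^sub>v (B *\<^sub>v v)))\<^sup>2"
proof -
  assume v: "v \<in> carrier_vec m"
  have Bv: "B *\<^sub>v v \<in> carrier_vec K" using B v by simp
  have BT: "B\<^sup>T \<in> carrier_mat m K" and SB: "\<Sigma>W * B \<in> carrier_mat K m" and SBv: "\<Sigma>W *\<^sub>v (B *\<^sub>v v) \<in> carrier_vec K"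
    using B S Bv by auto
  have "G = B\<^sup>T * (\<Sigma>W * B)" unfolding G_def by (rule assoc_mult_mat[OF BT S B])
  then have "G *\<^sub>v v = B\<^sup>T *\<^sub>v (\<Sigma>W *\<^sub>v (B *\<^sub>v v))"
    using assoc_mult_mat_vec[OF BT SB v] assoc_mult_mat_vec[OF S B v] by simp
  then have "v \<bullet> (G *\<^sub>v v) = (B\<^sup>T *\<^sub>v (\<Sigma>W *\<^sub>v (B *\<^sub>v v))) \<bullet> v"
    using v BT SBv comm_scalar_prod[of v m "B\<^sup>T *\<^sub>v (\<Sigma>W *\<^sub>v (B *\<^sub>v v))"] by simp
  also have "\<dots> = (\<Sigma>W *\<^sub>v (B *\<^sub>v v)) \<bullet> (B *\<^sub>v v)" by (rule transpose_vec_mult_scalar[OF B v SBv])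
  also have "\<dots> = (B *\<^sub>v v) \<bullet> (\<Sigma>W *\<^sub>v (B *\<^sub>v v))" using SBv Bv by (rule comm_scalar_prod)
  also have "\<dots> = (vnorm (N *\<^sub>v (B *\<^sub>v v)))\<^sup>2" by (rule vnorm_N[OF Bv, symmetric])
  finally show ?thesis .
qed

lemma G_sym: "G\<^sup>T = G"
proof (rule eq_matI)
  fix k l assume "k < dim_row G" "l < dim_col G"
  then have kl: "k < m" "l < m" using G by auto
  have "G $$ (l,k) = G $$ (k,l)"
    unfolding G_entry[OF kl] G_entry[OF kl(2,1)]
    using symmetric_scalar_prod[OF S S_sym colB[OF kl(1)] colB[OF kl(2)]] colB[OF kl(1)] colB[OF kl(2)] S
      comm_scalar_prod[of "col B l" K "\<Sigma>W *\<^sub>v col B k"] by simp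
  then show "G\<^sup>T $$ (k,l) = G $$ (k,l)" using kl G by simp
qed (use G in auto)

lemma kth_G_nonneg: "1 \<le> k \<Longrightarrow> k \<le> m \<Longrightarrow> 0 \<le> kth_eigenvalue G k"
  using kth_eigenvalue_nonneg[OF G G_sym, of "k - 1"] quad_G by simp

end

text \<open>The last six reals are the uniform bounds hidden in the asymptotic hypotheses. All
  constants defined in this locale depend only on them and on the two noise constants, so they are
  the same for all sample sizes.\<close>

locale hv_model = hv_noise M n K m \<gamma>w \<gamma>e \<Sigma>W \<tau> W E B
  for M :: "'a measure" and n K m :: nat and \<gamma>w \<gamma>e :: real and \<Sigma>W :: "real mat" and \<tau> :: real
    and W E :: "'a \<Rightarrow> real mat" and B :: "real mat" +
  fixes X \<Psi> A :: "real mat" and p s :: nat and Rb :: real and ck cF cl cu cK :: real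
  assumes X: "X \<in> carrier_mat n p" and Psi: "\<Psi> \<in> carrier_mat p m" and A: "A \<in> carrier_mat p K"
    and rank_B: "mat_rank B = K" and p1: "1 \<le> p" and K1: "1 \<le> K" and Km: "K < m"
    and design: "\<And>j. j < p \<Longrightarrow> sample_cov X $$ (j,j) = 1"
    and sparse: "l0l2_norm \<Psi> \<le> s" and Rb: "0 \<le> Rb" "(frob_norm (A * B))\<^sup>2 \<le> Rb"
    and re_pos: "re_const X m s 4 > 0" and re_inv: "real_of_ereal (inverse (re_const X m s 4)) \<le> ck"
    and opF: "1 / real n * (op_norm (X * (\<Psi> + A * B)))\<^sup>2 \<le> cF * (real m + real s)"
    and Lam1: "kth_eigenvalue (B\<^sup>T * \<Sigma>W * B) 1 \<le> cu * real m"
    and LamK: "cl * real m \<le> kth_eigenvalue (B\<^sup>T * \<Sigma>W * B) K"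
    and KcK: "real K \<le> cK * real n"
    and cpos: "1 \<le> ck" "1 \<le> cF" "0 < cl" "1 \<le> cu" "1 \<le> cK"
begin

definition L :: "real mat" where "L = A * B"
definition F :: "real mat" where "F = \<Psi> + L"
definition P :: "real mat" where "P = proj_rows B"
definition sig :: real where "sig = kth_eigenvalue (sample_cov X) 1"
definition supp :: "nat set" where "supp = {j. j < p \<and> row \<Psi> j \<noteq> 0\<^sub>v m}"

lemma n0: "0 < n" and m0: "0 < m" using n Km by auto

lemma L: "L \<in> carrier_mat p m" using A B by (simp add: L_def)
lemma F: "F \<in> carrier_mat p m" using Psi L by (simp add: F_def)
lemma L_Rb: "fip L L \<le> Rb" using Rb(2) by (simp add: L_def frob_sq)

lemma supp: "supp \<subseteq> {..<p}" "card supp \<le> s" "\<And>j. j < p \<Longrightarrow> j \<notin> supp \<Longrightarrow> row \<Psi> j = 0\<^sub>v m"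
  using sparse Psi by (auto simp: supp_def l0l2_norm_def)

lemma proj: "is_proj m K P" and PBT: "P * B\<^sup>T = B\<^sup>T" and BP: "B * P = B"
  using proj_rows_is_proj[OF B rank_B] by (auto simp: P_def)

lemmas projD = is_projD[OF proj]

lemma PG: "P * G = G" and GP: "G * P = G"
proof -
  have BT: "B\<^sup>T \<in> carrier_mat m K" and BTS: "B\<^sup>T * \<Sigma>W \<in> carrier_mat m K" using B S by auto
  have "G * P = B\<^sup>T * \<Sigma>W * (B * P)" unfolding G_def by (rule assoc_mult_mat[OF BTS B projD(1)])
  then show GP: "G * P = G" by (simp add: BP G_def)
  show "P * G = G" using arg_cong[OF GP, of transpose_mat] transpose_mult[OF G projD(1)] projD(2) G_sym by simp
qed

lemma quad_G_le: "v \<in> carrier_vec m \<Longrightarrow> v \<bullet> (G *\<^sub>v v) \<le> cu * real m * (v \<bullet> v)"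
  using quadratic_le_largest[OF G G_sym, of v] Lam1 vnorm_sq[of v]
  by (metis G_def mult_right_mono order_trans zero_le_power2)

lemma quad_G_ge: "v \<in> carrier_vec m \<Longrightarrow> cl * real m * (vnorm (P *\<^sub>v v))\<^sup>2 \<le> v \<bullet> (G *\<^sub>v v)"
proof -
  assume v: "v \<in> carrier_vec m"
  have pos: "0 < cl * real m" using cpos m0 by simp
  have psd: "0 \<le> v \<bullet> (G *\<^sub>v v)" if "v \<in> carrier_vec m" for v using quad_G[OF that] by simp
  have "cl * real m * (vnorm (P *\<^sub>v v))\<^sup>2 \<le> kth_eigenvalue G K * (vnorm (P *\<^sub>v v))\<^sup>2"
    using LamK by (intro mult_right_mono) (auto simp: G_def)
  also have "\<dots> \<le> v \<bullet> (G *\<^sub>v v)"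
    using LamK pos K1 Km by (intro quadratic_ge_kth[OF G G_sym psd proj PG _ _ _ v]) (auto simp: G_def)
  finally show ?thesis .
qed

section \<open>Trace and operator norm of the noise covariance\<close>

definition cV :: real where "cV = \<gamma>w\<^sup>2 * cu + \<gamma>e\<^sup>2"

lemma cV_pos: "0 < cV" using gw ge cpos by (simp add: cV_def add_pos_pos)

text \<open>G = G P, so the trace of G is an inner product with a projection of rank K; each
  direction contributes at most the largest eigenvalue. This is the origin of the factor K in the
  rates.\<close>

lemma trace_G: "(\<Sum>k<m. G $$ (k,k)) \<le> cu * real m * real K"
proof -
  have "(\<Sum>k<m. G $$ (k,k)) = fip (1\<^sub>m m) G"
  proof -
    have "fip (1\<^sub>m m) G = (\<Sum>i<m. \<Sum>j<m. if j = i then G $$ (i,i) else 0)"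
      unfolding fip_eq[OF one_carrier_mat] by (intro sum.cong refl) auto
    then show ?thesis by simp
  qed
  also have "\<dots> = fip G (1\<^sub>m m)" using G by (intro fip_commute) auto
  also have "\<dots> = fip (G * P) (1\<^sub>m m)" by (simp add: GP)
  also have "\<dots> = fip G P" using fip_mult_left2[OF G projD(1), of "1\<^sub>m m"] projD by simp
  also have "\<dots> = (\<Sum>a<m. col P a \<bullet> (G *\<^sub>v col P a))" by (rule fip_proj[OF proj G])
  also have "\<dots> \<le> (\<Sum>a<m. cu * real m * (col P a \<bullet> col P a))" using projD by (intro sum_mono quad_G_le) auto
  also have "\<dots> = cu * real m * fip P P" using fip_cols[OF projD(1) projD(1)] by (simp add: sum_distrib_left)
  finally show ?thesis using projD by simp
qed

lemma V_eq: "V = \<gamma>w\<^sup>2 * (\<Sum>k<m. G $$ (k,k)) + \<gamma>e\<^sup>2 * real m"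
proof -
  have "V = (\<Sum>k<m. \<gamma>w\<^sup>2 * G $$ (k,k) + \<gamma>e\<^sup>2)" unfolding V_def by (intro sum.cong refl) (simp add: g_sq)
  then show ?thesis by (simp add: sum.distrib sum_distrib_left)
qed

lemma G_diag_nonneg: "k < m \<Longrightarrow> 0 \<le> G $$ (k,k)" by (simp add: G_diag)

lemma V_pos: "0 < V"
  unfolding V_eq using ge m0 by (intro add_nonneg_pos mult_nonneg_nonneg sum_nonneg G_diag_nonneg) auto

lemma V_le: "V \<le> cV * (real K * real m)"
proof -
  have "V \<le> \<gamma>w\<^sup>2 * (cu * real m * real K) + \<gamma>e\<^sup>2 * real m"
    unfolding V_eq by (intro add_mono mult_left_mono trace_G) auto
  also have "\<gamma>e\<^sup>2 * real m \<le> \<gamma>e\<^sup>2 * (real K * real m)" using K1 mult_right_mono[of 1 "real K" "real m"] by (intro mult_left_mono) auto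
  finally show ?thesis by (simp add: cV_def algebra_simps)
qed

abbreviation "Gam \<equiv> Gamma_eps \<gamma>w \<gamma>e \<Sigma>W B"

lemma Gam_eq: "Gam = \<gamma>w\<^sup>2 \<cdot>\<^sub>m G + \<gamma>e\<^sup>2 \<cdot>\<^sub>m 1\<^sub>m m"
  using B by (simp add: Gamma_eps_def G_def)

lemma Gam: "Gam \<in> carrier_mat m m" unfolding Gam_eq using G by simp

lemma trace_Gam: "mat_trace Gam = V"
proof -
  have d: "dim_row Gam = m" using Gam by simp
  have "mat_trace Gam = (\<Sum>k<m. \<gamma>w\<^sup>2 * G $$ (k,k) + \<gamma>e\<^sup>2)"
    unfolding mat_trace_def d unfolding Gam_eq using G by (intro sum.cong refl) auto
  then show ?thesis by (simp add: V_eq sum.distrib sum_distrib_left)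
qed

lemma frob_G: "frob_norm G \<le> (\<Sum>k<m. G $$ (k,k))"
proof -
  have NB: "N * B \<in> carrier_mat K m" using N B by simp
  have "G = (N * B)\<^sup>T * (N * B)"
  proof -
    have BT: "B\<^sup>T \<in> carrier_mat m K" using B by simp
    have "(N * B)\<^sup>T = B\<^sup>T * N" using transpose_mult[OF N B] N_sym by simp
    then have "(N * B)\<^sup>T * (N * B) = B\<^sup>T * (N * (N * B))" using assoc_mult_mat[OF BT N NB] by simp
    also have "N * (N * B) = \<Sigma>W * B" using assoc_mult_mat[OF N N B] NN by simp
    also have "B\<^sup>T * (\<Sigma>W * B) = G" unfolding G_def by (rule assoc_mult_mat[OF BT S B, symmetric])
    finally show ?thesis by simp
  qed
  then have "frob_norm G \<le> (frob_norm (N * B))\<^sup>2" using frob_gram[OF NB] by simp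
  also have "\<dots> = (\<Sum>k<m. (vnorm (col (N * B) k))\<^sup>2)" by (rule frob_sq_cols[OF NB])
  also have "\<dots> = (\<Sum>k<m. G $$ (k,k))" using N B by (intro sum.cong refl) (simp add: G_diag del: col_mult2 flip: col_mult2[OF N B])
  finally show ?thesis .
qed

lemma bdd_op:
  assumes "Z \<in> carrier_mat a b"
  shows "bdd_above {vnorm (Z *\<^sub>v v) |v. v \<in> carrier_vec (dim_col Z) \<and> vnorm v \<le> 1}"
proof (rule bdd_aboveI[of _ "frob_norm Z"])
  fix x assume "x \<in> {vnorm (Z *\<^sub>v v) |v. v \<in> carrier_vec (dim_col Z) \<and> vnorm v \<le> 1}"
  then obtain v where v: "x = vnorm (Z *\<^sub>v v)" "v \<in> carrier_vec b" "vnorm v \<le> 1" using assms by auto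
  have "x \<le> frob_norm Z * vnorm v" using vnorm_mult_le_frob[OF assms v(2)] v(1) by simp
  also have "\<dots> \<le> frob_norm Z * 1" using v(3) by (intro mult_left_mono) auto
  finally show "x \<le> frob_norm Z" by simp
qed

lemma op_norm_bound:
  assumes Z: "Z \<in> carrier_mat a b" and v: "v \<in> carrier_vec b"
  shows "vnorm (Z *\<^sub>v v) \<le> op_norm Z * vnorm v" "0 \<le> op_norm Z"
proof -
  have up: "vnorm (Z *\<^sub>v v) \<le> op_norm Z" if "v \<in> carrier_vec b" "vnorm v \<le> 1" for v
    unfolding op_norm_def using that Z by (intro cSup_upper bdd_op[OF Z]) auto
  show "0 \<le> op_norm Z" using order_trans[OF vnorm_ge0 up[of "0\<^sub>v b"]] by (simp add: vnorm_0)
  show "vnorm (Z *\<^sub>v v) \<le> op_norm Z * vnorm v"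
  proof (cases "vnorm v = 0")
    case True
    then show ?thesis using vnorm_mult_le_frob[OF Z v] by simp
  next
    case False
    define v' where "v' = (1 / vnorm v) \<cdot>\<^sub>v v"
    have v': "v' \<in> carrier_vec b" "vnorm v' \<le> 1" using v False by (auto simp: v'_def vnorm_smult)
    have "v = vnorm v \<cdot>\<^sub>v v'" using False by (simp add: v'_def smult_smult_assoc)
    then have "Z *\<^sub>v v = vnorm v \<cdot>\<^sub>v (Z *\<^sub>v v')" using mult_mat_vec[OF Z v'(1), of "vnorm v"] by simp
    then show ?thesis using mult_left_mono[OF up[OF v'], of "vnorm v"] by (simp add: vnorm_smult mult.commute)
  qed
qed

text \<open>Together these give an effective rank of at least 1, on which the choice of \<epsilon>'
  in the first penalty relies.\<close>

lemma op_norm_Gam: "0 < op_norm Gam" "op_norm Gam \<le> V"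
proof -
  show "op_norm Gam \<le> V"
    unfolding op_norm_def
  proof (rule cSup_least)
    show "{vnorm (Gam *\<^sub>v v) |v. v \<in> carrier_vec (dim_col Gam) \<and> vnorm v \<le> 1} \<noteq> {}"
      using Gam vnorm_0 by (fastforce intro: exI[of _ "0\<^sub>v m"])
    fix x assume "x \<in> {vnorm (Gam *\<^sub>v v) |v. v \<in> carrier_vec (dim_col Gam) \<and> vnorm v \<le> 1}"
    then obtain v where v: "x = vnorm (Gam *\<^sub>v v)" "v \<in> carrier_vec m" "vnorm v \<le> 1" using Gam by auto
    have Gv: "G *\<^sub>v v \<in> carrier_vec m" using G v by simp
    have "Gam *\<^sub>v v = (\<gamma>w\<^sup>2 \<cdot>\<^sub>m G) *\<^sub>v v + (\<gamma>e\<^sup>2 \<cdot>\<^sub>m 1\<^sub>m m) *\<^sub>v v"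
      unfolding Gam_eq using G v by (intro add_mult_distrib_mat_vec[of _ m m]) auto
    also have "(\<gamma>w\<^sup>2 \<cdot>\<^sub>m G) *\<^sub>v v = \<gamma>w\<^sup>2 \<cdot>\<^sub>v (G *\<^sub>v v)" using G v by (intro eq_vecI) auto
    also have "(\<gamma>e\<^sup>2 \<cdot>\<^sub>m 1\<^sub>m m) *\<^sub>v v = \<gamma>e\<^sup>2 \<cdot>\<^sub>v v" using v by (intro eq_vecI) (auto simp: scalar_prod_left_unit)
    finally have "x \<le> \<gamma>w\<^sup>2 * vnorm (G *\<^sub>v v) + \<gamma>e\<^sup>2 * vnorm v"
      using vnorm_add[of "\<gamma>w\<^sup>2 \<cdot>\<^sub>v (G *\<^sub>v v)" m "\<gamma>e\<^sup>2 \<cdot>\<^sub>v v"] v Gv by (simp add: vnorm_smult del: index_mult_mat_vec)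
    also have "\<dots> \<le> \<gamma>w\<^sup>2 * ((\<Sum>k<m. G $$ (k,k)) * 1) + \<gamma>e\<^sup>2 * real m"
    proof (intro add_mono mult_left_mono)
      have "vnorm (G *\<^sub>v v) \<le> frob_norm G * vnorm v" by (rule vnorm_mult_le_frob[OF G v(2)])
      also have "\<dots> \<le> (\<Sum>k<m. G $$ (k,k)) * 1" using v(3) frob_G by (intro mult_mono sum_nonneg G_diag_nonneg) auto
      finally show "vnorm (G *\<^sub>v v) \<le> (\<Sum>k<m. G $$ (k,k)) * 1" .
      show "vnorm v \<le> real m" using v(3) m0 by linarith
    qed auto
    finally show "x \<le> V" by (simp add: V_eq)
  qed
  have u: "unit_vec m 0 \<in> carrier_vec m" by simp
  have "(vnorm (unit_vec m 0 :: real vec))\<^sup>2 = 1\<^sup>2" unfolding vnorm_sq using m0 by (simp add: scalar_prod_left_unit[of _ m])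
  then have vu: "vnorm (unit_vec m 0) = 1" using vnorm_ge0 power2_eq_imp_eq by fastforce
  have "\<gamma>e\<^sup>2 \<le> unit_vec m 0 \<bullet> (Gam *\<^sub>v unit_vec m 0)"
  proof -
    have "unit_vec m 0 \<bullet> (Gam *\<^sub>v unit_vec m 0) = Gam $$ (0,0)"
      using Gam m0 by (simp add: scalar_prod_left_unit[of _ m] scalar_prod_right_unit[of _ m])
    also have "\<dots> = \<gamma>w\<^sup>2 * G $$ (0,0) + \<gamma>e\<^sup>2" unfolding Gam_eq using G m0 by simp
    finally show ?thesis using G_diag_nonneg[OF m0] by simp
  qed
  also have "\<dots> \<le> vnorm (unit_vec m 0) * vnorm (Gam *\<^sub>v unit_vec m 0)"
    using scalar_prod_le_vnorm[OF u, of "Gam *\<^sub>v unit_vec m 0"] Gam by simp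
  also have "\<dots> \<le> op_norm Gam" using op_norm_bound(1)[OF Gam u] vu by simp
  finally show "0 < op_norm Gam" using ge by (smt (verit) zero_less_power)
qed

lemma eff_rank: "1 \<le> effective_rank Gam"
  using op_norm_Gam by (simp add: effective_rank_def trace_Gam)

section \<open>Normalized design and sample covariance\<close>

lemma col_X: "j < p \<Longrightarrow> (vnorm (col X j))\<^sup>2 = real n"
proof -
  assume j: "j < p"
  have "sample_cov X $$ (j,j) = (1 / real n) * (col X j \<bullet> col X j)" using X j by (simp add: sample_cov_def)
  then show ?thesis using design[OF j] n0 by (simp add: vnorm_sq field_simps)
qed

lemma fip_X: "fip X X = real n * real p"
  using fip_cols[OF X X] col_X by (simp add: vnorm_sq[symmetric])

lemma sample_cov_X: "sample_cov X \<in> carrier_mat p p" "(sample_cov X)\<^sup>T = sample_cov X"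
    "v \<in> carrier_vec p \<Longrightarrow> v \<bullet> (sample_cov X *\<^sub>v v) = (vnorm (X *\<^sub>v v))\<^sup>2 / real n"
proof -
  have XT: "X\<^sup>T \<in> carrier_mat p n" and XX: "X\<^sup>T * X \<in> carrier_mat p p" using X by auto
  have d: "sample_cov X = (1 / real n) \<cdot>\<^sub>m (X\<^sup>T * X)" using X by (simp add: sample_cov_def)
  show "sample_cov X \<in> carrier_mat p p" unfolding d using XX by simp
  have "(X\<^sup>T * X)\<^sup>T = X\<^sup>T * X" using transpose_mult[OF XT X] by simp
  then show "(sample_cov X)\<^sup>T = sample_cov X" unfolding d by (simp only: transpose_smult_mat)
  assume v: "v \<in> carrier_vec p"
  have Xv: "X *\<^sub>v v \<in> carrier_vec n" using X v by simp
  have c: "X\<^sup>T *\<^sub>v (X *\<^sub>v v) \<in> carrier_vec p" using XT Xv by simp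
  have "sample_cov X *\<^sub>v v = (1 / real n) \<cdot>\<^sub>v ((X\<^sup>T * X) *\<^sub>v v)" unfolding d using XX v by (intro eq_vecI) auto
  also have "(X\<^sup>T * X) *\<^sub>v v = X\<^sup>T *\<^sub>v (X *\<^sub>v v)" by (rule assoc_mult_mat_vec[OF XT X v])
  finally have "v \<bullet> (sample_cov X *\<^sub>v v) = (1 / real n) * (v \<bullet> (X\<^sup>T *\<^sub>v (X *\<^sub>v v)))" using v c by simp
  also have "v \<bullet> (X\<^sup>T *\<^sub>v (X *\<^sub>v v)) = (X\<^sup>T *\<^sub>v (X *\<^sub>v v)) \<bullet> v" by (rule comm_scalar_prod[OF v c])
  also have "\<dots> = (X *\<^sub>v v) \<bullet> (X *\<^sub>v v)" by (rule transpose_vec_mult_scalar[OF X v Xv])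
  finally show "v \<bullet> (sample_cov X *\<^sub>v v) = (vnorm (X *\<^sub>v v))\<^sup>2 / real n" by (simp add: vnorm_sq)
qed

lemma sig0: "0 \<le> sig"
  using kth_eigenvalue_nonneg[OF sample_cov_X(1,2), of 0] sample_cov_X(3) p1 by (simp add: sig_def)

lemma sig_bound:
  assumes Z: "Z \<in> carrier_mat p k"
  shows "fip (X * Z) (X * Z) \<le> real n * sig * fip Z Z"
proof -
  have "frob_norm (X * Z) \<le> sqrt (real n * sig) * frob_norm Z"
  proof (rule frob_mult_le_op[OF X Z])
    show "0 \<le> sqrt (real n * sig)" using sig0 by simp
    fix v :: "real vec" assume v: "v \<in> carrier_vec p"
    have "(vnorm (X *\<^sub>v v))\<^sup>2 / real n \<le> sig * (vnorm v)\<^sup>2"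
      using quadratic_le_largest[OF sample_cov_X(1,2) v] sample_cov_X(3)[OF v] by (simp add: sig_def vnorm_sq)
    then have "(vnorm (X *\<^sub>v v))\<^sup>2 \<le> sig * (vnorm v)\<^sup>2 * real n" using n0 by (simp add: pos_divide_le_eq)
    also have "\<dots> = (sqrt (real n * sig) * vnorm v)\<^sup>2" using sig0 by (simp only: power_mult_distrib) simp
    finally show "vnorm (X *\<^sub>v v) \<le> sqrt (real n * sig) * vnorm v" by (rule power2_le_imp_le) (use sig0 in simp)
  qed
  then have "(frob_norm (X * Z))\<^sup>2 \<le> (sqrt (real n * sig) * frob_norm Z)\<^sup>2" by (intro power_mono) auto
  then show ?thesis using sig0 by (simp add: power_mult_distrib frob_sq)
qed

lemma max_diag_sample_cov: "max_diag (sample_cov X) = 1"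
proof -
  have d: "dim_row (sample_cov X) = p" using sample_cov_X(1) by simp
  have "(\<lambda>j. sample_cov X $$ (j,j)) ` {..<p} = (\<lambda>j. 1) ` {..<p}" by (rule image_cong[OF refl]) (simp add: design)
  moreover have "0 \<in> {..<p}" using p1 by simp
  then have "{..<p} \<noteq> {}" by blast
  ultimately show ?thesis by (simp add: max_diag_def d image_constant_conv)
qed

lemma re_bound:
  assumes "D \<in> re_cone p m supp 4"
  shows "(frob_norm (restrict_rows supp D))\<^sup>2 \<le> ck\<^sup>2 * (fip (X * D) (X * D) / real n)"
  using re_const_bound[OF X n0 _ re_pos re_inv supp(1,2) assms] cpos by simp

definition err :: real where "err = Err_P n p m K s (mat_rank X) sig Rb"

lemma err_ge: "real K / sqrt (real n) \<le> err" "0 \<le> err"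
proof -
  have "0 \<le> Min {sig * Rb / real m + real K * real s / real n,
          real (mat_rank X) * real K / real n,
          sqrt ((real p + sig * real s) * real K * Rb / (real n * real m)) + real K * real s / real n}"
    using sig0 Rb by (intro Min.boundedI) (auto intro!: add_nonneg_nonneg)
  then show "real K / sqrt (real n) \<le> err" unfolding err_def Err_P_def by simp
  moreover have "0 \<le> real K / sqrt (real n)" by simp
  ultimately show "0 \<le> err" by linarith
qed

end

section \<open>Choice of the ridge penalty\<close>

text \<open>The bound by 1 is the usual penalty level for a normalized design; the bound by \<nu>
  makes the penalty disappear with \<nu>.\<close>

lemma (in ridge) max_diag_ridge_M:
  assumes p: "1 \<le> p"
  shows "\<And>j. j < p \<Longrightarrow> (vnorm (col (Q * X) j))\<^sup>2 \<le> real n * max_diag (ridge_M X \<nu>)"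
    "0 \<le> max_diag (ridge_M X \<nu>)" "max_diag (ridge_M X \<nu>) \<le> \<nu>"
    "(\<And>j. j < p \<Longrightarrow> (vnorm (col X j))\<^sup>2 \<le> real n) \<Longrightarrow> max_diag (ridge_M X \<nu>) \<le> 1"
proof -
  let ?D = "(\<lambda>j. ridge_M X \<nu> $$ (j,j)) ` {..<p}"
  have d: "dim_row (ridge_M X \<nu>) = p" using X by (simp add: ridge_M_def)
  have md: "max_diag (ridge_M X \<nu>) = Max ?D" by (simp add: max_diag_def d)
  have "0 \<in> {..<p}" using p by simp
  then have ne: "?D \<noteq> {}" by blast
  have n: "0 < real n" using n_pos by simp
  show up: "(vnorm (col (Q * X) j))\<^sup>2 \<le> real n * max_diag (ridge_M X \<nu>)" if j: "j < p" for j
  proof -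
    have "ridge_M X \<nu> $$ (j,j) \<le> Max ?D" using j by (intro Max_ge) auto
    then show ?thesis unfolding md ridge_M_diag[OF j] using n by (simp add: divide_le_eq mult.commute)
  qed
  have "0 \<le> real n * max_diag (ridge_M X \<nu>)"
    using up[of 0] p order_trans[OF zero_le_power2] by fastforce
  then show "0 \<le> max_diag (ridge_M X \<nu>)" using n by (simp add: zero_le_mult_iff)
  have *: "max_diag (ridge_M X \<nu>) \<le> c" if c: "\<And>j. j < p \<Longrightarrow> (vnorm (col (Q * X) j))\<^sup>2 \<le> real n * c" for c
    unfolding md using ne c ridge_M_diag n by (intro Max.boundedI) (auto simp: divide_le_eq mult.commute)
  show "max_diag (ridge_M X \<nu>) \<le> \<nu>" by (rule *) (rule vnorm_col_QX_le)
  assume "\<And>j. j < p \<Longrightarrow> (vnorm (col X j))\<^sup>2 \<le> real n"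
  then show "max_diag (ridge_M X \<nu>) \<le> 1"
    by (intro *) (metis vnorm_col_QX_le(2) order_trans mult.right_neutral)
qed

context hv_model
begin

lemma ridge: "0 < \<nu> \<Longrightarrow> ridge X n p \<nu>"
  using X n0 by unfold_locales

text \<open>The first penalty at the value of \<epsilon>' for which 2 ln(p / \<epsilon>') divided by
  the effective rank equals 2 T.\<close>

definition lam :: "real \<Rightarrow> real \<Rightarrow> real" where
  "lam T \<nu> = 4 * sqrt (max_diag (ridge_M X \<nu>)) * (1 + sqrt (2 * T)) * sqrt (V / real n)"

definition bias :: "real \<Rightarrow> real" where "bias \<nu> = fip (X * L) (ridge_Q X \<nu> * (X * L)) / real n"

definition dof :: "real \<Rightarrow> real" where "dof \<nu> = fip (1\<^sub>m n) (1\<^sub>m n) - fip (1\<^sub>m n) (ridge_Q X \<nu>)"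

text \<open>The factor 200 exceeds 2 * 96, the largest numerical coefficient arising from the three
  choices of \<nu> below.\<close>

definition C0 :: real where "C0 = 200 * ck\<^sup>2 * (1 + cV)"

lemma max_diag_M:
  assumes "0 < \<nu>"
  shows "0 \<le> max_diag (ridge_M X \<nu>)" "max_diag (ridge_M X \<nu>) \<le> \<nu>" "max_diag (ridge_M X \<nu>) \<le> 1"
  using ridge.max_diag_ridge_M(2-)[OF ridge[OF assms] p1] col_X by auto

lemma one_plus_sqrt_sq: "1 \<le> T \<Longrightarrow> (1 + sqrt (2 * T))\<^sup>2 \<le> 6 * (T::real)"
proof -
  assume T: "1 \<le> T"
  have "(1 + sqrt (2 * T))\<^sup>2 \<le> 2 * 1\<^sup>2 + 2 * (sqrt (2 * T))\<^sup>2"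
    using sum_squares_bound[of 1 "sqrt (2 * T)"] by (simp add: power2_eq_square algebra_simps)
  then show ?thesis using T by simp
qed

lemma lam_nonneg: "0 < \<nu> \<Longrightarrow> 0 \<le> T \<Longrightarrow> 0 \<le> lam T \<nu>"
  using max_diag_M(1) V_pos by (simp add: lam_def)

lemma lam_sq:
  assumes "0 < \<nu>" "1 \<le> T"
  shows "(lam T \<nu>)\<^sup>2 \<le> 96 * T * (V / real n)"
proof -
  have "(lam T \<nu>)\<^sup>2 = 16 * (max_diag (ridge_M X \<nu>) * ((1 + sqrt (2 * T))\<^sup>2 * (V / real n)))"
    using max_diag_M(1)[OF assms(1)] V_pos by (simp add: lam_def power_mult_distrib power_divide)
  also have "\<dots> \<le> 16 * (1 * (6 * T * (V / real n)))"
    using max_diag_M[OF assms(1)] one_plus_sqrt_sq[OF assms(2)] V_pos assms(2)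
    by (intro mult_left_mono mult_mono) auto
  finally show ?thesis by simp
qed

lemma lam_le_sqrt: "0 < \<nu> \<Longrightarrow> 0 \<le> T \<Longrightarrow> lam T \<nu> \<le> 4 * (1 + sqrt (2 * T)) * sqrt (V / real n) * sqrt \<nu>"
proof -
  assume a: "0 < \<nu>" "0 \<le> T"
  have "lam T \<nu> = 4 * (1 + sqrt (2 * T)) * sqrt (V / real n) * sqrt (max_diag (ridge_M X \<nu>))"
    by (simp only: lam_def mult_ac)
  also have "\<dots> \<le> 4 * (1 + sqrt (2 * T)) * sqrt (V / real n) * sqrt \<nu>"
    using max_diag_M(2)[OF a(1)] a V_pos by (intro mult_left_mono mult_nonneg_nonneg) auto
  finally show ?thesis .
qed

lemma bias_bounds:
  assumes \<nu>: "0 < \<nu>"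
  shows "0 \<le> bias \<nu>" "bias \<nu> \<le> \<nu> * Rb" "bias \<nu> \<le> sig * Rb"
proof -
  interpret r: ridge X n p \<nu> by (rule ridge[OF \<nu>])
  have XL: "X * L \<in> carrier_mat n m" using X L by simp
  have b: "real n * bias \<nu> = fip (X * L) (r.Q * (X * L))" using n0 by (simp add: bias_def r.Q_def)
  have "0 \<le> fip (r.Q * (X * L)) (r.Q * (X * L))" by (simp add: frob_sq[symmetric])
  then have "0 \<le> real n * bias \<nu>" using r.Q_contraction(1)[OF XL] b by simp
  then show "0 \<le> bias \<nu>" using n0 by (simp add: zero_le_mult_iff)
  have "real n * bias \<nu> \<le> real n * \<nu> * Rb"
    using b r.quad_Q_image[OF L] mult_left_mono[OF L_Rb, of "real n * \<nu>"] \<nu> by simp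
  then show "bias \<nu> \<le> \<nu> * Rb" using n0 by (simp add: mult.assoc)
  have "real n * bias \<nu> \<le> real n * sig * Rb"
    using b r.Q_contraction(2)[OF XL] sig_bound[OF L] mult_left_mono[OF L_Rb, of "real n * sig"] sig0 by simp
  then show "bias \<nu> \<le> sig * Rb" using n0 by (simp add: mult.assoc)
qed

lemma dof_bounds:
  assumes \<nu>: "0 < \<nu>"
  shows "dof \<nu> \<le> real p / \<nu>" "dof \<nu> \<le> real (mat_rank X)"
proof -
  interpret r: ridge X n p \<nu> by (rule ridge[OF \<nu>])
  have d: "dof \<nu> = r.dof" by (simp add: dof_def r.dof_def r.Q_def)
  show "dof \<nu> \<le> real p / \<nu>" using r.dof_le_frob fip_X n0 by (simp add: d)
  obtain H where H: "is_proj n (mat_rank X) H" "H * X = X" using proj_column_space[OF X] .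
  show "dof \<nu> \<le> real (mat_rank X)" using r.dof_le_proj[of H] H is_projD[OF H(1)] by (simp add: d)
qed

text \<open>In the second alternative the first step is controlled by the slow lasso rate. It is only used
  for a tiny \<open>\<nu>\<close>, where the ridge residual matrix, hence \<open>lam\<close>, is so small that no sparsity is
  needed; this gives the member \<open>q K / n\<close> of the minimum in \<open>err\<close>.\<close>

definition tuned :: "real \<Rightarrow> real \<Rightarrow> real \<Rightarrow> bool" where
  "tuned T \<nu> r \<longleftrightarrow> 0 < \<nu> \<and> bias \<nu> \<le> r \<and>
     ((lam T \<nu>)\<^sup>2 * real s * (ck\<^sup>2 * (1 + sig / \<nu>)) \<le> r \<or> bias \<nu> + lam T \<nu> * l1l2_norm \<Psi> \<le> r) \<and>
     r + V * dof \<nu> / real n \<le> C0 * T * real m * err"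

lemma fast_term:
  assumes "0 < \<nu>" "1 \<le> T"
  shows "(lam T \<nu>)\<^sup>2 * real s * (ck\<^sup>2 * (1 + sig / \<nu>)) \<le> 96 * T * ck\<^sup>2 * (V * real s / real n * (1 + sig / \<nu>))"
proof -
  have "0 \<le> real s * (ck\<^sup>2 * (1 + sig / \<nu>))" using sig0 assms by simp
  from mult_right_mono[OF lam_sq[OF assms] this] show ?thesis by (simp only: times_divide_eq_left times_divide_eq_right mult_ac)
qed

lemma V_n: "V / real n \<le> cV * (real m * (real K / sqrt (real n)))"
proof -
  have "1 / real n \<le> 1 / sqrt (real n)" using n0 by (intro divide_left_mono) (auto simp: real_sqrt_le_iff real_le_lsqrt self_le_power)
  then have "V * (1 / real n) \<le> cV * (real K * real m) * (1 / sqrt (real n))"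
    using V_le V_pos by (intro mult_mono) auto
  then show ?thesis by (simp add: mult_ac)
qed

lemma V_sqrt_n: "V / sqrt (real n) \<le> cV * (real m * (real K / sqrt (real n)))"
  using divide_right_mono[OF V_le, of "sqrt (real n)"] by (simp add: mult_ac)

lemma V_s_n: "V * real s / real n \<le> cV * (real m * (real K * real s / real n))"
  using mult_right_mono[OF V_le, of "real s / real n"] by (simp add: mult_ac)

text \<open>For \<nu> \<ge> \<sigma> the form of Q is comparable to that of X up to a factor 2, and
  \<nu> \<ge> p makes the degrees of freedom at most 1; the price is the full bias \<sigma>
  R.\<close>

lemma tuned_large_penalty:
  assumes T: "1 \<le> T" and e: "err = sig * Rb / real m + real K * real s / real n + real K / sqrt (real n)"
  shows "\<exists>\<nu> r. tuned T \<nu> r"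
proof -
  \<comment> \<open>The sum instead of the maximum; p \<ge> 1 also makes it positive when \<sigma> =
    0.\<close>
  define \<nu> where "\<nu> = sig + real p"
  have \<nu>: "0 < \<nu>" using sig0 p1 by (simp add: \<nu>_def)
  define r where "r = sig * Rb + 96 * T * ck\<^sup>2 * (V * real s / real n * 2)"
  have "sig / \<nu> \<le> 1" using sig0 p1 \<nu> by (simp add: \<nu>_def divide_le_eq)
  then have "96 * T * ck\<^sup>2 * (V * real s / real n * (1 + sig / \<nu>)) \<le> 96 * T * ck\<^sup>2 * (V * real s / real n * 2)"
    using T V_pos by (intro mult_left_mono) auto
  then have fast: "(lam T \<nu>)\<^sup>2 * real s * (ck\<^sup>2 * (1 + sig / \<nu>)) \<le> r"
    using fast_term[OF \<nu> T] sig0 Rb(1) unfolding r_def by (meson add_increasing mult_nonneg_nonneg order_trans)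
  have b: "bias \<nu> \<le> r" using bias_bounds(3)[OF \<nu>] T V_pos by (simp add: r_def add_increasing2)
  have "dof \<nu> \<le> 1" using dof_bounds(1)[OF \<nu>] sig0 \<nu> by (intro order_trans[OF dof_bounds(1)[OF \<nu>]]) (simp add: \<nu>_def divide_le_eq)
  then have d: "V * dof \<nu> / real n \<le> cV * (real m * (real K / sqrt (real n)))"
    using V_n mult_left_mono[of "dof \<nu>" 1 "V / real n"] V_pos by simp
  define x y z where "x = sig * Rb" and "y = real m * (real K * real s / real n)" and "z = real m * (real K / sqrt (real n))"
  have nn: "0 \<le> x" "0 \<le> y" "0 \<le> z" using sig0 Rb by (auto simp: x_def y_def z_def)
  have kc: "1 \<le> T * ck\<^sup>2" using mult_mono[of 1 T 1 "ck\<^sup>2"] T cpos by simp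
  have "r + V * dof \<nu> / real n \<le> x + 96 * T * ck\<^sup>2 * (cV * y * 2) + cV * z"
    using d V_s_n T unfolding r_def x_def[symmetric] y_def[symmetric] z_def[symmetric]
    by (intro add_mono mult_left_mono mult_right_mono) auto
  also have "\<dots> \<le> 200 * (T * ck\<^sup>2) * (1 + cV) * x + 200 * (T * ck\<^sup>2) * (1 + cV) * y + 200 * (T * ck\<^sup>2) * (1 + cV) * z"
  proof (intro add_mono)
    have "1 * 1 \<le> 200 * (T * ck\<^sup>2) * (1 + cV)" using kc cV_pos by (intro mult_mono) auto
    then show "x \<le> 200 * (T * ck\<^sup>2) * (1 + cV) * x" using mult_right_mono[OF _ nn(1), of 1] by simp
    have "192 * (T * ck\<^sup>2) * cV \<le> 200 * (T * ck\<^sup>2) * (1 + cV)" using kc cV_pos T by (intro mult_mono) auto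
    from mult_right_mono[OF this nn(2)] show "96 * T * ck\<^sup>2 * (cV * y * 2) \<le> 200 * (T * ck\<^sup>2) * (1 + cV) * y"
      by (simp add: mult_ac)
    have "1 * cV \<le> 200 * (T * ck\<^sup>2) * (1 + cV)" using kc cV_pos by (intro mult_mono) auto
    from mult_right_mono[OF this nn(3)] show "cV * z \<le> 200 * (T * ck\<^sup>2) * (1 + cV) * z" by simp
  qed
  also have "\<dots> = C0 * T * real m * err"
    unfolding e C0_def x_def y_def z_def using m0 by (simp add: algebra_simps)
  finally show ?thesis using \<nu> b fast unfolding tuned_def by blast
qed

text \<open>As \<nu> tends to 0 both the bias and the lasso penalty vanish and only the degrees of
  freedom remain, which are at most q. The allowance r = V / sqrt n costs no more than the summand K
  / sqrt n.\<close>

lemma tuned_small_penalty: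
  assumes T: "1 \<le> T" and e: "err = real (mat_rank X) * real K / real n + real K / sqrt (real n)"
  shows "\<exists>\<nu> r. tuned T \<nu> r"
proof -
  define a where "a = 4 * (1 + sqrt (2 * T)) * sqrt (V / real n) * l1l2_norm \<Psi>"
  define r where "r = V / sqrt (real n)"
  \<comment> \<open>\<nu> will be the square of \<mu>, since the penalty scales with sqrt \<nu>. The
    minimum with 1 gives \<mu>^2 \<le> \<mu> for the bias, and the summand 1 keeps the denominator
    positive.\<close>
  define \<mu> where "\<mu> = min 1 (r / (Rb + a + 1))"
  have a0: "0 \<le> a" using T V_pos l1l2_ge0 by (simp add: a_def)
  have den: "0 < Rb + a + 1" using a0 Rb by simp
  have r0: "0 < r" using V_pos n0 by (simp add: r_def)
  have \<mu>: "0 < \<mu>" "\<mu> \<le> 1" using r0 den by (auto simp: \<mu>_def)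
  have \<mu>r: "\<mu> * (Rb + a) \<le> r"
  proof -
    have "\<mu> * (Rb + a) \<le> \<mu> * (Rb + a + 1)" using \<mu> by (intro mult_left_mono) auto
    also have "\<dots> \<le> r / (Rb + a + 1) * (Rb + a + 1)" using den by (intro mult_right_mono) (auto simp: \<mu>_def)
    finally show ?thesis using den by simp
  qed
  define \<nu> where "\<nu> = \<mu>\<^sup>2"
  have \<nu>: "0 < \<nu>" using \<mu> by (simp add: \<nu>_def)
  have "bias \<nu> \<le> \<mu> * Rb"
    using order_trans[OF bias_bounds(2)[OF \<nu>] mult_right_mono[of \<nu> \<mu> Rb]] \<mu> Rb(1) by (simp add: \<nu>_def power2_eq_square mult_left_le)
  moreover have "lam T \<nu> * l1l2_norm \<Psi> \<le> \<mu> * a"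
  proof -
    have "sqrt \<nu> = \<mu>" using \<mu> by (simp add: \<nu>_def)
    then have "lam T \<nu> \<le> 4 * (1 + sqrt (2 * T)) * sqrt (V / real n) * \<mu>" using lam_le_sqrt[OF \<nu>, of T] T by simp
    from mult_right_mono[OF this l1l2_ge0[of \<Psi>]] show ?thesis by (simp add: a_def mult_ac)
  qed
  ultimately have slow: "bias \<nu> + lam T \<nu> * l1l2_norm \<Psi> \<le> r" using \<mu>r by (simp add: algebra_simps)
  then have b: "bias \<nu> \<le> r" using lam_nonneg[OF \<nu>, of T] T l1l2_ge0[of \<Psi>]
    by (smt (verit) mult_nonneg_nonneg)
  define x z where "x = real m * (real (mat_rank X) * real K / real n)" and "z = real m * (real K / sqrt (real n))"
  have nn: "0 \<le> x" "0 \<le> z" by (auto simp: x_def z_def)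
  have kc: "1 \<le> T * ck\<^sup>2" using mult_mono[of 1 T 1 "ck\<^sup>2"] T cpos by simp
  have "V * dof \<nu> \<le> cV * (real K * real m) * real (mat_rank X)"
    using V_le V_pos dof_bounds(2)[OF \<nu>] cV_pos by (smt (verit) mult_left_mono mult_right_mono of_nat_0_le_iff)
  from divide_right_mono[OF this, of "real n"] have "V * dof \<nu> / real n \<le> cV * x" by (simp add: x_def mult_ac)
  then have "r + V * dof \<nu> / real n \<le> cV * z + cV * x" using V_sqrt_n by (simp add: r_def z_def)
  also have "\<dots> \<le> 200 * (T * ck\<^sup>2) * (1 + cV) * z + 200 * (T * ck\<^sup>2) * (1 + cV) * x"
  proof -
    have "1 * cV \<le> 200 * (T * ck\<^sup>2) * (1 + cV)" using kc cV_pos by (intro mult_mono) auto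
    then show ?thesis using nn by (intro add_mono mult_right_mono) auto
  qed
  also have "\<dots> = C0 * T * real m * err" unfolding e C0_def x_def z_def by (simp add: algebra_simps)
  finally show ?thesis using \<nu> b slow unfolding tuned_def by blast
qed

text \<open>Two costs decrease like 1/\<nu>: the degrees of freedom, at most p / \<nu>, and the loss
  \<sigma> / \<nu> in the restricted eigenvalue, which multiplies s. Both are governed by h = p +
  \<sigma> s, and \<nu> equates V h / (n \<nu>) with the bias \<nu> R.\<close>

lemma tuned_balanced_penalty:
  assumes T: "1 \<le> T" and R0: "0 < Rb"
    and e: "err = sqrt ((real p + sig * real s) * real K * Rb / (real n * real m)) + real K * real s / real n
      + real K / sqrt (real n)"
  shows "\<exists>\<nu> r. tuned T \<nu> r"
proof -
  define h where "h = real p + sig * real s"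
  have h: "0 < h" "real p \<le> h" "sig * real s \<le> h" using p1 sig0 by (auto simp: h_def intro!: add_pos_nonneg)
  define \<nu> where "\<nu> = sqrt (h * V / (real n * Rb))"
  have \<nu>: "0 < \<nu>" using h V_pos n0 R0 by (simp add: \<nu>_def)
  have key: "V * h / (real n * \<nu>) = \<nu> * Rb"
  proof -
    have "\<nu> * \<nu> = h * V / (real n * Rb)" using h V_pos R0 by (simp add: \<nu>_def)
    then have "V * h = \<nu> * \<nu> * (real n * Rb)" using n0 R0 by (simp add: field_simps)
    then show ?thesis using \<nu> n0 by (simp add: field_simps)
  qed
  define x y z where "x = real m * sqrt (h * real K * Rb / (real n * real m))"
    and "y = real m * (real K * real s / real n)" and "z = real m * (real K / sqrt (real n))"
  have nn: "0 \<le> x" "0 \<le> y" "0 \<le> z" using h R0 by (auto simp: x_def y_def z_def)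
  have \<nu>R: "\<nu> * Rb \<le> (1 + cV) * x"
  proof -
    have "(\<nu> * Rb)\<^sup>2 = h * V * Rb / real n" using h V_pos R0 n0 by (simp add: \<nu>_def power_mult_distrib) (simp add: power2_eq_square)
    also have "\<dots> \<le> h * (cV * (real K * real m)) * Rb / real n"
      using h R0 by (intro divide_right_mono mult_right_mono mult_left_mono V_le) auto
    also have "\<dots> = cV * x\<^sup>2" using h R0 m0 by (simp add: x_def power_mult_distrib) (simp add: power2_eq_square)
    also have "\<dots> \<le> (1 + cV)\<^sup>2 * x\<^sup>2" using cV_pos by (intro mult_right_mono) (auto simp: power2_eq_square algebra_simps)
    finally have "(\<nu> * Rb)\<^sup>2 \<le> ((1 + cV) * x)\<^sup>2" by (simp add: power_mult_distrib)
    then show ?thesis by (rule power2_le_imp_le) (use cV_pos nn in auto)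
  qed
  define r where "r = 96 * (T * ck\<^sup>2) * (V * real s / real n + \<nu> * Rb)"
  have kc: "1 \<le> T * ck\<^sup>2" using mult_mono[of 1 T 1 "ck\<^sup>2"] T cpos by simp
  have vs: "V * real s / real n * (sig / \<nu>) \<le> \<nu> * Rb"
  proof -
    have "V * real s / real n * (sig / \<nu>) = V * (sig * real s) / (real n * \<nu>)" by simp
    also have "\<dots> \<le> V * h / (real n * \<nu>)" using h V_pos \<nu> by (intro divide_right_mono mult_left_mono) auto
    finally show ?thesis using key by simp
  qed
  then have "96 * T * ck\<^sup>2 * (V * real s / real n * (1 + sig / \<nu>)) \<le> r"
    unfolding r_def mult.assoc[symmetric, of 96] mult.assoc[symmetric, of "96 * T"]
    using T by (intro mult_left_mono) (auto simp: distrib_left)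
  then have fast: "(lam T \<nu>)\<^sup>2 * real s * (ck\<^sup>2 * (1 + sig / \<nu>)) \<le> r" using fast_term[OF \<nu> T] by simp
  have p0: "0 \<le> V * real s / real n" "0 \<le> \<nu> * Rb" using V_pos \<nu> R0 by auto
  have "1 * (\<nu> * Rb) \<le> 96 * (T * ck\<^sup>2) * (V * real s / real n + \<nu> * Rb)" using kc p0 by (intro mult_mono) auto
  then have b: "bias \<nu> \<le> r" using bias_bounds(2)[OF \<nu>] by (simp add: r_def)
  have d: "V * dof \<nu> / real n \<le> \<nu> * Rb"
  proof -
    have "V * dof \<nu> \<le> V * (h / \<nu>)"
      using dof_bounds(1)[OF \<nu>] divide_right_mono[OF h(2), of \<nu>] V_pos \<nu> by (intro mult_left_mono) auto
    from divide_right_mono[OF this, of "real n"] show ?thesis using key by (simp add: mult_ac)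
  qed
  have "r + V * dof \<nu> / real n \<le> 96 * (T * ck\<^sup>2) * (cV * y + (1 + cV) * x) + (1 + cV) * x"
    unfolding r_def using d \<nu>R V_s_n T kc by (intro add_mono mult_left_mono) (auto simp: y_def)
  also have "\<dots> = 96 * (T * ck\<^sup>2) * cV * y + (96 * (T * ck\<^sup>2) + 1) * (1 + cV) * x" by (simp add: algebra_simps)
  also have "\<dots> \<le> 200 * (T * ck\<^sup>2) * (1 + cV) * y + 200 * (T * ck\<^sup>2) * (1 + cV) * x"
    using kc cV_pos nn by (intro add_mono mult_right_mono mult_mono) auto
  also have "\<dots> \<le> 200 * (T * ck\<^sup>2) * (1 + cV) * y + 200 * (T * ck\<^sup>2) * (1 + cV) * x + 200 * (T * ck\<^sup>2) * (1 + cV) * z"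
    using kc cV_pos nn by simp
  also have "\<dots> = C0 * T * real m * err" unfolding e C0_def x_def y_def z_def h_def by (simp add: algebra_simps)
  finally show ?thesis using \<nu> b fast unfolding tuned_def by blast
qed

lemma tuned_exists:
  assumes T: "1 \<le> T"
  obtains \<nu> r where "tuned T \<nu> r"
proof -
  define mA mB mC where "mA = sig * Rb / real m + real K * real s / real n"
    and "mB = real (mat_rank X) * real K / real n"
    and "mC = sqrt ((real p + sig * real s) * real K * Rb / (real n * real m)) + real K * real s / real n"
  have e: "err = Min {mA, mB, mC} + real K / sqrt (real n)" by (simp add: err_def Err_P_def mA_def mB_def mC_def)
  have "Min {mA, mB, mC} \<in> {mA, mB, mC}" by (intro Min_in) auto
  \<comment> \<open>For R = 0 the balancing \<nu> would be a quotient by zero; but then the third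
    member coincides with the first, which the large penalty attains.\<close>
  then consider "Min {mA, mB, mC} = mA" | "Min {mA, mB, mC} = mB" | "Min {mA, mB, mC} = mC" "Rb = 0"
    | "Min {mA, mB, mC} = mC" "0 < Rb" using Rb(1) by fastforce
  then have "\<exists>\<nu> r. tuned T \<nu> r"
  proof cases
    case 1
    then show ?thesis by (intro tuned_large_penalty[OF T]) (simp add: e mA_def)
  next
    case 2
    then show ?thesis by (intro tuned_small_penalty[OF T]) (simp add: e mB_def)
  next
    case 3
    then show ?thesis using e by (intro tuned_large_penalty[OF T]) (simp add: mC_def)
  next
    case 4
    then show ?thesis by (intro tuned_balanced_penalty[OF T]) (auto simp: e mC_def)
  qed
  then show ?thesis using that by blast
qed

end

section \<open>The good event\<close>

lemma vnorm_row_transpose_mult: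
  assumes Z: "Z \<in> carrier_mat n a" and Y: "Y \<in> carrier_mat n m" and j: "j < a" and t: "0 \<le> t"
    and le: "\<And>k. k < m \<Longrightarrow> \<bar>col Z j \<bullet> col Y k\<bar> \<le> vnorm (col Z j) * h k * t"
  shows "(vnorm (row (Z\<^sup>T * Y) j))\<^sup>2 \<le> (vnorm (col Z j))\<^sup>2 * (\<Sum>k<m. (h k)\<^sup>2) * t\<^sup>2"
proof -
  have "(vnorm (row (Z\<^sup>T * Y) j))\<^sup>2 = (\<Sum>k<m. (row (Z\<^sup>T * Y) j $ k)\<^sup>2)"
    unfolding vnorm_sq using Z Y by (subst scalar_prod_eq_sum[of _ m]) (auto simp: power2_eq_square)
  also have "\<dots> = (\<Sum>k<m. \<bar>col Z j \<bullet> col Y k\<bar>\<^sup>2)" using Z Y j by (intro sum.cong refl) simp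
  also have "\<dots> \<le> (\<Sum>k<m. (vnorm (col Z j) * h k * t)\<^sup>2)" by (intro sum_mono power_mono le) auto
  finally show ?thesis by (simp add: power_mult_distrib sum_distrib_left sum_distrib_right)
qed

context hv_model
begin

text \<open>The conjuncts serve, in order, the noise in the first lasso, its two cross terms in the
  residual covariance, the case s = 0, the noise in the third step, the random part of the signal,
  and the shrinkage and fluctuation of the noise Gram matrix.\<close>

definition good :: "real \<Rightarrow> real \<Rightarrow> real \<Rightarrow> 'a \<Rightarrow> bool" where
  "good T \<delta> \<nu> \<omega> \<longleftrightarrow>
     (\<forall>j<p. vnorm (row ((ridge_Q X \<nu> * X)\<^sup>T * noise_mat \<omega>) j) \<le> real n * lam T \<nu> / 4) \<and>
     (\<forall>j<p. vnorm (row ((ridge_Q X \<nu> * (ridge_Q X \<nu> * X))\<^sup>T * noise_mat \<omega>) j) \<le> real n * lam T \<nu> / 4) \<and>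
     (frob_norm ((ridge_Q X \<nu> * (ridge_Q X \<nu> * (X * L)))\<^sup>T * noise_mat \<omega>))\<^sup>2 \<le> real n * bias \<nu> * V * (2 * T) \<and>
     (\<forall>j<p. vnorm (row (X\<^sup>T * noise_mat \<omega>) j) \<le> sqrt (real n * V * (2 * T))) \<and>
     (\<forall>j<p. vnorm (row (X\<^sup>T * E \<omega>) j) \<le> \<gamma>e * sqrt (real n * real m * (2 * T))) \<and>
     (\<forall>v\<in>carrier_vec m. vnorm (W \<omega> * B *\<^sub>v v)
        \<le> 4 * \<gamma>w * sqrt (2 * (6 * real n + 6 * real K + T)) * sqrt (v \<bullet> (G *\<^sub>v v))) \<and>
     fip (noise_mat \<omega>) (noise_mat \<omega>) - fip (noise_mat \<omega>) (ridge_Q X \<nu> * noise_mat \<omega>) \<le> 64 * V * dof \<nu> / \<delta> \<and>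
     (frob_norm ((1 / real n) \<cdot>\<^sub>m ((noise_mat \<omega>)\<^sup>T * noise_mat \<omega>) - (G + \<tau>\<^sup>2 \<cdot>\<^sub>m 1\<^sub>m m)))\<^sup>2
        \<le> 65536 * V\<^sup>2 / real n / \<delta>"

text \<open>The linear forms and the operator norm together cost (8 p m + 2 m^2 + 2) exp(-T), at
  most 12 (p m)^2 exp(-T) and so \<delta>/2; the two Markov bounds get \<delta>/4 each, which turns
  their constants 16 and 16384 into 64 and 65536.\<close>

lemma good_event:
  assumes \<nu>: "0 < \<nu>" and T: "0 < T" and \<delta>: "0 < \<delta>"
    and T\<delta>: "24 * (real p * real m)\<^sup>2 * exp (- T) \<le> \<delta>"
  obtains F where "F \<in> events" "prob F \<le> \<delta>" "\<And>\<omega>. \<omega> \<in> space M - F \<Longrightarrow> good T \<delta> \<nu> \<omega>"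
proof -
  interpret r: ridge X n p \<nu> by (rule ridge[OF \<nu>])
  have XL: "X * L \<in> carrier_mat n m" using X L by simp
  have QX: "r.Q * X \<in> carrier_mat n p" and QQX: "r.Q * (r.Q * X) \<in> carrier_mat n p"
    and QXL: "r.Q * (X * L) \<in> carrier_mat n m" and QQXL: "r.Q * (r.Q * (X * L)) \<in> carrier_mat n m"
    using r.Q X XL by auto
  define cols where "cols Z = col Z ` {..<dim_col Z}" for Z :: "real mat"
  have cols: "finite (cols Z)" "cols Z \<subseteq> carrier_vec n" "card (cols Z) \<le> k"
    "\<And>j. j < k \<Longrightarrow> col Z j \<in> cols Z" if "Z \<in> carrier_mat n k" for Z k
    using that card_image_le[of "{..<k}" "col Z"] by (auto simp: cols_def)
  define U where "U = cols (r.Q * X) \<union> cols (r.Q * (r.Q * X)) \<union> cols (r.Q * (r.Q * (X * L))) \<union> cols X"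
  have U: "finite U" "U \<subseteq> carrier_vec n" using cols[OF QX] cols[OF QQX] cols[OF QQXL] cols[OF X] by (auto simp: U_def)
  have "card U \<le> p + p + m + p"
    unfolding U_def using cols(3)[OF QX] cols(3)[OF QQX] cols(3)[OF QQXL] cols(3)[OF X]
    by (meson add_mono card_Un_le order_trans)
  then have cardU: "real (card U) \<le> 3 * real p + real m" by linarith
  obtain F1 where F1: "F1 \<in> events" "prob F1 \<le> real (card U) * real m * (2 * exp (- T))"
    "\<And>\<omega> u k. \<omega> \<in> space M - F1 \<Longrightarrow> u \<in> U \<Longrightarrow> k < m \<Longrightarrow> \<bar>u \<bullet> col (noise_mat \<omega>) k\<bar> \<le> vnorm u * g k * sqrt (2 * T)"
    using bad_lin[OF U T] by blast
  obtain F2 where F2: "F2 \<in> events" "prob F2 \<le> real (card (cols X)) * real m * (2 * exp (- T))"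
    "\<And>\<omega> u k. \<omega> \<in> space M - F2 \<Longrightarrow> u \<in> cols X \<Longrightarrow> k < m \<Longrightarrow> \<bar>u \<bullet> col (E \<omega>) k\<bar> \<le> vnorm u * \<gamma>e * sqrt (2 * T)"
    using bad_lin_E[OF cols(1,2)[OF X] T] by blast
  have K0: "0 < K" using K1 by simp
  obtain F3 where F3: "F3 \<in> events" "prob F3 \<le> 2 * exp (- T)"
    "\<And>\<omega> v. \<omega> \<in> space M - F3 \<Longrightarrow> v \<in> carrier_vec m \<Longrightarrow> vnorm (W \<omega> * B *\<^sub>v v)
        \<le> 4 * \<gamma>w * sqrt (2 * (6 * real n + 6 * real K + T)) * sqrt (v \<bullet> (G *\<^sub>v v))"
    using bad_op[OF K0 T] by blast
  define d where "d = \<delta> / 4"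
  have d: "0 < d" using \<delta> by (simp add: d_def)
  define H where "H = 1\<^sub>m n - r.Q"
  have H: "H \<in> carrier_mat n n" using r.Q by (simp add: H_def)
  have fipH: "fip Z (H * Z) = fip Z Z - fip Z (r.Q * Z)" if Z: "Z \<in> carrier_mat n k" for Z k
  proof -
    have "H * Z = Z - r.Q * Z" unfolding H_def using minus_mult_distrib_mat[OF one_carrier_mat r.Q Z] Z by simp
    then show ?thesis using fip_minus_right[of Z n k "r.Q * Z" Z] Z r.Q by simp
  qed
  have psd: "0 \<le> fip Z (H * Z)" if "Z \<in> carrier_mat n k" for Z k
    using fipH[OF that] r.Q_contraction(2)[OF that] by simp
  have oneH: "fip (1\<^sub>m n) H = dof \<nu>"
    using r.Q fip_minus_right[of "1\<^sub>m n" n n r.Q "1\<^sub>m n"] by (simp add: H_def dof_def r.Q_def)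
  have "\<exists>F4\<in>events. prob F4 \<le> d \<and>
    (\<forall>\<omega>\<in>space M - F4. fip (noise_mat \<omega>) (H * noise_mat \<omega>) \<le> 16 * V * fip (1\<^sub>m n) H / d)"
  proof (rule bad_quadratic[OF d H psd])
    fix F4 assume "F4 \<in> events" "prob F4 \<le> d"
      "\<And>\<omega>. \<omega> \<in> space M - F4 \<Longrightarrow> fip (noise_mat \<omega>) (H * noise_mat \<omega>) \<le> 16 * V * fip (1\<^sub>m n) H / d"
    then show ?thesis by (intro bexI[of _ F4] conjI ballI)
  qed
  then obtain F4 where F4: "F4 \<in> events" "prob F4 \<le> d"
    "\<And>\<omega>. \<omega> \<in> space M - F4 \<Longrightarrow> fip (noise_mat \<omega>) (H * noise_mat \<omega>) \<le> 16 * V * fip (1\<^sub>m n) H / d"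
    by blast
  obtain F5 where F5: "F5 \<in> events" "prob F5 \<le> d"
    "\<And>\<omega>. \<omega> \<in> space M - F5 \<Longrightarrow>
      (frob_norm ((1 / real n) \<cdot>\<^sub>m ((noise_mat \<omega>)\<^sup>T * noise_mat \<omega>) - (G + \<tau>\<^sup>2 \<cdot>\<^sub>m 1\<^sub>m m)))\<^sup>2 \<le> 16384 * V\<^sup>2 / real n / d"
    using bad_gram[OF d] by blast
  define F where "F = F1 \<union> F2 \<union> F3 \<union> F4 \<union> F5"
  have F: "F \<in> events" using F1 F2 F3 F4 F5 by (simp add: F_def)
  have pF: "prob F \<le> \<delta>"
  proof -
    have "prob F \<le> prob F1 + prob F2 + prob F3 + prob F4 + prob F5"
    proof -
      have un: "prob (A' \<union> B') \<le> a + prob B'" if "A' \<in> events" "B' \<in> events" "prob A' \<le> a" for A' B' a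
        using measure_Un_le[OF that(1,2)] that(3) by simp
      show ?thesis unfolding F_def
        by (intro un sets.Un F1(1) F2(1) F3(1) F4(1) F5(1) order_refl)
    qed
    moreover have "prob F1 + prob F2 + prob F3 \<le> \<delta> / 2"
    proof -
      have pm: "1 \<le> real p" "1 \<le> real m" using p1 m0 by auto
      have x: "1 \<le> real p * real m" using mult_mono[OF pm] pm by simp
      then have x2: "real p * real m \<le> (real p * real m)\<^sup>2" using mult_right_mono[OF x, of "real p * real m"] by (simp add: power2_eq_square)
      have "real m * real m \<le> real p * real m * (real p * real m)"
        using mult_mono[of 1 "real p * real p" "real m * real m" "real m * real m"] pm mult_mono[OF pm(1) pm(1)] by (simp add: mult_ac)
      then have m2: "real m * real m \<le> (real p * real m)\<^sup>2" by (simp add: power2_eq_square)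
      have "prob F1 \<le> (3 * real p + real m) * real m * (2 * exp (- T))"
        by (intro order_trans[OF F1(2)] mult_right_mono cardU) auto
      moreover have "prob F2 \<le> real p * real m * (2 * exp (- T))"
        using cols(3)[OF X] by (intro order_trans[OF F2(2)] mult_right_mono) auto
      ultimately have "prob F1 + prob F2 + prob F3 \<le> (8 * (real p * real m) + 2 * (real m * real m) + 2) * exp (- T)"
        using F3(2) by (simp add: algebra_simps)
      also have "\<dots> \<le> (12 * (real p * real m)\<^sup>2) * exp (- T)" using x x2 m2 by (intro mult_right_mono) auto
      finally show ?thesis using T\<delta> by simp
    qed
    ultimately show ?thesis using F4(2) F5(2) by (simp add: d_def)
  qed
  have "good T \<delta> \<nu> \<omega>" if \<omega>: "\<omega> \<in> space M - F" for \<omega>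
  proof -
    have \<omega>': "\<omega> \<in> space M - F1" "\<omega> \<in> space M - F2" "\<omega> \<in> space M - F3" "\<omega> \<in> space M - F4" "\<omega> \<in> space M - F5" "\<omega> \<in> space M"
      using \<omega> by (auto simp: F_def)
    let ?e = "noise_mat \<omega>"
    have e: "?e \<in> carrier_mat n m" and Ec: "E \<omega> \<in> carrier_mat n m" using \<omega>' noise_mat E by auto
    have t: "0 \<le> sqrt (2 * T)" "(sqrt (2 * T))\<^sup>2 = 2 * T" using T by auto
    have rb: "(vnorm (row (Z\<^sup>T * ?e) j))\<^sup>2 \<le> (vnorm (col Z j))\<^sup>2 * V * (2 * T)"
      if Z: "Z \<in> carrier_mat n k" "cols Z \<subseteq> U" and j: "j < k" for Z k j
      using vnorm_row_transpose_mult[OF Z(1) e j t(1), of g] F1(3)[OF \<omega>'(1)] cols(4)[OF Z(1) j] Z(2) t(2)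
      by (auto simp: V_def)
    have inU: "cols (r.Q * X) \<subseteq> U" "cols (r.Q * (r.Q * X)) \<subseteq> U" "cols (r.Q * (r.Q * (X * L))) \<subseteq> U" "cols X \<subseteq> U"
      by (auto simp: U_def)
    have md: "(vnorm (col (r.Q * X) j))\<^sup>2 \<le> real n * max_diag (ridge_M X \<nu>)" if "j < p" for j
      by (rule r.max_diag_ridge_M(1)[OF p1 that])
    have lam_ge: "x \<le> real n * lam T \<nu> / 4" if "x\<^sup>2 \<le> real n * max_diag (ridge_M X \<nu>) * V * (2 * T)" for x
    proof -
      have "2 * T \<le> (1 + sqrt (2 * T))\<^sup>2" using T t(1) by (simp add: power2_eq_square algebra_simps)
      then have "x\<^sup>2 \<le> real n * max_diag (ridge_M X \<nu>) * V * (1 + sqrt (2 * T))\<^sup>2"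
        using max_diag_M(1)[OF \<nu>] V_pos by (intro order_trans[OF that] mult_left_mono) auto
      also have "\<dots> = (real n * lam T \<nu> / 4)\<^sup>2"
      proof -
        have "c * M * v * u\<^sup>2 = (c * (4 * sqrt M * u * sqrt (v / c)) / 4)\<^sup>2" if "0 \<le> M" "0 < v" "0 < c" for M u v c :: real
          using that by (simp add: power_mult_distrib) (simp add: power2_eq_square)
        from this[OF max_diag_M(1)[OF \<nu>] V_pos] show ?thesis unfolding lam_def using n0 by simp
      qed
      finally show ?thesis by (rule power2_le_imp_le) (use lam_nonneg[OF \<nu>, of T] T in simp)
    qed
    have mono: "a * V * (2 * T) \<le> b * V * (2 * T)" if "a \<le> b" for a b :: real
      using that V_pos T by (intro mult_right_mono) auto
    have 1: "vnorm (row ((r.Q * X)\<^sup>T * ?e) j) \<le> real n * lam T \<nu> / 4" if j: "j < p" for j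
      by (rule lam_ge) (rule order_trans[OF rb[OF QX inU(1) j] mono[OF md[OF j]]])
    have 2: "vnorm (row ((r.Q * (r.Q * X))\<^sup>T * ?e) j) \<le> real n * lam T \<nu> / 4" if j: "j < p" for j
      by (rule lam_ge) (rule order_trans[OF rb[OF QQX inU(2) j] mono[OF order_trans[OF r.vnorm_col_QX_le(3)[OF j] md[OF j]]]])
    have 3: "(frob_norm ((r.Q * (r.Q * (X * L)))\<^sup>T * ?e))\<^sup>2 \<le> real n * bias \<nu> * V * (2 * T)"
    proof -
      have c: "(r.Q * (r.Q * (X * L)))\<^sup>T * ?e \<in> carrier_mat m m" using QQXL e by simp
      have "(frob_norm ((r.Q * (r.Q * (X * L)))\<^sup>T * ?e))\<^sup>2 = (\<Sum>j<m. (vnorm (row ((r.Q * (r.Q * (X * L)))\<^sup>T * ?e) j))\<^sup>2)"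
        by (rule frob_sq_rows[OF c])
      also have "\<dots> \<le> (\<Sum>j<m. (vnorm (col (r.Q * (r.Q * (X * L))) j))\<^sup>2 * V * (2 * T))"
        by (intro sum_mono rb[OF QQXL inU(3)]) simp
      also have "\<dots> = fip (r.Q * (r.Q * (X * L))) (r.Q * (r.Q * (X * L))) * V * (2 * T)"
        by (simp add: frob_sq_cols[OF QQXL, unfolded frob_sq] sum_distrib_right)
      also have "\<dots> \<le> real n * bias \<nu> * V * (2 * T)"
      proof (rule mono)
        have "fip (r.Q * (r.Q * (X * L))) (r.Q * (r.Q * (X * L))) \<le> fip (r.Q * (X * L)) (r.Q * (X * L))"
          by (rule r.Q_contraction'[OF QXL])
        also have "\<dots> \<le> fip (X * L) (r.Q * (X * L))" by (rule r.Q_contraction(1)[OF XL])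
        finally show "fip (r.Q * (r.Q * (X * L))) (r.Q * (r.Q * (X * L))) \<le> real n * bias \<nu>"
          using n0 by (simp add: bias_def r.Q_def)
      qed
      finally show ?thesis .
    qed
    have 4: "vnorm (row (X\<^sup>T * ?e) j) \<le> sqrt (real n * V * (2 * T))" if j: "j < p" for j
      using rb[OF X inU(4) j] col_X[OF j] by (intro real_le_rsqrt) simp
    have 5: "vnorm (row (X\<^sup>T * E \<omega>) j) \<le> \<gamma>e * sqrt (real n * real m * (2 * T))" if j: "j < p" for j
    proof (rule power2_le_imp_le)
      have "(vnorm (row (X\<^sup>T * E \<omega>) j))\<^sup>2 \<le> (vnorm (col X j))\<^sup>2 * (\<Sum>k<m. \<gamma>e\<^sup>2) * (sqrt (2 * T))\<^sup>2"
        using F2(3)[OF \<omega>'(2)] cols(4)[OF X j] by (intro vnorm_row_transpose_mult[OF X Ec j t(1)]) auto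
      then show "(vnorm (row (X\<^sup>T * E \<omega>) j))\<^sup>2 \<le> (\<gamma>e * sqrt (real n * real m * (2 * T)))\<^sup>2"
        using col_X[OF j] T by (simp add: power_mult_distrib mult_ac)
    qed (use ge T in auto)
    have 6: "fip ?e ?e - fip ?e (r.Q * ?e) \<le> 64 * V * dof \<nu> / \<delta>"
      using F4(3)[OF \<omega>'(4)] fipH[OF e] \<delta> by (simp add: oneH d_def)
    have 7: "(frob_norm ((1 / real n) \<cdot>\<^sub>m (?e\<^sup>T * ?e) - (G + \<tau>\<^sup>2 \<cdot>\<^sub>m 1\<^sub>m m)))\<^sup>2 \<le> 65536 * V\<^sup>2 / real n / \<delta>"
      using F5(3)[OF \<omega>'(5)] by (simp add: d_def)
    show ?thesis
      unfolding good_def using 1 2 3 4 5 6 7 F3(3)[OF \<omega>'(3)] by (simp add: r.Q_def)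
  qed
  then show thesis using that F pF by blast
qed

end

section \<open>Error of the estimated projection\<close>

context hv_model
begin

abbreviation "Yr \<omega> \<equiv> response X \<Psi> A B (W \<omega>) (E \<omega>)"

lemma response_eq: "Yr \<omega> = X * (\<Psi> + L) + noise_mat \<omega>"
  by (simp add: response_def noise_mat_def L_def)

lemma response_carrier: "\<omega> \<in> space M \<Longrightarrow> Yr \<omega> \<in> carrier_mat n m"
  using noise_mat[of \<omega>] X Psi L by (simp add: response_eq)

text \<open>The lasso lemmas require a strictly positive penalty. A zero penalty would force Q X =
  0, hence X = 0, against the normalized columns.\<close>

lemma lam_pos:
  assumes \<nu>: "0 < \<nu>" and T: "0 \<le> T"
  shows "0 < lam T \<nu>"
proof -
  interpret r: ridge X n p \<nu> by (rule ridge[OF \<nu>])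
  have QX: "r.Q * X \<in> carrier_mat n p" using r.Q X by simp
  have "max_diag (ridge_M X \<nu>) \<noteq> 0"
  proof
    assume z: "max_diag (ridge_M X \<nu>) = 0"
    have "(frob_norm (r.Q * X))\<^sup>2 = (\<Sum>j<p. (vnorm (col (r.Q * X) j))\<^sup>2)" by (rule frob_sq_cols[OF QX])
    also have "\<dots> = (\<Sum>j<p. 0)"
      using r.max_diag_ridge_M(1)[OF p1] z by (intro sum.cong refl antisym) auto
    finally have "r.Q * X = 0\<^sub>m n p" using frob_eq_0[OF QX] by simp
    then have "X = 0\<^sub>m n p" using r.split[OF X] r.S by simp
    then have "fip X X = 0" by (simp add: fip_def)
    then show False using fip_X n0 p1 by simp
  qed
  then have "0 < max_diag (ridge_M X \<nu>)" using max_diag_M(1)[OF \<nu>] by simp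
  then show ?thesis using T V_pos n0 by (simp add: lam_def add_pos_nonneg)
qed

lemma dof_nonneg: "0 < \<nu> \<Longrightarrow> 0 \<le> dof \<nu>"
proof -
  assume \<nu>: "0 < \<nu>"
  interpret r: ridge X n p \<nu> by (rule ridge[OF \<nu>])
  show "0 \<le> dof \<nu>" using r.Q_contraction(2)[of "1\<^sub>m n" n] r.Q by (simp add: dof_def r.Q_def)
qed

text \<open>Twice the constant of the covariance error, by Davis--Kahan, over the constant of the
  eigenvalue gap.\<close>

definition C2 :: real where "C2 = (256 * C0 + 516 * cV) / cl"

lemma C0_pos: "0 < C0" using cpos cV_pos by (simp add: C0_def)

lemma C2_pos: "0 < C2" using cpos cV_pos C0_pos by (simp add: C2_def)

text \<open>Deterministic on the good event, and valid for every solution of step 1 and every choice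
  of top eigenvectors. One factor T comes from the tuning, the other from replacing 1/\<delta> by
  T.\<close>

lemma projection_error:
  assumes T: "1 \<le> T" and \<delta>: "0 < \<delta>" "1 / \<delta> \<le> T" and tuned: "tuned T \<nu> r"
    and \<omega>: "\<omega> \<in> space M" and good: "good T \<delta> \<nu> \<omega>"
    and sol: "step1_solution X (Yr \<omega>) (lam T \<nu>) \<nu> \<Psi>h Lh"
    and U: "top_eigenvectors (residual_cov X (Yr \<omega>) (\<Psi>h + Lh)) K U"
  shows "is_proj m K (U * U\<^sup>T)" "frob_norm (P - U * U\<^sup>T) \<le> C2 * T\<^sup>2 * err"
proof -
  have \<nu>: "0 < \<nu>" and br: "bias \<nu> \<le> r"
    and alt: "(lam T \<nu>)\<^sup>2 * real s * (ck\<^sup>2 * (1 + sig / \<nu>)) \<le> r \<or> bias \<nu> + lam T \<nu> * l1l2_norm \<Psi> \<le> r"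
    and rC: "r + V * dof \<nu> / real n \<le> C0 * T * real m * err"
    using tuned by (auto simp: tuned_def)
  interpret r: ridge X n p \<nu> by (rule ridge[OF \<nu>])
  let ?e = "noise_mat \<omega>"
  define l where "l = lam T \<nu>"
  have l: "0 < l" using lam_pos[OF \<nu>, of T] T by (simp add: l_def)
  have e: "?e \<in> carrier_mat n m" by (rule noise_mat[OF \<omega>])
  have XL: "X * L \<in> carrier_mat n m" using X L by simp
  have g1: "\<And>j. j < p \<Longrightarrow> vnorm (row ((r.Q * X)\<^sup>T * ?e) j) \<le> real n * l / 4"
    and g2: "\<And>j. j < p \<Longrightarrow> vnorm (row ((r.Q * (r.Q * X))\<^sup>T * ?e) j) \<le> real n * l / 4"
    and g3: "(frob_norm ((r.Q * (r.Q * (X * L)))\<^sup>T * ?e))\<^sup>2 \<le> real n * bias \<nu> * V * (2 * T)"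
    and g4: "fip ?e ?e - fip ?e (r.Q * ?e) \<le> 64 * V * dof \<nu> / \<delta>"
    and g5: "(frob_norm ((1 / real n) \<cdot>\<^sub>m (?e\<^sup>T * ?e) - (G + \<tau>\<^sup>2 \<cdot>\<^sub>m 1\<^sub>m m)))\<^sup>2 \<le> 65536 * V\<^sup>2 / real n / \<delta>"
    using good by (auto simp: good_def r.Q_def l_def)
  define D where "D = \<Psi>h - \<Psi>"
  have D: "D \<in> carrier_mat p m" and res: "Yr \<omega> - X * (\<Psi>h + Lh) = r.Q * (?e + (X * L - X * D))"
    and basic: "fip (X * D) (r.Q * (X * D)) / real n / 2 \<le> 2 * bias \<nu>
       + l / 2 * l1l2_norm D + l * (l1l2_norm \<Psi> - l1l2_norm (\<Psi> + D))"
    using r.step1_basic[OF sol[folded l_def] Psi L e response_eq g1] by (auto simp: D_def bias_def r.Q_def)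
  have XD: "X * D \<in> carrier_mat n m" using X D by simp
  define g where "g = fip (X * D) (r.Q * (X * D)) / real n"
  have g: "0 \<le> g"
  proof -
    have "0 \<le> fip (r.Q * (X * D)) (r.Q * (X * D))" by (simp add: frob_sq[symmetric])
    then show ?thesis using r.Q_contraction(1)[OF XD] by (simp add: g_def)
  qed
  have b0: "0 \<le> bias \<nu>" by (rule bias_bounds(1)[OF \<nu>])
  have basic': "g / 2 \<le> 2 * bias \<nu> + l / 2 * l1l2_norm D + l * (l1l2_norm \<Psi> - l1l2_norm (\<Psi> + D))"
    using basic by (simp add: g_def)
  have r0: "0 \<le> r" using b0 br by linarith
  have lasso: "g \<le> 16 * r" "l * l1l2_norm D \<le> 20 * r"
  proof -
    have "g \<le> 16 * r \<and> l * l1l2_norm D \<le> 20 * r"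
      using alt
    proof
      assume a: "(lam T \<nu>)\<^sup>2 * real s * (ck\<^sup>2 * (1 + sig / \<nu>)) \<le> r"
      have re: "(frob_norm (restrict_rows supp D))\<^sup>2 \<le> ck\<^sup>2 * (1 + sig / \<nu>) * g" if c: "D \<in> re_cone p m supp 4"
      proof -
        have "fip (X * D) (X * D) \<le> (1 + sig / \<nu>) * fip (X * D) (r.Q * (X * D))"
          by (rule r.quad_Q_lower[OF sig0 sig_bound XD])
        from divide_right_mono[OF this, of "real n"] have "fip (X * D) (X * D) / real n \<le> (1 + sig / \<nu>) * g"
          by (simp add: g_def)
        from mult_left_mono[OF this, of "ck\<^sup>2"] show ?thesis using re_bound[OF c] by (simp add: mult.assoc)
      qed
      have c0: "0 \<le> ck\<^sup>2 * (1 + sig / \<nu>)" using sig0 \<nu> by simp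
      have "max (bias \<nu>) (l\<^sup>2 * real s * (ck\<^sup>2 * (1 + sig / \<nu>))) \<le> r" using a br by (simp add: l_def)
      with lasso_bound[OF D Psi supp l g b0 c0 basic' re] show ?thesis by linarith
    next
      assume "bias \<nu> + lam T \<nu> * l1l2_norm \<Psi> \<le> r"
      then have a: "bias \<nu> + l * l1l2_norm \<Psi> \<le> r" by (simp add: l_def)
      have 4: "4 * (bias \<nu> + l * l1l2_norm \<Psi>) \<le> 4 * r" using a by simp
      have "g \<le> 16 * r" using order_trans[OF lasso_slow_bound(1)[OF D Psi l g b0 basic'] 4] r0 by simp
      moreover have "l * l1l2_norm D \<le> 20 * r" using order_trans[OF lasso_slow_bound(2)[OF D Psi l g b0 basic'] 4] r0 by simp
      ultimately show ?thesis ..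
    qed
    then show "g \<le> 16 * r" "l * l1l2_norm D \<le> 20 * r" by auto
  qed
  have Vn: "0 \<le> V / real n" using V_pos by simp
  define e1 e2 e3 where "e1 = r + T * (V / real n)" and "e2 = 64 * T * (V * dof \<nu> / real n)"
    and "e3 = 256 * T * (V / sqrt (real n))"
  have e1: "frob_norm ((r.Q * (r.Q * (X * L)))\<^sup>T * ?e) \<le> real n * e1"
  proof -
    \<comment> \<open>The geometric mean of bias and noise level is paid by their sum: 2 (n r) (T V)
      is at most the square of n r + T V.\<close>
    have "real n * bias \<nu> * V * (2 * T) \<le> real n * r * V * (2 * T)"
      using br V_pos T by (intro mult_right_mono mult_left_mono) auto
    also have "\<dots> \<le> (real n * r + T * V)\<^sup>2"
    proof -
      have "2 * (real n * r) * (T * V) \<le> (real n * r + T * V)\<^sup>2" by (simp add: power2_sum)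
      then show ?thesis by (simp add: mult_ac)
    qed
    finally have "(frob_norm ((r.Q * (r.Q * (X * L)))\<^sup>T * ?e))\<^sup>2 \<le> (real n * r + T * V)\<^sup>2" using g3 by linarith
    then have "frob_norm ((r.Q * (r.Q * (X * L)))\<^sup>T * ?e) \<le> real n * r + T * V"
      by (rule power2_le_imp_le) (use r0 T V_pos in simp)
    then show ?thesis using n0 by (simp add: e1_def distrib_left)
  qed
  have e2: "fip ?e ?e - fip ?e (r.Q * ?e) \<le> real n * e2"
  proof -
    have "64 * V * dof \<nu> / \<delta> = 64 * V * dof \<nu> * (1 / \<delta>)" by simp
    also have "\<dots> \<le> 64 * V * dof \<nu> * T" using \<delta> V_pos dof_nonneg[OF \<nu>] by (intro mult_left_mono) auto
    finally show ?thesis using g4 n0 by (simp add: e2_def mult_ac)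
  qed
  have e3: "frob_norm ((1 / real n) \<cdot>\<^sub>m (?e\<^sup>T * ?e) - (G + \<tau>\<^sup>2 \<cdot>\<^sub>m 1\<^sub>m m)) \<le> e3"
  proof (rule power2_le_imp_le)
    \<comment> \<open>65536 is the square of 256, and 1/\<delta> \<le> T \<le> T^2 avoids a square
      root of \<delta>.\<close>
    have "65536 * V\<^sup>2 / real n / \<delta> = 65536 * V\<^sup>2 / real n * (1 / \<delta>)" by simp
    also have "\<dots> \<le> 65536 * V\<^sup>2 / real n * T\<^sup>2"
      using \<delta> T self_le_power[of T 2] by (intro mult_left_mono) auto
    also have "\<dots> = e3\<^sup>2" by (simp add: e3_def power_mult_distrib power_divide)
    finally show "(frob_norm ((1 / real n) \<cdot>\<^sub>m (?e\<^sup>T * ?e) - (G + \<tau>\<^sup>2 \<cdot>\<^sub>m 1\<^sub>m m)))\<^sup>2 \<le> e3\<^sup>2" using g5 by simp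
    show "0 \<le> e3" using T V_pos by (simp add: e3_def)
  qed
  have Gc: "G + \<tau>\<^sup>2 \<cdot>\<^sub>m 1\<^sub>m m \<in> carrier_mat m m" using G by simp
  define Sh where "Sh = residual_cov X (Yr \<omega>) (\<Psi>h + Lh)"
  have bb: "fip (X * L) (r.Q * (X * L)) \<le> real n * r"
    using mult_left_mono[OF br, of "real n"] n0 by (simp add: bias_def r.Q_def)
  have gg: "fip (X * D) (r.Q * (X * D)) \<le> real n * g" using n0 by (simp add: g_def)
  have "frob_norm (Sh - (G + \<tau>\<^sup>2 \<cdot>\<^sub>m 1\<^sub>m m)) \<le> e3 + 2 * e2 + 2 * e1 + l * l1l2_norm D + 2 * r + 2 * g"
    unfolding Sh_def using l by (intro r.residual_cov_bound[OF L D e Gc res g2 _ e1 e2 e3 bb gg]) auto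
  also have "\<dots> \<le> e3 + 2 * e2 + 2 * e1 + 54 * r" using lasso by linarith
  also have "\<dots> = 256 * T * (V / sqrt (real n)) + 2 * T * (V / real n) + 128 * T * (V * dof \<nu> / real n) + 56 * r"
    by (simp add: e1_def e2_def e3_def)
  also have "\<dots> \<le> 256 * T * (cV * (real m * err)) + 2 * T * (cV * (real m * err)) + 128 * T * (C0 * T * real m * err)"
  proof -
    have m_err: "cV * (real m * (real K / sqrt (real n))) \<le> cV * (real m * err)"
      using cV_pos err_ge by (intro mult_left_mono) auto
    have "256 * T * (V / sqrt (real n)) \<le> 256 * T * (cV * (real m * err))"
      using T order_trans[OF V_sqrt_n m_err] by (intro mult_left_mono) auto
    moreover have "2 * T * (V / real n) \<le> 2 * T * (cV * (real m * err))"
      using T order_trans[OF V_n m_err] by (intro mult_left_mono) auto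
    moreover have "128 * T * (V * dof \<nu> / real n) + 56 * r \<le> 128 * T * (C0 * T * real m * err)"
    proof -
      have "56 * r \<le> 128 * T * r" using T r0 by (intro mult_right_mono) auto
      moreover have "128 * T * (r + V * dof \<nu> / real n) \<le> 128 * T * (C0 * T * real m * err)"
        using T rC by (intro mult_left_mono) auto
      ultimately show ?thesis by (simp add: distrib_left)
    qed
    ultimately show ?thesis by linarith
  qed
  also have "\<dots> \<le> (258 * cV + 128 * C0) * (T\<^sup>2 * (real m * err))"
  proof -
    have "T * (258 * cV * (real m * err)) \<le> T\<^sup>2 * (258 * cV * (real m * err))"
      using T self_le_power[of T 2] cV_pos err_ge by (intro mult_right_mono) auto
    then show ?thesis by (simp add: algebra_simps power2_eq_square)
  qed
  finally have Sh_le: "frob_norm (Sh - (G + \<tau>\<^sup>2 \<cdot>\<^sub>m 1\<^sub>m m)) \<le> (258 * cV + 128 * C0) * (T\<^sup>2 * (real m * err))" .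
  have "Yr \<omega> - X * (\<Psi>h + Lh) \<in> carrier_mat n m"
    unfolding res using r.Q e XL XD by simp
  then have rc: "(Yr \<omega> - X * (\<Psi>h + Lh))\<^sup>T * (Yr \<omega> - X * (\<Psi>h + Lh)) \<in> carrier_mat m m"
    "((Yr \<omega> - X * (\<Psi>h + Lh))\<^sup>T * (Yr \<omega> - X * (\<Psi>h + Lh)))\<^sup>T = (Yr \<omega> - X * (\<Psi>h + Lh))\<^sup>T * (Yr \<omega> - X * (\<Psi>h + Lh))"
    using transpose_mult[of "(Yr \<omega> - X * (\<Psi>h + Lh))\<^sup>T" m n "Yr \<omega> - X * (\<Psi>h + Lh)" m] by auto
  have Sh: "Sh \<in> carrier_mat m m" "Sh\<^sup>T = Sh"
    using rc by (auto simp: Sh_def residual_cov_def transpose_smult_mat)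
  have UU: "U \<in> carrier_mat m K" "U\<^sup>T * U = 1\<^sub>m K" using U Sh by (auto simp: top_eigenvectors_def Sh_def[symmetric])
  show P': "is_proj m K (U * U\<^sup>T)" by (rule is_proj_orthonormal[OF UU])
  have pos: "0 < cl * real m" using cpos m0 by simp
  \<comment> \<open>Here homoscedasticity is used: the covariance of E is the multiple of the
    identity that Davis--Kahan does not see.\<close>
  have "frob_norm (P - U * U\<^sup>T) \<le> 2 * frob_norm (Sh - (G + \<tau>\<^sup>2 \<cdot>\<^sub>m 1\<^sub>m m)) / (cl * real m)"
    using Km U by (intro davis_kahan[OF proj P' G GP pos quad_G_ge Sh(1)] ky_fan[OF Sh proj]) (auto simp: Sh_def)
  also have "\<dots> \<le> 2 * ((258 * cV + 128 * C0) * (T\<^sup>2 * (real m * err))) / (cl * real m)"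
    using Sh_le pos by (intro divide_right_mono mult_left_mono) auto
  also have "\<dots> = C2 * T\<^sup>2 * err" using m0 cpos by (simp add: C2_def field_simps)
  finally show "frob_norm (P - U * U\<^sup>T) \<le> C2 * T\<^sup>2 * err" .
qed

end

section \<open>Error of the third step\<close>

lemma mat_group_aux:
  fixes a b c d :: "real mat"
  assumes "a \<in> carrier_mat n m" "b \<in> carrier_mat n m" "c \<in> carrier_mat n m" "d \<in> carrier_mat n m"
  shows "a - c = (a - b) - (c - b)" "a - c = (a + b) - (c + b)" "(a - b) + d - (a - c) = (c - b) + d"
    "a - 0\<^sub>m n m = 0\<^sub>m n m + a"
  using assms by (auto intro!: eq_matI)

lemma vnorm_row_mult_proj:
  assumes P: "is_proj m k P" and Z: "Z \<in> carrier_mat p m" and j: "j < p"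
  shows "vnorm (row (Z * (1\<^sub>m m - P)) j) \<le> vnorm (row Z j)"
proof -
  define H where "H = 1\<^sub>m m - P"
  have H: "H \<in> carrier_mat m m" "H\<^sup>T = H" using is_proj_complement[OF P] by (auto simp: H_def)
  have "row (Z * H) j = H *\<^sub>v row Z j"
  proof (rule eq_vecI)
    fix i assume "i < dim_vec (H *\<^sub>v row Z j)"
    then have i: "i < m" using H by simp
    have "row H i = col H i" using H i by (metis carrier_matD(2) row_transpose)
    then show "row (Z * H) j $ i = (H *\<^sub>v row Z j) $ i"
      using i j Z H(1) comm_scalar_prod[of "row Z j" m "col H i"] by simp
  qed (use Z H in auto)
  then show ?thesis using proj_contraction(2)[OF P, of "row Z j"] Z j by (simp add: H_def)
qed

text \<open>The deviation of the data from X \<Theta>* is split by the way it is paid for: N1 is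
  small in Frobenius norm and enters as a bias, N2 has rows dominated by the penalty.\<close>

lemma step3_basic:
  assumes sol: "step3_solution X Y Ph l3 \<Theta>" and X: "X \<in> carrier_mat n p" and Y: "Y \<in> carrier_mat n m"
    and Ph: "Ph \<in> carrier_mat m m" and Th: "Th \<in> carrier_mat p m" and n: "0 < n"
    and N: "N1 \<in> carrier_mat n m" "N2 \<in> carrier_mat n m" "Y * (1\<^sub>m m - Ph) - X * Th = N1 + N2"
    and row: "\<And>j. j < p \<Longrightarrow> vnorm (row (X\<^sup>T * N2) j) \<le> real n * l3 / 4"
  defines "D \<equiv> \<Theta> - Th"
  shows "D \<in> carrier_mat p m"
    "fip (X * D) (X * D) / real n / 2 \<le> 2 * ((frob_norm N1)\<^sup>2 / real n) + l3 / 2 * l1l2_norm D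
       + l3 * (l1l2_norm Th - l1l2_norm (Th + D))"
proof -
  have \<Theta>: "\<Theta> \<in> carrier_mat p m" using sol X Y by (simp add: step3_solution_def)
  show D: "D \<in> carrier_mat p m" using \<Theta> Th by (simp add: D_def)
  define Yp where "Yp = Y * (1\<^sub>m m - Ph)"
  have Yp: "Yp \<in> carrier_mat n m" unfolding Yp_def by (rule mult_carrier_mat[OF Y]) (use Ph in simp)
  have XD: "X * D \<in> carrier_mat n m" and XT: "X * Th \<in> carrier_mat n m" and X\<Theta>: "X * \<Theta> \<in> carrier_mat n m"
    using X D Th \<Theta> by auto
  define N where "N = N1 + N2"
  have Nc: "N \<in> carrier_mat n m" using N by (simp add: N_def)
  have YN: "Yp - X * Th = N" using N by (simp add: Yp_def N_def)
  have ThD: "Th + D = \<Theta>" using \<Theta> Th by (auto simp: D_def)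
  have XDe: "X * D = X * \<Theta> - X * Th" unfolding D_def by (rule mult_minus_distrib_mat[OF X \<Theta> Th])
  have Y\<Theta>: "Yp - X * \<Theta> = N - X * D"
    unfolding XDe YN[symmetric] by (rule mat_group_aux(1)[OF Yp XT X\<Theta> Yp])
  have "step3_objective X Y Ph l3 \<Theta> \<le> step3_objective X Y Ph l3 Th"
    using sol X Y Th by (auto simp: step3_solution_def)
  moreover have "dim_row X = n" "dim_col Y = m" using X Y by auto
  ultimately have obj: "fip (N - X * D) (N - X * D) / real n + l3 * l1l2_norm \<Theta> \<le> fip N N / real n + l3 * l1l2_norm Th"
    by (simp add: step3_objective_def Yp_def[symmetric] Y\<Theta> YN frob_sq)
  have "fip (N - X * D) (N - X * D) = fip N (N - X * D) - fip (X * D) (N - X * D)"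
    using Nc XD by (intro fip_minus_left[of _ n m]) auto
  also have "\<dots> = (fip N N - fip N (X * D)) - (fip (X * D) N - fip (X * D) (X * D))"
    by (simp only: fip_minus_right[OF Nc XD Nc] fip_minus_right[OF Nc XD XD])
  finally have "fip (N - X * D) (N - X * D) = fip N N - 2 * fip (X * D) N + fip (X * D) (X * D)"
    using fip_commute[OF Nc XD] by simp
  with obj have a: "(fip (X * D) (X * D) - 2 * fip (X * D) N) / real n \<le> l3 * (l1l2_norm Th - l1l2_norm (Th + D))"
    unfolding ThD by (simp add: diff_divide_distrib add_divide_distrib algebra_simps)
  have "fip (X * D) N = fip (X * D) N1 + fip (X * D) N2"
    unfolding N_def using N XD by (intro fip_add_right) auto
  moreover have "2 * fip (X * D) N1 \<le> fip (X * D) (X * D) / 2 + 2 * (frob_norm N1)\<^sup>2"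
  proof -
    have "2 * fip (X * D) N1 \<le> 2 * (frob_norm (X * D) * frob_norm N1)" using fip_le_frob[OF XD N(1)] by simp
    also have "\<dots> \<le> (frob_norm (X * D))\<^sup>2 / 2 + 2 * (frob_norm N1)\<^sup>2"
      using sum_squares_bound[of "frob_norm (X * D)" "2 * frob_norm N1"] by (simp add: power_mult_distrib field_simps)
    finally show ?thesis by (simp add: frob_sq)
  qed
  moreover have "2 * fip (X * D) N2 \<le> real n * (l3 / 2 * l1l2_norm D)"
  proof -
    have XN: "X\<^sup>T * N2 \<in> carrier_mat p m" using X N by simp
    have "fip (X * D) N2 = fip D (X\<^sup>T * N2)" by (rule fip_mult_left[OF X D N(2)])
    also have "\<dots> = fip (X\<^sup>T * N2) D" by (rule fip_commute[OF D XN])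
    also have "\<dots> \<le> real n * l3 / 4 * l1l2_norm D" using fip_le_l1l2[OF XN D row] by simp
    finally show ?thesis by simp
  qed
  ultimately have "fip (X * D) (X * D) - 2 * fip (X * D) N
      \<ge> fip (X * D) (X * D) / 2 - 2 * (frob_norm N1)\<^sup>2 - real n * (l3 / 2 * l1l2_norm D)" by linarith
  from divide_right_mono[OF this, of "real n"] a
  have "(fip (X * D) (X * D) / 2 - 2 * (frob_norm N1)\<^sup>2 - real n * (l3 / 2 * l1l2_norm D)) / real n
      \<le> l3 * (l1l2_norm Th - l1l2_norm (Th + D))" by simp
  then show "fip (X * D) (X * D) / real n / 2 \<le> 2 * ((frob_norm N1)\<^sup>2 / real n) + l3 / 2 * l1l2_norm D
       + l3 * (l1l2_norm Th - l1l2_norm (Th + D))"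
    using n by (simp add: diff_divide_distrib)
qed

context hv_model
begin

definition Th :: "real mat" where "Th = Theta_star \<Psi> B"

lemma Th_eq: "Th = \<Psi> * (1\<^sub>m m - P)"
  using B by (simp add: Th_def Theta_star_def P_def)

lemma Pc: "1\<^sub>m m - P \<in> carrier_mat m m" using projD by simp

lemma Th: "Th \<in> carrier_mat p m" unfolding Th_eq by (rule mult_carrier_mat[OF Psi Pc])

lemma mult_compl: "Z \<in> carrier_mat a m \<Longrightarrow> is_proj m k H \<Longrightarrow> Z * (1\<^sub>m m - H) = Z - Z * H"
  using mult_minus_distrib_mat[of Z a m "1\<^sub>m m" m H] is_projD[of m k H] by simp

text \<open>L = A B has its rows in the range of P and is annihilated by I - P, so the target
  depends on \<Psi> and L only through F.\<close>

lemma X_Th: "X * Th = X * F * (1\<^sub>m m - P)"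
proof -
  have "L * P = L" unfolding L_def using assoc_mult_mat[OF A B projD(1)] by (simp add: BP)
  then have "L * (1\<^sub>m m - P) = 0\<^sub>m p m" using mult_compl[OF L proj] L by simp
  then have "F * (1\<^sub>m m - P) = Th"
    unfolding F_def Th_eq using add_mult_distrib_mat[OF Psi L Pc] mult_carrier_mat[OF Psi Pc] by simp
  then show ?thesis using assoc_mult_mat[OF X F Pc] by simp
qed

lemma Th_supp: "j < p \<Longrightarrow> j \<notin> supp \<Longrightarrow> row Th j = 0\<^sub>v m"
proof -
  assume j: "j < p" "j \<notin> supp"
  have "row \<Psi> j = 0\<^sub>v m" by (rule supp(3)[OF j])
  then show ?thesis unfolding Th_eq using Psi Pc j by (intro eq_vecI) auto
qed

lemma step3_decomposition:
  assumes \<omega>: "\<omega> \<in> space M" and Ph: "is_proj m K Ph"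
  shows "Yr \<omega> * (1\<^sub>m m - Ph) - X * Th = (X * F + W \<omega> * B) * (P - Ph) + E \<omega> * (1\<^sub>m m - Ph)"
proof -
  note ph = is_projD[OF Ph]
  have WB: "W \<omega> * B \<in> carrier_mat n m" using W[OF \<omega>] B by simp
  have XF: "X * F \<in> carrier_mat n m" using X F by simp
  have e: "E \<omega> \<in> carrier_mat n m" by (rule E[OF \<omega>])
  define Z where "Z = X * F + W \<omega> * B"
  have Z: "Z \<in> carrier_mat n m" using XF WB by (simp add: Z_def)
  have phc: "1\<^sub>m m - Ph \<in> carrier_mat m m" using ph by simp
  have Y: "Yr \<omega> = Z + E \<omega>"
    unfolding response_eq noise_mat_def Z_def F_def[symmetric] using XF WB e by (simp add: assoc_add_mat[of _ n m])
  have "W \<omega> * B * P = W \<omega> * B" using assoc_mult_mat[OF W[OF \<omega>] B projD(1)] by (simp add: BP)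
  then have ZP: "Z * P = X * F * P + W \<omega> * B" unfolding Z_def using add_mult_distrib_mat[OF XF WB projD(1)] by simp
  have XFP: "X * F * P \<in> carrier_mat n m" by (rule mult_carrier_mat[OF XF projD(1)])
  have "X * Th = X * F - X * F * P" unfolding X_Th by (rule mult_compl[OF XF proj])
  also have "\<dots> = Z - Z * P" unfolding ZP unfolding Z_def by (rule mat_group_aux(2)[OF XF WB XFP XF])
  finally have XT: "X * Th = Z - Z * P" .
  have "Yr \<omega> * (1\<^sub>m m - Ph) = Z * (1\<^sub>m m - Ph) + E \<omega> * (1\<^sub>m m - Ph)"
    unfolding Y by (rule add_mult_distrib_mat[OF Z e phc])
  then have "Yr \<omega> * (1\<^sub>m m - Ph) = Z - Z * Ph + E \<omega> * (1\<^sub>m m - Ph)" by (simp only: mult_compl[OF Z Ph])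
  then show ?thesis
    unfolding XT Z_def[symmetric] mult_minus_distrib_mat[OF Z projD(1) ph(1)]
    using mat_group_aux(3)[OF Z mult_carrier_mat[OF Z ph(1)] mult_carrier_mat[OF Z projD(1)] mult_carrier_mat[OF e phc]]
    by simp
qed

definition C4 :: real where "C4 = (sqrt cF + 4 * \<gamma>w * sqrt (26 * cK * cu)) * C2"
text \<open>Bounds the Frobenius norm of the perturbation N1 divided by sqrt n: a factor T from the
  operator norm of the signal times T^2 from the projection error.\<close>

definition b3 :: "real \<Rightarrow> real" where "b3 T = C4 * T ^ 3 * (sqrt (real m + real s) * err)"
text \<open>Serves two purposes: it is above the prescribed lower bound of the third penalty for
  \<epsilon> = 1/2, and it dominates the rows of X^T E on the good event.\<close>

definition l0 :: "real \<Rightarrow> real" where "l0 T = 4 * \<gamma>e * sqrt (real m) * (1 + sqrt (2 * T)) / sqrt (real n)"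
text \<open>For \<open>s = 0\<close> the rate vanishes, so \<open>\<Theta>\<close> has to be recovered exactly: the penalty is taken so
  large that the third step returns \<open>0\<close>.\<close>

definition l3 :: "real \<Rightarrow> real" where
  "l3 T = (if s = 0 then max (l0 T) (4 / real n * (l1l2_norm (X\<^sup>T * (X * F)) + sqrt (real n * V * (2 * T))))
           else max (l0 T) (b3 T / sqrt (real s)))"
definition C5 :: real where "C5 = 20 * ((1 + ck\<^sup>2) * C4 + 12 * \<gamma>e * ck\<^sup>2)"

lemma C4_nonneg: "0 \<le> C4" using C2_pos cpos gw by (simp add: C4_def)

lemma l0_pos: "0 \<le> T \<Longrightarrow> 0 < l0 T" using ge m0 n0 by (simp add: l0_def add_pos_nonneg)

lemma l3_ge: "l0 T \<le> l3 T" by (simp add: l3_def)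

lemma lower_l0:
  assumes "ln (2 * real p) \<le> T"
  shows "lambda3_lower X m \<gamma>e (1/2) \<le> l3 T"
proof -
  have d: "dim_row X = n" "dim_col X = p" using X by auto
  have "0 \<le> ln (2 * real p)" using p1 by simp
  then have "sqrt (2 * ln (2 * real p)) \<le> sqrt (2 * T)" using assms by simp
  also have "\<dots> \<le> sqrt (real m) * sqrt (2 * T)"
    using mult_right_mono[of 1 "sqrt (real m)" "sqrt (2 * T)"] m0 assms \<open>0 \<le> ln _\<close> by simp
  finally have "sqrt (real m) + sqrt (2 * ln (2 * real p)) \<le> sqrt (real m) * (1 + sqrt (2 * T))"
    by (simp add: distrib_left)
  then have "4 * \<gamma>e * (sqrt (real m) + sqrt (2 * ln (2 * real p))) / sqrt (real n)
      \<le> 4 * \<gamma>e * (sqrt (real m) * (1 + sqrt (2 * T))) / sqrt (real n)"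
    using ge by (intro divide_right_mono mult_left_mono) auto
  then have "lambda3_lower X m \<gamma>e (1/2) \<le> l0 T"
    by (simp add: lambda3_lower_def l0_def max_diag_sample_cov d mult.commute[of "real p" 2] mult.assoc)
  then show ?thesis using l3_ge[of T] by linarith
qed

text \<open>The deterministic part uses the hypothesis on X F, the random part the grid bound. Both
  have the form sqrt n sqrt(m + s) T, once m in the bound for G is enlarged to m + s.\<close>

lemma op_signal:
  assumes T: "1 \<le> T" and \<omega>: "\<omega> \<in> space M" and good: "good T \<delta> \<nu> \<omega>" and v: "v \<in> carrier_vec m"
  shows "vnorm ((X * F + W \<omega> * B) *\<^sub>v v)
    \<le> sqrt (real n) * (sqrt (real m + real s) * ((sqrt cF + 4 * \<gamma>w * sqrt (26 * cK * cu)) * T)) * vnorm v"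
proof -
  have WB: "W \<omega> * B \<in> carrier_mat n m" using W[OF \<omega>] B by simp
  have XF: "X * F \<in> carrier_mat n m" using X F by simp
  have "sqrt T \<le> sqrt (T\<^sup>2)" using T self_le_power[of T 2] by (intro real_sqrt_le_mono) auto
  then have sT: "sqrt T \<le> T" using T by simp
  have "(X * F + W \<omega> * B) *\<^sub>v v = X * F *\<^sub>v v + W \<omega> * B *\<^sub>v v" by (rule add_mult_distrib_mat_vec[OF XF WB v])
  then have 0: "vnorm ((X * F + W \<omega> * B) *\<^sub>v v) \<le> vnorm (X * F *\<^sub>v v) + vnorm (W \<omega> * B *\<^sub>v v)"
    using vnorm_add[of "X * F *\<^sub>v v" n "W \<omega> * B *\<^sub>v v"] mult_mat_vec_carrier[OF XF v] mult_mat_vec_carrier[OF WB v] by simp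
  have 1: "vnorm (X * F *\<^sub>v v) \<le> sqrt (real n) * (sqrt (real m + real s) * (sqrt cF * T)) * vnorm v"
  proof -
    have "(op_norm (X * F))\<^sup>2 \<le> real n * ((real m + real s) * cF)"
      using opF n0 by (simp add: F_def L_def divide_le_eq mult_ac)
    then have "op_norm (X * F) \<le> sqrt (real n) * (sqrt (real m + real s) * sqrt cF)"
      by (metis real_le_rsqrt real_sqrt_mult)
    also have "\<dots> \<le> sqrt (real n) * (sqrt (real m + real s) * (sqrt cF * T))"
      using T cpos by (intro mult_left_mono) (auto simp: mult_le_cancel_left1)
    finally show ?thesis
      by (intro order_trans[OF op_norm_bound(1)[OF XF v]] mult_right_mono) auto
  qed
  have 2: "vnorm (W \<omega> * B *\<^sub>v v) \<le> sqrt (real n) * (sqrt (real m + real s) * (4 * \<gamma>w * sqrt (26 * cK * cu) * T)) * vnorm v"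
  proof -
    have "vnorm (W \<omega> * B *\<^sub>v v) \<le> 4 * \<gamma>w * sqrt (2 * (6 * real n + 6 * real K + T)) * sqrt (v \<bullet> (G *\<^sub>v v))"
      using good v by (simp add: good_def)
    \<comment> \<open>26 = 12 + 12 + 2: the contributions of n, of K \<le> cK n and of T are each
      compared with cK T n.\<close>
    also have "\<dots> \<le> 4 * \<gamma>w * sqrt (26 * cK * T * real n) * (sqrt (cu * (real m + real s)) * vnorm v)"
    proof (intro mult_mono)
      have a: "1 * 1 \<le> cK * T" using cpos T by (intro mult_mono) auto
      have "12 * real n \<le> 12 * (cK * T * real n)" using a by (simp add: mult_le_cancel_right1)
      moreover have "12 * real K \<le> 12 * (cK * T * real n)"
      proof -
        have "cK * 1 * real n \<le> cK * T * real n" using cpos T by (intro mult_right_mono mult_left_mono) auto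
        then show ?thesis using KcK by simp
      qed
      moreover have "2 * T \<le> 2 * (cK * T * real n)"
      proof -
        have "1 * T * 1 \<le> cK * T * real n" using cpos T n0 by (intro mult_mono) auto
        then show ?thesis by simp
      qed
      ultimately show "sqrt (2 * (6 * real n + 6 * real K + T)) \<le> sqrt (26 * cK * T * real n)"
        by (intro real_sqrt_le_mono) simp
      have "v \<bullet> (G *\<^sub>v v) \<le> cu * (real m + real s) * (vnorm v)\<^sup>2"
      proof -
        have "cu * real m * (vnorm v)\<^sup>2 \<le> cu * (real m + real s) * (vnorm v)\<^sup>2"
          using cpos by (intro mult_right_mono mult_left_mono) auto
        then show ?thesis using quad_G_le[OF v] by (simp add: vnorm_sq)
      qed
      from real_sqrt_le_mono[OF this] show "sqrt (v \<bullet> (G *\<^sub>v v)) \<le> sqrt (cu * (real m + real s)) * vnorm v"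
        by (simp add: real_sqrt_mult)
    qed (use gw cpos T quad_G[OF v] in auto)
    also have "\<dots> = sqrt (real n) * (sqrt (real m + real s) * (4 * \<gamma>w * sqrt (26 * cK * cu) * sqrt T)) * vnorm v"
      by (simp add: real_sqrt_mult)
    also have "\<dots> \<le> sqrt (real n) * (sqrt (real m + real s) * (4 * \<gamma>w * sqrt (26 * cK * cu) * T)) * vnorm v"
      using sT gw cpos by (intro mult_right_mono mult_left_mono) auto
    finally show ?thesis .
  qed
  show ?thesis using 0 1 2 by (simp add: distrib_left distrib_right)
qed

lemma rate_eq: "rate X m K s Rb = max (real s / sqrt (real n)) (sqrt (real s * (real m + real s) / real m) * err)"
  using X by (simp add: rate_def err_def sig_def)

lemma row_noise_proj:
  assumes "is_proj m K Ph" "Z \<in> carrier_mat n m" "j < p"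
  shows "vnorm (row (X\<^sup>T * (Z * (1\<^sub>m m - Ph))) j) \<le> vnorm (row (X\<^sup>T * Z) j)"
proof -
  have c: "1\<^sub>m m - Ph \<in> carrier_mat m m" using is_projD[OF assms(1)] by simp
  have XT: "X\<^sup>T \<in> carrier_mat p n" and XZ: "X\<^sup>T * Z \<in> carrier_mat p m" using X assms(2) by auto
  show ?thesis using vnorm_row_mult_proj[OF assms(1) XZ assms(3)] assoc_mult_mat[OF XT assms(2) c] by simp
qed

text \<open>The oracle inequality is applied with bias \<open>(b3 T)\<^sup>2\<close> and one factor
  of the penalty is cancelled. After division by sqrt m the part s * \<open>l0\<close> gives the
  member s / sqrt n of the rate, and the part sqrt s * \<open>b3\<close> gives the member with
  \<open>err\<close>.\<close>

lemma step3_error_pos: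
  assumes T: "1 \<le> T" and \<omega>: "\<omega> \<in> space M" and good: "good T \<delta> \<nu> \<omega>"
    and Ph: "is_proj m K Ph" "frob_norm (P - Ph) \<le> C2 * T\<^sup>2 * err"
    and sol: "step3_solution X (Yr \<omega>) Ph (l3 T) \<Theta>" and s: "s \<noteq> 0"
  shows "1 / sqrt (real m) * l1l2_norm (\<Theta> - Th) \<le> C5 * T ^ 3 * rate X m K s Rb"
proof -
  note ph = is_projD[OF Ph(1)]
  have e: "E \<omega> \<in> carrier_mat n m" by (rule E[OF \<omega>])
  have WB: "W \<omega> * B \<in> carrier_mat n m" using W[OF \<omega>] B by simp
  have Z: "X * F + W \<omega> * B \<in> carrier_mat n m" using X F WB by simp
  have PPh: "P - Ph \<in> carrier_mat m m" using projD ph by simp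
  define N1 where "N1 = (X * F + W \<omega> * B) * (P - Ph)"
  define N2 where "N2 = E \<omega> * (1\<^sub>m m - Ph)"
  have N: "N1 \<in> carrier_mat n m" "N2 \<in> carrier_mat n m"
    using mult_carrier_mat[OF Z PPh] mult_carrier_mat[OF e, of "1\<^sub>m m - Ph" m] ph by (auto simp: N1_def N2_def)
  have dec: "Yr \<omega> * (1\<^sub>m m - Ph) - X * Th = N1 + N2"
    unfolding N1_def N2_def by (rule step3_decomposition[OF \<omega> Ph(1)])
  have l3: "0 < l3 T" using l0_pos[of T] l3_ge[of T] T by linarith
  have row: "vnorm (row (X\<^sup>T * N2) j) \<le> real n * l3 T / 4" if j: "j < p" for j
  proof -
    have "vnorm (row (X\<^sup>T * N2) j) \<le> vnorm (row (X\<^sup>T * E \<omega>) j)" unfolding N2_def by (rule row_noise_proj[OF Ph(1) e j])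
    also have "\<dots> \<le> \<gamma>e * sqrt (real n * real m * (2 * T))" using good j by (simp add: good_def)
    also have "\<dots> \<le> real n * l0 T / 4"
    proof -
      have "real n * l0 T / 4 = \<gamma>e * (sqrt (real n) * (sqrt (real m) * (1 + sqrt (2 * T))))"
      proof -
        have "real n * l0 T / 4 = \<gamma>e * ((real n / sqrt (real n)) * (sqrt (real m) * (1 + sqrt (2 * T))))"
          by (simp add: l0_def)
        then show ?thesis by (simp only: real_div_sqrt of_nat_0_le_iff)
      qed
      moreover have "\<gamma>e * (sqrt (real n) * (sqrt (real m) * sqrt (2 * T))) \<le> \<gamma>e * (sqrt (real n) * (sqrt (real m) * (1 + sqrt (2 * T))))"
        using ge by (intro mult_left_mono) auto
      ultimately show ?thesis by (simp add: real_sqrt_mult)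
    qed
    also have "\<dots> \<le> real n * l3 T / 4" using l3_ge[of T] by (simp add: mult_left_mono)
    finally show ?thesis .
  qed
  define D where "D = \<Theta> - Th"
  have D: "D \<in> carrier_mat p m"
    and basic: "fip (X * D) (X * D) / real n / 2 \<le> 2 * ((frob_norm N1)\<^sup>2 / real n) + l3 T / 2 * l1l2_norm D
       + l3 T * (l1l2_norm Th - l1l2_norm (Th + D))"
    using step3_basic[OF sol X response_carrier[OF \<omega>] ph(1) Th n0 N dec row] by (auto simp: D_def)
  have b3: "0 \<le> b3 T" using C4_nonneg T err_ge by (simp add: b3_def)
  have N1: "(frob_norm N1)\<^sup>2 / real n \<le> (b3 T)\<^sup>2"
  proof -
    define c where "c = sqrt (real n) * (sqrt (real m + real s) * ((sqrt cF + 4 * \<gamma>w * sqrt (26 * cK * cu)) * T))"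
    have c: "0 \<le> c" using cpos gw T by (simp add: c_def)
    have "frob_norm N1 \<le> c * frob_norm (P - Ph)"
      unfolding N1_def by (rule frob_mult_le_op[OF Z PPh c]) (unfold c_def, rule op_signal[OF T \<omega> good])
    also have "\<dots> \<le> c * (C2 * T\<^sup>2 * err)" using Ph(2) c by (rule mult_left_mono)
    also have "\<dots> = sqrt (real n) * b3 T" by (simp add: c_def b3_def C4_def power2_eq_square power3_eq_cube)
    finally have "(frob_norm N1)\<^sup>2 \<le> (sqrt (real n) * b3 T)\<^sup>2" by (rule power_mono) (simp add: frob_norm_def sum_nonneg)
    then show ?thesis using n0 by (simp add: power_mult_distrib divide_le_eq mult.commute)
  qed
  define g where "g = fip (X * D) (X * D) / real n"
  have g: "0 \<le> g" by (simp add: g_def frob_sq[symmetric])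
  have basic': "g / 2 \<le> 2 * (b3 T)\<^sup>2 + l3 T / 2 * l1l2_norm D + l3 T * (l1l2_norm Th - l1l2_norm (Th + D))"
    using basic N1 by (simp add: g_def)
  have re: "(frob_norm (restrict_rows supp D))\<^sup>2 \<le> ck\<^sup>2 * g" if "D \<in> re_cone p m supp 4"
    using re_bound[OF that] by (simp add: g_def)
  have "l3 T * l1l2_norm D \<le> 20 * max ((b3 T)\<^sup>2) ((l3 T)\<^sup>2 * real s * ck\<^sup>2)"
    by (rule lasso_bound(2)[OF D Th supp(1,2) Th_supp l3 g _ _ basic' re]) auto
  also have "\<dots> \<le> 20 * (b3 T * sqrt (real s) * l3 T + l3 T * (l3 T * real s * ck\<^sup>2))"
  proof -
    \<comment> \<open>This is what the second term in the maximum defining the penalty is for: the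
      squared bias then carries a factor of the penalty, which can be divided out.\<close>
    have "b3 T / sqrt (real s) \<le> l3 T" using s by (simp add: l3_def)
    then have "b3 T \<le> sqrt (real s) * l3 T" using s by (simp add: divide_le_eq mult.commute)
    from mult_left_mono[OF this b3] have "(b3 T)\<^sup>2 \<le> b3 T * sqrt (real s) * l3 T" by (simp add: power2_eq_square)
    moreover have "0 \<le> b3 T * sqrt (real s) * l3 T" "0 \<le> l3 T * (l3 T * real s * ck\<^sup>2)" using b3 l3 by auto
    moreover have "(l3 T)\<^sup>2 * real s * ck\<^sup>2 = l3 T * (l3 T * real s * ck\<^sup>2)"
      by (simp only: power2_eq_square mult.assoc)
    ultimately have "max ((b3 T)\<^sup>2) ((l3 T)\<^sup>2 * real s * ck\<^sup>2) \<le> b3 T * sqrt (real s) * l3 T + l3 T * (l3 T * real s * ck\<^sup>2)"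
      by linarith
    then show ?thesis by (rule mult_left_mono) simp
  qed
  also have "\<dots> = l3 T * (20 * (b3 T * sqrt (real s) + l3 T * real s * ck\<^sup>2))" by (simp add: algebra_simps)
  finally have "l1l2_norm D \<le> 20 * (b3 T * sqrt (real s) + l3 T * real s * ck\<^sup>2)" using l3 by simp
  also have "\<dots> \<le> 20 * (b3 T * sqrt (real s) + (l0 T * real s + b3 T * sqrt (real s)) * ck\<^sup>2)"
  proof -
    have "l3 T \<le> l0 T + b3 T / sqrt (real s)" using s b3 l0_pos[of T] T by (simp add: l3_def)
    from mult_right_mono[OF this, of "real s"] have "l3 T * real s \<le> l0 T * real s + b3 T * (real s / sqrt (real s))"
      by (simp add: distrib_right)
    then have "l3 T * real s \<le> l0 T * real s + b3 T * sqrt (real s)" by (simp add: real_div_sqrt)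
    then show ?thesis by (intro mult_left_mono add_left_mono mult_right_mono) auto
  qed
  also have "\<dots> = 20 * ((1 + ck\<^sup>2) * (b3 T * sqrt (real s)) + ck\<^sup>2 * (l0 T * real s))" by (simp add: algebra_simps)
  finally have Dle: "l1l2_norm D \<le> 20 * ((1 + ck\<^sup>2) * (b3 T * sqrt (real s)) + ck\<^sup>2 * (l0 T * real s))" .
  define \<rho> where "\<rho> = rate X m K s Rb"
  have "sqrt (real m) * sqrt (real m) = real m" by simp
  have r1: "1 / sqrt (real m) * (b3 T * sqrt (real s)) \<le> C4 * T ^ 3 * \<rho>"
  proof -
    have "1 / sqrt (real m) * (b3 T * sqrt (real s)) = C4 * T ^ 3 * (sqrt (real s * (real m + real s) / real m) * err)"
      by (simp add: b3_def real_sqrt_mult real_sqrt_divide mult_ac)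
    also have "\<dots> \<le> C4 * T ^ 3 * \<rho>" unfolding \<rho>_def rate_eq using C4_nonneg T by (intro mult_left_mono) auto
    finally show ?thesis .
  qed
  have r2: "1 / sqrt (real m) * (l0 T * real s) \<le> 12 * \<gamma>e * T ^ 3 * \<rho>"
  proof -
    \<comment> \<open>Both members of the rate are brought to the common power of T.\<close>
    have T3: "1 + sqrt (2 * T) \<le> 3 * T ^ 3"
    proof -
      have "sqrt (2 * T) \<le> sqrt ((2 * T)\<^sup>2)" using T self_le_power[of "2 * T" 2] by (intro real_sqrt_le_mono) auto
      also have "sqrt ((2 * T)\<^sup>2) = 2 * T" using T by (intro real_sqrt_unique) auto
      finally have "1 + sqrt (2 * T) \<le> 3 * T" using T by linarith
      then show ?thesis using self_le_power[of T 3] T by simp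
    qed
    have "1 / sqrt (real m) * (l0 T * real s) = 4 * \<gamma>e * ((1 + sqrt (2 * T)) * (real s / sqrt (real n)))"
      using m0 by (simp add: l0_def)
    also have "\<dots> \<le> 4 * \<gamma>e * (3 * T ^ 3 * \<rho>)"
      unfolding \<rho>_def rate_eq using ge T3 T by (intro mult_left_mono mult_mono) auto
    finally show ?thesis by simp
  qed
  have "1 / sqrt (real m) * l1l2_norm D
      \<le> 20 * ((1 + ck\<^sup>2) * (1 / sqrt (real m) * (b3 T * sqrt (real s))) + ck\<^sup>2 * (1 / sqrt (real m) * (l0 T * real s)))"
  proof -
    have "1 / sqrt (real m) * l1l2_norm D \<le> 1 / sqrt (real m) * (20 * ((1 + ck\<^sup>2) * (b3 T * sqrt (real s)) + ck\<^sup>2 * (l0 T * real s)))"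
      by (rule mult_left_mono[OF Dle]) simp
    also have "\<dots> = 20 * ((1 + ck\<^sup>2) * (1 / sqrt (real m) * (b3 T * sqrt (real s))) + ck\<^sup>2 * (1 / sqrt (real m) * (l0 T * real s)))"
      by (simp only: distrib_left mult_ac)
    finally show ?thesis .
  qed
  also have "\<dots> \<le> 20 * ((1 + ck\<^sup>2) * (C4 * T ^ 3 * \<rho>) + ck\<^sup>2 * (12 * \<gamma>e * T ^ 3 * \<rho>))"
    by (intro mult_left_mono add_mono r1 r2) auto
  also have "\<dots> = C5 * T ^ 3 * \<rho>" by (simp add: C5_def algebra_simps)
  finally show ?thesis by (simp add: D_def \<rho>_def)
qed

text \<open>Here \<Theta>* = 0, and the whole projected response takes the role of the noise N2. The
  penalty dominates it, so the basic inequality with vanishing bias forces the solution to be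
  0.\<close>

lemma step3_error_zero:
  assumes T: "1 \<le> T" and \<omega>: "\<omega> \<in> space M" and good: "good T \<delta> \<nu> \<omega>"
    and Ph: "is_proj m K Ph" and sol: "step3_solution X (Yr \<omega>) Ph (l3 T) \<Theta>" and s: "s = 0"
  shows "l1l2_norm (\<Theta> - Th) = 0"
proof -
  note ph = is_projD[OF Ph]
  have Y: "Yr \<omega> \<in> carrier_mat n m" by (rule response_carrier[OF \<omega>])
  have e: "noise_mat \<omega> \<in> carrier_mat n m" by (rule noise_mat[OF \<omega>])
  have XF: "X * F \<in> carrier_mat n m" and XT: "X\<^sup>T \<in> carrier_mat p n" using X F by auto
  have YP: "Yr \<omega> * (1\<^sub>m m - Ph) \<in> carrier_mat n m" by (rule mult_carrier_mat[OF Y]) (use ph in simp)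
  have "supp = {}" using supp(1,2) s finite_subset[OF supp(1)] by auto
  then have rows: "row Th j = 0\<^sub>v m" if "j < p" for j using Th_supp that by simp
  have Th0: "Th = 0\<^sub>m p m"
  proof (rule l1l2_eq_0[OF Th])
    show "l1l2_norm Th = 0" using rows Th by (simp add: l1l2_norm_def)
  qed
  have l3: "0 < l3 T" using l0_pos[of T] l3_ge[of T] T by linarith
  have row: "vnorm (row (X\<^sup>T * (Yr \<omega> * (1\<^sub>m m - Ph))) j) \<le> real n * l3 T / 4" if j: "j < p" for j
  proof -
    have "vnorm (row (X\<^sup>T * (Yr \<omega> * (1\<^sub>m m - Ph))) j) \<le> vnorm (row (X\<^sup>T * Yr \<omega>) j)" by (rule row_noise_proj[OF Ph Y j])
    also have "X\<^sup>T * Yr \<omega> = X\<^sup>T * (X * F) + X\<^sup>T * noise_mat \<omega>"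
      unfolding response_eq F_def[symmetric] by (rule mult_add_distrib_mat[OF XT XF e])
    also have "vnorm (row (X\<^sup>T * (X * F) + X\<^sup>T * noise_mat \<omega>) j) \<le> vnorm (row (X\<^sup>T * (X * F)) j) + vnorm (row (X\<^sup>T * noise_mat \<omega>) j)"
    proof -
      have c: "X\<^sup>T * (X * F) \<in> carrier_mat p m" "X\<^sup>T * noise_mat \<omega> \<in> carrier_mat p m" using XT XF e by auto
      then have "row (X\<^sup>T * (X * F) + X\<^sup>T * noise_mat \<omega>) j = row (X\<^sup>T * (X * F)) j + row (X\<^sup>T * noise_mat \<omega>) j"
        using j by (intro row_add) auto
      then show ?thesis using c j by (simp only:) (intro vnorm_add[of _ m] row_carrier_vec; auto)
    qed
    also have "vnorm (row (X\<^sup>T * (X * F)) j) \<le> l1l2_norm (X\<^sup>T * (X * F))"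
      using j XT XF unfolding l1l2_norm_def by (intro member_le_sum) auto
    also have "vnorm (row (X\<^sup>T * noise_mat \<omega>) j) \<le> sqrt (real n * V * (2 * T))" using good j by (simp add: good_def)
    finally have "vnorm (row (X\<^sup>T * (Yr \<omega> * (1\<^sub>m m - Ph))) j) \<le> l1l2_norm (X\<^sup>T * (X * F)) + sqrt (real n * V * (2 * T))"
      by simp
    also have "\<dots> \<le> real n * l3 T / 4"
    proof -
      have "4 / real n * (l1l2_norm (X\<^sup>T * (X * F)) + sqrt (real n * V * (2 * T))) \<le> l3 T" using l3_def[of T] s by (simp only: if_P max.cobounded2)
      from mult_left_mono[OF this, of "real n / 4"] show ?thesis using n0 by simp
    qed
    finally show ?thesis .
  qed
  have dec: "Yr \<omega> * (1\<^sub>m m - Ph) - X * Th = 0\<^sub>m n m + Yr \<omega> * (1\<^sub>m m - Ph)"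
  proof -
    have "X * Th = 0\<^sub>m n m" using X by (simp add: Th0)
    then show ?thesis using mat_group_aux(4)[OF YP YP YP YP] by simp
  qed
  define D where "D = \<Theta> - Th"
  have D: "D \<in> carrier_mat p m"
    and basic: "fip (X * D) (X * D) / real n / 2 \<le> 2 * ((frob_norm (0\<^sub>m n m))\<^sup>2 / real n) + l3 T / 2 * l1l2_norm D
       + l3 T * (l1l2_norm Th - l1l2_norm (Th + D))"
    using step3_basic[OF sol X Y ph(1) Th n0 _ YP dec row] by (auto simp: D_def)
  have "l1l2_norm Th = 0" "Th + D = D" using rows Th D by (auto simp: l1l2_norm_def Th0)
  moreover have "0 \<le> fip (X * D) (X * D) / real n / 2" by (simp add: frob_sq[symmetric])
  ultimately have "0 \<le> l3 T / 2 * l1l2_norm D + l3 T * (0 - l1l2_norm D)" using basic by simp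
  then have "l3 T / 2 * l1l2_norm D \<le> 0" by (simp add: algebra_simps)
  then have "l1l2_norm D \<le> 0" using l3 by (simp add: mult_le_0_iff)
  then show ?thesis using l1l2_ge0[of D] by (simp only: D_def)
qed

end

section \<open>Asymptotics\<close>

lemma (in prob_space) inner_prob_ge:
  assumes "A \<in> events" "A \<subseteq> S"
  shows "prob A \<le> inner_prob M S"
  unfolding inner_prob_def
proof (rule cSup_upper)
  show "prob A \<in> prob ` {A \<in> events. A \<subseteq> S}" using assms by blast
  show "bdd_above (prob ` {A \<in> events. A \<subseteq> S})" by (rule bdd_aboveI[of _ 1]) auto
qed

lemma (in prob_space) inner_prob_le_1: "inner_prob M S \<le> 1"
  unfolding inner_prob_def
proof (rule cSup_least)
  show "prob ` {A \<in> events. A \<subseteq> S} \<noteq> {}" by auto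
qed auto

context hv_model
begin

text \<open>The statement for one sample size: all tuning parameters are fixed before the data, and
  the failure probability \<delta> is traded against the level T.\<close>

lemma estimator_bound:
  assumes \<delta>: "0 < \<delta>" "\<delta> \<le> 1" and T: "1 / \<delta> \<le> T" "24 * (real p * real m)\<^sup>2 * exp (- T) \<le> \<delta>"
  obtains l2 \<epsilon>' where "0 < l2" "0 < \<epsilon>'" "\<epsilon>' < 1" "lambda3_lower X m \<gamma>e (1/2) \<le> l3 T"
    "1 - \<delta> \<le> inner_prob M (error_event M X Yr K (lambda1 X Gam l2 \<epsilon>') l2 (l3 T) (Theta_star \<Psi> B)
       (C5 * T ^ 3 * rate X m K s Rb))"
proof -
  have T1: "1 \<le> T" using \<delta> T(1) order_trans[of 1 "1 / \<delta>" T] by simp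
  have pm: "1 \<le> real p" "1 \<le> real m" using p1 m0 by auto
  have x: "1 * real p \<le> (real p * real m)\<^sup>2"
  proof -
    have "real p * 1 \<le> real p * real m" using pm by (intro mult_left_mono) auto
    moreover have "1 * 1 \<le> real p * real m" using pm by (intro mult_mono) auto
    then have "real p * real m \<le> (real p * real m)\<^sup>2" by (intro self_le_power) auto
    ultimately show ?thesis by simp
  qed
  have eT: "24 * (real p * real m)\<^sup>2 \<le> exp T"
  proof -
    have "24 * (real p * real m)\<^sup>2 = 24 * (real p * real m)\<^sup>2 * exp (- T) * exp T" by (simp add: exp_minus)
    also have "\<dots> \<le> 1 * exp T" using T(2) \<delta>(2) by (intro mult_right_mono) auto
    finally show ?thesis by simp
  qed
  then have p_exp: "2 * real p \<le> exp T" "real p < exp T" using x pm by linarith+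
  have "ln (2 * real p) \<le> ln (exp T)" using p_exp(1) pm by (subst ln_le_cancel_iff) auto
  then have lnp: "ln (2 * real p) \<le> T" by simp
  obtain \<nu> r where tuned: "tuned T \<nu> r" using tuned_exists[OF T1] .
  have \<nu>: "0 < \<nu>" using tuned by (simp add: tuned_def)
  \<comment> \<open>This choice cancels the effective rank in \<open>lambda1\<close>.\<close>
  define \<epsilon>' where "\<epsilon>' = real p * exp (- (effective_rank Gam * T))"
  have \<epsilon>0: "0 < \<epsilon>'" using pm by (simp add: \<epsilon>'_def)
  have \<epsilon>1: "\<epsilon>' < 1"
  proof -
    have "1 * T \<le> effective_rank Gam * T" using eff_rank T1 by (intro mult_right_mono) auto
    then have "\<epsilon>' \<le> real p * exp (- T)" unfolding \<epsilon>'_def by (intro mult_left_mono) auto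
    also have "\<dots> < 1" using p_exp(2) by (simp add: exp_minus divide_simps)
    finally show ?thesis .
  qed
  have lam: "lambda1 X Gam \<nu> \<epsilon>' = lam T \<nu>"
  proof -
    have d: "dim_row X = n" "dim_col X = p" using X by auto
    have "real p / \<epsilon>' = exp (effective_rank Gam * T)" using pm by (simp add: \<epsilon>'_def exp_minus inverse_eq_divide)
    then have "2 * ln (real p / \<epsilon>') / effective_rank Gam = 2 * T" using eff_rank by simp
    then show ?thesis by (simp add: lambda1_def lam_def d trace_Gam)
  qed
  have T0: "0 < T" using T1 by simp
  obtain Fb where Fb: "Fb \<in> events" "prob Fb \<le> \<delta>" "\<And>\<omega>. \<omega> \<in> space M - Fb \<Longrightarrow> good T \<delta> \<nu> \<omega>"
    using good_event[OF \<nu> T0 \<delta>(1) T(2)] by blast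
  have C5: "0 \<le> C5" using C4_nonneg ge by (simp add: C5_def)
  have rate0: "0 \<le> rate X m K s Rb" unfolding rate_eq by (simp add: le_max_iff_disj)
  have dTh: "dim_col (Theta_star \<Psi> B) = m" using Th by (simp add: Th_def)
  have sub: "space M - Fb \<subseteq> error_event M X Yr K (lambda1 X Gam \<nu> \<epsilon>') \<nu> (l3 T) (Theta_star \<Psi> B) (C5 * T ^ 3 * rate X m K s Rb)"
  proof
    fix \<omega> assume \<omega>: "\<omega> \<in> space M - Fb"
    have "1 / sqrt (real m) * l1l2_norm (\<Theta> - Th) \<le> C5 * T ^ 3 * rate X m K s Rb"
      if est: "three_step_estimate X (Yr \<omega>) K (lam T \<nu>) \<nu> (l3 T) \<Theta>" for \<Theta>
    proof -
      obtain \<Psi>h Lh U where sol: "step1_solution X (Yr \<omega>) (lam T \<nu>) \<nu> \<Psi>h Lh"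
        and U: "top_eigenvectors (residual_cov X (Yr \<omega>) (\<Psi>h + Lh)) K U"
        and s3: "step3_solution X (Yr \<omega>) (U * U\<^sup>T) (l3 T) \<Theta>"
        using est by (auto simp: three_step_estimate_def)
      have \<omega>': "\<omega> \<in> space M" and good: "good T \<delta> \<nu> \<omega>" using \<omega> Fb(3) by auto
      note pe = projection_error[OF T1 \<delta>(1) T(1) tuned \<omega>' good sol U]
      show ?thesis
      proof (cases "s = 0")
        case True
        then show ?thesis using step3_error_zero[OF T1 \<omega>' good pe(1) s3] C5 rate0 T1 by simp
      next
        case False
        then show ?thesis by (rule step3_error_pos[OF T1 \<omega>' good pe s3])
      qed
    qed
    then show "\<omega> \<in> error_event M X Yr K (lambda1 X Gam \<nu> \<epsilon>') \<nu> (l3 T) (Theta_star \<Psi> B) (C5 * T ^ 3 * rate X m K s Rb)"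
      using \<omega> by (simp add: error_event_def lam dTh Th_def)
  qed
  have "1 - \<delta> \<le> prob (space M - Fb)" using Fb(2) prob_compl[OF Fb(1)] by simp
  also have "\<dots> \<le> inner_prob M (error_event M X Yr K (lambda1 X Gam \<nu> \<epsilon>') \<nu> (l3 T) (Theta_star \<Psi> B) (C5 * T ^ 3 * rate X m K s Rb))"
    by (rule inner_prob_ge[OF _ sub]) (use Fb(1) in auto)
  finally show thesis using that[OF \<nu> \<epsilon>0 \<epsilon>1 lower_l0[OF lnp]] by simp
qed

end

section \<open>The logarithmic factor and the passage to the limit\<close>

lemma log_factor_ge_1: "1 \<le> m \<Longrightarrow> 1 \<le> p \<Longrightarrow> 1 \<le> log_factor m p"
  by (simp add: log_factor_def)

text \<open>With l the logarithmic factor, exp l = e p m \<ge> 2 p m. The share 12 l of the exponent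
  pays for the union bound, and the share c l for d, because 1/d \<le> c l \<le> exp(c l).\<close>

lemma log_factor_tail:
  assumes "1 \<le> m" "1 \<le> p" and d: "0 < d" "1 / d \<le> c * log_factor m p"
  shows "24 * (real p * real m)\<^sup>2 * exp (- ((12 + c) * log_factor m p)) \<le> d"
proof -
  define x where "x = real p * real m"
  define l where "l = log_factor m p"
  have x: "1 \<le> x" using mult_mono[of 1 "real p" 1 "real m"] assms by (simp add: x_def)
  have l: "exp l = exp 1 * x" using assms by (simp add: l_def log_factor_def x_def exp_add)
  have "2 * x \<le> exp l" unfolding l using exp_ge_add_one_self[of 1] x by (intro mult_right_mono) auto
  \<comment> \<open>A generous power: 2^12 = 4096 exceeds the numerical factor 24 and x^12 exceeds
    x^2.\<close>
  then have "(2 * x) ^ 12 \<le> exp l ^ 12" using x by (intro power_mono) auto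
  then have a: "4096 * x ^ 12 \<le> exp (12 * l)" by (simp add: power_mult_distrib exp_of_nat_mult[symmetric])
  have "24 * x\<^sup>2 \<le> 4096 * x ^ 12" using x by (intro mult_mono power_increasing) auto
  with a have b: "24 * x\<^sup>2 * exp (- (12 * l)) \<le> 1" by (simp add: exp_minus divide_simps)
  have c: "exp (- (c * l)) \<le> d"
  proof -
    have "1 / d \<le> c * l" using d(2) by (simp add: l_def)
    also have "\<dots> \<le> exp (c * l)" using exp_ge_add_one_self[of "c * l"] by linarith
    finally have "1 / d \<le> exp (c * l)" .
    then show ?thesis using d(1) by (simp add: exp_minus divide_simps mult.commute)
  qed
  have "24 * x\<^sup>2 * exp (- ((12 + c) * l)) = 24 * x\<^sup>2 * exp (- (12 * l)) * exp (- (c * l))"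
    by (simp add: distrib_right exp_add[symmetric])
  also have "\<dots> \<le> 1 * d" using b c by (intro mult_mono) auto
  finally show ?thesis by (simp add: x_def l_def)
qed

text \<open>If max(m, p) tends to infinity, the logarithmic factor can pay for a failure probability
  that tends to 0, with one constant C. The second part fixes the failure probability in advance and
  lets C depend on it. The exponent k is common to both.\<close>

theorem corollary8:
  fixes M :: "nat \<Rightarrow> 'a measure"
    and p m K s :: "nat \<Rightarrow> nat"
    and R \<tau> :: "nat \<Rightarrow> real"
    and \<gamma>w \<gamma>e :: real
    and X \<Psi> A B \<Sigma>W :: "nat \<Rightarrow> real Matrix.mat"
    and W E :: "nat \<Rightarrow> 'a \<Rightarrow> real Matrix.mat"
  assumes gammas: "\<gamma>w > 0" "\<gamma>e > 0"
    and dims: "\<And>n. n \<ge> 1 \<Longrightarrow> p n \<ge> 1 \<and> m n \<ge> 1 \<and> K n \<ge> 1 \<and> K n < m n \<and> s n \<le> p n"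
    and carriers: "\<And>n. n \<ge> 1 \<Longrightarrow> X n \<in> carrier_mat n (p n) \<and> \<Psi> n \<in> carrier_mat (p n) (m n) \<and>
           A n \<in> carrier_mat (p n) (K n) \<and> B n \<in> carrier_mat (K n) (m n)"
    and rank_B: "\<And>n. n \<ge> 1 \<Longrightarrow> mat_rank (B n) = K n"
    and noise: "\<And>n. n \<ge> 1 \<Longrightarrow>
           noise_model (M n) n (K n) (m n) \<gamma>w \<gamma>e (\<Sigma>W n) (\<tau> n) (W n) (E n)"
    and design: "\<And>n j. n \<ge> 1 \<Longrightarrow> j < p n \<Longrightarrow> sample_cov (X n) $$ (j, j) = 1"
    and sparse: "\<And>n. n \<ge> 1 \<Longrightarrow> l0l2_norm (\<Psi> n) \<le> s n"
    and low: "\<And>n. n \<ge> 1 \<Longrightarrow> R n \<ge> 0 \<and> (frob_norm (A n * B n))\<^sup>2 \<le> R n"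
    and a1: "(\<lambda>n. real_of_ereal (inverse (re_const (X n) (m n) (s n) 4))) \<in> O(\<lambda>_. 1)"
    and a2: "(\<lambda>n. 1 / real n * (op_norm (X n * (\<Psi> n + A n * B n)))\<^sup>2)
               \<in> O(\<lambda>n. real (m n) + real (s n))"
    and b1: "(\<lambda>n. kth_eigenvalue ((B n)\<^sup>T * \<Sigma>W n * B n) 1) \<in> \<Theta>(\<lambda>n. real (m n))"
    and b2: "(\<lambda>n. kth_eigenvalue ((B n)\<^sup>T * \<Sigma>W n * B n) (K n)) \<in> \<Theta>(\<lambda>n. real (m n))"
    and c1: "\<And>n. n \<ge> 1 \<Longrightarrow> re_const (X n) (m n) (s n) 4 > 0"
    and c2: "(\<lambda>n. real (K n)) \<in> O(\<lambda>n. real n)"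
  shows "\<exists>k::nat.
     (filterlim (\<lambda>n. max (m n) (p n)) at_top sequentially \<longrightarrow>
       (\<exists>C l2 \<epsilon>' \<epsilon> l3.
          (\<forall>n\<ge>1. l2 n > 0 \<and> 0 < \<epsilon>' n \<and> \<epsilon>' n < 1 \<and> 0 < \<epsilon> n \<and> \<epsilon> n < 1 \<and>
                 l3 n \<ge> lambda3_lower (X n) (m n) \<gamma>e (\<epsilon> n)) \<and>
          (\<lambda>n. inner_prob (M n)
             (error_event (M n) (X n) (\<lambda>\<omega>. response (X n) (\<Psi> n) (A n) (B n) (W n \<omega>) (E n \<omega>)) (K n)
                (lambda1 (X n) (Gamma_eps \<gamma>w \<gamma>e (\<Sigma>W n) (B n)) (l2 n) (\<epsilon>' n)) (l2 n) (l3 n)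
                (Theta_star (\<Psi> n) (B n))
                (C * log_factor (m n) (p n) ^ k * rate (X n) (m n) (K n) (s n) (R n))))
          \<longlonglongrightarrow> 1)) \<and>
     (\<forall>\<delta>>0. \<exists>C l2 \<epsilon>' \<epsilon> l3.
          (\<forall>n\<ge>1. l2 n > 0 \<and> 0 < \<epsilon>' n \<and> \<epsilon>' n < 1 \<and> 0 < \<epsilon> n \<and> \<epsilon> n < 1 \<and>
                 l3 n \<ge> lambda3_lower (X n) (m n) \<gamma>e (\<epsilon> n)) \<and>
          (\<forall>\<^sub>F n in sequentially. 1 - \<delta> \<le> inner_prob (M n)
             (error_event (M n) (X n) (\<lambda>\<omega>. response (X n) (\<Psi> n) (A n) (B n) (W n \<omega>) (E n \<omega>)) (K n)
                (lambda1 (X n) (Gamma_eps \<gamma>w \<gamma>e (\<Sigma>W n) (B n)) (l2 n) (\<epsilon>' n)) (l2 n) (l3 n)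
                (Theta_star (\<Psi> n) (B n))
                (C * log_factor (m n) (p n) ^ k * rate (X n) (m n) (K n) (s n) (R n)))))"
proof -
  obtain ck where ck: "\<forall>\<^sub>F n in sequentially. norm (real_of_ereal (inverse (re_const (X n) (m n) (s n) 4))) \<le> ck * norm (1::real)"
    using a1 by (elim landau_o.bigE)
  obtain cF where cF: "\<forall>\<^sub>F n in sequentially. norm (1 / real n * (op_norm (X n * (\<Psi> n + A n * B n)))\<^sup>2)
      \<le> cF * norm (real (m n) + real (s n))"
    using a2 by (elim landau_o.bigE)
  obtain cu where cu: "\<forall>\<^sub>F n in sequentially. norm (kth_eigenvalue ((B n)\<^sup>T * \<Sigma>W n * B n) 1) \<le> cu * norm (real (m n))"
    using bigthetaD1[OF b1] by (elim landau_o.bigE)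
  obtain cl where cl: "0 < cl" "\<forall>\<^sub>F n in sequentially. norm (kth_eigenvalue ((B n)\<^sup>T * \<Sigma>W n * B n) (K n)) \<ge> cl * norm (real (m n))"
    using bigthetaD2[OF b2] by (elim landau_omega.bigE)
  obtain cK where cK: "\<forall>\<^sub>F n in sequentially. norm (real (K n)) \<le> cK * norm (real n)"
    using c2 by (elim landau_o.bigE)
  \<comment> \<open>The constants are raised to at least 1, as the locale demands; \<open>cl\<close>
    is a lower bound and stays.\<close>
  define ck' cF' cu' cK' where "ck' = max 1 ck" and "cF' = max 1 cF" and "cu' = max 1 cu" and "cK' = max 1 cK"
  define hv where "hv n \<longleftrightarrow> hv_model (M n) n (K n) (m n) \<gamma>w \<gamma>e (\<Sigma>W n) (\<tau> n) (W n) (E n) (B n) (X n) (\<Psi> n) (A n)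
      (p n) (s n) (R n) ck' cF' cl cu' cK'" for n
  have ev_hv: "\<forall>\<^sub>F n in sequentially. hv n"
    using ck cF cu cl(2) cK eventually_ge_at_top[of "1::nat"]
  proof eventually_elim
    case (elim n)
    note d = dims[OF elim(6)] and c = carriers[OF elim(6)] and lo = low[OF elim(6)]
    interpret hv_noise "M n" n "K n" "m n" \<gamma>w \<gamma>e "\<Sigma>W n" "\<tau> n" "W n" "E n" "B n"
    proof (intro hv_noise.intro hv_noise_axioms.intro)
      show "prob_space (M n)" using noise[OF elim(6)] by (simp add: noise_model_def)
    qed (use noise[OF elim(6)] c gammas elim(6) in auto)
    \<comment> \<open>The asymptotic lower bound is for the absolute value of the eigenvalue, so
      nonnegativity is needed to remove it.\<close>
    have G0: "0 \<le> kth_eigenvalue ((B n)\<^sup>T * \<Sigma>W n * B n) (K n)"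
      using kth_G_nonneg[of "K n"] d by (simp add: G_def)
    have mono: "a * y \<le> max 1 a * y" if "0 \<le> y" for a y :: real
      using that by (intro mult_right_mono) auto
    have le: "x \<le> max 1 ck" if "norm x \<le> ck * norm (1::real)" for x :: real using that by simp
    show ?case
      unfolding hv_def
    proof (intro hv_model.intro hv_model_axioms.intro)
      show "hv_noise (M n) n (K n) (m n) \<gamma>w \<gamma>e (\<Sigma>W n) (\<tau> n) (W n) (E n) (B n)" by unfold_locales
      show "real_of_ereal (inverse (re_const (X n) (m n) (s n) 4)) \<le> ck'"
        unfolding ck'_def by (rule le[OF elim(1)])
      show "1 / real n * (op_norm (X n * (\<Psi> n + A n * B n)))\<^sup>2 \<le> cF' * (real (m n) + real (s n))"
        using elim(2) mono[of "real (m n) + real (s n)" cF] by (simp add: cF'_def)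
      show "kth_eigenvalue ((B n)\<^sup>T * \<Sigma>W n * B n) 1 \<le> cu' * real (m n)"
        using elim(3) mono[of "real (m n)" cu] by (simp add: cu'_def)
      show "cl * real (m n) \<le> kth_eigenvalue ((B n)\<^sup>T * \<Sigma>W n * B n) (K n)" using elim(4) G0 by simp
      show "real (K n) \<le> cK' * real n" using elim(5) mono[of "real n" cK] by (simp add: cK'_def)
    qed (use d c lo rank_B[OF elim(6)] design[OF elim(6)] sparse[OF elim(6)] c1[OF elim(6)] cl(1) in
        \<open>auto simp: ck'_def cF'_def cu'_def cK'_def\<close>)
  qed
  define C5 where "C5 = hv_model.C5 \<gamma>w \<gamma>e ck' cF' cl cu' cK'"
  define prb where "prb C l2 \<epsilon>' l3 n = inner_prob (M n)
             (error_event (M n) (X n) (\<lambda>\<omega>. response (X n) (\<Psi> n) (A n) (B n) (W n \<omega>) (E n \<omega>)) (K n)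
                (lambda1 (X n) (Gamma_eps \<gamma>w \<gamma>e (\<Sigma>W n) (B n)) l2 \<epsilon>') l2 l3
                (Theta_star (\<Psi> n) (B n))
                (C * log_factor (m n) (p n) ^ 3 * rate (X n) (m n) (K n) (s n) (R n)))" for C l2 \<epsilon>' l3 n
  \<comment> \<open>Both parts of the claim are instances with a sequence d of failure probabilities
    whose inverse is at most a multiple of the logarithmic factor; the level T is then that factor
    times 12 + c0.\<close>
  have main: "\<exists>C l2 \<epsilon>' \<epsilon> l3.
          (\<forall>n\<ge>1. l2 n > 0 \<and> 0 < \<epsilon>' n \<and> \<epsilon>' n < 1 \<and> 0 < \<epsilon> n \<and> \<epsilon> n < 1 \<and>
                 l3 n \<ge> lambda3_lower (X n) (m n) \<gamma>e (\<epsilon> n)) \<and>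
          (\<forall>\<^sub>F n in sequentially. 1 - d n \<le> prb C (l2 n) (\<epsilon>' n) (l3 n) n)"
    if d: "\<And>n. n \<ge> 1 \<Longrightarrow> 0 < d n \<and> d n \<le> 1 \<and> 1 / d n \<le> c0 * log_factor (m n) (p n)" for d c0
  proof -
    have "\<exists>x. 0 < fst x \<and> 0 < fst (snd x) \<and> fst (snd x) < 1 \<and> lambda3_lower (X n) (m n) \<gamma>e (1/2) \<le> snd (snd x) \<and>
        (hv n \<and> n \<ge> 1 \<longrightarrow> 1 - d n \<le> prb (C5 * (12 + c0) ^ 3) (fst x) (fst (snd x)) (snd (snd x)) n)" for n
    proof (cases "hv n \<and> n \<ge> 1")
      case True
      interpret hv_model "M n" n "K n" "m n" \<gamma>w \<gamma>e "\<Sigma>W n" "\<tau> n" "W n" "E n" "B n" "X n" "\<Psi> n" "A n"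
        "p n" "s n" "R n" ck' cF' cl cu' cK'
        using True by (simp add: hv_def)
      define T where "T = (12 + c0) * log_factor (m n) (p n)"
      have dn: "0 < d n" "d n \<le> 1" "1 / d n \<le> c0 * log_factor (m n) (p n)" using d True by auto
      have lf: "1 \<le> log_factor (m n) (p n)" using dims True by (intro log_factor_ge_1) auto
      have T: "1 / d n \<le> T" using dn(3) lf by (simp add: T_def distrib_right)
      have tail: "24 * (real (p n) * real (m n))\<^sup>2 * exp (- T) \<le> d n"
        unfolding T_def using dims True dn by (intro log_factor_tail) auto
      obtain l2 \<epsilon>' where *: "0 < l2" "0 < \<epsilon>'" "\<epsilon>' < 1" "lambda3_lower (X n) (m n) \<gamma>e (1/2) \<le> l3 T"
        "1 - d n \<le> inner_prob (M n) (error_event (M n) (X n) Yr (K n) (lambda1 (X n) Gam l2 \<epsilon>') l2 (l3 T)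
          (Theta_star (\<Psi> n) (B n)) (C5 * T ^ 3 * rate (X n) (m n) (K n) (s n) (R n)))"
        using estimator_bound[OF dn(1,2) T tail] unfolding \<open>C5 = _\<close> by blast
      then have "1 - d n \<le> prb (C5 * (12 + c0) ^ 3) l2 \<epsilon>' (l3 T) n"
        by (simp add: prb_def T_def power_mult_distrib mult.assoc)
      with * show ?thesis by (intro exI[of _ "(l2, \<epsilon>', l3 T)"]) simp
    next
      case False
      \<comment> \<open>Where the uniform bounds fail, only the constraints on the tuning parameters
        have to be met; this concerns finitely many n.\<close>
      then show ?thesis by (intro exI[of _ "(1, 1/2, lambda3_lower (X n) (m n) \<gamma>e (1/2))"]) auto
    qed
    then obtain x where x: "\<And>n. 0 < fst (x n) \<and> 0 < fst (snd (x n)) \<and> fst (snd (x n)) < 1 \<and>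
        lambda3_lower (X n) (m n) \<gamma>e (1/2) \<le> snd (snd (x n)) \<and>
        (hv n \<and> n \<ge> 1 \<longrightarrow> 1 - d n \<le> prb (C5 * (12 + c0) ^ 3) (fst (x n)) (fst (snd (x n))) (snd (snd (x n))) n)"
      by metis
    have "\<forall>\<^sub>F n in sequentially. 1 - d n \<le> prb (C5 * (12 + c0) ^ 3) (fst (x n)) (fst (snd (x n))) (snd (snd (x n))) n"
      using ev_hv eventually_ge_at_top[of "1::nat"] by eventually_elim (use x in blast)
    then show ?thesis
      using x by (intro exI[of _ "C5 * (12 + c0) ^ 3"] exI[of _ "\<lambda>n. fst (x n)"] exI[of _ "\<lambda>n. fst (snd (x n))"]
        exI[of _ "\<lambda>_. 1/2"] exI[of _ "\<lambda>n. snd (snd (x n))"]) auto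
  qed
  have lf: "1 \<le> log_factor (m n) (p n)" if "n \<ge> 1" for n using dims[OF that] by (intro log_factor_ge_1) auto
  show ?thesis
  proof (rule exI[of _ 3], intro conjI impI allI)
    assume lim: "filterlim (\<lambda>n. max (m n) (p n)) at_top sequentially"
    \<comment> \<open>Tends to 0, while its inverse is only logarithmic.\<close>
    define d where "d n = 1 / (2 * log_factor (m n) (p n))" for n
    have "0 < d n \<and> d n \<le> 1 \<and> 1 / d n \<le> 2 * log_factor (m n) (p n)" if "n \<ge> 1" for n
      using lf[OF that] by (simp add: d_def)
    from main[OF this] obtain C l2 \<epsilon>' \<epsilon> l3 where
      *: "\<forall>n\<ge>1. l2 n > 0 \<and> 0 < \<epsilon>' n \<and> \<epsilon>' n < 1 \<and> 0 < \<epsilon> n \<and> \<epsilon> n < 1 \<and> l3 n \<ge> lambda3_lower (X n) (m n) \<gamma>e (\<epsilon> n)"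
      and lower: "\<forall>\<^sub>F n in sequentially. 1 - d n \<le> prb C (l2 n) (\<epsilon>' n) (l3 n) n" by blast
    \<comment> \<open>The sum of the two logarithms dominates the logarithm of the maximum because m
      and p are at least 1.\<close>
    have "filterlim (\<lambda>n. log_factor (m n) (p n)) at_top sequentially"
    proof (rule filterlim_at_top_mono)
      show "filterlim (\<lambda>n. ln (real (max (m n) (p n)))) at_top sequentially"
        by (rule filterlim_compose[OF ln_at_top filterlim_compose[OF filterlim_real_sequentially lim]])
      show "\<forall>\<^sub>F n in sequentially. ln (real (max (m n) (p n))) \<le> log_factor (m n) (p n)"
        using eventually_ge_at_top[of "1::nat"]
      proof eventually_elim
        case (elim n)
        then show ?case using dims[OF elim] by (auto simp: log_factor_def max_def)
      qed
    qed
    then have "(\<lambda>n. 1 / 2 * inverse (log_factor (m n) (p n))) \<longlonglongrightarrow> 1 / 2 * 0"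
      by (intro tendsto_mult tendsto_const tendsto_inverse_0_at_top)
    then have "d \<longlonglongrightarrow> 0" by (simp add: d_def[abs_def] field_simps)
    then have "(\<lambda>n. 1 - d n) \<longlonglongrightarrow> 1 - 0" by (intro tendsto_diff tendsto_const)
    then have d1: "(\<lambda>n. 1 - d n) \<longlonglongrightarrow> 1" by simp
    have upper: "\<forall>\<^sub>F n in sequentially. prb C (l2 n) (\<epsilon>' n) (l3 n) n \<le> 1"
      using eventually_ge_at_top[of "1::nat"]
    proof eventually_elim
      case (elim n)
      have "prob_space (M n)" using noise[OF elim] by (simp add: noise_model_def)
      then show ?case unfolding prb_def by (rule prob_space.inner_prob_le_1)
    qed
    have "(\<lambda>n. prb C (l2 n) (\<epsilon>' n) (l3 n) n) \<longlonglongrightarrow> 1"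
      by (rule tendsto_sandwich[OF lower upper d1 tendsto_const])
    with * show "\<exists>C l2 \<epsilon>' \<epsilon> l3.
          (\<forall>n\<ge>1. l2 n > 0 \<and> 0 < \<epsilon>' n \<and> \<epsilon>' n < 1 \<and> 0 < \<epsilon> n \<and> \<epsilon> n < 1 \<and>
                 l3 n \<ge> lambda3_lower (X n) (m n) \<gamma>e (\<epsilon> n)) \<and>
          (\<lambda>n. inner_prob (M n)
             (error_event (M n) (X n) (\<lambda>\<omega>. response (X n) (\<Psi> n) (A n) (B n) (W n \<omega>) (E n \<omega>)) (K n)
                (lambda1 (X n) (Gamma_eps \<gamma>w \<gamma>e (\<Sigma>W n) (B n)) (l2 n) (\<epsilon>' n)) (l2 n) (l3 n)
                (Theta_star (\<Psi> n) (B n))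
                (C * log_factor (m n) (p n) ^ 3 * rate (X n) (m n) (K n) (s n) (R n))))
          \<longlonglongrightarrow> 1"
      unfolding prb_def by blast
  next
    fix \<delta> :: real assume \<delta>: "\<delta> > 0"
    \<comment> \<open>A constant sequence; its inverse is at most itself times the logarithmic
      factor, which is at least 1.\<close>
    have "0 < min \<delta> 1 \<and> min \<delta> 1 \<le> 1 \<and> 1 / min \<delta> 1 \<le> (1 / min \<delta> 1) * log_factor (m n) (p n)" if "n \<ge> 1" for n
      using mult_left_mono[OF lf[OF that], of "1 / min \<delta> 1"] \<delta> by simp
    from main[OF this] obtain C l2 \<epsilon>' \<epsilon> l3 where
      *: "\<forall>n\<ge>1. l2 n > 0 \<and> 0 < \<epsilon>' n \<and> \<epsilon>' n < 1 \<and> 0 < \<epsilon> n \<and> \<epsilon> n < 1 \<and> l3 n \<ge> lambda3_lower (X n) (m n) \<gamma>e (\<epsilon> n)"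
      and lower: "\<forall>\<^sub>F n in sequentially. 1 - min \<delta> 1 \<le> prb C (l2 n) (\<epsilon>' n) (l3 n) n" by blast
    have "\<forall>\<^sub>F n in sequentially. 1 - \<delta> \<le> prb C (l2 n) (\<epsilon>' n) (l3 n) n"
      using lower by eventually_elim linarith
    with * show "\<exists>C l2 \<epsilon>' \<epsilon> l3.
          (\<forall>n\<ge>1. l2 n > 0 \<and> 0 < \<epsilon>' n \<and> \<epsilon>' n < 1 \<and> 0 < \<epsilon> n \<and> \<epsilon> n < 1 \<and>
                 l3 n \<ge> lambda3_lower (X n) (m n) \<gamma>e (\<epsilon> n)) \<and>
          (\<forall>\<^sub>F n in sequentially. 1 - \<delta> \<le> inner_prob (M n)
             (error_event (M n) (X n) (\<lambda>\<omega>. response (X n) (\<Psi> n) (A n) (B n) (W n \<omega>) (E n \<omega>)) (K n)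
                (lambda1 (X n) (Gamma_eps \<gamma>w \<gamma>e (\<Sigma>W n) (B n)) (l2 n) (\<epsilon>' n)) (l2 n) (l3 n)
                (Theta_star (\<Psi> n) (B n))
                (C * log_factor (m n) (p n) ^ 3 * rate (X n) (m n) (K n) (s n) (R n))))"
      unfolding prb_def by blast
  qed
qed

end
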